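(* Let $H$ be a finite-dimensional Hopf algebra with dual $\widehat H$, $X$ an algebra, $\alpha:X\to X\otimes H^{\mathrm{op}}$ a right coaction of $H^{\mathrm{op}}$ and $\beta:X\to X\otimes\widehat H$ a right coaction of $\widehat H$. Write $\alpha(x)=x_{[0]}\otimes x_{[1]}^{\mathrm{op}}$, $\beta(x)=x^{[0]}\otimes x^{[1]}$, and define $$\beta^{\mathrm{op}}:X^{\mathrm{op}}\to X^{\mathrm{op}}\otimes\widehat H^{\mathrm{op}},\quad x^{\mathrm{op}}\mapsto (x^{[0]})^{\mathrm{op}}\otimes (x^{[1]})^{\mathrm{op}},\qquad \alpha^{\mathrm{op}}:X^{\mathrm{op}}\to X^{\mathrm{op}}\otimes H,\quad x^{\mathrm{op}}\mapsto (x_{[0]})^{\mathrm{op}}\otimes x_{[1]},$$ which are right coactions of $\widehat H^{\mathrm{op}}$ and $H$ on $X^{\mathrm{op}}$, respectively. Then $(X,\alpha,\beta)$ is a right-right $(H,\widehat H)$-Yetter--Drinfeld algebra if and only if $(X^{\mathrm{op}},\beta^{\mathrm{op}},\alpha^{\mathrm{op}})$ is a right-right $(\widehat H,H)$-Yetter--Drinfeld algebra. Moreover, $(X,\alpha,\beta)$ is braided commutative if and only if $(X^{\mathrm{op}},\beta^{\mathrm{op}},\alpha^{\mathrm{op}})$ is braided commutative.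
   Context: $\Bbbk$ is a field, algebras are unital $\Bbbk$-algebras; for an algebra $Y$, $Y^{\mathrm{op}}$ is the opposite algebra with elements $y^{\mathrm{op}}$. For a finite-dimensional Hopf algebra $K$ with structure maps $\Delta,\varepsilon,S_K$, $\widehat K$ is the dual Hopf algebra, $\mathbf p(k,\theta)=\theta(k)$, with $\mathbf p(k,\theta\theta')=\mathbf p(k_{(1)},\theta)\mathbf p(k_{(2)},\theta')$, $\mathbf p(kk',\theta)=\mathbf p(k,\theta_{(1)})\mathbf p(k',\theta_{(2)})$. The bidual of $H$ is identified with $H$. $K^{\mathrm{op}}$ is the Hopf algebra with opposite product and the same coproduct. For dual bases $(k_i)$, $(\widehat k_i)$ of $K$, $\widehat K$, put ${}^{\circ}U_K=\sum_ik_i^{\mathrm{op}}\otimes\widehat k_i\in K^{\mathrm{op}}\otimes\widehat K$ (invertible). $\mathrm{Ad}(W)(z)=WzW^{-1}$; $\Sigma$ is the flip. A right coaction of a Hopf algebra $K$ on an algebra $Y$ is an algebra homomorphism $\alpha:Y\to Y\otimes K$ with $(\alpha\otimes\mathrm{id})\alpha=(\mathrm{id}\otimes\Delta_K)\alpha$, $(\mathrm{id}\otimes\varepsilon_K)\alpha=\mathrm{id}$. A right-right $(K,\widehat K)$-Yetter--Drinfeld algebra is a triple $(Y,\alpha,\beta)$ with right coactions $\alpha:Y\to Y\otimes K^{\mathrm{op}}$ of $K^{\mathrm{op}}$ and $\beta:Y\to Y\otimes\widehat K$ of $\widehat K$ such that $(\alpha\otimes\mathrm{id})\beta=(\mathrm{id}_Y\otimes\mathrm{Ad}({}^{\circ}U_K)^{-1})(\mathrm{id}_Y\otimes\Sigma)(\beta\otimes\mathrm{id}_{K^{\mathrm{op}}})\alpha$.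 (Used for $K=H$ and $K=\widehat H$.) The Heisenberg algebra $\mathcal H(K)=K\#\widehat K$ is $K\otimes\widehat K$ with product $(k\#\theta)(k'\#\theta')=k\,k'_{(1)}\,\mathbf p(k'_{(2)},\theta_{(1)})\#\theta_{(2)}\theta'$. A right-right $(K,\widehat K)$-Yetter--Drinfeld algebra $(Y,\alpha,\beta)$ is braided commutative if for all $x,y\in Y$, in the tensor product algebra $Y\otimes\mathcal H(K)$, $$(x_{[0]}\otimes S_K(x_{[1]})\#1)(y^{[0]}\otimes1\#y^{[1]})=(y^{[0]}\otimes1\#y^{[1]})(x_{[0]}\otimes S_K(x_{[1]})\#1),$$ where $\alpha(x)=x_{[0]}\otimes x_{[1]}^{\mathrm{op}}$, $\beta(y)=y^{[0]}\otimes y^{[1]}$ (summations understood). *)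

theory Defs
  imports "HOL.Hull" "HOL-Algebra.Module" "HOL-Algebra.AbelCoset"
begin

section \<open>Vector spaces and algebras over a field\<close>

text \<open>
  The ground field is a \<open>field R\<close>. Vector spaces and (not necessarily commutative) algebras are
  records of type \<open>('a, 'b) module\<close>; for a mere vector space the fields \<open>mult\<close> and \<open>one\<close> are
  ignored.
\<close>

locale unital_algebra = field R + module R A + ring A for R (structure) and A (structure) +
  assumes smult_mult_left:
    "\<lbrakk>a \<in> carrier R; x \<in> carrier A; y \<in> carrier A\<rbrakk> \<Longrightarrow>
       (a \<odot>\<^bsub>A\<^esub> x) \<otimes>\<^bsub>A\<^esub> y = a \<odot>\<^bsub>A\<^esub> (x \<otimes>\<^bsub>A\<^esub> y)"
  and smult_mult_right:
    "\<lbrakk>a \<in> carrier R; x \<in> carrier A; y \<in> carrier A\<rbrakk> \<Longrightarrow>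
       x \<otimes>\<^bsub>A\<^esub> (a \<odot>\<^bsub>A\<^esub> y) = a \<odot>\<^bsub>A\<^esub> (x \<otimes>\<^bsub>A\<^esub> y)"

definition lin_hom ::
  "('a, 'm) ring_scheme \<Rightarrow> ('a, 'b, 'n) module_scheme \<Rightarrow> ('a, 'c, 'o) module_scheme \<Rightarrow> ('b \<Rightarrow> 'c) set"
  where "lin_hom R V W =
    {f \<in> carrier V \<rightarrow> carrier W.
       (\<forall>x\<in>carrier V. \<forall>y\<in>carrier V. f (x \<oplus>\<^bsub>V\<^esub> y) = f x \<oplus>\<^bsub>W\<^esub> f y) \<and>
       (\<forall>a\<in>carrier R. \<forall>x\<in>carrier V. f (a \<odot>\<^bsub>V\<^esub> x) = a \<odot>\<^bsub>W\<^esub> f x)}"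

definition alg_hom ::
  "('a, 'm) ring_scheme \<Rightarrow> ('a, 'b, 'n) module_scheme \<Rightarrow> ('a, 'c, 'o) module_scheme \<Rightarrow> ('b \<Rightarrow> 'c) set"
  where "alg_hom R A B = lin_hom R A B \<inter> ring_hom A B"

definition ground :: "('a, 'm) ring_scheme \<Rightarrow> ('a, 'a) module"
  where "ground R =
    \<lparr>carrier = carrier R, mult = mult R, one = one R, zero = zero R, add = add R, smult = mult R\<rparr>"

definition finite_dimensional :: "('a, 'm) ring_scheme \<Rightarrow> ('a, 'b, 'n) module_scheme \<Rightarrow> bool"
  where "finite_dimensional R V \<longleftrightarrow>
    (\<exists>B. finite B \<and> B \<subseteq> carrier V \<and> (\<lambda>N. submodule N R V) hull B = carrier V)"

text \<open>The element \<open>x\<^sup>o\<^sup>p\<close> of the opposite algebra is \<open>x\<close> itself; only the product changes.\<close>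

definition op_alg :: "('a, 'b, 'n) module_scheme \<Rightarrow> ('a, 'b, 'n) module_scheme"
  where "op_alg A = A\<lparr>mult := (\<lambda>x y. y \<otimes>\<^bsub>A\<^esub> x)\<rparr>"


section \<open>Tensor products\<close>

text \<open>
  The tensor product of \<open>V\<close> and \<open>W\<close> is the free vector space on \<open>carrier V \<times> carrier W\<close>
  modulo the subspace generated by the bilinearity relations; its elements are cosets.
\<close>

definition free_space :: "('a, 'm) ring_scheme \<Rightarrow> 'p set \<Rightarrow> ('a, 'p \<Rightarrow> 'a) module"
  where "free_space R S =
    \<lparr>carrier = {f. range f \<subseteq> carrier R \<and> finite {p. f p \<noteq> \<zero>\<^bsub>R\<^esub>} \<and> {p. f p \<noteq> \<zero>\<^bsub>R\<^esub>} \<subseteq> S},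
     mult = undefined, one = undefined,
     zero = (\<lambda>p. \<zero>\<^bsub>R\<^esub>), add = (\<lambda>f g p. f p \<oplus>\<^bsub>R\<^esub> g p), smult = (\<lambda>a f p. a \<otimes>\<^bsub>R\<^esub> f p)\<rparr>"

definition unit_vec :: "('a, 'm) ring_scheme \<Rightarrow> 'p \<Rightarrow> 'p \<Rightarrow> 'a"
  where "unit_vec R p = (\<lambda>q. if q = p then \<one>\<^bsub>R\<^esub> else \<zero>\<^bsub>R\<^esub>)"

definition tensor_free ::
  "('a, 'm) ring_scheme \<Rightarrow> ('a, 'b, 'n) module_scheme \<Rightarrow> ('a, 'c, 'o) module_scheme
     \<Rightarrow> ('a, 'b \<times> 'c \<Rightarrow> 'a) module"
  where "tensor_free R V W = free_space R (carrier V \<times> carrier W)"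

definition bilinearity_relations ::
  "('a, 'm) ring_scheme \<Rightarrow> ('a, 'b, 'n) module_scheme \<Rightarrow> ('a, 'c, 'o) module_scheme
     \<Rightarrow> ('b \<times> 'c \<Rightarrow> 'a) set"
  where "bilinearity_relations R V W =
    (let F = tensor_free R V W; \<delta> = (\<lambda>v w. unit_vec R (v, w)) in
      {\<delta> (v \<oplus>\<^bsub>V\<^esub> v') w \<ominus>\<^bsub>F\<^esub> (\<delta> v w \<oplus>\<^bsub>F\<^esub> \<delta> v' w) | v v' w.
         v \<in> carrier V \<and> v' \<in> carrier V \<and> w \<in> carrier W} \<union>
      {\<delta> v (w \<oplus>\<^bsub>W\<^esub> w') \<ominus>\<^bsub>F\<^esub> (\<delta> v w \<oplus>\<^bsub>F\<^esub> \<delta> v w') | v w w'.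
         v \<in> carrier V \<and> w \<in> carrier W \<and> w' \<in> carrier W} \<union>
      {\<delta> (a \<odot>\<^bsub>V\<^esub> v) w \<ominus>\<^bsub>F\<^esub> a \<odot>\<^bsub>F\<^esub> \<delta> v w | a v w.
         a \<in> carrier R \<and> v \<in> carrier V \<and> w \<in> carrier W} \<union>
      {\<delta> v (a \<odot>\<^bsub>W\<^esub> w) \<ominus>\<^bsub>F\<^esub> a \<odot>\<^bsub>F\<^esub> \<delta> v w | a v w.
         a \<in> carrier R \<and> v \<in> carrier V \<and> w \<in> carrier W})"

definition tensor_null ::
  "('a, 'm) ring_scheme \<Rightarrow> ('a, 'b, 'n) module_scheme \<Rightarrow> ('a, 'c, 'o) module_scheme
     \<Rightarrow> ('b \<times> 'c \<Rightarrow> 'a) set"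
  where "tensor_null R V W =
    (\<lambda>N. submodule N R (tensor_free R V W)) hull bilinearity_relations R V W"

text \<open>\<open>tens R V W v w\<close> is the elementary tensor \<open>v \<otimes> w\<close> of \<open>V \<otimes> W\<close>.\<close>

definition tens ::
  "('a, 'm) ring_scheme \<Rightarrow> ('a, 'b, 'n) module_scheme \<Rightarrow> ('a, 'c, 'o) module_scheme
     \<Rightarrow> 'b \<Rightarrow> 'c \<Rightarrow> ('b \<times> 'c \<Rightarrow> 'a) set"
  where "tens R V W v w = tensor_null R V W +>\<^bsub>tensor_free R V W\<^esub> unit_vec R (v, w)"

text \<open>
  For a bilinear map \<open>B\<close> with values in \<open>Z\<close>, \<open>tlift R Z B\<close> is the linear map with
  \<open>v \<otimes> w \<mapsto> B v w\<close>; the value does not depend on the chosen representative. Thus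
  \<open>tlift R Z (\<lambda>v w. B v w) t\<close> is the Sweedler-type expression \<open>\<Sum> B t\<^sub>1 t\<^sub>2\<close> for
  \<open>t = \<Sum> t\<^sub>1 \<otimes> t\<^sub>2\<close>.
\<close>

definition tlift ::
  "('a, 'm) ring_scheme \<Rightarrow> ('a, 'z, 'n) module_scheme \<Rightarrow> ('b \<Rightarrow> 'c \<Rightarrow> 'z) \<Rightarrow> ('b \<times> 'c \<Rightarrow> 'a) set \<Rightarrow> 'z"
  where "tlift R Z B t =
    (let f = (SOME f. f \<in> t) in
      finsum Z (\<lambda>p. f p \<odot>\<^bsub>Z\<^esub> B (fst p) (snd p)) {p. f p \<noteq> \<zero>\<^bsub>R\<^esub>})"

definition tensor_space ::
  "('a, 'm) ring_scheme \<Rightarrow> ('a, 'b, 'n) module_scheme \<Rightarrow> ('a, 'c, 'o) module_scheme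
     \<Rightarrow> ('a, ('b \<times> 'c \<Rightarrow> 'a) set) module"
  where "tensor_space R V W =
    (let F = tensor_free R V W; N = tensor_null R V W in
      \<lparr>carrier = a_rcosets\<^bsub>F\<^esub> N, mult = undefined, one = undefined,
       zero = N, add = (\<lambda>s t. s <+>\<^bsub>F\<^esub> t),
       smult = (\<lambda>a t. \<Union>f\<in>t. N +>\<^bsub>F\<^esub> (a \<odot>\<^bsub>F\<^esub> f))\<rparr>)"

text \<open>
  The tensor product algebra, \<open>(a \<otimes> b) (a' \<otimes> b') = a a' \<otimes> b b'\<close>. When the factors are mere
  vector spaces, only its linear structure \<^const>\<open>tensor_space\<close> is meaningful.
\<close>

definition tensor ::
  "('a, 'm) ring_scheme \<Rightarrow> ('a, 'b, 'n) module_scheme \<Rightarrow> ('a, 'c, 'o) module_scheme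
     \<Rightarrow> ('a, ('b \<times> 'c \<Rightarrow> 'a) set) module"
  where "tensor R A B =
    (tensor_space R A B)
      \<lparr>mult := (\<lambda>s t.
         tlift R (tensor_space R A B) (\<lambda>a b.
           tlift R (tensor_space R A B) (\<lambda>a' b'. tens R A B (a \<otimes>\<^bsub>A\<^esub> a') (b \<otimes>\<^bsub>B\<^esub> b')) t) s),
       one := tens R A B \<one>\<^bsub>A\<^esub> \<one>\<^bsub>B\<^esub>\<rparr>"

text \<open>\<open>tmap R V' W' f g\<close> is the map \<open>f \<otimes> g\<close> with values in \<open>V' \<otimes> W'\<close>.\<close>

definition tmap ::
  "('a, 'm) ring_scheme \<Rightarrow> ('a, 'd, 'n) module_scheme \<Rightarrow> ('a, 'e, 'o) module_scheme
     \<Rightarrow> ('b \<Rightarrow> 'd) \<Rightarrow> ('c \<Rightarrow> 'e) \<Rightarrow> ('b \<times> 'c \<Rightarrow> 'a) set \<Rightarrow> ('d \<times> 'e \<Rightarrow> 'a) set"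
  where "tmap R V' W' f g = tlift R (tensor R V' W') (\<lambda>v w. tens R V' W' (f v) (g w))"

definition tassoc ::
  "('a, 'm) ring_scheme \<Rightarrow> ('a, 'b, 'n) module_scheme \<Rightarrow> ('a, 'c, 'o) module_scheme
     \<Rightarrow> ('a, 'd, 'p) module_scheme
     \<Rightarrow> ((('b \<times> 'c \<Rightarrow> 'a) set) \<times> 'd \<Rightarrow> 'a) set \<Rightarrow> ('b \<times> (('c \<times> 'd \<Rightarrow> 'a) set) \<Rightarrow> 'a) set"
  where "tassoc R U V W =
    (let T = tensor R U (tensor R V W) in
      tlift R T (\<lambda>s w. tlift R T (\<lambda>u v. tens R U (tensor R V W) u (tens R V W v w)) s))"

definition tflip ::
  "('a, 'm) ring_scheme \<Rightarrow> ('a, 'b, 'n) module_scheme \<Rightarrow> ('a, 'c, 'o) module_scheme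
     \<Rightarrow> ('b \<times> 'c \<Rightarrow> 'a) set \<Rightarrow> ('c \<times> 'b \<Rightarrow> 'a) set"
  where "tflip R V W = tlift R (tensor R W V) (\<lambda>v w. tens R W V w v)"


section \<open>Hopf algebras\<close>

record ('a, 'b) hopf = "('a, 'b) module" +
  comult :: "'b \<Rightarrow> ('b \<times> 'b \<Rightarrow> 'a) set"
  counit :: "'b \<Rightarrow> 'a"
  antipode :: "'b \<Rightarrow> 'b"

locale hopf_algebra = unital_algebra R K
  for R :: "('a, 'm) ring_scheme" (structure) and K :: "('a, 'b, 'n) hopf_scheme" (structure) +
  assumes comult_hom: "comult K \<in> alg_hom R K (tensor R K K)"
    and counit_hom: "counit K \<in> alg_hom R K (ground R)"
    and antipode_hom: "antipode K \<in> lin_hom R K K"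
    and coassoc: "h \<in> carrier K \<Longrightarrow>
      tassoc R K K K (tmap R (tensor R K K) K (comult K) id (comult K h)) =
      tmap R K (tensor R K K) id (comult K) (comult K h)"
    and counit_left: "h \<in> carrier K \<Longrightarrow> tlift R K (\<lambda>a b. counit K a \<odot>\<^bsub>K\<^esub> b) (comult K h) = h"
    and counit_right: "h \<in> carrier K \<Longrightarrow> tlift R K (\<lambda>a b. counit K b \<odot>\<^bsub>K\<^esub> a) (comult K h) = h"
    and antipode_left: "h \<in> carrier K \<Longrightarrow>
      tlift R K (\<lambda>a b. antipode K a \<otimes>\<^bsub>K\<^esub> b) (comult K h) = counit K h \<odot>\<^bsub>K\<^esub> \<one>\<^bsub>K\<^esub>"
    and antipode_right: "h \<in> carrier K \<Longrightarrow>
      tlift R K (\<lambda>a b. a \<otimes>\<^bsub>K\<^esub> antipode K b) (comult K h) = counit K h \<odot>\<^bsub>K\<^esub> \<one>\<^bsub>K\<^esub>"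

text \<open>
  The antipode of \<open>K\<^sup>o\<^sup>p\<close> is \<open>S\<^sup>-\<^sup>1\<close> (the antipode of a finite-dimensional Hopf algebra is
  bijective).
\<close>

definition hopf_op :: "('a, 'b, 'n) hopf_scheme \<Rightarrow> ('a, 'b, 'n) hopf_scheme"
  where "hopf_op K = (op_alg K)\<lparr>antipode := inv_into (carrier K) (antipode K)\<rparr>"

text \<open>
  Functionals are extensional functions, so that equality in the dual is equality of functions.
  Product and coproduct are transposed with respect to \<open>\<p>(k, \<theta>) = \<theta> k\<close>:
  \<open>\<p>(k, \<theta>\<theta>') = \<p>(k\<^sub>1, \<theta>) \<p>(k\<^sub>2, \<theta>')\<close> and \<open>\<p>(kk', \<theta>) = \<p>(k, \<theta>\<^sub>1) \<p>(k', \<theta>\<^sub>2)\<close>; for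
  finite-dimensional \<open>K\<close> the latter determines the coproduct.
\<close>

definition dual_algebra ::
  "('a, 'm) ring_scheme \<Rightarrow> ('a, 'b, 'n) hopf_scheme \<Rightarrow> ('a, 'b \<Rightarrow> 'a) module"
  where "dual_algebra R K =
    \<lparr>carrier = lin_hom R K (ground R) \<inter> extensional (carrier K),
     mult = (\<lambda>\<theta> \<theta>'. \<lambda>k\<in>carrier K. tlift R (ground R) (\<lambda>a b. \<theta> a \<otimes>\<^bsub>R\<^esub> \<theta>' b) (comult K k)),
     one = (\<lambda>k\<in>carrier K. counit K k),
     zero = (\<lambda>k\<in>carrier K. \<zero>\<^bsub>R\<^esub>),
     add = (\<lambda>\<theta> \<theta>'. \<lambda>k\<in>carrier K. \<theta> k \<oplus>\<^bsub>R\<^esub> \<theta>' k),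
     smult = (\<lambda>a \<theta>. \<lambda>k\<in>carrier K. a \<otimes>\<^bsub>R\<^esub> \<theta> k)\<rparr>"

definition dual ::
  "('a, 'm) ring_scheme \<Rightarrow> ('a, 'b, 'n) hopf_scheme \<Rightarrow> ('a, 'b \<Rightarrow> 'a) hopf"
  where "dual R K =
    (let D = dual_algebra R K in
      \<lparr>carrier = carrier D, mult = mult D, one = one D, zero = zero D, add = add D,
       smult = smult D,
       comult = (\<lambda>\<theta>. THE t. t \<in> carrier (tensor R D D) \<and>
         (\<forall>k\<in>carrier K. \<forall>k'\<in>carrier K.
            tlift R (ground R) (\<lambda>\<phi> \<psi>. \<phi> k \<otimes>\<^bsub>R\<^esub> \<psi> k') t = \<theta> (k \<otimes>\<^bsub>K\<^esub> k'))),
       counit = (\<lambda>\<theta>. \<theta> \<one>\<^bsub>K\<^esub>),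
       antipode = (\<lambda>\<theta>. \<lambda>k\<in>carrier K. \<theta> (antipode K k))\<rparr>)"

text \<open>The canonical map from \<open>K\<close> to its bidual.\<close>

definition to_bidual ::
  "('a, 'm) ring_scheme \<Rightarrow> ('a, 'b, 'n) hopf_scheme \<Rightarrow> 'b \<Rightarrow> ('b \<Rightarrow> 'a) \<Rightarrow> 'a"
  where "to_bidual R K k = (\<lambda>\<theta>\<in>carrier (dual R K). \<theta> k)"

text \<open>
  A pair of dual bases is given by a finite set \<open>B\<close> of vectors and the family \<open>\<kappa>\<close> of coordinate
  functionals; the two conditions say that \<open>B\<close> spans and is linearly independent.
\<close>

definition dual_bases ::
  "('a, 'm) ring_scheme \<Rightarrow> ('a, 'b, 'n) hopf_scheme \<Rightarrow> 'b set \<Rightarrow> ('b \<Rightarrow> 'b \<Rightarrow> 'a) \<Rightarrow> bool"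
  where "dual_bases R K B \<kappa> \<longleftrightarrow>
    finite B \<and> B \<subseteq> carrier K \<and> \<kappa> \<in> B \<rightarrow> carrier (dual R K) \<and>
    (\<forall>x\<in>carrier K. finsum K (\<lambda>b. \<kappa> b x \<odot>\<^bsub>K\<^esub> b) B = x) \<and>
    (\<forall>b\<in>B. \<forall>c\<in>B. \<kappa> b c = (if b = c then \<one>\<^bsub>R\<^esub> else \<zero>\<^bsub>R\<^esub>))"

text \<open>\<open>\<Sum> k\<^sub>i\<^sup>o\<^sup>p \<otimes> \<kappa>\<^sub>i\<close>; it does not depend on the choice of the dual bases.\<close>

definition canonical_element ::
  "('a, 'm) ring_scheme \<Rightarrow> ('a, 'b, 'n) hopf_scheme \<Rightarrow> ('b \<times> ('b \<Rightarrow> 'a) \<Rightarrow> 'a) set"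
  where "canonical_element R K =
    (let (B, \<kappa>) = (SOME (B, \<kappa>). dual_bases R K B \<kappa>) in
      finsum (tensor R (hopf_op K) (dual R K)) (\<lambda>b. tens R (hopf_op K) (dual R K) b (\<kappa> b)) B)"

definition Ad :: "('b, 'm) monoid_scheme \<Rightarrow> 'b \<Rightarrow> 'b \<Rightarrow> 'b"
  where "Ad A w z = w \<otimes>\<^bsub>A\<^esub> z \<otimes>\<^bsub>A\<^esub> inv\<^bsub>A\<^esub> w"

text \<open>
  The Heisenberg algebra, with product
  \<open>(k # \<theta>) (k' # \<theta>') = k k'\<^sub>1 \<p>(k'\<^sub>2, \<theta>\<^sub>1) # \<theta>\<^sub>2 \<theta>'\<close> and unit \<open>1 # 1\<close>.
\<close>

definition heisenberg ::
  "('a, 'm) ring_scheme \<Rightarrow> ('a, 'b, 'n) hopf_scheme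
     \<Rightarrow> ('a, ('b \<times> ('b \<Rightarrow> 'a) \<Rightarrow> 'a) set) module"
  where "heisenberg R K =
    (let L = dual R K; T = tensor R K L in
      T\<lparr>mult := (\<lambda>s t.
        tlift R T (\<lambda>k \<theta>. tlift R T (\<lambda>k' \<theta>'.
          tlift R T (\<lambda>k'\<^sub>1 k'\<^sub>2. tlift R T (\<lambda>\<theta>\<^sub>1 \<theta>\<^sub>2.
            \<theta>\<^sub>1 k'\<^sub>2 \<odot>\<^bsub>T\<^esub> tens R K L (k \<otimes>\<^bsub>K\<^esub> k'\<^sub>1) (\<theta>\<^sub>2 \<otimes>\<^bsub>L\<^esub> \<theta>'))
            (comult L \<theta>)) (comult K k')) t) s)\<rparr>)"


section \<open>Coactions and Yetter--Drinfeld algebras\<close>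

definition right_coaction ::
  "('a, 'm) ring_scheme \<Rightarrow> ('a, 'b, 'n) hopf_scheme \<Rightarrow> ('a, 'y, 'o) module_scheme
     \<Rightarrow> ('y \<Rightarrow> ('y \<times> 'b \<Rightarrow> 'a) set) \<Rightarrow> bool"
  where "right_coaction R K Y \<alpha> \<longleftrightarrow>
    \<alpha> \<in> alg_hom R Y (tensor R Y K) \<and>
    (\<forall>y\<in>carrier Y.
       tassoc R Y K K (tmap R (tensor R Y K) K \<alpha> id (\<alpha> y)) =
       tmap R Y (tensor R K K) id (comult K) (\<alpha> y)) \<and>
    (\<forall>y\<in>carrier Y. tlift R Y (\<lambda>u k. counit K k \<odot>\<^bsub>Y\<^esub> u) (\<alpha> y) = y)"

definition yetter_drinfeld_algebra ::
  "('a, 'm) ring_scheme \<Rightarrow> ('a, 'b, 'n) hopf_scheme \<Rightarrow> ('a, 'y, 'o) module_scheme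
     \<Rightarrow> ('y \<Rightarrow> ('y \<times> 'b \<Rightarrow> 'a) set) \<Rightarrow> ('y \<Rightarrow> ('y \<times> ('b \<Rightarrow> 'a) \<Rightarrow> 'a) set) \<Rightarrow> bool"
  where "yetter_drinfeld_algebra R K Y \<alpha> \<beta> \<longleftrightarrow>
    unital_algebra R Y \<and>
    right_coaction R (hopf_op K) Y \<alpha> \<and>
    right_coaction R (dual R K) Y \<beta> \<and>
    (let Kop = hopf_op K; L = dual R K; T = tensor R Kop L in
      \<forall>y\<in>carrier Y.
        tassoc R Y Kop L (tmap R (tensor R Y Kop) L \<alpha> id (\<beta> y)) =
        tmap R Y T id (inv_into (carrier T) (Ad T (canonical_element R K)))
          (tmap R Y T id (tflip R L Kop)
            (tassoc R Y L Kop (tmap R (tensor R Y L) Kop \<beta> id (\<alpha> y)))))"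

definition braided_commutative ::
  "('a, 'm) ring_scheme \<Rightarrow> ('a, 'b, 'n) hopf_scheme \<Rightarrow> ('a, 'y, 'o) module_scheme
     \<Rightarrow> ('y \<Rightarrow> ('y \<times> 'b \<Rightarrow> 'a) set) \<Rightarrow> ('y \<Rightarrow> ('y \<times> ('b \<Rightarrow> 'a) \<Rightarrow> 'a) set) \<Rightarrow> bool"
  where "braided_commutative R K Y \<alpha> \<beta> \<longleftrightarrow>
    yetter_drinfeld_algebra R K Y \<alpha> \<beta> \<and>
    (let L = dual R K; A = heisenberg R K; T = tensor R Y A;
         p = (\<lambda>x. tmap R Y A id (\<lambda>k. tens R K L (antipode K k) \<one>\<^bsub>L\<^esub>) (\<alpha> x));
         q = (\<lambda>y. tmap R Y A id (\<lambda>\<theta>. tens R K L \<one>\<^bsub>K\<^esub> \<theta>) (\<beta> y)) in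
      \<forall>x\<in>carrier Y. \<forall>y\<in>carrier Y. p x \<otimes>\<^bsub>T\<^esub> q y = q y \<otimes>\<^bsub>T\<^esub> p x)"

text \<open>
  For \<open>\<alpha> x = \<Sum> x\<^sub>0 \<otimes> x\<^sub>1\<close>, the map \<open>x\<^sup>o\<^sup>p \<mapsto> \<Sum> x\<^sub>0\<^sup>o\<^sup>p \<otimes> x\<^sub>1\<close> from \<open>X\<^sup>o\<^sup>p\<close> to \<open>X\<^sup>o\<^sup>p \<otimes> L\<close>. Here \<open>x\<^sub>1\<close> is
  read in the target \<open>L\<close>, which carries the product opposite to that of the coacting Hopf algebra
  of \<open>\<alpha>\<close>.
\<close>

definition op_coaction ::
  "('a, 'm) ring_scheme \<Rightarrow> ('a, 'b, 'n) hopf_scheme \<Rightarrow> ('a, 'x, 'o) module_scheme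
     \<Rightarrow> ('x \<Rightarrow> ('x \<times> 'b \<Rightarrow> 'a) set) \<Rightarrow> 'x \<Rightarrow> ('x \<times> 'b \<Rightarrow> 'a) set"
  where "op_coaction R L X \<alpha> x = tlift R (tensor R (op_alg X) L) (tens R (op_alg X) L) (\<alpha> x)"

text \<open>
  A coaction of \<open>K\<close>, regarded as a coaction of the bidual along the canonical isomorphism.
\<close>

definition bidual_coaction ::
  "('a, 'm) ring_scheme \<Rightarrow> ('a, 'b, 'n) hopf_scheme \<Rightarrow> ('a, 'y, 'o) module_scheme
     \<Rightarrow> ('y \<Rightarrow> ('y \<times> 'b \<Rightarrow> 'a) set) \<Rightarrow> 'y \<Rightarrow> ('y \<times> (('b \<Rightarrow> 'a) \<Rightarrow> 'a) \<Rightarrow> 'a) set"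
  where "bidual_coaction R K Y \<alpha> y = tmap R Y (dual R (dual R K)) id (to_bidual R K) (\<alpha> y)"

end

theory Submission
  imports Defs
begin

text \<open>
  Let \<open>L\<close> be the dual of the finite-dimensional Hopf algebra \<open>K\<close>. An element of \<open>X \<otimes> K\<close>, of \<open>X \<otimes> L\<close>
  or of \<open>X \<otimes> (K \<otimes> L)\<close> is determined by its slices \<open>(id \<otimes> f) t \<in> X\<close>, where \<open>f\<close> runs through the functionals
  on the finite-dimensional factor (\<open>tensor_eqI\<close>). Slicing turns both conditions of the theorem into
  identities in \<open>X\<close> that are visibly unchanged when \<open>(H, X, \<alpha>, \<beta>)\<close> is replaced by
  \<open>(dual H, X\<^sup>o\<^sup>p, \<beta>\<^sup>o\<^sup>p, \<alpha>\<^sup>o\<^sup>p)\<close>.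

  The Yetter--Drinfeld equation contains \<open>Ad U\<close> for the canonical element \<open>U\<close>. Multiplying by \<open>U\<close> on the
  left clears the inverse, and slicing with \<open>\<theta> \<otimes> k\<close> leaves the following identity (\<open>yd_cond\<close>), in
  Sweedler notation:
  \<open>\<Sum> \<theta> (a k\<^sub>1) \<phi> (k\<^sub>2) u = \<Sum> \<theta> (k\<^sub>2 a') \<phi>' (k\<^sub>1) u'\<close>.
  Here \<open>u \<otimes> a \<otimes> \<phi>\<close> stands for \<open>(\<alpha> \<otimes> id) (\<beta> y)\<close>, and \<open>u' \<otimes> \<phi>' \<otimes> a'\<close> for \<open>(\<beta> \<otimes> id) (\<alpha> y)\<close>. Duality
  exchanges \<open>\<alpha>\<close> with \<open>\<beta>\<close>, \<open>k\<close> with \<open>\<theta>\<close> and left with right multiplication by \<open>U\<close>, so the identity for the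
  opposite triple has the same two sides, in the other order (\<open>yd_cond_dual\<close>). The argument
  needs \<open>U\<close> to be invertible; the inverse is \<open>\<Sum> S\<^sup>-\<^sup>1 b \<otimes> coord b\<close>, and so the antipode has to be bijective. It is onto
  because its convolution powers are linearly dependent and take values in its image (\<open>antipode_surj\<close>),
  and it is one-to-one because the antipode of the dual is onto.

  In the braided commutativity relation, coassociativity reduces all slices to one of
  them, \<open>x y = \<Sum> y\<^sup>1 (S x\<^sub>1) y\<^sup>0 x\<^sub>0\<close> (\<open>bc_equation_iff\<close>). For the opposite triple this is the same
  identity with \<open>x\<close> and \<open>y\<close> exchanged (\<open>bc_cond_dual\<close>).

  All this takes place in the calculus of Sweedler sums. It rests on the universal property of the
  tensor product (\<open>tlift_lin\<close>, \<open>tlift_tens\<close>), and on the fact that the dual is again a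
  Hopf algebra (\<open>dual_hopf_algebra\<close>), so that whatever is proved for \<open>K\<close> holds for \<open>L\<close> and its dual as well.
\<close>

section \<open>Sums in vector spaces\<close>

context field begin

abbreviation vs where "vs V \<equiv> module R V"

lemma vs_abelian_group: "vs V \<Longrightarrow> abelian_group V"
  by (simp add: module_def)

lemma vs_abelian_monoid: "vs V \<Longrightarrow> abelian_monoid V"
  using vs_abelian_group abelian_group_def by blast

lemma vs_add_closed [simp]:
  "vs V \<Longrightarrow> x \<in> carrier V \<Longrightarrow> y \<in> carrier V \<Longrightarrow> x \<oplus>\<^bsub>V\<^esub> y \<in> carrier V"
  by (simp add: abelian_monoid.a_closed vs_abelian_monoid)

lemma vs_zero_closed [simp]: "vs V \<Longrightarrow> \<zero>\<^bsub>V\<^esub> \<in> carrier V"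
  by (simp add: abelian_monoid.zero_closed vs_abelian_monoid)

lemma vs_smult_closed [simp]:
  "vs V \<Longrightarrow> a \<in> carrier R \<Longrightarrow> x \<in> carrier V \<Longrightarrow> a \<odot>\<^bsub>V\<^esub> x \<in> carrier V"
  by (simp add: module.smult_closed)

lemma vs_finsum_closed [simp]:
  "vs V \<Longrightarrow> (\<And>i. i \<in> A \<Longrightarrow> f i \<in> carrier V) \<Longrightarrow> finsum V f A \<in> carrier V"
  by (simp add: abelian_monoid.finsum_closed vs_abelian_monoid)

lemma vs_finsum_cong:
  "vs V \<Longrightarrow> A = B \<Longrightarrow> (\<And>i. i \<in> B \<Longrightarrow> f i = g i) \<Longrightarrow> (\<And>i. i \<in> B \<Longrightarrow> g i \<in> carrier V) \<Longrightarrow>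
    finsum V f A = finsum V g B"
  by (rule abelian_monoid.finsum_cong'[OF vs_abelian_monoid]) auto

lemma vs_finsum_insert:
  "vs V \<Longrightarrow> finite A \<Longrightarrow> a \<notin> A \<Longrightarrow> (\<And>i. i \<in> insert a A \<Longrightarrow> f i \<in> carrier V) \<Longrightarrow>
    finsum V f (insert a A) = f a \<oplus>\<^bsub>V\<^esub> finsum V f A"
  by (rule abelian_monoid.finsum_insert[OF vs_abelian_monoid]) auto

lemma vs_finsum_empty [simp]: "vs V \<Longrightarrow> finsum V f {} = \<zero>\<^bsub>V\<^esub>"
  by (simp add: abelian_monoid.finsum_empty vs_abelian_monoid)

lemma vs_finsum_zero:
  "vs V \<Longrightarrow> (\<And>i. i \<in> A \<Longrightarrow> f i = \<zero>\<^bsub>V\<^esub>) \<Longrightarrow> finsum V f A = \<zero>\<^bsub>V\<^esub>"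
  using vs_finsum_cong[of V A A f "\<lambda>_. \<zero>\<^bsub>V\<^esub>"]
  by (simp add: abelian_monoid.finsum_zero vs_abelian_monoid)

lemma vs_finsum_smult:
  assumes "vs V" "a \<in> carrier R" "\<And>i. i \<in> A \<Longrightarrow> f i \<in> carrier V"
  shows "a \<odot>\<^bsub>V\<^esub> finsum V f A = finsum V (\<lambda>i. a \<odot>\<^bsub>V\<^esub> f i) A"
proof (cases "finite A")
  case True
  with assms show ?thesis by (simp add: module.finsum_smult_ldistr Pi_def)
next
  case False
  with assms show ?thesis
    by (simp add: finsum_def finprod_def module.smult_r_null)
qed

lemma vs_finsum_add:
  "vs V \<Longrightarrow> (\<And>i. i \<in> A \<Longrightarrow> f i \<in> carrier V) \<Longrightarrow> (\<And>i. i \<in> A \<Longrightarrow> g i \<in> carrier V) \<Longrightarrow>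
    finsum V (\<lambda>i. f i \<oplus>\<^bsub>V\<^esub> g i) A = finsum V f A \<oplus>\<^bsub>V\<^esub> finsum V g A"
  by (rule abelian_monoid.finsum_addf[OF vs_abelian_monoid]) auto

lemma vs_finsum_swap:
  assumes V: "vs V" and A: "finite A" and B: "finite B"
    and g: "\<And>i j. i \<in> A \<Longrightarrow> j \<in> B \<Longrightarrow> g i j \<in> carrier V"
  shows "finsum V (\<lambda>i. finsum V (g i) B) A = finsum V (\<lambda>j. finsum V (\<lambda>i. g i j) A) B"
  using A g
proof (induction A)
  case empty
  then show ?case using V by (simp add: vs_finsum_zero)
next
  case (insert a A)
  have "finsum V (\<lambda>j. finsum V (\<lambda>i. g i j) (insert a A)) B
      = finsum V (\<lambda>j. g a j \<oplus>\<^bsub>V\<^esub> finsum V (\<lambda>i. g i j) A) B"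
    using insert V by (intro vs_finsum_cong) (auto intro!: vs_finsum_insert vs_finsum_closed)
  also have "\<dots> = finsum V (g a) B \<oplus>\<^bsub>V\<^esub> finsum V (\<lambda>j. finsum V (\<lambda>i. g i j) A) B"
    using insert V by (intro vs_finsum_add) (auto intro!: vs_finsum_closed)
  also have "\<dots> = finsum V (g a) B \<oplus>\<^bsub>V\<^esub> finsum V (\<lambda>i. finsum V (g i) B) A"
    using insert by simp
  also have "\<dots> = finsum V (\<lambda>i. finsum V (g i) B) (insert a A)"
    using insert V by (intro vs_finsum_insert[symmetric]) (auto intro!: vs_finsum_closed)
  finally show ?case ..
qed

lemma vs_finsum_superset:
  assumes V: "vs V" and "finite P" "Q \<subseteq> P" "\<And>p. p \<in> P \<Longrightarrow> g p \<in> carrier V"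
    "\<And>p. p \<in> P - Q \<Longrightarrow> g p = \<zero>\<^bsub>V\<^esub>"
  shows "finsum V g Q = finsum V g P"
proof -
  interpret V: abelian_group V using V by (rule vs_abelian_group)
  show ?thesis
    by (rule V.add.finprod_mono_neutral_cong_left[of P Q g g, folded finsum_def])
      (use assms in auto)
qed

lemma vs_smult_zero [simp]: "vs V \<Longrightarrow> x \<in> carrier V \<Longrightarrow> \<zero> \<odot>\<^bsub>V\<^esub> x = \<zero>\<^bsub>V\<^esub>"
  by (rule module.smult_l_null)

lemma vs_smult_zero_right [simp]: "vs V \<Longrightarrow> a \<in> carrier R \<Longrightarrow> a \<odot>\<^bsub>V\<^esub> \<zero>\<^bsub>V\<^esub> = \<zero>\<^bsub>V\<^esub>"
  by (rule module.smult_r_null)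

lemma vs_smult_one [simp]: "vs V \<Longrightarrow> x \<in> carrier V \<Longrightarrow> \<one> \<odot>\<^bsub>V\<^esub> x = x"
  by (rule module.smult_one)

lemma vs_smult_smult:
  "vs V \<Longrightarrow> a \<in> carrier R \<Longrightarrow> b \<in> carrier R \<Longrightarrow> x \<in> carrier V \<Longrightarrow>
    a \<odot>\<^bsub>V\<^esub> (b \<odot>\<^bsub>V\<^esub> x) = (a \<otimes> b) \<odot>\<^bsub>V\<^esub> x"
  by (simp add: module.smult_assoc1)

lemma vs_add_zero [simp]:
  "vs V \<Longrightarrow> x \<in> carrier V \<Longrightarrow> x \<oplus>\<^bsub>V\<^esub> \<zero>\<^bsub>V\<^esub> = x"
  "vs V \<Longrightarrow> x \<in> carrier V \<Longrightarrow> \<zero>\<^bsub>V\<^esub> \<oplus>\<^bsub>V\<^esub> x = x"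
  by (simp_all add: abelian_monoid.r_zero abelian_monoid.l_zero vs_abelian_monoid)

section \<open>Linear maps\<close>

lemma lin_homI:
  assumes "\<And>x. x \<in> carrier V \<Longrightarrow> f x \<in> carrier W"
    and "\<And>x y. x \<in> carrier V \<Longrightarrow> y \<in> carrier V \<Longrightarrow> f (x \<oplus>\<^bsub>V\<^esub> y) = f x \<oplus>\<^bsub>W\<^esub> f y"
    and "\<And>a x. a \<in> carrier R \<Longrightarrow> x \<in> carrier V \<Longrightarrow> f (a \<odot>\<^bsub>V\<^esub> x) = a \<odot>\<^bsub>W\<^esub> f x"
  shows "f \<in> lin_hom R V W"
  using assms by (auto simp: lin_hom_def)

lemma lin_closed: "f \<in> lin_hom R V W \<Longrightarrow> x \<in> carrier V \<Longrightarrow> f x \<in> carrier W"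
  and lin_plus: "f \<in> lin_hom R V W \<Longrightarrow> x \<in> carrier V \<Longrightarrow> y \<in> carrier V \<Longrightarrow>
    f (x \<oplus>\<^bsub>V\<^esub> y) = f x \<oplus>\<^bsub>W\<^esub> f y"
  and lin_scale: "f \<in> lin_hom R V W \<Longrightarrow> a \<in> carrier R \<Longrightarrow> x \<in> carrier V \<Longrightarrow>
    f (a \<odot>\<^bsub>V\<^esub> x) = a \<odot>\<^bsub>W\<^esub> f x"
  by (auto simp: lin_hom_def)

lemma lin_zero:
  assumes "vs V" "vs W" "f \<in> lin_hom R V W"
  shows "f \<zero>\<^bsub>V\<^esub> = \<zero>\<^bsub>W\<^esub>"
proof -
  have "f \<zero>\<^bsub>V\<^esub> = f (\<zero> \<odot>\<^bsub>V\<^esub> \<zero>\<^bsub>V\<^esub>)" using assms by simp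
  also have "\<dots> = \<zero> \<odot>\<^bsub>W\<^esub> f \<zero>\<^bsub>V\<^esub>" using assms by (intro lin_scale) auto
  finally show ?thesis using assms lin_closed[of f V W "\<zero>\<^bsub>V\<^esub>"] by simp
qed

lemma lin_finsum:
  assumes "vs V" "vs W" "f \<in> lin_hom R V W" "\<And>i. i \<in> A \<Longrightarrow> g i \<in> carrier V"
  shows "f (finsum V g A) = finsum W (\<lambda>i. f (g i)) A"
proof (cases "finite A")
  case True
  then show ?thesis using assms(4)
  proof (induction A)
    case empty
    then show ?case using assms by (simp add: lin_zero)
  next
    case (insert a A)
    have "finsum V g (insert a A) = g a \<oplus>\<^bsub>V\<^esub> finsum V g A"
      using insert assms(1) by (intro vs_finsum_insert) auto
    moreover have "finsum W (\<lambda>i. f (g i)) (insert a A) = f (g a) \<oplus>\<^bsub>W\<^esub> finsum W (\<lambda>i. f (g i)) A"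
      using insert assms(1-3) by (intro vs_finsum_insert) (auto intro: lin_closed)
    ultimately show ?case using insert assms(1-3) by (simp add: lin_plus)
  qed
next
  case False
  then show ?thesis using assms by (simp add: finsum_def finprod_def lin_zero)
qed

lemma lin_id: "(\<lambda>x. x) \<in> lin_hom R V V"
  by (auto simp: lin_hom_def)

lemma lin_comp: "h \<in> lin_hom R W Z \<Longrightarrow> f \<in> lin_hom R V W \<Longrightarrow> (\<lambda>x. h (f x)) \<in> lin_hom R V Z"
  by (auto simp: lin_hom_def Pi_def)

lemma lin_hom_cong:
  assumes "f \<in> lin_hom R V W" "vs V" "\<And>x. x \<in> carrier V \<Longrightarrow> f x = g x"
  shows "g \<in> lin_hom R V W"
  using assms(1,2) by (intro lin_homI) (simp_all add: assms(3)[symmetric] lin_closed lin_plus lin_scale)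

lemma lin_smult_const:
  assumes W: "vs W" and a: "a \<in> carrier R" and f: "f \<in> lin_hom R V W"
  shows "(\<lambda>x. a \<odot>\<^bsub>W\<^esub> f x) \<in> lin_hom R V W"
  by (rule lin_homI)
    (use assms lin_closed[OF f] in \<open>auto simp: lin_plus[OF f] lin_scale[OF f] vs_smult_smult
       module.smult_r_distr m_comm\<close>)

lemma ground_simps [simp]:
  "carrier (ground R) = carrier R" "\<zero>\<^bsub>ground R\<^esub> = \<zero>" "\<one>\<^bsub>ground R\<^esub> = \<one>"
  "a \<oplus>\<^bsub>ground R\<^esub> b = a \<oplus> b" "a \<otimes>\<^bsub>ground R\<^esub> b = a \<otimes> b" "a \<odot>\<^bsub>ground R\<^esub> b = a \<otimes> b"
  by (simp_all add: ground_def)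

lemma vs_ground [simp]: "vs (ground R)"
  by (rule moduleI, rule is_cring, rule abelian_groupI)
    (auto simp: l_distr r_distr a_ac m_assoc intro: l_neg)

lemma lin_scalar:
  assumes W: "vs W" and w: "w \<in> carrier W" and f: "f \<in> lin_hom R V (ground R)"
  shows "(\<lambda>x. f x \<odot>\<^bsub>W\<^esub> w) \<in> lin_hom R V W"
  by (rule lin_homI)
    (use assms lin_closed[OF f] in \<open>auto simp: lin_plus[OF f] lin_scale[OF f] vs_smult_smult
       module.smult_l_distr\<close>)

lemma lin_ground_mult:
  assumes f: "f \<in> lin_hom R V (ground R)" and c: "c \<in> carrier R"
  shows "(\<lambda>x. f x \<otimes> c) \<in> lin_hom R V (ground R)" "(\<lambda>x. c \<otimes> f x) \<in> lin_hom R V (ground R)"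
  by (rule lin_homI; use lin_closed[OF f] c in \<open>auto simp: lin_plus[OF f] lin_scale[OF f]
       l_distr r_distr m_assoc m_comm m_lcomm\<close>)+

definition bil where
  "bil V W Z B \<longleftrightarrow> (\<forall>v\<in>carrier V. B v \<in> lin_hom R W Z) \<and>
     (\<forall>w\<in>carrier W. (\<lambda>v. B v w) \<in> lin_hom R V Z)"

lemma bilI:
  assumes "\<And>v. v \<in> carrier V \<Longrightarrow> (\<lambda>w. B v w) \<in> lin_hom R W Z"
    "\<And>w. w \<in> carrier W \<Longrightarrow> (\<lambda>v. B v w) \<in> lin_hom R V Z"
  shows "bil V W Z B"
  using assms by (simp add: bil_def)

lemma bil_closed: "bil V W Z B \<Longrightarrow> v \<in> carrier V \<Longrightarrow> w \<in> carrier W \<Longrightarrow> B v w \<in> carrier Z"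
  by (auto simp: bil_def intro: lin_closed)

lemma bil_left: "bil V W Z B \<Longrightarrow> w \<in> carrier W \<Longrightarrow> (\<lambda>v. B v w) \<in> lin_hom R V Z"
  and bil_right: "bil V W Z B \<Longrightarrow> v \<in> carrier V \<Longrightarrow> B v \<in> lin_hom R W Z"
  by (auto simp: bil_def)

section \<open>Free vector spaces\<close>

lemma free_space_carrier:
  "f \<in> carrier (free_space R S) \<longleftrightarrow>
    (\<forall>p. f p \<in> carrier R) \<and> finite {p. f p \<noteq> \<zero>} \<and> {p. f p \<noteq> \<zero>} \<subseteq> S"
  by (auto simp: free_space_def)

lemma free_space_simps [simp]:
  "\<zero>\<^bsub>free_space R S\<^esub> = (\<lambda>p. \<zero>)" "f \<oplus>\<^bsub>free_space R S\<^esub> g = (\<lambda>p. f p \<oplus> g p)"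
  "a \<odot>\<^bsub>free_space R S\<^esub> f = (\<lambda>p. a \<otimes> f p)"
  by (simp_all add: free_space_def)

lemma free_space_add_closed:
  assumes "f \<in> carrier (free_space R S)" "g \<in> carrier (free_space R S)"
  shows "(\<lambda>p. f p \<oplus> g p) \<in> carrier (free_space R S)"
proof -
  have "{p. f p \<oplus> g p \<noteq> \<zero>} \<subseteq> {p. f p \<noteq> \<zero>} \<union> {p. g p \<noteq> \<zero>}" by auto
  then show ?thesis using assms by (auto simp: free_space_carrier intro: finite_subset)
qed

lemma free_space_smult_closed:
  assumes "f \<in> carrier (free_space R S)" "a \<in> carrier R"
  shows "(\<lambda>p. a \<otimes> f p) \<in> carrier (free_space R S)"
proof -
  have "{p. a \<otimes> f p \<noteq> \<zero>} \<subseteq> {p. f p \<noteq> \<zero>}" using assms(2) by auto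
  then show ?thesis using assms by (auto simp: free_space_carrier intro: finite_subset)
qed

lemma vs_free_space [simp]: "vs (free_space R S)"
proof (rule moduleI, rule is_cring, rule abelian_groupI)
  fix f assume f: "f \<in> carrier (free_space R S)"
  have "(\<lambda>p. \<ominus> f p) \<in> carrier (free_space R S)"
  proof -
    have "{p. \<ominus> f p \<noteq> \<zero>} \<subseteq> {p. f p \<noteq> \<zero>}" by auto
    then show ?thesis using f by (auto simp: free_space_carrier intro: finite_subset)
  qed
  moreover have "(\<lambda>p. \<ominus> f p \<oplus> f p) = (\<lambda>p. \<zero>)" using f by (auto simp: free_space_carrier l_neg)
  ultimately show "\<exists>y\<in>carrier (free_space R S). y \<oplus>\<^bsub>free_space R S\<^esub> f = \<zero>\<^bsub>free_space R S\<^esub>"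
    by (auto intro!: bexI[of _ "\<lambda>p. \<ominus> f p"])
qed (auto simp: free_space_add_closed free_space_smult_closed,
     auto simp: free_space_carrier a_ac l_distr r_distr m_assoc)

lemma unit_vec_closed: "p \<in> S \<Longrightarrow> unit_vec R p \<in> carrier (free_space R S)"
proof -
  assume p: "p \<in> S"
  have "{q. unit_vec R p q \<noteq> \<zero>} \<subseteq> {p}" by (auto simp: unit_vec_def)
  then show ?thesis using p by (auto simp: free_space_carrier unit_vec_def intro: finite_subset)
qed

text \<open>The linear map on the free space that extends a map on the basis.\<close>

definition fext where "fext Z b f = finsum Z (\<lambda>p. f p \<odot>\<^bsub>Z\<^esub> b p) {p. f p \<noteq> \<zero>}"

text \<open>
  Summing over a finite set that contains the support allows \<open>f\<close>, \<open>g\<close> and \<open>f + g\<close> to be summed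
  over the same set.
\<close>

lemma fext_superset:
  assumes "vs Z" "finite P" "P \<subseteq> S" "{p. f p \<noteq> \<zero>} \<subseteq> P" "f \<in> carrier (free_space R S)"
    "\<And>p. p \<in> S \<Longrightarrow> b p \<in> carrier Z"
  shows "fext Z b f = finsum Z (\<lambda>p. f p \<odot>\<^bsub>Z\<^esub> b p) P"
  unfolding fext_def
  by (rule vs_finsum_superset) (use assms in \<open>auto simp: free_space_carrier subset_iff\<close>)

lemma fext_lin:
  assumes Z: "vs Z" and b: "\<And>p. p \<in> S \<Longrightarrow> b p \<in> carrier Z"
  shows "fext Z b \<in> lin_hom R (free_space R S) Z"
proof (rule lin_homI)
  fix f assume f: "f \<in> carrier (free_space R S)"
  then show "fext Z b f \<in> carrier Z" unfolding fext_def
    using Z b by (auto simp: free_space_carrier intro!: vs_finsum_closed)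
next
  fix f g assume f: "f \<in> carrier (free_space R S)" and g: "g \<in> carrier (free_space R S)"
  define P where "P = {p. f p \<noteq> \<zero>} \<union> {p. g p \<noteq> \<zero>}"
  have P: "finite P" "P \<subseteq> S" "{p. f p \<noteq> \<zero>} \<subseteq> P" "{p. g p \<noteq> \<zero>} \<subseteq> P" "{p. f p \<oplus> g p \<noteq> \<zero>} \<subseteq> P"
    using f g by (auto simp: P_def free_space_carrier)
  have fg: "f p \<in> carrier R" "g p \<in> carrier R" for p using f g by (auto simp: free_space_carrier)
  show "fext Z b (f \<oplus>\<^bsub>free_space R S\<^esub> g) = fext Z b f \<oplus>\<^bsub>Z\<^esub> fext Z b g"
    using P Z b f g fg
    by (simp add: fext_superset[of Z P S] free_space_add_closed subset_iff
        module.smult_l_distr vs_finsum_add[symmetric] cong: vs_finsum_cong)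
next
  fix a f assume a: "a \<in> carrier R" and f: "f \<in> carrier (free_space R S)"
  define P where "P = {p. f p \<noteq> \<zero>}"
  have P: "finite P" "P \<subseteq> S" "{p. f p \<noteq> \<zero>} \<subseteq> P" "{p. a \<otimes> f p \<noteq> \<zero>} \<subseteq> P"
    using f a by (auto simp: P_def free_space_carrier)
  have fg: "f p \<in> carrier R" for p using f by (auto simp: free_space_carrier)
  show "fext Z b (a \<odot>\<^bsub>free_space R S\<^esub> f) = a \<odot>\<^bsub>Z\<^esub> fext Z b f"
    using P Z b f fg a
    by (simp add: fext_superset[of Z P S] free_space_smult_closed subset_iff
        vs_finsum_smult vs_smult_smult cong: vs_finsum_cong)
qed

lemma fext_unit_vec:
  assumes Z: "vs Z" and b: "b p \<in> carrier Z"
  shows "fext Z b (unit_vec R p) = b p"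
proof -
  have "{q. unit_vec R p q \<noteq> \<zero>} = insert p {}" by (auto simp: unit_vec_def)
  then have "fext Z b (unit_vec R p) = unit_vec R p p \<odot>\<^bsub>Z\<^esub> b p \<oplus>\<^bsub>Z\<^esub> \<zero>\<^bsub>Z\<^esub>"
    using Z b by (simp only: fext_def) (subst vs_finsum_insert, auto simp: unit_vec_def)
  then show ?thesis using Z b by (simp add: unit_vec_def)
qed

lemma free_space_induct [consumes 1, case_names zero add]:
  assumes f: "f \<in> carrier (free_space R S)"
    and zero: "P (\<lambda>p. \<zero>)"
    and add: "\<And>f a p. f \<in> carrier (free_space R S) \<Longrightarrow> a \<in> carrier R \<Longrightarrow> p \<in> S \<Longrightarrow> P f \<Longrightarrow>
       P (f \<oplus>\<^bsub>free_space R S\<^esub> (a \<odot>\<^bsub>free_space R S\<^esub> unit_vec R p))"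
  shows "P f"
proof -
  have "\<forall>f. f \<in> carrier (free_space R S) \<longrightarrow> {p. f p \<noteq> \<zero>} = Q \<longrightarrow> P f" if "finite Q" for Q
    using that
  proof (induction Q)
    case empty
    show ?case using zero by (auto simp: fun_eq_iff[of _ "\<lambda>p. \<zero>", symmetric])
  next
    case (insert q Q)
    show ?case
    proof (intro allI impI)
      fix f assume f: "f \<in> carrier (free_space R S)" and Q: "{p. f p \<noteq> \<zero>} = insert q Q"
      define g where "g = f(q := \<zero>)"
      have g: "{p. g p \<noteq> \<zero>} = Q" using Q insert(2) by (auto simp: g_def)
      have gS: "g \<in> carrier (free_space R S)" using f Q g insert(1)
        by (auto simp: free_space_carrier) (simp add: g_def)
      have fq: "f q \<in> carrier R" "q \<in> S" using f Q by (auto simp: free_space_carrier)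
      have "f = g \<oplus>\<^bsub>free_space R S\<^esub> (f q \<odot>\<^bsub>free_space R S\<^esub> unit_vec R q)"
        using f by (auto simp: g_def unit_vec_def free_space_carrier)
      then show "P f" using add[OF gS fq] insert(3) g gS by metis
    qed
  qed
  with f show ?thesis by (auto simp: free_space_carrier)
qed

end

context field begin

section \<open>Tensor products\<close>

abbreviation tF where "tF V W \<equiv> tensor_free R V W"
abbreviation tN where "tN V W \<equiv> tensor_null R V W"
abbreviation T where "T V W \<equiv> tensor R V W"
abbreviation ts where "ts V W v w \<equiv> tens R V W v w"

lemma vs_tF [simp]: "vs (tF V W)" by (simp add: tensor_free_def)

lemma vs_minus_closed [simp]:
  "vs V \<Longrightarrow> x \<in> carrier V \<Longrightarrow> y \<in> carrier V \<Longrightarrow> x \<ominus>\<^bsub>V\<^esub> y \<in> carrier V"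
  by (simp add: abelian_group.minus_closed vs_abelian_group)

lemma unit_vec_tF [simp]:
  "v \<in> carrier V \<Longrightarrow> w \<in> carrier W \<Longrightarrow> unit_vec R (v, w) \<in> carrier (tF V W)"
  by (simp add: tensor_free_def unit_vec_closed)

text \<open>
  The whole space is a submodule that contains the relations, so the intersection that defines the
  hull is taken over a nonempty family and is again a submodule.
\<close>

lemma submodule_tN:
  assumes V: "vs V" and W: "vs W"
  shows "submodule (tN V W) R (tF V W)" and "bilinearity_relations R V W \<subseteq> tN V W"
proof -
  let ?F = "tF V W"
  interpret F: module R ?F by simp
  have rel: "bilinearity_relations R V W \<subseteq> carrier ?F"
    using V W by (auto simp: bilinearity_relations_def Let_def)
  have c: "submodule (carrier ?F) R ?F" by (rule F.carrier_is_submodule)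
  define S where "S = {N. submodule N R ?F \<and> bilinearity_relations R V W \<subseteq> N}"
  have S: "carrier ?F \<in> S" using rel c by (simp add: S_def)
  have tN: "tN V W = \<Inter>S" by (simp add: tensor_null_def hull_def S_def)
  have E: "N \<subseteq> carrier ?F" "\<zero>\<^bsub>?F\<^esub> \<in> N" "a \<in> N \<Longrightarrow> \<ominus>\<^bsub>?F\<^esub> a \<in> N"
    "a \<in> N \<Longrightarrow> b \<in> N \<Longrightarrow> a \<oplus>\<^bsub>?F\<^esub> b \<in> N" "r \<in> carrier R \<Longrightarrow> a \<in> N \<Longrightarrow> r \<odot>\<^bsub>?F\<^esub> a \<in> N"
    if "N \<in> S" for N a b r
  proof -
    have N: "submodule N R ?F" using that by (simp add: S_def)
    show "N \<subseteq> carrier ?F" "a \<in> N \<Longrightarrow> \<ominus>\<^bsub>?F\<^esub> a \<in> N"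
      "a \<in> N \<Longrightarrow> b \<in> N \<Longrightarrow> a \<oplus>\<^bsub>?F\<^esub> b \<in> N" "r \<in> carrier R \<Longrightarrow> a \<in> N \<Longrightarrow> r \<odot>\<^bsub>?F\<^esub> a \<in> N"
      using F.submoduleE[OF N] by auto
    show "\<zero>\<^bsub>?F\<^esub> \<in> N"
      using subgroup.one_closed[OF submodule.axioms(1)[OF N]] by simp
  qed
  show "submodule (tN V W) R ?F" unfolding tN
  proof (rule F.submoduleI)
    show "\<Inter>S \<subseteq> carrier ?F" using S by blast
    show "\<zero>\<^bsub>?F\<^esub> \<in> \<Inter>S" using E(2) by blast
    show "\<And>a. a \<in> \<Inter>S \<Longrightarrow> \<ominus>\<^bsub>?F\<^esub> a \<in> \<Inter>S" using E(3) by blast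
    show "\<And>a b. a \<in> \<Inter>S \<Longrightarrow> b \<in> \<Inter>S \<Longrightarrow> a \<oplus>\<^bsub>?F\<^esub> b \<in> \<Inter>S" using E(4) by blast
    show "\<And>a x. a \<in> carrier R \<Longrightarrow> x \<in> \<Inter>S \<Longrightarrow> a \<odot>\<^bsub>?F\<^esub> x \<in> \<Inter>S" using E(5) by blast
  qed
  show "bilinearity_relations R V W \<subseteq> tN V W" unfolding tN by (auto simp: S_def)
qed

lemma tN_minimal:
  assumes "submodule N R (tF V W)" "bilinearity_relations R V W \<subseteq> N"
  shows "tN V W \<subseteq> N"
  using assms unfolding tensor_null_def by (intro hull_minimal)

lemma tN_subgroup:
  assumes "vs V" "vs W" shows "abelian_subgroup (tN V W) (tF V W)"
  using submodule.axioms(1)[OF submodule_tN(1)[OF assms]]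
  by (intro abelian_subgroupI3 additive_subgroupI vs_abelian_group) simp_all

definition cls where "cls V W f = tN V W +>\<^bsub>tF V W\<^esub> f"

lemma tlift_fext: "tlift R Z B t = fext Z (\<lambda>p. B (fst p) (snd p)) (SOME f. f \<in> t)"
  by (simp add: tlift_def fext_def Let_def)

lemma tensor_simps:
  "carrier (T V W) = a_rcosets\<^bsub>tF V W\<^esub> tN V W"
  "\<zero>\<^bsub>T V W\<^esub> = tN V W" "s \<oplus>\<^bsub>T V W\<^esub> t = s <+>\<^bsub>tF V W\<^esub> t"
  "a \<odot>\<^bsub>T V W\<^esub> t = (\<Union>f\<in>t. tN V W +>\<^bsub>tF V W\<^esub> (a \<odot>\<^bsub>tF V W\<^esub> f))"
  by (simp_all add: tensor_def tensor_space_def Let_def)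

context
  fixes V :: "('a, 'v, 'p) module_scheme" and W :: "('a, 'w, 'q) module_scheme"
  assumes V: "vs V" and W: "vs W"
begin

interpretation F: module R "tF V W" by simp
interpretation N: abelian_subgroup "tN V W" "tF V W" by (rule tN_subgroup[OF V W])

lemma cls_closed: "f \<in> carrier (tF V W) \<Longrightarrow> cls V W f \<in> carrier (T V W)"
  by (simp add: cls_def tensor_simps F.M.a_rcosetsI N.a_subset)

lemma cls_cases:
  assumes "t \<in> carrier (T V W)"
  obtains f where "f \<in> carrier (tF V W)" "t = cls V W f"
  using assms by (auto simp: tensor_simps A_RCOSETS_def' cls_def)

lemma cls_rep:
  assumes f: "f \<in> carrier (tF V W)" and g: "g \<in> cls V W f"
  shows "g \<in> carrier (tF V W)" "cls V W g = cls V W f" "g \<ominus>\<^bsub>tF V W\<^esub> f \<in> tN V W"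
proof -
  show gF: "g \<in> carrier (tF V W)" using f g N.a_elemrcos_carrier by (simp add: cls_def)
  show "cls V W g = cls V W f"
    using N.a_repr_independence'[OF g[unfolded cls_def] f] by (simp add: cls_def)
  show "g \<ominus>\<^bsub>tF V W\<^esub> f \<in> tN V W"
  proof -
    obtain n where n: "n \<in> tN V W" "g = n \<oplus>\<^bsub>tF V W\<^esub> f"
      using g unfolding cls_def a_r_coset_def' by blast
    then have "g \<ominus>\<^bsub>tF V W\<^esub> f = n"
      using f N.a_Hcarr by (simp only: F.minus_eq F.M.a_assoc F.M.r_neg F.M.a_inv_closed F.M.r_zero)
    then show ?thesis using n by simp
  qed
qed

lemma cls_self: "f \<in> carrier (tF V W) \<Longrightarrow> f \<in> cls V W f"
  by (simp add: cls_def N.a_rcos_self)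

lemma cls_add: "f \<in> carrier (tF V W) \<Longrightarrow> g \<in> carrier (tF V W) \<Longrightarrow>
    cls V W f \<oplus>\<^bsub>T V W\<^esub> cls V W g = cls V W (f \<oplus>\<^bsub>tF V W\<^esub> g)"
  by (simp add: cls_def tensor_simps N.a_rcos_sum)

lemma cls_null: "f \<in> tN V W \<Longrightarrow> cls V W f = \<zero>\<^bsub>T V W\<^esub>"
  by (simp add: cls_def tensor_simps N.a_rcos_const)

lemma cls_eqI:
  assumes f: "f \<in> carrier (tF V W)" and g: "g \<in> carrier (tF V W)"
    and d: "g \<ominus>\<^bsub>tF V W\<^esub> f \<in> tN V W"
  shows "cls V W g = cls V W f"
proof -
  have "g = (g \<ominus>\<^bsub>tF V W\<^esub> f) \<oplus>\<^bsub>tF V W\<^esub> f"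
    using f g by (simp only: F.minus_eq F.M.a_assoc F.M.l_neg F.M.a_inv_closed F.M.r_zero)
  then have "g \<in> tN V W +>\<^bsub>tF V W\<^esub> f" using d unfolding a_r_coset_def' by blast
  then show ?thesis using f cls_rep(2) by (simp add: cls_def)
qed

lemma cls_smult:
  assumes f: "f \<in> carrier (tF V W)" and a: "a \<in> carrier R"
  shows "a \<odot>\<^bsub>T V W\<^esub> cls V W f = cls V W (a \<odot>\<^bsub>tF V W\<^esub> f)"
proof -
  have c: "cls V W (a \<odot>\<^bsub>tF V W\<^esub> g) = cls V W (a \<odot>\<^bsub>tF V W\<^esub> f)" if g: "g \<in> cls V W f" for g
  proof (rule cls_eqI)
    have "a \<odot>\<^bsub>tF V W\<^esub> g \<ominus>\<^bsub>tF V W\<^esub> a \<odot>\<^bsub>tF V W\<^esub> f = a \<odot>\<^bsub>tF V W\<^esub> (g \<ominus>\<^bsub>tF V W\<^esub> f)"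
      using f a cls_rep(1)[OF f g] by (simp only: F.minus_eq F.smult_r_distr F.smult_r_minus F.M.a_inv_closed)
    also have "\<dots> \<in> tN V W"
      using cls_rep(3)[OF f g] a F.submoduleE(4)[OF submodule_tN(1)[OF V W]] by blast
    finally show "a \<odot>\<^bsub>tF V W\<^esub> g \<ominus>\<^bsub>tF V W\<^esub> a \<odot>\<^bsub>tF V W\<^esub> f \<in> tN V W" .
  qed (use f a cls_rep(1)[OF f g] in \<open>auto simp del: free_space_simps\<close>)
  have "a \<odot>\<^bsub>T V W\<^esub> cls V W f = (\<Union>g\<in>cls V W f. cls V W (a \<odot>\<^bsub>tF V W\<^esub> g))"
    by (simp only: tensor_simps cls_def)
  also have "\<dots> = (\<Union>g\<in>cls V W f. cls V W (a \<odot>\<^bsub>tF V W\<^esub> f))"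
    by (rule SUP_cong) (simp_all only: c)
  also have "\<dots> = cls V W (a \<odot>\<^bsub>tF V W\<^esub> f)" using cls_self[OF f] by blast
  finally show ?thesis .
qed

lemma vs_tensor [simp]: "vs (T V W)"
proof (rule moduleI, rule is_cring)
  have z: "\<zero>\<^bsub>T V W\<^esub> = cls V W \<zero>\<^bsub>tF V W\<^esub>" using cls_null N.zero_closed by metis
  show "abelian_group (T V W)"
  proof (rule abelian_groupI)
    fix x assume "x \<in> carrier (T V W)"
    then obtain f where f: "f \<in> carrier (tF V W)" "x = cls V W f" by (rule cls_cases)
    have "cls V W (\<ominus>\<^bsub>tF V W\<^esub> f) \<oplus>\<^bsub>T V W\<^esub> x = \<zero>\<^bsub>T V W\<^esub>"
      using f by (simp add: cls_add F.M.l_neg z)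
    then show "\<exists>y\<in>carrier (T V W). y \<oplus>\<^bsub>T V W\<^esub> x = \<zero>\<^bsub>T V W\<^esub>"
      using f by (blast intro: cls_closed F.M.a_inv_closed)
  qed (auto elim!: cls_cases simp: cls_add z cls_closed F.M.a_ac)
next
  fix a x assume "a \<in> carrier R" "x \<in> carrier (T V W)"
  then show "a \<odot>\<^bsub>T V W\<^esub> x \<in> carrier (T V W)"
    by (auto elim!: cls_cases simp: cls_smult cls_closed)
next
  fix a b x assume "a \<in> carrier R" "b \<in> carrier R" "x \<in> carrier (T V W)"
  then show "(a \<oplus> b) \<odot>\<^bsub>T V W\<^esub> x = a \<odot>\<^bsub>T V W\<^esub> x \<oplus>\<^bsub>T V W\<^esub> b \<odot>\<^bsub>T V W\<^esub> x"
    and "(a \<otimes> b) \<odot>\<^bsub>T V W\<^esub> x = a \<odot>\<^bsub>T V W\<^esub> (b \<odot>\<^bsub>T V W\<^esub> x)"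
    by (auto elim!: cls_cases simp: cls_smult cls_add F.smult_l_distr F.smult_assoc1)
next
  fix a x y assume "a \<in> carrier R" "x \<in> carrier (T V W)" "y \<in> carrier (T V W)"
  then show "a \<odot>\<^bsub>T V W\<^esub> (x \<oplus>\<^bsub>T V W\<^esub> y) = a \<odot>\<^bsub>T V W\<^esub> x \<oplus>\<^bsub>T V W\<^esub> a \<odot>\<^bsub>T V W\<^esub> y"
    by (auto elim!: cls_cases simp: cls_smult cls_add F.smult_r_distr)
next
  fix x assume "x \<in> carrier (T V W)"
  then show "\<one> \<odot>\<^bsub>T V W\<^esub> x = x" by (auto elim!: cls_cases simp: cls_smult)
qed

lemma ts_cls: "ts V W v w = cls V W (unit_vec R (v, w))"
  by (simp add: tens_def cls_def)

lemma ts_closed [simp]: "v \<in> carrier V \<Longrightarrow> w \<in> carrier W \<Longrightarrow> ts V W v w \<in> carrier (T V W)"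
  by (simp add: ts_cls cls_closed)

lemma ts_lin_left0:
  assumes w: "w \<in> carrier W"
  shows "(\<lambda>v. ts V W v w) \<in> lin_hom R V (T V W)"
proof (rule lin_homI)
  fix x y assume x: "x \<in> carrier V" and y: "y \<in> carrier V"
  have "unit_vec R (x \<oplus>\<^bsub>V\<^esub> y, w) \<ominus>\<^bsub>tF V W\<^esub> (unit_vec R (x, w) \<oplus>\<^bsub>tF V W\<^esub> unit_vec R (y, w))
     \<in> bilinearity_relations R V W"
    unfolding bilinearity_relations_def Let_def using x y w by blast
  then show "ts V W (x \<oplus>\<^bsub>V\<^esub> y) w = ts V W x w \<oplus>\<^bsub>T V W\<^esub> ts V W y w"
    using x y w V submodule_tN(2)[OF V W] by (simp only: ts_cls cls_add unit_vec_tF) (rule cls_eqI, auto)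
next
  fix a x assume x: "x \<in> carrier V" and a: "a \<in> carrier R"
  have "unit_vec R (a \<odot>\<^bsub>V\<^esub> x, w) \<ominus>\<^bsub>tF V W\<^esub> (a \<odot>\<^bsub>tF V W\<^esub> unit_vec R (x, w))
     \<in> bilinearity_relations R V W"
    unfolding bilinearity_relations_def Let_def using x a w by blast
  then show "ts V W (a \<odot>\<^bsub>V\<^esub> x) w = a \<odot>\<^bsub>T V W\<^esub> ts V W x w"
    using x a w V submodule_tN(2)[OF V W] by (simp only: ts_cls cls_smult unit_vec_tF) (rule cls_eqI, auto)
qed (use w in simp)

lemma ts_lin_right0:
  assumes v: "v \<in> carrier V"
  shows "(\<lambda>w. ts V W v w) \<in> lin_hom R W (T V W)"
proof (rule lin_homI)
  fix x y assume x: "x \<in> carrier W" and y: "y \<in> carrier W"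
  have "unit_vec R (v, x \<oplus>\<^bsub>W\<^esub> y) \<ominus>\<^bsub>tF V W\<^esub> (unit_vec R (v, x) \<oplus>\<^bsub>tF V W\<^esub> unit_vec R (v, y))
     \<in> bilinearity_relations R V W"
    unfolding bilinearity_relations_def Let_def using x y v by blast
  then show "ts V W v (x \<oplus>\<^bsub>W\<^esub> y) = ts V W v x \<oplus>\<^bsub>T V W\<^esub> ts V W v y"
    using x y v W submodule_tN(2)[OF V W] by (simp only: ts_cls cls_add unit_vec_tF) (rule cls_eqI, auto)
next
  fix a x assume x: "x \<in> carrier W" and a: "a \<in> carrier R"
  have "unit_vec R (v, a \<odot>\<^bsub>W\<^esub> x) \<ominus>\<^bsub>tF V W\<^esub> (a \<odot>\<^bsub>tF V W\<^esub> unit_vec R (v, x))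
     \<in> bilinearity_relations R V W"
    unfolding bilinearity_relations_def Let_def using x a v by blast
  then show "ts V W v (a \<odot>\<^bsub>W\<^esub> x) = a \<odot>\<^bsub>T V W\<^esub> ts V W v x"
    using x a v W submodule_tN(2)[OF V W] by (simp only: ts_cls cls_smult unit_vec_tF) (rule cls_eqI, auto)
qed (use v in simp)

lemma ts_bil: "bil V W (T V W) (ts V W)"
  by (intro bilI ts_lin_left0 ts_lin_right0)

lemma tensor_induct [consumes 1, case_names zero add]:
  assumes t: "t \<in> carrier (T V W)"
    and zero: "P \<zero>\<^bsub>T V W\<^esub>"
    and add: "\<And>t v w. t \<in> carrier (T V W) \<Longrightarrow> v \<in> carrier V \<Longrightarrow> w \<in> carrier W \<Longrightarrow> P t \<Longrightarrow>
       P (t \<oplus>\<^bsub>T V W\<^esub> ts V W v w)"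
  shows "P t"
proof -
  have "P (cls V W f)" if "f \<in> carrier (tF V W)" for f
    using that unfolding tensor_free_def
  proof (induction f rule: free_space_induct)
    case zero
    have "(\<lambda>p. \<zero>) = \<zero>\<^bsub>tF V W\<^esub>" by (simp add: tensor_free_def)
    then have "cls V W (\<lambda>p. \<zero>) = \<zero>\<^bsub>T V W\<^esub>" using cls_null N.zero_closed by metis
    then show ?case using \<open>P \<zero>\<^bsub>T V W\<^esub>\<close> by simp
  next
    case (add f a p)
    obtain v w where p: "p = (v, w)" "v \<in> carrier V" "w \<in> carrier W" using add(3) by auto
    have f: "f \<in> carrier (tF V W)" using add by (simp add: tensor_free_def)
    have "cls V W (f \<oplus>\<^bsub>tF V W\<^esub> (a \<odot>\<^bsub>tF V W\<^esub> unit_vec R p)) =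
        cls V W f \<oplus>\<^bsub>T V W\<^esub> ts V W (a \<odot>\<^bsub>V\<^esub> v) w"
      using f add(2) p lin_scale[OF ts_lin_left0, of w a v]
      by (simp add: cls_add cls_smult ts_cls)
    then show ?case
      using assms(3)[OF cls_closed[OF f] _ p(3), of "a \<odot>\<^bsub>V\<^esub> v"] add p V
      by (simp add: tensor_free_def)
  qed
  then show ?thesis using t by (auto elim: cls_cases)
qed

lemma lin_eq_on_tens:
  assumes t: "t \<in> carrier (T V W)" and Z: "vs Z"
    and f: "f \<in> lin_hom R (T V W) Z" and g: "g \<in> lin_hom R (T V W) Z"
    and eq: "\<And>v w. v \<in> carrier V \<Longrightarrow> w \<in> carrier W \<Longrightarrow> f (ts V W v w) = g (ts V W v w)"
  shows "f t = g t"
  using t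
  by (induction t rule: tensor_induct) (use Z f g eq in \<open>auto simp: lin_zero[of _ Z] lin_plus\<close>)

lemma some_rep:
  assumes t: "t \<in> carrier (T V W)"
  shows "(SOME f. f \<in> t) \<in> t" "(SOME f. f \<in> t) \<in> carrier (tF V W)"
proof -
  obtain f where f: "f \<in> carrier (tF V W)" "t = cls V W f" using t by (rule cls_cases)
  show g: "(SOME f. f \<in> t) \<in> t"
    by (rule someI[of "\<lambda>g. g \<in> t" f]) (use f cls_self in simp)
  show "(SOME f. f \<in> t) \<in> carrier (tF V W)" using cls_rep(1) f g by simp
qed

lemma some_rep_coeffs:
  assumes t: "t \<in> carrier (T V W)"
  shows "(SOME f. f \<in> t) p \<in> carrier R" "finite {p. (SOME f. f \<in> t) p \<noteq> \<zero>}"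
    "(SOME f. f \<in> t) p \<noteq> \<zero> \<Longrightarrow> fst p \<in> carrier V \<and> snd p \<in> carrier W"
  using some_rep(2)[OF t] unfolding tensor_free_def free_space_carrier by (blast, blast, auto)

text \<open>
  The linear extension of a bilinear \<open>B\<close> to the free space kills the bilinearity relations. Its
  kernel is a submodule, hence contains \<open>tensor_null\<close>, and the value on a coset does not depend on
  the representative that \<open>tlift\<close> chooses.
\<close>

lemma tlift_cls:
  assumes Z: "vs Z" and B: "bil V W Z B" and f: "f \<in> carrier (tF V W)"
  shows "tlift R Z B (cls V W f) = fext Z (\<lambda>p. B (fst p) (snd p)) f"
proof -
  let ?b = "\<lambda>p. B (fst p) (snd p)"
  interpret Z: module R Z by (rule Z)
  have b: "?b p \<in> carrier Z" if "p \<in> carrier V \<times> carrier W" for p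
    using that B by (auto intro: bil_closed)
  have lin: "fext Z ?b \<in> lin_hom R (tF V W) Z"
    unfolding tensor_free_def by (rule fext_lin) (use Z b in auto)
  have u: "fext Z ?b (unit_vec R (v, w)) = B v w" if "v \<in> carrier V" "w \<in> carrier W" for v w
    using fext_unit_vec[OF Z, of ?b "(v, w)"] that b[of "(v, w)"] by simp
  have minus: "fext Z ?b (g \<ominus>\<^bsub>tF V W\<^esub> h) = fext Z ?b g \<ominus>\<^bsub>Z\<^esub> fext Z ?b h"
    if g: "g \<in> carrier (tF V W)" and h: "h \<in> carrier (tF V W)" for g h
  proof -
    have "\<ominus>\<^bsub>tF V W\<^esub> h = (\<ominus> \<one>) \<odot>\<^bsub>tF V W\<^esub> h"
      using h by (simp only: F.smult_l_minus one_closed F.smult_one)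
    then show ?thesis using g h lin_closed[OF lin h]
      by (simp add: F.minus_eq Z.minus_eq lin_plus[OF lin] lin_scale[OF lin] Z.smult_l_minus)
  qed
  define K where "K = {g \<in> carrier (tF V W). fext Z ?b g = \<zero>\<^bsub>Z\<^esub>}"
  have "submodule K R (tF V W)"
  proof (rule F.submoduleI)
    fix a assume a: "a \<in> K"
    then show "\<ominus>\<^bsub>tF V W\<^esub> a \<in> K"
      using minus[of "\<zero>\<^bsub>tF V W\<^esub>" a] lin_zero[OF _ Z lin] by (simp add: K_def F.minus_eq Z.minus_eq)
  qed (auto simp: K_def lin_plus[OF lin] lin_scale[OF lin] lin_zero[OF _ Z lin] Z)
  moreover have "bilinearity_relations R V W \<subseteq> K"
  proof -
    have n: "x \<ominus>\<^bsub>Z\<^esub> x = \<zero>\<^bsub>Z\<^esub>" if "x \<in> carrier Z" for x using that by (simp add: Z.r_neg Z.minus_eq)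
    show ?thesis using V W b
      by (auto simp: K_def bilinearity_relations_def Let_def minus u lin_plus[OF lin]
          lin_scale[OF lin] lin_plus[OF bil_left[OF B]] lin_plus[OF bil_right[OF B]]
          lin_scale[OF bil_left[OF B]] lin_scale[OF bil_right[OF B]] n)
  qed
  ultimately have K: "tN V W \<subseteq> K" by (rule tN_minimal)
  define g where "g = (SOME g. g \<in> cls V W f)"
  have g: "g \<in> cls V W f" unfolding g_def by (rule some_rep(1)[OF cls_closed[OF f]])
  have "g \<ominus>\<^bsub>tF V W\<^esub> f \<in> K" using cls_rep(3)[OF f g] K by auto
  then have "fext Z ?b g \<ominus>\<^bsub>Z\<^esub> fext Z ?b f = \<zero>\<^bsub>Z\<^esub>" using minus[OF cls_rep(1)[OF f g] f] by (simp add: K_def)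
  then have "fext Z ?b g = fext Z ?b f"
    using lin_closed[OF lin cls_rep(1)[OF f g]] lin_closed[OF lin f]
      Z.M.minus_equality[of "fext Z ?b g" "\<ominus>\<^bsub>Z\<^esub> fext Z ?b f"]
    by (simp add: Z.minus_eq)
  then show ?thesis by (simp add: tlift_fext g_def)
qed

lemma tlift_lin:
  assumes Z: "vs Z" and B: "bil V W Z B"
  shows "tlift R Z B \<in> lin_hom R (T V W) Z"
proof -
  have lin: "fext Z (\<lambda>p. B (fst p) (snd p)) \<in> lin_hom R (tF V W) Z"
    unfolding tensor_free_def by (rule fext_lin) (use Z B in \<open>auto intro: bil_closed\<close>)
  show ?thesis
  proof (rule lin_homI)
    fix x assume "x \<in> carrier (T V W)"
    then show "tlift R Z B x \<in> carrier Z"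
      using lin_closed[OF lin] by (auto elim!: cls_cases simp: tlift_cls[OF Z B])
  next
    fix x y assume "x \<in> carrier (T V W)" "y \<in> carrier (T V W)"
    then obtain f g where fg: "f \<in> carrier (tF V W)" "g \<in> carrier (tF V W)" "x = cls V W f" "y = cls V W g"
      by (meson cls_cases)
    have "tlift R Z B (cls V W (f \<oplus>\<^bsub>tF V W\<^esub> g)) =
       tlift R Z B (cls V W f) \<oplus>\<^bsub>Z\<^esub> tlift R Z B (cls V W g)"
      using fg by (subst (1 2 3) tlift_cls[OF Z B]) (auto simp: lin_plus[OF lin])
    then show "tlift R Z B (x \<oplus>\<^bsub>T V W\<^esub> y) = tlift R Z B x \<oplus>\<^bsub>Z\<^esub> tlift R Z B y"
      using fg cls_add by simp
  next
    fix a x assume "a \<in> carrier R" "x \<in> carrier (T V W)"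
    then obtain f where fg: "a \<in> carrier R" "f \<in> carrier (tF V W)" "x = cls V W f"
      by (meson cls_cases)
    have "tlift R Z B (cls V W (a \<odot>\<^bsub>tF V W\<^esub> f)) = a \<odot>\<^bsub>Z\<^esub> tlift R Z B (cls V W f)"
      using fg by (subst (1 2) tlift_cls[OF Z B]) (auto simp: lin_scale[OF lin])
    then show "tlift R Z B (a \<odot>\<^bsub>T V W\<^esub> x) = a \<odot>\<^bsub>Z\<^esub> tlift R Z B x"
      using fg cls_smult by simp
  qed
qed

lemma tlift_tens:
  assumes "vs Z" "bil V W Z B" "v \<in> carrier V" "w \<in> carrier W"
  shows "tlift R Z B (ts V W v w) = B v w"
  using assms fext_unit_vec[of Z "\<lambda>p. B (fst p) (snd p)" "(v, w)"]
  by (simp add: ts_cls tlift_cls bil_closed)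

text \<open>
  On a fixed tensor, \<open>tlift\<close> is a finite linear combination of values of \<open>B\<close>. This is what the
  next four facts use; they allow linear maps, congruences and further sums to be moved through a
  Sweedler sum.
\<close>

lemma tlift_closed:
  assumes "vs Z" "t \<in> carrier (T V W)"
    "\<And>v w. v \<in> carrier V \<Longrightarrow> w \<in> carrier W \<Longrightarrow> B v w \<in> carrier Z"
  shows "tlift R Z B t \<in> carrier Z"
  unfolding tlift_fext fext_def
  by (rule vs_finsum_closed) (use assms some_rep_coeffs[OF assms(2)] in auto)

lemma tlift_cong:
  assumes Z: "vs Z" and t: "t \<in> carrier (T V W)"
    "\<And>v w. v \<in> carrier V \<Longrightarrow> w \<in> carrier W \<Longrightarrow> B v w = B' v w"
    "\<And>v w. v \<in> carrier V \<Longrightarrow> w \<in> carrier W \<Longrightarrow> B' v w \<in> carrier Z"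
  shows "tlift R Z B t = tlift R Z B' t"
  unfolding tlift_fext fext_def
  by (rule vs_finsum_cong) (use assms some_rep_coeffs[OF t(1)] in auto)

lemma lin_tlift:
  assumes Z: "vs Z" and Z': "vs Z'" and h: "h \<in> lin_hom R Z Z'" and t: "t \<in> carrier (T V W)"
    and B: "\<And>v w. v \<in> carrier V \<Longrightarrow> w \<in> carrier W \<Longrightarrow> B v w \<in> carrier Z"
  shows "h (tlift R Z B t) = tlift R Z' (\<lambda>v w. h (B v w)) t"
  unfolding tlift_fext fext_def using Z Z' B some_rep_coeffs[OF t]
  by (subst lin_finsum[OF Z Z' h]) (auto simp: lin_scale[OF h] lin_closed[OF h] intro!: vs_finsum_cong)

lemma lin_tlift_param:
  assumes Z: "vs Z" and t: "t \<in> carrier (T V W)"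
    and G: "\<And>v w. v \<in> carrier V \<Longrightarrow> w \<in> carrier W \<Longrightarrow> (\<lambda>x. G x v w) \<in> lin_hom R U Z"
  shows "(\<lambda>x. tlift R Z (\<lambda>v w. G x v w) t) \<in> lin_hom R U Z"
proof -
  define f where "f = (SOME f. f \<in> t)"
  have fp: "f p \<in> carrier R" for p unfolding f_def by (rule some_rep_coeffs[OF t])
  have "(\<lambda>x. G x (fst p) (snd p)) \<in> lin_hom R U Z" if "f p \<noteq> \<zero>" for p
    using G that some_rep_coeffs(3)[OF t, of p] unfolding f_def by blast
  note gl = lin_closed[OF this] lin_plus[OF this] lin_scale[OF this]
  show ?thesis unfolding tlift_fext fext_def f_def[symmetric]
  proof (rule lin_homI)
    fix x assume "x \<in> carrier U"
    then show "finsum Z (\<lambda>p. f p \<odot>\<^bsub>Z\<^esub> G x (fst p) (snd p)) {p. f p \<noteq> \<zero>} \<in> carrier Z"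
      using Z fp gl(1) by (intro vs_finsum_closed vs_smult_closed) auto
  next
    fix x y assume xy: "x \<in> carrier U" "y \<in> carrier U"
    show "finsum Z (\<lambda>p. f p \<odot>\<^bsub>Z\<^esub> G (x \<oplus>\<^bsub>U\<^esub> y) (fst p) (snd p)) {p. f p \<noteq> \<zero>} =
       finsum Z (\<lambda>p. f p \<odot>\<^bsub>Z\<^esub> G x (fst p) (snd p)) {p. f p \<noteq> \<zero>} \<oplus>\<^bsub>Z\<^esub>
       finsum Z (\<lambda>p. f p \<odot>\<^bsub>Z\<^esub> G y (fst p) (snd p)) {p. f p \<noteq> \<zero>}"
      using xy Z fp gl(1,2)
      by (subst vs_finsum_add[symmetric]) (auto simp: module.smult_r_distr intro!: vs_finsum_cong)
  next
    fix a x assume ax: "a \<in> carrier R" "x \<in> carrier U"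
    show "finsum Z (\<lambda>p. f p \<odot>\<^bsub>Z\<^esub> G (a \<odot>\<^bsub>U\<^esub> x) (fst p) (snd p)) {p. f p \<noteq> \<zero>} =
       a \<odot>\<^bsub>Z\<^esub> finsum Z (\<lambda>p. f p \<odot>\<^bsub>Z\<^esub> G x (fst p) (snd p)) {p. f p \<noteq> \<zero>}"
      using ax Z fp gl(1,3)
      by (subst vs_finsum_smult) (auto simp: vs_smult_smult m_comm intro!: vs_finsum_cong)
  qed
qed

end

lemma tlift_swap:
  assumes V: "vs V" and W: "vs W" and V': "vs V'" and W': "vs W'" and Z: "vs Z"
    and t: "t \<in> carrier (T V W)" and s: "s \<in> carrier (T V' W')"
    and G: "\<And>v w v' w'. v \<in> carrier V \<Longrightarrow> w \<in> carrier W \<Longrightarrow> v' \<in> carrier V' \<Longrightarrow> w' \<in> carrier W' \<Longrightarrow>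
       G v w v' w' \<in> carrier Z"
  shows "tlift R Z (\<lambda>v w. tlift R Z (\<lambda>v' w'. G v w v' w') s) t =
         tlift R Z (\<lambda>v' w'. tlift R Z (\<lambda>v w. G v w v' w') t) s"
proof -
  define f where "f = (SOME f. f \<in> t)"
  define g where "g = (SOME g. g \<in> s)"
  note fp = some_rep_coeffs[OF V W t, folded f_def]
  note gp = some_rep_coeffs[OF V' W' s, folded g_def]
  have c: "G (fst p) (snd p) (fst q) (snd q) \<in> carrier Z" if "f p \<noteq> \<zero>" "g q \<noteq> \<zero>" for p q
    using fp(3)[OF that(1)] gp(3)[OF that(2)] G by blast
  have c': "f p \<odot>\<^bsub>Z\<^esub> (g q \<odot>\<^bsub>Z\<^esub> G (fst p) (snd p) (fst q) (snd q)) \<in> carrier Z"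
    "g q \<odot>\<^bsub>Z\<^esub> G (fst p) (snd p) (fst q) (snd q) \<in> carrier Z"
    "f p \<odot>\<^bsub>Z\<^esub> G (fst p) (snd p) (fst q) (snd q) \<in> carrier Z"
    "f p \<odot>\<^bsub>Z\<^esub> (g q \<odot>\<^bsub>Z\<^esub> G (fst p) (snd p) (fst q) (snd q)) =
     g q \<odot>\<^bsub>Z\<^esub> (f p \<odot>\<^bsub>Z\<^esub> G (fst p) (snd p) (fst q) (snd q))" if "f p \<noteq> \<zero>" "g q \<noteq> \<zero>" for p q
    using c[OF that] fp(1)[of p] gp(1)[of q] Z by (simp_all add: vs_smult_smult m_comm)
  let ?h = "\<lambda>p q. f p \<odot>\<^bsub>Z\<^esub> (g q \<odot>\<^bsub>Z\<^esub> G (fst p) (snd p) (fst q) (snd q))"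
  have "tlift R Z (\<lambda>v w. tlift R Z (\<lambda>v' w'. G v w v' w') s) t =
     finsum Z (\<lambda>p. finsum Z (\<lambda>q. ?h p q) {q. g q \<noteq> \<zero>}) {p. f p \<noteq> \<zero>}"
    unfolding tlift_fext fext_def f_def[symmetric] g_def[symmetric]
    by (rule vs_finsum_cong[OF Z refl], subst vs_finsum_smult)
      (use Z fp gp c'(1,2) in \<open>auto intro!: vs_finsum_closed simp del: vs_smult_closed\<close>)
  also have "\<dots> = finsum Z (\<lambda>q. finsum Z (\<lambda>p. ?h p q) {p. f p \<noteq> \<zero>}) {q. g q \<noteq> \<zero>}"
    using Z fp gp c' by (intro vs_finsum_swap) auto
  also have "\<dots> = tlift R Z (\<lambda>v' w'. tlift R Z (\<lambda>v w. G v w v' w') t) s"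
    unfolding tlift_fext fext_def f_def[symmetric] g_def[symmetric]
    by (rule vs_finsum_cong[OF Z refl], subst vs_finsum_smult)
      (use Z fp gp c in \<open>auto simp: vs_smult_smult m_comm intro!: vs_finsum_cong vs_finsum_closed
        vs_smult_closed[OF Z] simp del: vs_smult_closed\<close>)
  finally show ?thesis .
qed

end

section \<open>Dependence on the linear structure\<close>

text \<open>
  The vector space structure alone. Tensor products, and the maps between them, see nothing else
  of an algebra, so they do not change when it is replaced by its opposite.
\<close>

definition lin_part where "lin_part V = (carrier V, zero V, add V, smult V)"

lemma lin_part_op [simp]: "lin_part (op_alg V) = lin_part V" "lin_part (hopf_op K) = lin_part K"
  by (simp_all add: lin_part_def op_alg_def hopf_op_def)

lemma op_simps [simp]:
  "carrier (op_alg A) = carrier A" "\<zero>\<^bsub>op_alg A\<^esub> = \<zero>\<^bsub>A\<^esub>" "\<one>\<^bsub>op_alg A\<^esub> = \<one>\<^bsub>A\<^esub>"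
  "x \<oplus>\<^bsub>op_alg A\<^esub> y = x \<oplus>\<^bsub>A\<^esub> y" "x \<otimes>\<^bsub>op_alg A\<^esub> y = y \<otimes>\<^bsub>A\<^esub> x" "a \<odot>\<^bsub>op_alg A\<^esub> x = a \<odot>\<^bsub>A\<^esub> x"
  "carrier (hopf_op K) = carrier K" "\<zero>\<^bsub>hopf_op K\<^esub> = \<zero>\<^bsub>K\<^esub>" "\<one>\<^bsub>hopf_op K\<^esub> = \<one>\<^bsub>K\<^esub>"
  "k \<oplus>\<^bsub>hopf_op K\<^esub> l = k \<oplus>\<^bsub>K\<^esub> l" "k \<otimes>\<^bsub>hopf_op K\<^esub> l = l \<otimes>\<^bsub>K\<^esub> k" "a \<odot>\<^bsub>hopf_op K\<^esub> k = a \<odot>\<^bsub>K\<^esub> k"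
  "comult (hopf_op K) = comult K" "counit (hopf_op K) = counit K"
  by (simp_all add: op_alg_def hopf_op_def)

text \<open>
  The two records may have different extension types, so they cannot be compared as a whole.
\<close>

lemma finsum_lin_part: "lin_part V = lin_part V' \<Longrightarrow> finsum V = finsum V'"
  by (intro ext) (simp add: finsum_def finprod_def lin_part_def)

lemma lin_hom_lin_part:
  "lin_part V = lin_part V' \<Longrightarrow> lin_part W = lin_part W' \<Longrightarrow> lin_hom R V W = lin_hom R V' W'"
  by (simp add: lin_hom_def lin_part_def)

lemma tlift_lin_part: "lin_part Z = lin_part Z' \<Longrightarrow> tlift R Z = tlift R Z'"
  by (intro ext) (simp add: tlift_def Let_def finsum_lin_part[of Z Z'], simp add: lin_part_def)

lemma tensor_free_lin_part:
  "lin_part V = lin_part V' \<Longrightarrow> lin_part W = lin_part W' \<Longrightarrow> tensor_free R V W = tensor_free R V' W'"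
  by (simp add: tensor_free_def lin_part_def)

lemma tensor_null_lin_part:
  "lin_part V = lin_part V' \<Longrightarrow> lin_part W = lin_part W' \<Longrightarrow> tensor_null R V W = tensor_null R V' W'"
  by (simp add: tensor_null_def bilinearity_relations_def tensor_free_def lin_part_def)

lemma tens_lin_part:
  "lin_part V = lin_part V' \<Longrightarrow> lin_part W = lin_part W' \<Longrightarrow> tens R V W = tens R V' W'"
  using tensor_free_lin_part[of V V' W W' R] tensor_null_lin_part[of V V' W W' R]
  by (intro ext) (simp add: tens_def)

lemma tensor_space_lin_part:
  "lin_part V = lin_part V' \<Longrightarrow> lin_part W = lin_part W' \<Longrightarrow> tensor_space R V W = tensor_space R V' W'"
  using tensor_free_lin_part[of V V' W W' R] tensor_null_lin_part[of V V' W W' R]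
  by (simp add: tensor_space_def)

lemma lin_part_tensor_space: "lin_part (tensor_space R V W) = lin_part (tensor R V W)"
  by (simp add: lin_part_def tensor_def)

lemma tensor_lin_part:
  "lin_part V = lin_part V' \<Longrightarrow> lin_part W = lin_part W' \<Longrightarrow> lin_part (tensor R V W) = lin_part (tensor R V' W')"
  using tensor_space_lin_part[of V V' W W' R] lin_part_tensor_space[of R] by metis

lemma tmap_lin_part:
  "lin_part V = lin_part V' \<Longrightarrow> lin_part W = lin_part W' \<Longrightarrow> tmap R V W = tmap R V' W'"
  by (intro ext) (simp add: tmap_def tens_lin_part[of V V' W W'] tlift_lin_part[OF tensor_lin_part[of V V' W W']])

lemma tflip_lin_part:
  "lin_part V = lin_part V' \<Longrightarrow> lin_part W = lin_part W' \<Longrightarrow> tflip R V W = tflip R V' W'"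
  by (intro ext) (simp add: tflip_def tens_lin_part[of W W' V V'] tlift_lin_part[OF tensor_lin_part[of W W' V V']])

lemma tassoc_lin_part:
  assumes U: "lin_part U = lin_part U'" and V: "lin_part V = lin_part V'" and W: "lin_part W = lin_part W'"
  shows "tassoc R U V W = tassoc R U' V' W'"
proof -
  note VW = tensor_lin_part[OF V W, of R]
  show ?thesis
    unfolding tassoc_def Let_def tlift_lin_part[OF tensor_lin_part[OF U VW]] tens_lin_part[OF V W]
      tens_lin_part[OF U VW] ..
qed

lemma module_lin_part:
  assumes "lin_part V = lin_part V'" "module R V" shows "module R V'"
proof -
  have e: "carrier V' = carrier V" "zero V' = zero V" "add V' = add V" "smult V' = smult V"
    using assms(1) by (auto simp: lin_part_def)
  interpret V: module R V by fact
  have "abelian_group V'"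
    by (rule abelian_groupI) (auto simp: e V.M.a_ac intro: V.M.l_neg)
  then show ?thesis using assms(2) by (simp add: module_def module_axioms_def e)
qed

context field begin

lemma vs_op [simp]: "vs (op_alg V) = vs V" "vs (hopf_op K) = vs K"
  using module_lin_part[of "op_alg V" V R] module_lin_part[of V "op_alg V" R]
    module_lin_part[of "hopf_op K" K R] module_lin_part[of K "hopf_op K" R] by auto

section \<open>Linear and multilinear maps on tensor products\<close>

text \<open>
  Linearity of an expression in one of its variables. Together with \<open>bilI\<close> and \<open>trilI\<close> these rules
  discharge the side conditions of the universal property.
\<close>

named_theorems lins

lemmas [lins] = lin_id lin_smult_const lin_scalar lin_ground_mult

lemma lin_tens_left [lins]:
  "vs V \<Longrightarrow> vs W \<Longrightarrow> f \<in> lin_hom R U V \<Longrightarrow> w \<in> carrier W \<Longrightarrow> (\<lambda>x. ts V W (f x) w) \<in> lin_hom R U (T V W)"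
  by (rule lin_comp[OF ts_lin_left0])

lemma lin_tens_right [lins]:
  "vs V \<Longrightarrow> vs W \<Longrightarrow> f \<in> lin_hom R U W \<Longrightarrow> v \<in> carrier V \<Longrightarrow> (\<lambda>x. ts V W v (f x)) \<in> lin_hom R U (T V W)"
  by (rule lin_comp[OF ts_lin_right0])

lemma lin_tlift_arg:
  "vs V \<Longrightarrow> vs W \<Longrightarrow> vs Z \<Longrightarrow> bil V W Z B \<Longrightarrow> f \<in> lin_hom R U (T V W) \<Longrightarrow>
    (\<lambda>x. tlift R Z B (f x)) \<in> lin_hom R U Z"
  by (rule lin_comp[OF tlift_lin])

lemma lin_plus_fun [lins]:
  assumes "vs W" and f: "f \<in> lin_hom R V W" and g: "g \<in> lin_hom R V W"
  shows "(\<lambda>x. f x \<oplus>\<^bsub>W\<^esub> g x) \<in> lin_hom R V W"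
proof -
  interpret W: module R W by fact
  show ?thesis
    by (rule lin_homI)
      (use lin_closed[OF f] lin_closed[OF g] in \<open>auto simp: lin_plus[OF f] lin_plus[OF g]
        lin_scale[OF f] lin_scale[OF g] W.smult_r_distr W.M.a_ac\<close>)
qed

lemma lin_finsum_fun:
  assumes W: "vs W" and I: "finite I" and f: "\<And>i. i \<in> I \<Longrightarrow> (\<lambda>x. f i x) \<in> lin_hom R V W"
  shows "(\<lambda>x. finsum W (\<lambda>i. f i x) I) \<in> lin_hom R V W"
proof (rule lin_homI)
  note gl = lin_closed[OF f] lin_plus[OF f] lin_scale[OF f]
  show "\<And>x. x \<in> carrier V \<Longrightarrow> finsum W (\<lambda>i. f i x) I \<in> carrier W" using W gl by simp
  show "finsum W (\<lambda>i. f i (x \<oplus>\<^bsub>V\<^esub> y)) I = finsum W (\<lambda>i. f i x) I \<oplus>\<^bsub>W\<^esub> finsum W (\<lambda>i. f i y) I"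
    if "x \<in> carrier V" "y \<in> carrier V" for x y
    using W gl that by (subst vs_finsum_add[symmetric]) (auto intro!: vs_finsum_cong)
  show "finsum W (\<lambda>i. f i (a \<odot>\<^bsub>V\<^esub> x)) I = a \<odot>\<^bsub>W\<^esub> finsum W (\<lambda>i. f i x) I"
    if "a \<in> carrier R" "x \<in> carrier V" for a x
    using W gl that by (subst vs_finsum_smult) (auto intro!: vs_finsum_cong)
qed

lemma bil_tens: "vs V \<Longrightarrow> vs W \<Longrightarrow> bil V W (T V W) (\<lambda>v w. ts V W v w)"
  by (rule ts_bil)

lemma tlift_eta:
  assumes "vs V" "vs W" "t \<in> carrier (T V W)"
  shows "tlift R (T V W) (\<lambda>v w. ts V W v w) t = t"
  using lin_eq_on_tens[OF assms vs_tensor[OF assms(1,2)] tlift_lin[OF _ _ _ bil_tens] lin_id]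
    assms by (simp add: tlift_tens bil_tens)

lemma lin_eta:
  assumes V: "vs V" and W: "vs W" and Z: "vs Z" and h: "h \<in> lin_hom R (T V W) Z"
    and t: "t \<in> carrier (T V W)"
  shows "h t = tlift R Z (\<lambda>v w. h (ts V W v w)) t"
  using lin_tlift[OF V W vs_tensor[OF V W] Z h t, of "ts V W"] V W t by (simp add: tlift_eta)

lemma lin_hom_closed_apply [simp]:
  "f \<in> lin_hom R V W \<Longrightarrow> x \<in> carrier V \<Longrightarrow> f x \<in> carrier W"
  by (rule lin_closed)

lemma bil_tmap:
  assumes "vs V'" "vs W'" "f \<in> lin_hom R V V'" "g \<in> lin_hom R W W'"
  shows "bil V W (T V' W') (\<lambda>v w. ts V' W' (f v) (g w))"
  using assms by (intro bilI lins) auto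

lemma tmap_lin:
  assumes "vs V" "vs W" "vs V'" "vs W'" "f \<in> lin_hom R V V'" "g \<in> lin_hom R W W'"
  shows "tmap R V' W' f g \<in> lin_hom R (T V W) (T V' W')"
  unfolding tmap_def using assms by (intro tlift_lin bil_tmap vs_tensor)

lemma bil_comp:
  assumes B: "bil V' W' Z B" and "f \<in> lin_hom R V V'" "g \<in> lin_hom R W W'"
  shows "bil V W Z (\<lambda>v w. B (f v) (g w))"
  using assms by (intro bilI lin_comp[OF bil_left[OF B]] lin_comp[OF bil_right[OF B]]) auto

lemma tlift_tmap:
  assumes V: "vs V" and W: "vs W" and V': "vs V'" and W': "vs W'" and Z: "vs Z"
    and f: "f \<in> lin_hom R V V'" and g: "g \<in> lin_hom R W W'" and B: "bil V' W' Z B"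
    and t: "t \<in> carrier (T V W)"
  shows "tlift R Z B (tmap R V' W' f g t) = tlift R Z (\<lambda>v w. B (f v) (g w)) t"
proof -
  have "tlift R Z B (tmap R V' W' f g t) = tlift R Z (\<lambda>v w. tlift R Z B (ts V' W' (f v) (g w))) t"
    unfolding tmap_def
    by (rule lin_tlift[OF V W vs_tensor[OF V' W'] Z tlift_lin[OF V' W' Z B] t]) (use assms in auto)
  also have "\<dots> = tlift R Z (\<lambda>v w. B (f v) (g w)) t"
    using assms by (intro tlift_cong[OF V W Z t]) (auto simp: tlift_tens bil_closed)
  finally show ?thesis .
qed

lemma tmap_tens:
  assumes "vs V" "vs W" "vs V'" "vs W'" "f \<in> lin_hom R V V'" "g \<in> lin_hom R W W'"
    "v \<in> carrier V" "w \<in> carrier W"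
  shows "tmap R V' W' f g (ts V W v w) = ts V' W' (f v) (g w)"
  unfolding tmap_def
  by (rule tlift_tens[OF assms(1,2) vs_tensor[OF assms(3,4)] bil_tmap[OF assms(3-6)] assms(7,8)])

lemma tmap_id_closed:
  assumes "vs V" "vs W" "vs W'" "g \<in> lin_hom R W W'" "t \<in> carrier (T V W)"
  shows "tmap R V W' id g t \<in> carrier (T V W')"
  using tmap_lin[OF assms(1,2,1,3) _ assms(4), of id] lin_id[of V] assms(5)
  by (auto simp: id_def intro: lin_closed)

text \<open>
  Trilinear maps. They extend to both bracketings of a triple tensor product (\<open>tlift_tassoc\<close>).
\<close>

definition tril where
  "tril U V W Z G \<longleftrightarrow> (\<forall>u\<in>carrier U. bil V W Z (G u)) \<and>
     (\<forall>v\<in>carrier V. \<forall>w\<in>carrier W. (\<lambda>u. G u v w) \<in> lin_hom R U Z)"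

lemma trilI:
  assumes "\<And>v w. v \<in> carrier V \<Longrightarrow> w \<in> carrier W \<Longrightarrow> (\<lambda>u. G u v w) \<in> lin_hom R U Z"
    "\<And>u w. u \<in> carrier U \<Longrightarrow> w \<in> carrier W \<Longrightarrow> (\<lambda>v. G u v w) \<in> lin_hom R V Z"
    "\<And>u v. u \<in> carrier U \<Longrightarrow> v \<in> carrier V \<Longrightarrow> (\<lambda>w. G u v w) \<in> lin_hom R W Z"
  shows "tril U V W Z G"
  using assms by (auto simp: tril_def intro!: bilI)

lemma tril_lin:
  assumes "tril U V W Z G"
  shows "v \<in> carrier V \<Longrightarrow> w \<in> carrier W \<Longrightarrow> (\<lambda>u. G u v w) \<in> lin_hom R U Z"
    "u \<in> carrier U \<Longrightarrow> w \<in> carrier W \<Longrightarrow> (\<lambda>v. G u v w) \<in> lin_hom R V Z"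
    "u \<in> carrier U \<Longrightarrow> v \<in> carrier V \<Longrightarrow> G u v \<in> lin_hom R W Z"
    "u \<in> carrier U \<Longrightarrow> bil V W Z (G u)"
    "w \<in> carrier W \<Longrightarrow> bil U V Z (\<lambda>u v. G u v w)"
    "u \<in> carrier U \<Longrightarrow> v \<in> carrier V \<Longrightarrow> w \<in> carrier W \<Longrightarrow> G u v w \<in> carrier Z"
  using assms by (auto simp: tril_def bil_def dest: lin_closed)

lemma bil_tril_right:
  assumes "vs U" "vs V" "vs W" "vs Z" "tril U V W Z G"
  shows "bil U (T V W) Z (\<lambda>u s. tlift R Z (\<lambda>v w. G u v w) s)"
  by (intro bilI tlift_lin lin_tlift_param[of V W] tril_lin(1,4)[OF assms(5)] assms)

lemma bil_tril_left:
  assumes "vs U" "vs V" "vs W" "vs Z" "tril U V W Z G"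
  shows "bil (T U V) W Z (\<lambda>s w. tlift R Z (\<lambda>u v. G u v w) s)"
  by (intro bilI tlift_lin lin_tlift_param[of U V] tril_lin(3,5)[OF assms(5)] assms)

lemma tril_tens:
  assumes "vs U" "vs V" "vs W"
  shows "tril U V W (T U (T V W)) (\<lambda>u v w. ts U (T V W) u (ts V W v w))"
  using assms by (intro trilI lins vs_tensor) auto

lemma tassoc_lin:
  assumes "vs U" "vs V" "vs W"
  shows "tassoc R U V W \<in> lin_hom R (T (T U V) W) (T U (T V W))"
  unfolding tassoc_def Let_def using assms
  by (intro tlift_lin bil_tril_left tril_tens vs_tensor)

lemma tlift_tassoc:
  assumes U: "vs U" and V: "vs V" and W: "vs W" and Z: "vs Z" and G: "tril U V W Z G"
    and t: "t \<in> carrier (T (T U V) W)"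
  shows "tlift R Z (\<lambda>u s. tlift R Z (\<lambda>v w. G u v w) s) (tassoc R U V W t) =
    tlift R Z (\<lambda>s w. tlift R Z (\<lambda>u v. G u v w) s) t"
proof -
  let ?T = "T U (T V W)" and ?B = "\<lambda>u s. tlift R Z (\<lambda>v w. G u v w) s"
  note b = bil_tril_right[OF U V W Z G]
  have h: "tlift R Z ?B \<in> lin_hom R ?T Z" using assms b by (intro tlift_lin vs_tensor)
  have c: "ts U (T V W) u (ts V W v w) \<in> carrier ?T"
    if "u \<in> carrier U" "v \<in> carrier V" "w \<in> carrier W" for u v w
    using that U V W by simp
  have "tlift R Z ?B (tassoc R U V W t) =
      tlift R Z (\<lambda>s w. tlift R Z ?B (tlift R ?T (\<lambda>u v. ts U (T V W) u (ts V W v w)) s)) t"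
    unfolding tassoc_def Let_def
    by (rule lin_tlift[OF vs_tensor[OF U V] W vs_tensor[OF U vs_tensor[OF V W]] Z h t])
      (rule tlift_closed[OF U V]; use U V W c in simp)
  also have "\<dots> = tlift R Z (\<lambda>s w. tlift R Z (\<lambda>u v. tlift R Z ?B (ts U (T V W) u (ts V W v w))) s) t"
    using U V W Z c
    by (intro tlift_cong[OF vs_tensor[OF U V] W Z t] lin_tlift[OF U V _ Z h] tlift_closed[OF U V]
        lin_closed[OF h]) auto
  also have "\<dots> = tlift R Z (\<lambda>s w. tlift R Z (\<lambda>u v. G u v w) s) t"
  proof (rule tlift_cong[OF vs_tensor[OF U V] W Z t])
    fix s w assume s: "s \<in> carrier (T U V)" and w: "w \<in> carrier W"
    show "tlift R Z (\<lambda>u v. tlift R Z ?B (ts U (T V W) u (ts V W v w))) s = tlift R Z (\<lambda>u v. G u v w) s"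
      using w U V W Z G
      by (intro tlift_cong[OF U V Z s])
        (simp_all add: tlift_tens[OF U vs_tensor[OF V W] Z b] tlift_tens[OF V W Z tril_lin(4)[OF G]] tril_lin(6)[OF G])
    show "tlift R Z (\<lambda>u v. G u v w) s \<in> carrier Z"
      using w G by (intro tlift_closed[OF U V Z s]) (auto intro: tril_lin(6)[OF G])
  qed
  finally show ?thesis .
qed

lemma tflip_lin:
  assumes "vs V" "vs W" shows "tflip R V W \<in> lin_hom R (T V W) (T W V)"
  unfolding tflip_def using assms by (intro tlift_lin vs_tensor bilI lins) auto

section \<open>Coordinates and slices\<close>

text \<open>
  A finite family \<open>e\<close> of vectors with functionals \<open>f\<close> that reconstruct every vector. This is what
  makes the functionals separate points, and it passes to tensor products (\<open>coords_tensor\<close>) and to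
  the dual (\<open>coords_L\<close>).
\<close>

definition coords where
  "coords W I e f \<longleftrightarrow> finite I \<and> (\<forall>i\<in>I. e i \<in> carrier W \<and> f i \<in> lin_hom R W (ground R)) \<and>
     (\<forall>w\<in>carrier W. w = finsum W (\<lambda>i. f i w \<odot>\<^bsub>W\<^esub> e i) I)"

text \<open>The map \<open>id \<otimes> g\<close> from \<open>V \<otimes> W\<close> to \<open>V\<close>.\<close>

definition slice where "slice V g t = tlift R V (\<lambda>v w. g w \<odot>\<^bsub>V\<^esub> v) t"

lemma slice_bil:
  assumes "vs V" "vs W" "g \<in> lin_hom R W (ground R)"
  shows "bil V W V (\<lambda>v w. g w \<odot>\<^bsub>V\<^esub> v)"
  using assms lin_closed[OF assms(3)] by (intro bilI lins) auto

lemma slice_lin: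
  assumes "vs V" "vs W" "g \<in> lin_hom R W (ground R)"
  shows "slice V g \<in> lin_hom R (T V W) V"
  unfolding slice_def[abs_def] by (intro tlift_lin slice_bil assms)

lemma tensor_expand:
  assumes V: "vs V" and W: "vs W" and c: "coords W I e f" and t: "t \<in> carrier (T V W)"
  shows "t = finsum (T V W) (\<lambda>i. ts V W (slice V (f i) t) (e i)) I"
proof -
  have f: "f i \<in> lin_hom R W (ground R)" "e i \<in> carrier W" "finite I" if "i \<in> I" for i
    using c that by (auto simp: coords_def)
  show ?thesis
  proof (rule lin_eq_on_tens[OF V W t vs_tensor[OF V W] lin_id])
    show "(\<lambda>t. finsum (T V W) (\<lambda>i. ts V W (slice V (f i) t) (e i)) I) \<in> lin_hom R (T V W) (T V W)"
      using V W f c by (intro lin_finsum_fun vs_tensor lins slice_lin) (auto simp: coords_def)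
    fix v w assume v: "v \<in> carrier V" and w: "w \<in> carrier W"
    have "ts V W v w = ts V W v (finsum W (\<lambda>i. f i w \<odot>\<^bsub>W\<^esub> e i) I)"
      using c w by (simp add: coords_def)
    also have "\<dots> = finsum (T V W) (\<lambda>i. ts V W v (f i w \<odot>\<^bsub>W\<^esub> e i)) I"
      using V W f v w lin_closed[OF f(1)]
      by (intro lin_finsum[OF W vs_tensor[OF V W] ts_lin_right0[OF V W v]]) auto
    also have "\<dots> = finsum (T V W) (\<lambda>i. ts V W (slice V (f i) (ts V W v w)) (e i)) I"
      using V W f v w lin_closed[OF f(1)]
      by (intro vs_finsum_cong)
        (auto simp: slice_def tlift_tens slice_bil lin_scale[OF ts_lin_right0[OF V W v]]
          lin_scale[OF ts_lin_left0[OF V W]])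
    finally show "ts V W v w = finsum (T V W) (\<lambda>i. ts V W (slice V (f i) (ts V W v w)) (e i)) I" .
  qed
qed

text \<open>
  Equality of slices is equality of tensors when the second factor is finite-dimensional: the
  slices are the coefficients in \<open>tensor_expand\<close>.
\<close>

lemma tensor_eqI:
  assumes V: "vs V" and W: "vs W" and c: "coords W I e f"
    and s: "s \<in> carrier (T V W)" and t: "t \<in> carrier (T V W)"
    and eq: "\<And>i. i \<in> I \<Longrightarrow> slice V (f i) s = slice V (f i) t"
  shows "s = t"
proof -
  have f: "f i \<in> lin_hom R W (ground R)" "e i \<in> carrier W" if "i \<in> I" for i
    using c that by (auto simp: coords_def)
  have "finsum (T V W) (\<lambda>i. ts V W (slice V (f i) s) (e i)) I = finsum (T V W) (\<lambda>i. ts V W (slice V (f i) t) (e i)) I"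
    using eq V W f t by (intro vs_finsum_cong) (auto intro!: ts_closed lin_closed[OF slice_lin])
  then show ?thesis using tensor_expand[OF V W c s] tensor_expand[OF V W c t] by simp
qed

text \<open>The functional \<open>g \<otimes> h\<close>.\<close>

definition fprod where "fprod g h = tlift R (ground R) (\<lambda>v w. g v \<otimes> h w)"

lemma fprod_bil:
  assumes "g \<in> lin_hom R V (ground R)" "h \<in> lin_hom R W (ground R)"
  shows "bil V W (ground R) (\<lambda>v w. g v \<otimes> h w)"
  using assms lin_closed[OF assms(1)] lin_closed[OF assms(2)] by (intro bilI lins) auto

lemma fprod_lin:
  assumes "vs V" "vs W" "g \<in> lin_hom R V (ground R)" "h \<in> lin_hom R W (ground R)"
  shows "fprod g h \<in> lin_hom R (T V W) (ground R)"
  unfolding fprod_def using assms by (intro tlift_lin fprod_bil vs_ground)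

lemma fprod_tens:
  assumes "vs V" "vs W" "g \<in> lin_hom R V (ground R)" "h \<in> lin_hom R W (ground R)"
    "v \<in> carrier V" "w \<in> carrier W"
  shows "fprod g h (ts V W v w) = g v \<otimes> h w"
  unfolding fprod_def using assms tlift_tens fprod_bil vs_ground by metis

lemma coords_tensor:
  assumes V: "vs V" and W: "vs W" and c: "coords V I e f" and d: "coords W J e' f'"
  shows "coords (T V W) (I \<times> J) (\<lambda>p. ts V W (e (fst p)) (e' (snd p))) (\<lambda>p. fprod (f (fst p)) (f' (snd p)))"
proof -
  have f: "f i \<in> lin_hom R V (ground R)" "e i \<in> carrier V" if "i \<in> I" for i
    using c that by (auto simp: coords_def)
  have f': "f' i \<in> lin_hom R W (ground R)" "e' i \<in> carrier W" if "i \<in> J" for i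
    using d that by (auto simp: coords_def)
  have I: "finite I" "finite J" using c d by (auto simp: coords_def)
  let ?T = "T V W"
  let ?h = "\<lambda>t. finsum ?T (\<lambda>j. finsum ?T (\<lambda>i. fprod (f i) (f' j) t \<odot>\<^bsub>?T\<^esub> ts V W (e i) (e' j)) I) J"
  have h: "?h \<in> lin_hom R ?T ?T"
    using V W f f' I by (intro lin_finsum_fun vs_tensor lins fprod_lin) auto
  have *: "t = finsum ?T (\<lambda>p. fprod (f (fst p)) (f' (snd p)) t \<odot>\<^bsub>?T\<^esub> ts V W (e (fst p)) (e' (snd p))) (I \<times> J)"
    if t: "t \<in> carrier ?T" for t
  proof -
    have cl: "fprod (f i) (f' j) t \<odot>\<^bsub>?T\<^esub> ts V W (e i) (e' j) \<in> carrier ?T" if "i \<in> I" "j \<in> J" for i j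
      using that V W f f' t lin_closed[OF fprod_lin[OF V W f(1) f'(1)] t] by simp
    have "t = ?h t"
    proof (rule lin_eq_on_tens[OF V W t vs_tensor[OF V W] lin_id h])
      fix v w assume v: "v \<in> carrier V" and w: "w \<in> carrier W"
      have fv: "f i v \<in> carrier R" if "i \<in> I" for i using lin_closed[OF f(1)[OF that] v] by simp
      have fw: "f' i w \<in> carrier R" if "i \<in> J" for i using lin_closed[OF f'(1)[OF that] w] by simp
      have vv: "v = finsum V (\<lambda>i. f i v \<odot>\<^bsub>V\<^esub> e i) I" and ww: "w = finsum W (\<lambda>i. f' i w \<odot>\<^bsub>W\<^esub> e' i) J"
        using c d v w by (auto simp: coords_def)
      have "ts V W v w = ts V W v (finsum W (\<lambda>i. f' i w \<odot>\<^bsub>W\<^esub> e' i) J)"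
        using ww by simp
      also have "\<dots> = finsum ?T (\<lambda>j. f' j w \<odot>\<^bsub>?T\<^esub> ts V W v (e' j)) J"
        using V W f' v w fw
        by (subst lin_finsum[OF W vs_tensor[OF V W] ts_lin_right0[OF V W v]])
          (simp, rule vs_finsum_cong[OF vs_tensor[OF V W] refl],
            simp_all add: lin_scale[OF ts_lin_right0[OF V W v]])
      also have "\<dots> = ?h (ts V W v w)"
      proof (rule vs_finsum_cong[OF vs_tensor[OF V W] refl])
        fix j assume j: "j \<in> J"
        have "ts V W v (e' j) = ts V W (finsum V (\<lambda>i. f i v \<odot>\<^bsub>V\<^esub> e i) I) (e' j)"
          using vv by simp
        also have "\<dots> = finsum ?T (\<lambda>i. f i v \<odot>\<^bsub>?T\<^esub> ts V W (e i) (e' j)) I"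
          using V W f v f' fv j
          by (subst lin_finsum[OF V vs_tensor[OF V W] ts_lin_left0[OF V W]])
            (simp, simp, rule vs_finsum_cong[OF vs_tensor[OF V W] refl],
              simp_all add: lin_scale[OF ts_lin_left0[OF V W]])
        finally show "f' j w \<odot>\<^bsub>?T\<^esub> ts V W v (e' j) =
            finsum ?T (\<lambda>i. fprod (f i) (f' j) (ts V W v w) \<odot>\<^bsub>?T\<^esub> ts V W (e i) (e' j)) I"
          using V W f v f' fv fw j w
          by (simp add: vs_finsum_smult vs_smult_smult fprod_tens m_comm cong: vs_finsum_cong)
        show "finsum ?T (\<lambda>i. fprod (f i) (f' j) (ts V W v w) \<odot>\<^bsub>?T\<^esub> ts V W (e i) (e' j)) I \<in> carrier ?T"
          using V W f v f' fv fw j w by (simp add: fprod_tens)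
      qed
      finally show "ts V W v w = ?h (ts V W v w)" .
    qed
    also have "\<dots> = finsum ?T (\<lambda>p. fprod (f (fst p)) (f' (snd p)) t \<odot>\<^bsub>?T\<^esub> ts V W (e (fst p)) (e' (snd p))) (I \<times> J)"
      using I(2) cl
    proof (induction J)
      case empty
      then show ?case using V W by simp
    next
      case (insert j J)
      let ?g = "\<lambda>p. fprod (f (fst p)) (f' (snd p)) t \<odot>\<^bsub>?T\<^esub> ts V W (e (fst p)) (e' (snd p))"
      interpret M: abelian_group ?T using V W by (intro vs_abelian_group vs_tensor)
      have 1: "I \<times> insert j J = (\<lambda>i. (i, j)) ` I \<union> I \<times> J" by auto
      have "finsum ?T ?g ((\<lambda>i. (i, j)) ` I \<union> I \<times> J) =
          finsum ?T ?g ((\<lambda>i. (i, j)) ` I) \<oplus>\<^bsub>?T\<^esub> finsum ?T ?g (I \<times> J)"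
        using insert I by (intro M.finsum_Un_disjoint) auto
      also have "finsum ?T ?g ((\<lambda>i. (i, j)) ` I) = finsum ?T (\<lambda>i. ?g (i, j)) I"
        using insert I by (intro M.finsum_reindex) (auto simp: inj_on_def)
      finally show ?case unfolding 1
        using insert V W by (subst vs_finsum_insert) auto
    qed
    finally show ?thesis .
  qed
  show ?thesis unfolding coords_def using * V W f f' I by (auto intro!: fprod_lin)
qed

end

context field begin

section \<open>Algebras\<close>

abbreviation alg where "alg A \<equiv> unital_algebra R A"

lemma alg_vs [simp]: "alg A \<Longrightarrow> vs A"
  by (simp add: unital_algebra_def)

lemma alg_ring: "alg A \<Longrightarrow> ring A"
  by (simp add: unital_algebra_def)

lemma alg_closed [simp]:
  "alg A \<Longrightarrow> x \<in> carrier A \<Longrightarrow> y \<in> carrier A \<Longrightarrow> x \<otimes>\<^bsub>A\<^esub> y \<in> carrier A" "alg A \<Longrightarrow> \<one>\<^bsub>A\<^esub> \<in> carrier A"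
  using alg_ring[of A] monoid.m_closed[of A] monoid.one_closed[of A] by (auto simp: ring_def)

lemma alg_one [simp]:
  "alg A \<Longrightarrow> x \<in> carrier A \<Longrightarrow> \<one>\<^bsub>A\<^esub> \<otimes>\<^bsub>A\<^esub> x = x" "alg A \<Longrightarrow> x \<in> carrier A \<Longrightarrow> x \<otimes>\<^bsub>A\<^esub> \<one>\<^bsub>A\<^esub> = x"
  using alg_ring[of A] monoid.l_one[of A] monoid.r_one[of A] by (auto simp: ring_def)

lemma alg_assoc:
  "alg A \<Longrightarrow> x \<in> carrier A \<Longrightarrow> y \<in> carrier A \<Longrightarrow> z \<in> carrier A \<Longrightarrow>
    (x \<otimes>\<^bsub>A\<^esub> y) \<otimes>\<^bsub>A\<^esub> z = x \<otimes>\<^bsub>A\<^esub> (y \<otimes>\<^bsub>A\<^esub> z)"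
  using alg_ring[of A] monoid.m_assoc[of A] by (auto simp: ring_def)

lemma alg_bil: "alg A \<Longrightarrow> bil A A A (\<lambda>x y. x \<otimes>\<^bsub>A\<^esub> y)"
  by (intro bilI lin_homI)
    (auto simp: alg_ring ring.ring_simprules unital_algebra.smult_mult_left unital_algebra.smult_mult_right)

lemma lin_mult_left [lins]:
  "alg A \<Longrightarrow> f \<in> lin_hom R U A \<Longrightarrow> c \<in> carrier A \<Longrightarrow> (\<lambda>x. f x \<otimes>\<^bsub>A\<^esub> c) \<in> lin_hom R U A"
  by (rule lin_comp[OF bil_left[OF alg_bil]])

lemma lin_mult_right [lins]:
  "alg A \<Longrightarrow> f \<in> lin_hom R U A \<Longrightarrow> c \<in> carrier A \<Longrightarrow> (\<lambda>x. c \<otimes>\<^bsub>A\<^esub> f x) \<in> lin_hom R U A"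
  by (rule lin_comp[OF bil_right[OF alg_bil]])

lemma alg_smult:
  "alg A \<Longrightarrow> a \<in> carrier R \<Longrightarrow> x \<in> carrier A \<Longrightarrow> y \<in> carrier A \<Longrightarrow> (a \<odot>\<^bsub>A\<^esub> x) \<otimes>\<^bsub>A\<^esub> y = a \<odot>\<^bsub>A\<^esub> (x \<otimes>\<^bsub>A\<^esub> y)"
  "alg A \<Longrightarrow> a \<in> carrier R \<Longrightarrow> x \<in> carrier A \<Longrightarrow> y \<in> carrier A \<Longrightarrow> x \<otimes>\<^bsub>A\<^esub> (a \<odot>\<^bsub>A\<^esub> y) = a \<odot>\<^bsub>A\<^esub> (x \<otimes>\<^bsub>A\<^esub> y)"
  by (auto simp: unital_algebra.smult_mult_left unital_algebra.smult_mult_right)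

lemma algI:
  assumes V: "vs A" and one: "\<one>\<^bsub>A\<^esub> \<in> carrier A" and b: "bil A A A (\<lambda>x y. x \<otimes>\<^bsub>A\<^esub> y)"
    and assoc: "\<And>x y z. x \<in> carrier A \<Longrightarrow> y \<in> carrier A \<Longrightarrow> z \<in> carrier A \<Longrightarrow>
      (x \<otimes>\<^bsub>A\<^esub> y) \<otimes>\<^bsub>A\<^esub> z = x \<otimes>\<^bsub>A\<^esub> (y \<otimes>\<^bsub>A\<^esub> z)"
    and ones: "\<And>x. x \<in> carrier A \<Longrightarrow> \<one>\<^bsub>A\<^esub> \<otimes>\<^bsub>A\<^esub> x = x" "\<And>x. x \<in> carrier A \<Longrightarrow> x \<otimes>\<^bsub>A\<^esub> \<one>\<^bsub>A\<^esub> = x"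
  shows "alg A"
proof -
  have "monoid A" by (rule monoidI) (use one assoc ones bil_closed[OF b] in auto)
  then have "ring A"
    by (intro ringI vs_abelian_group[OF V])
      (auto simp: lin_plus[OF bil_left[OF b]] lin_plus[OF bil_right[OF b]])
  then show ?thesis
    by (intro unital_algebra.intro unital_algebra_axioms.intro V field_axioms)
      (auto simp: lin_scale[OF bil_left[OF b]] lin_scale[OF bil_right[OF b]])
qed

lemma alg_op [simp]: assumes "alg A" shows "alg (op_alg A)"
proof (rule algI)
  show "bil (op_alg A) (op_alg A) (op_alg A) (\<lambda>x y. x \<otimes>\<^bsub>op_alg A\<^esub> y)"
    unfolding op_simps
    by (rule bilI; unfold lin_hom_lin_part[OF lin_part_op(1) lin_part_op(1)] op_simps;
        intro lins assms; simp)
qed (use assms in \<open>auto simp: alg_assoc\<close>)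

lemma alg_hopf_op [simp]: assumes "alg A" shows "alg (hopf_op A)"
proof (rule algI)
  show "bil (hopf_op A) (hopf_op A) (hopf_op A) (\<lambda>x y. x \<otimes>\<^bsub>hopf_op A\<^esub> y)"
    unfolding op_simps
    by (rule bilI; unfold lin_hom_lin_part[OF lin_part_op(2) lin_part_op(2)] op_simps;
        intro lins assms; simp)
qed (use assms in \<open>auto simp: alg_assoc\<close>)

lemma bil_eq_on_tens:
  assumes V: "vs V" and W: "vs W" and V': "vs V'" and W': "vs W'" and Z: "vs Z"
    and F: "bil (T V W) (T V' W') Z F" and G: "bil (T V W) (T V' W') Z G"
    and eq: "\<And>v w v' w'. v \<in> carrier V \<Longrightarrow> w \<in> carrier W \<Longrightarrow> v' \<in> carrier V' \<Longrightarrow> w' \<in> carrier W' \<Longrightarrow>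
      F (ts V W v w) (ts V' W' v' w') = G (ts V W v w) (ts V' W' v' w')"
    and s: "s \<in> carrier (T V W)" and t: "t \<in> carrier (T V' W')"
  shows "F s t = G s t"
proof (rule lin_eq_on_tens[OF V W s Z bil_left[OF F t] bil_left[OF G t]])
  fix v w assume vw: "v \<in> carrier V" "w \<in> carrier W"
  then have c: "ts V W v w \<in> carrier (T V W)" using V W by simp
  show "F (ts V W v w) t = G (ts V W v w) t"
    by (rule lin_eq_on_tens[OF V' W' t Z bil_right[OF F c] bil_right[OF G c]]) (rule eq[OF vw])
qed

text \<open>
  The definition multiplies in \<open>tensor_space\<close>, which has the same linear part as the tensor
  product algebra.
\<close>

lemma tensor_mult:
  "s \<otimes>\<^bsub>T A B\<^esub> t = tlift R (T A B) (\<lambda>a b. tlift R (T A B) (\<lambda>a' b'. ts A B (a \<otimes>\<^bsub>A\<^esub> a') (b \<otimes>\<^bsub>B\<^esub> b')) t) s"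
  unfolding tlift_lin_part[OF lin_part_tensor_space[symmetric]] by (simp add: tensor_def)

lemma tensor_one: "\<one>\<^bsub>T A B\<^esub> = ts A B \<one>\<^bsub>A\<^esub> \<one>\<^bsub>B\<^esub>"
  by (simp add: tensor_def)

context
  fixes A :: "('a, 'p, 'q) module_scheme" and B :: "('a, 'r, 's) module_scheme"
  assumes A: "alg A" and B: "alg B"
begin

lemma tensor_mult_bil0:
  assumes "a \<in> carrier A" "b \<in> carrier B"
  shows "bil A B (T A B) (\<lambda>a' b'. ts A B (a \<otimes>\<^bsub>A\<^esub> a') (b \<otimes>\<^bsub>B\<^esub> b'))"
  using A B assms by (intro bilI lins) auto

lemma tensor_mult_bil1:
  assumes "t \<in> carrier (T A B)"
  shows "bil A B (T A B) (\<lambda>a b. tlift R (T A B) (\<lambda>a' b'. ts A B (a \<otimes>\<^bsub>A\<^esub> a') (b \<otimes>\<^bsub>B\<^esub> b')) t)"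
  using A B assms by (intro bilI lin_tlift_param[of A B] lins vs_tensor) auto

lemma tensor_mult_bil: "bil (T A B) (T A B) (T A B) (\<lambda>s t. s \<otimes>\<^bsub>T A B\<^esub> t)"
  unfolding tensor_mult using A B
  by (intro bilI tlift_lin tensor_mult_bil1 lin_tlift_param[of A B] tensor_mult_bil0) auto

lemma tensor_mult_tens [simp]:
  assumes "a \<in> carrier A" "b \<in> carrier B" "a' \<in> carrier A" "b' \<in> carrier B"
  shows "ts A B a b \<otimes>\<^bsub>T A B\<^esub> ts A B a' b' = ts A B (a \<otimes>\<^bsub>A\<^esub> a') (b \<otimes>\<^bsub>B\<^esub> b')"
  unfolding tensor_mult using A B assms
    tlift_tens[OF _ _ _ tensor_mult_bil1[OF ts_closed]] tlift_tens[OF _ _ _ tensor_mult_bil0]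
  by simp

lemma alg_tensor [simp]: "alg (T A B)"
proof (rule algI[OF _ _ tensor_mult_bil])
  show "vs (T A B)" using A B by simp
  show one: "\<one>\<^bsub>T A B\<^esub> \<in> carrier (T A B)" using A B by (simp add: tensor_one)
  note vs = alg_vs[OF A] alg_vs[OF B]
  note l = bil_left[OF tensor_mult_bil] and r = bil_right[OF tensor_mult_bil]
  note cl = bil_closed[OF tensor_mult_bil]
  show "\<one>\<^bsub>T A B\<^esub> \<otimes>\<^bsub>T A B\<^esub> x = x" if x: "x \<in> carrier (T A B)" for x
    by (rule lin_eq_on_tens[OF vs x vs_tensor[OF vs] r[OF one] lin_id])
      (use A B in \<open>simp add: tensor_one\<close>)
  show "x \<otimes>\<^bsub>T A B\<^esub> \<one>\<^bsub>T A B\<^esub> = x" if x: "x \<in> carrier (T A B)" for x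
    by (rule lin_eq_on_tens[OF vs x vs_tensor[OF vs] l[OF one] lin_id])
      (use A B in \<open>simp add: tensor_one\<close>)
  show "(x \<otimes>\<^bsub>T A B\<^esub> y) \<otimes>\<^bsub>T A B\<^esub> z = x \<otimes>\<^bsub>T A B\<^esub> (y \<otimes>\<^bsub>T A B\<^esub> z)"
    if x: "x \<in> carrier (T A B)" and y: "y \<in> carrier (T A B)" and z: "z \<in> carrier (T A B)" for x y z
  proof (rule lin_eq_on_tens[OF vs x vs_tensor[OF vs]])
    show "(\<lambda>x. (x \<otimes>\<^bsub>T A B\<^esub> y) \<otimes>\<^bsub>T A B\<^esub> z) \<in> lin_hom R (T A B) (T A B)"
      by (rule lin_comp[OF l[OF z] l[OF y]])
    show "(\<lambda>x. x \<otimes>\<^bsub>T A B\<^esub> (y \<otimes>\<^bsub>T A B\<^esub> z)) \<in> lin_hom R (T A B) (T A B)"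
      by (rule l[OF cl[OF y z]])
    fix a b assume ab: "a \<in> carrier A" "b \<in> carrier B"
    let ?x = "ts A B a b"
    have x: "?x \<in> carrier (T A B)" using ab vs by simp
    show "(?x \<otimes>\<^bsub>T A B\<^esub> y) \<otimes>\<^bsub>T A B\<^esub> z = ?x \<otimes>\<^bsub>T A B\<^esub> (y \<otimes>\<^bsub>T A B\<^esub> z)"
    proof (rule bil_eq_on_tens[OF vs vs vs_tensor[OF vs] _ _ _ y z])
      show "bil (T A B) (T A B) (T A B) (\<lambda>y z. (?x \<otimes>\<^bsub>T A B\<^esub> y) \<otimes>\<^bsub>T A B\<^esub> z)"
        by (intro bilI r cl[OF x] lin_comp[OF l r[OF x]])
      show "bil (T A B) (T A B) (T A B) (\<lambda>y z. ?x \<otimes>\<^bsub>T A B\<^esub> (y \<otimes>\<^bsub>T A B\<^esub> z))"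
        by (intro bilI lin_comp[OF r[OF x] r] lin_comp[OF r[OF x] l])
    qed (use A B ab in \<open>simp add: alg_assoc\<close>)
  qed
qed

lemma lin_tensor_mult:
  assumes Z: "vs Z" and h: "h \<in> lin_hom R (T A B) Z"
    and s: "s \<in> carrier (T A B)" and t: "t \<in> carrier (T A B)"
  shows "h (s \<otimes>\<^bsub>T A B\<^esub> t) =
    tlift R Z (\<lambda>a b. tlift R Z (\<lambda>a' b'. h (ts A B (a \<otimes>\<^bsub>A\<^esub> a') (b \<otimes>\<^bsub>B\<^esub> b'))) t) s"
proof -
  note vs = alg_vs[OF A] alg_vs[OF B]
  note vt = vs_tensor[OF vs]
  have "h (s \<otimes>\<^bsub>T A B\<^esub> t) = tlift R Z (\<lambda>a b.
      h (tlift R (T A B) (\<lambda>a' b'. ts A B (a \<otimes>\<^bsub>A\<^esub> a') (b \<otimes>\<^bsub>B\<^esub> b')) t)) s"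
    unfolding tensor_mult
    by (rule lin_tlift[OF vs vt Z h s]) (rule bil_closed[OF tensor_mult_bil1[OF t]])
  also have "\<dots> = tlift R Z (\<lambda>a b. tlift R Z (\<lambda>a' b'. h (ts A B (a \<otimes>\<^bsub>A\<^esub> a') (b \<otimes>\<^bsub>B\<^esub> b'))) t) s"
  proof (rule tlift_cong[OF vs Z s])
    fix a b assume ab: "a \<in> carrier A" "b \<in> carrier B"
    show "h (tlift R (T A B) (\<lambda>a' b'. ts A B (a \<otimes>\<^bsub>A\<^esub> a') (b \<otimes>\<^bsub>B\<^esub> b')) t) =
        tlift R Z (\<lambda>a' b'. h (ts A B (a \<otimes>\<^bsub>A\<^esub> a') (b \<otimes>\<^bsub>B\<^esub> b'))) t"
      using A B ab by (intro lin_tlift[OF vs vt Z h t]) auto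
    show "tlift R Z (\<lambda>a' b'. h (ts A B (a \<otimes>\<^bsub>A\<^esub> a') (b \<otimes>\<^bsub>B\<^esub> b'))) t \<in> carrier Z"
      using A B ab h by (intro tlift_closed[OF vs Z t]) auto
  qed
  finally show ?thesis .
qed

end

end

section \<open>Sweedler calculus\<close>

text \<open>
  The algebra \<open>K\<close> is a parameter, so that the results apply to the dual and the bidual by
  interpretation.
\<close>

locale hopf_over = field R for R :: "('a, 'm) ring_scheme" (structure) +
  fixes K :: "('a, 'k, 'n) hopf_scheme"
  assumes hopf: "hopf_algebra R K"
begin

abbreviation K_mult (infixl "\<cdot>" 70) where "a \<cdot> b \<equiv> a \<otimes>\<^bsub>K\<^esub> b"
abbreviation K_smult (infixl "\<bullet>" 70) where "r \<bullet> a \<equiv> r \<odot>\<^bsub>K\<^esub> a"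
abbreviation S where "S \<equiv> antipode K"
abbreviation counit_K ("\<epsilon>") where "\<epsilon> \<equiv> counit K"

lemma alg_K [simp]: "alg K" using hopf by (simp add: hopf_algebra_def)

lemma vs_K [simp]: "vs K" by simp

lemma comult_alg_hom: "comult K \<in> alg_hom R K (T K K)"
  and counit_alg_hom: "\<epsilon> \<in> alg_hom R K (ground R)"
  and antipode_lin: "S \<in> lin_hom R K K"
  using hopf by (auto simp: hopf_algebra.comult_hom hopf_algebra.counit_hom hopf_algebra.antipode_hom)

lemma comult_lin: "comult K \<in> lin_hom R K (T K K)"
  and counit_lin: "\<epsilon> \<in> lin_hom R K (ground R)"
  using comult_alg_hom counit_alg_hom by (auto simp: alg_hom_def)

lemmas lin_antipode [lins] = lin_comp[OF antipode_lin] and lin_counit [lins] = lin_comp[OF counit_lin]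

lemma structure_closed [simp]:
  "k \<in> carrier K \<Longrightarrow> comult K k \<in> carrier (T K K)"
  "k \<in> carrier K \<Longrightarrow> \<epsilon> k \<in> carrier R"
  "k \<in> carrier K \<Longrightarrow> S k \<in> carrier K"
  using lin_closed[OF comult_lin] lin_closed[OF counit_lin] lin_closed[OF antipode_lin] by auto

lemma counit_mult [simp]:
  "k \<in> carrier K \<Longrightarrow> k' \<in> carrier K \<Longrightarrow> \<epsilon> (k \<cdot> k') = \<epsilon> k \<otimes> \<epsilon> k'"
  "\<epsilon> \<one>\<^bsub>K\<^esub> = \<one>"
  using counit_alg_hom by (auto simp: alg_hom_def ring_hom_def)

text \<open>The Sweedler sum \<open>\<Sum> B k\<^sub>1 k\<^sub>2\<close>.\<close>

abbreviation sw where "sw Z B k \<equiv> tlift R Z B (comult K k)"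

lemma sw_closed [simp]:
  "vs Z \<Longrightarrow> k \<in> carrier K \<Longrightarrow> (\<And>a b. a \<in> carrier K \<Longrightarrow> b \<in> carrier K \<Longrightarrow> B a b \<in> carrier Z) \<Longrightarrow>
    sw Z (\<lambda>a b. B a b) k \<in> carrier Z"
  by (rule tlift_closed[of K K]) auto

lemma sw_cong:
  "vs Z \<Longrightarrow> k \<in> carrier K \<Longrightarrow> (\<And>a b. a \<in> carrier K \<Longrightarrow> b \<in> carrier K \<Longrightarrow> B a b = B' a b) \<Longrightarrow>
    (\<And>a b. a \<in> carrier K \<Longrightarrow> b \<in> carrier K \<Longrightarrow> B' a b \<in> carrier Z) \<Longrightarrow>
    sw Z (\<lambda>a b. B a b) k = sw Z (\<lambda>a b. B' a b) k"
  by (rule tlift_cong[of K K]) auto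

lemma sw_push:
  "h \<in> lin_hom R Z Z' \<Longrightarrow> vs Z \<Longrightarrow> vs Z' \<Longrightarrow> k \<in> carrier K \<Longrightarrow>
    (\<And>a b. a \<in> carrier K \<Longrightarrow> b \<in> carrier K \<Longrightarrow> B a b \<in> carrier Z) \<Longrightarrow>
    h (sw Z (\<lambda>a b. B a b) k) = sw Z' (\<lambda>a b. h (B a b)) k"
  by (rule lin_tlift[of K K]) auto

lemma lin_sw_param:
  "vs Z \<Longrightarrow> k \<in> carrier K \<Longrightarrow>
    (\<And>a b. a \<in> carrier K \<Longrightarrow> b \<in> carrier K \<Longrightarrow> (\<lambda>x. G x a b) \<in> lin_hom R U Z) \<Longrightarrow>
    (\<lambda>x. sw Z (\<lambda>a b. G x a b) k) \<in> lin_hom R U Z"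
  by (rule lin_tlift_param[of K K]) auto

lemma lin_sw_arg:
  "vs Z \<Longrightarrow> bil K K Z (\<lambda>a b. B a b) \<Longrightarrow> f \<in> lin_hom R U K \<Longrightarrow> (\<lambda>x. sw Z (\<lambda>a b. B a b) (f x)) \<in> lin_hom R U Z"
  by (rule lin_comp[OF lin_comp[OF tlift_lin comult_lin]]) auto

text \<open>Coassociativity, as \<open>\<Sum> G k\<^sub>1\<^sub>1 k\<^sub>1\<^sub>2 k\<^sub>2 = \<Sum> G k\<^sub>1 k\<^sub>2\<^sub>1 k\<^sub>2\<^sub>2\<close> for trilinear \<open>G\<close>.\<close>

lemma sw_coassoc:
  assumes Z: "vs Z" and h: "h \<in> carrier K" and G: "tril K K K Z G"
  shows "sw Z (\<lambda>x c. sw Z (\<lambda>a b. G a b c) x) h = sw Z (\<lambda>a y. sw Z (\<lambda>b c. G a b c) y) h"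
proof -
  let ?L = "\<lambda>s w. tlift R Z (\<lambda>a b. G a b w) s" and ?R = "\<lambda>u s. tlift R Z (\<lambda>b c. G u b c) s"
  note l = lin_id[of K, folded id_def]
  have tc: "tmap R (T K K) K (comult K) id (comult K h) \<in> carrier (T (T K K) K)"
    using lin_closed[OF tmap_lin[OF _ _ _ _ comult_lin l]] h by simp
  have "sw Z (\<lambda>x c. sw Z (\<lambda>a b. G a b c) x) h = tlift R Z ?L (tmap R (T K K) K (comult K) id (comult K h))"
    using tlift_tmap[OF _ _ _ _ Z comult_lin l bil_tril_left[OF _ _ _ Z G]] h by simp
  also have "\<dots> = tlift R Z ?R (tassoc R K K K (tmap R (T K K) K (comult K) id (comult K h)))"
    by (rule tlift_tassoc[OF _ _ _ Z G tc, symmetric]) simp_all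
  also have "\<dots> = tlift R Z ?R (tmap R K (T K K) id (comult K) (comult K h))"
    using hopf_algebra.coassoc[OF hopf h] by simp
  also have "\<dots> = sw Z (\<lambda>a y. sw Z (\<lambda>b c. G a b c) y) h"
    using tlift_tmap[OF _ _ _ _ Z l comult_lin bil_tril_right[OF _ _ _ Z G]] h by simp
  finally show ?thesis .
qed

lemma sw_mult:
  assumes Z: "vs Z" and h: "h \<in> carrier K" and k: "k \<in> carrier K" and B: "bil K K Z B"
  shows "sw Z (\<lambda>a b. B a b) (h \<cdot> k) = sw Z (\<lambda>a b. sw Z (\<lambda>c d. B (a \<cdot> c) (b \<cdot> d)) k) h"
proof -
  have "comult K (h \<cdot> k) = comult K h \<otimes>\<^bsub>T K K\<^esub> comult K k"
    using comult_alg_hom h k by (auto simp: alg_hom_def ring_hom_def)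
  moreover have "tlift R Z (\<lambda>a b. B a b) (ts K K (a \<cdot> c) (b \<cdot> d)) = B (a \<cdot> c) (b \<cdot> d)"
    if "a \<in> carrier K" "b \<in> carrier K" "c \<in> carrier K" "d \<in> carrier K" for a b c d
    using that Z B by (simp add: tlift_tens)
  ultimately show ?thesis
    using Z h k bil_closed[OF B]
    by (simp add: lin_tensor_mult[OF alg_K alg_K Z tlift_lin[OF vs_K vs_K Z B]])
      (intro sw_cong, auto)
qed

lemma sw_one:
  assumes Z: "vs Z" and B: "bil K K Z B"
  shows "sw Z (\<lambda>a b. B a b) \<one>\<^bsub>K\<^esub> = B \<one>\<^bsub>K\<^esub> \<one>\<^bsub>K\<^esub>"
proof -
  have "comult K \<one>\<^bsub>K\<^esub> = ts K K \<one>\<^bsub>K\<^esub> \<one>\<^bsub>K\<^esub>"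
    using comult_alg_hom by (auto simp: alg_hom_def ring_hom_def tensor_one)
  then show ?thesis using Z B by (simp add: tlift_tens)
qed

lemma sw_counit_left:
  assumes Z: "vs Z" and f: "f \<in> lin_hom R K Z" and h: "h \<in> carrier K"
  shows "sw Z (\<lambda>a b. \<epsilon> a \<odot>\<^bsub>Z\<^esub> f b) h = f h"
proof -
  have "f h = f (sw K (\<lambda>a b. \<epsilon> a \<bullet> b) h)" using hopf_algebra.counit_left[OF hopf h] by simp
  also have "\<dots> = sw Z (\<lambda>a b. f (\<epsilon> a \<bullet> b)) h" using Z h by (intro sw_push[OF f]) auto
  also have "\<dots> = sw Z (\<lambda>a b. \<epsilon> a \<odot>\<^bsub>Z\<^esub> f b) h"
    using Z h f by (intro sw_cong) (auto simp: lin_scale)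
  finally show ?thesis ..
qed

lemma sw_counit_right:
  assumes Z: "vs Z" and f: "f \<in> lin_hom R K Z" and h: "h \<in> carrier K"
  shows "sw Z (\<lambda>a b. \<epsilon> b \<odot>\<^bsub>Z\<^esub> f a) h = f h"
proof -
  have "f h = f (sw K (\<lambda>a b. \<epsilon> b \<bullet> a) h)" using hopf_algebra.counit_right[OF hopf h] by simp
  also have "\<dots> = sw Z (\<lambda>a b. f (\<epsilon> b \<bullet> a)) h" using Z h by (intro sw_push[OF f]) auto
  also have "\<dots> = sw Z (\<lambda>a b. \<epsilon> b \<odot>\<^bsub>Z\<^esub> f a) h"
    using Z h f by (intro sw_cong) (auto simp: lin_scale)
  finally show ?thesis ..
qed

lemma sw_antipode_left:
  assumes Z: "vs Z" and f: "f \<in> lin_hom R K Z" and h: "h \<in> carrier K"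
  shows "sw Z (\<lambda>a b. f (S a \<cdot> b)) h = \<epsilon> h \<odot>\<^bsub>Z\<^esub> f \<one>\<^bsub>K\<^esub>"
proof -
  have "sw Z (\<lambda>a b. f (S a \<cdot> b)) h = f (sw K (\<lambda>a b. S a \<cdot> b) h)"
    using Z h by (intro sw_push[OF f, symmetric]) auto
  also have "\<dots> = f (\<epsilon> h \<bullet> \<one>\<^bsub>K\<^esub>)" using hopf_algebra.antipode_left[OF hopf h] by simp
  finally show ?thesis using lin_scale[OF f] h by simp
qed

lemma sw_antipode_right:
  assumes Z: "vs Z" and f: "f \<in> lin_hom R K Z" and h: "h \<in> carrier K"
  shows "sw Z (\<lambda>a b. f (a \<cdot> S b)) h = \<epsilon> h \<odot>\<^bsub>Z\<^esub> f \<one>\<^bsub>K\<^esub>"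
proof -
  have "sw Z (\<lambda>a b. f (a \<cdot> S b)) h = f (sw K (\<lambda>a b. a \<cdot> S b) h)"
    using Z h by (intro sw_push[OF f, symmetric]) auto
  also have "\<dots> = f (\<epsilon> h \<bullet> \<one>\<^bsub>K\<^esub>)" using hopf_algebra.antipode_right[OF hopf h] by simp
  finally show ?thesis using lin_scale[OF f] h by simp
qed

end

section \<open>The dual\<close>

context hopf_over begin

abbreviation L where "L \<equiv> dual R K"
abbreviation L_mult (infixl "\<star>" 70) where "\<theta> \<star> \<phi> \<equiv> \<theta> \<otimes>\<^bsub>L\<^esub> \<phi>"

lemma sw_closed_ground [simp]:
  "k \<in> carrier K \<Longrightarrow> (\<And>a b. a \<in> carrier K \<Longrightarrow> b \<in> carrier K \<Longrightarrow> B a b \<in> carrier R) \<Longrightarrow>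
    sw (ground R) (\<lambda>a b. B a b) k \<in> carrier R"
  using sw_closed[of "ground R" k B] by simp

lemma dual_simps:
  "carrier L = lin_hom R K (ground R) \<inter> extensional (carrier K)"
  "\<zero>\<^bsub>L\<^esub> = (\<lambda>k\<in>carrier K. \<zero>)" "\<one>\<^bsub>L\<^esub> = (\<lambda>k\<in>carrier K. \<epsilon> k)"
  "\<theta> \<oplus>\<^bsub>L\<^esub> \<phi> = (\<lambda>k\<in>carrier K. \<theta> k \<oplus> \<phi> k)" "a \<odot>\<^bsub>L\<^esub> \<theta> = (\<lambda>k\<in>carrier K. a \<otimes> \<theta> k)"
  "\<theta> \<star> \<phi> = (\<lambda>k\<in>carrier K. sw (ground R) (\<lambda>a b. \<theta> a \<otimes> \<phi> b) k)"
  "counit L \<theta> = \<theta> \<one>\<^bsub>K\<^esub>" "antipode L \<theta> = (\<lambda>k\<in>carrier K. \<theta> (S k))"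
  by (simp_all add: dual_def dual_algebra_def Let_def)

lemma dual_lin: "\<theta> \<in> carrier L \<Longrightarrow> \<theta> \<in> lin_hom R K (ground R)"
  by (simp add: dual_simps)

lemma lin_dual [lins]: "\<theta> \<in> carrier L \<Longrightarrow> f \<in> lin_hom R U K \<Longrightarrow> (\<lambda>x. \<theta> (f x)) \<in> lin_hom R U (ground R)"
  by (rule lin_comp[OF dual_lin])

lemma dual_apply_closed [simp]: "\<theta> \<in> carrier L \<Longrightarrow> k \<in> carrier K \<Longrightarrow> \<theta> k \<in> carrier R"
  using lin_closed[OF dual_lin] by simp

lemma dual_restrict: "f \<in> lin_hom R K (ground R) \<Longrightarrow> restrict f (carrier K) \<in> carrier L"
  by (auto simp: dual_simps intro: lin_hom_cong)

lemma dual_eqI: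
  "\<theta> \<in> carrier L \<Longrightarrow> \<phi> \<in> carrier L \<Longrightarrow> (\<And>k. k \<in> carrier K \<Longrightarrow> \<theta> k = \<phi> k) \<Longrightarrow> \<theta> = \<phi>"
  by (auto simp: dual_simps intro: extensionalityI)

lemma dual_apply [simp]:
  assumes "k \<in> carrier K"
  shows "\<zero>\<^bsub>L\<^esub> k = \<zero>" "\<one>\<^bsub>L\<^esub> k = \<epsilon> k" "(\<theta> \<oplus>\<^bsub>L\<^esub> \<phi>) k = \<theta> k \<oplus> \<phi> k" "(a \<odot>\<^bsub>L\<^esub> \<theta>) k = a \<otimes> \<theta> k"
    "(\<theta> \<star> \<phi>) k = sw (ground R) (\<lambda>a b. \<theta> a \<otimes> \<phi> b) k" "antipode L \<theta> k = \<theta> (S k)"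
  using assms by (simp_all add: dual_simps)

lemma dual_ext_closed:
  assumes "f \<in> lin_hom R K (ground R)" shows "(\<lambda>k\<in>carrier K. f k) \<in> carrier L"
  using dual_restrict[OF assms] by simp

lemma dual_add_closed: "\<theta> \<in> carrier L \<Longrightarrow> \<phi> \<in> carrier L \<Longrightarrow> \<theta> \<oplus>\<^bsub>L\<^esub> \<phi> \<in> carrier L"
  unfolding dual_simps(4)
  by (intro dual_ext_closed lin_plus_fun[of "ground R", simplified]) (auto intro: dual_lin)

lemma dual_smult_closed: "a \<in> carrier R \<Longrightarrow> \<theta> \<in> carrier L \<Longrightarrow> a \<odot>\<^bsub>L\<^esub> \<theta> \<in> carrier L"
  unfolding dual_simps(5) by (intro dual_ext_closed lins) (auto intro: lins)

lemma dual_zero_closed: "\<zero>\<^bsub>L\<^esub> \<in> carrier L"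
  unfolding dual_simps(2) by (intro dual_ext_closed lin_homI) auto

lemma vs_L [simp]: "vs L"
proof (rule moduleI, rule is_cring, rule abelian_groupI)
  fix \<theta> assume t: "\<theta> \<in> carrier L"
  have "(\<ominus> \<one>) \<odot>\<^bsub>L\<^esub> \<theta> \<oplus>\<^bsub>L\<^esub> \<theta> = \<zero>\<^bsub>L\<^esub>"
    by (rule dual_eqI) (use t in \<open>auto simp: dual_add_closed dual_smult_closed dual_zero_closed l_minus l_neg\<close>)
  then show "\<exists>\<phi>\<in>carrier L. \<phi> \<oplus>\<^bsub>L\<^esub> \<theta> = \<zero>\<^bsub>L\<^esub>" using t dual_smult_closed by blast
qed (auto simp: dual_add_closed dual_smult_closed dual_zero_closed l_distr r_distr a_ac m_assoc intro!: dual_eqI)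

lemma lin_ev: "k \<in> carrier K \<Longrightarrow> (\<lambda>\<theta>. \<theta> k) \<in> lin_hom R L (ground R)"
  by (rule lin_homI) auto

lemmas lin_ev_comp [lins] = lin_comp[OF lin_ev]

lemma lin_into_dual:
  assumes "\<And>x. x \<in> carrier U \<Longrightarrow> f x \<in> carrier L" "vs U"
    and "\<And>k. k \<in> carrier K \<Longrightarrow> (\<lambda>x. f x k) \<in> lin_hom R U (ground R)"
  shows "f \<in> lin_hom R U L"
proof (rule lin_homI)
  show "f (x \<oplus>\<^bsub>U\<^esub> y) = f x \<oplus>\<^bsub>L\<^esub> f y" if "x \<in> carrier U" "y \<in> carrier U" for x y
    by (rule dual_eqI) (use assms that lin_plus[OF assms(3)] in auto)
  show "f (a \<odot>\<^bsub>U\<^esub> x) = a \<odot>\<^bsub>L\<^esub> f x" if "a \<in> carrier R" "x \<in> carrier U" for a x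
    by (rule dual_eqI) (use assms that lin_scale[OF assms(3)] in auto)
qed (use assms in auto)

lemma dual_mult_closed: "\<theta> \<in> carrier L \<Longrightarrow> \<phi> \<in> carrier L \<Longrightarrow> \<theta> \<star> \<phi> \<in> carrier L"
  unfolding dual_simps(6) by (intro dual_ext_closed lin_sw_arg fprod_bil dual_lin lin_id) auto

text \<open>
  The product of the dual is the transpose of the coproduct, so its associativity is
  coassociativity and its unit laws are the counit laws.
\<close>

lemma alg_L [simp]: "alg L"
proof (rule algI)
  show "\<one>\<^bsub>L\<^esub> \<in> carrier L" unfolding dual_simps(3) by (intro dual_ext_closed counit_lin)
  show "bil L L L (\<lambda>x y. x \<star> y)"
    by (intro bilI lin_into_dual dual_mult_closed vs_L; simp;
        intro lin_sw_param lin_ground_mult lin_ev vs_ground dual_apply_closed)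
  fix \<theta> \<phi> \<psi> assume t: "\<theta> \<in> carrier L" and p: "\<phi> \<in> carrier L" and q: "\<psi> \<in> carrier L"
  show "(\<theta> \<star> \<phi>) \<star> \<psi> = \<theta> \<star> (\<phi> \<star> \<psi>)"
  proof (rule dual_eqI)
    fix k assume k: "k \<in> carrier K"
    have "((\<theta> \<star> \<phi>) \<star> \<psi>) k = sw (ground R) (\<lambda>x c. sw (ground R) (\<lambda>a b. \<theta> a \<otimes> \<phi> b \<otimes> \<psi> c) x) k"
      using t p q k dual_mult_closed[OF t p]
      by (simp, intro sw_cong, simp_all, intro sw_push[of "\<lambda>r. r \<otimes> _" "ground R" "ground R"] lins) auto
    also have "\<dots> = sw (ground R) (\<lambda>a y. sw (ground R) (\<lambda>b c. \<theta> a \<otimes> \<phi> b \<otimes> \<psi> c) y) k"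
      using t p q k by (intro sw_coassoc trilI lins) auto
    also have "\<dots> = (\<theta> \<star> (\<phi> \<star> \<psi>)) k"
      using t p q k dual_mult_closed[OF p q]
      by (simp add: m_assoc cong: sw_cong, intro sw_cong, simp_all,
          intro sw_push[of "\<lambda>r. _ \<otimes> r" "ground R" "ground R", symmetric] lins) auto
    finally show "((\<theta> \<star> \<phi>) \<star> \<psi>) k = (\<theta> \<star> (\<phi> \<star> \<psi>)) k" .
  qed (use t p q in \<open>auto intro!: dual_mult_closed\<close>)
next
  have one: "\<one>\<^bsub>L\<^esub> \<in> carrier L" unfolding dual_simps(3) by (intro dual_ext_closed counit_lin)
  fix \<theta> assume t: "\<theta> \<in> carrier L"
  have "(\<one>\<^bsub>L\<^esub> \<star> \<theta>) k = \<theta> k" "(\<theta> \<star> \<one>\<^bsub>L\<^esub>) k = \<theta> k" if k: "k \<in> carrier K" for k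
  proof -
    have "(\<one>\<^bsub>L\<^esub> \<star> \<theta>) k = sw (ground R) (\<lambda>a b. \<epsilon> a \<odot>\<^bsub>ground R\<^esub> \<theta> b) k"
      using t k by (simp, intro sw_cong) auto
    then show "(\<one>\<^bsub>L\<^esub> \<star> \<theta>) k = \<theta> k" using sw_counit_left[OF vs_ground dual_lin[OF t] k] by simp
    have "(\<theta> \<star> \<one>\<^bsub>L\<^esub>) k = sw (ground R) (\<lambda>a b. \<epsilon> b \<odot>\<^bsub>ground R\<^esub> \<theta> a) k"
      using t k by (simp, intro sw_cong) (auto simp: m_comm)
    then show "(\<theta> \<star> \<one>\<^bsub>L\<^esub>) k = \<theta> k" using sw_counit_right[OF vs_ground dual_lin[OF t] k] by simp
  qed
  then show "\<one>\<^bsub>L\<^esub> \<star> \<theta> = \<theta>" "\<theta> \<star> \<one>\<^bsub>L\<^esub> = \<theta>"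
    using t one by (auto intro!: dual_eqI dual_mult_closed)
qed simp

lemma dual_antipode_lin: "antipode L \<in> lin_hom R L L"
proof (rule lin_into_dual)
  show "antipode L \<theta> \<in> carrier L" if "\<theta> \<in> carrier L" for \<theta>
    unfolding dual_simps(8) using that by (intro dual_ext_closed lins)
qed (auto intro!: lins)

end

text \<open>Finite dimension enters through a pair of dual bases only.\<close>

locale fd_hopf = hopf_over +
  assumes dual_bases_exist: "\<exists>B \<kappa>. dual_bases R K B \<kappa>"
begin

text \<open>The pair of dual bases that \<open>canonical_element\<close> chooses.\<close>

definition basis where "basis = fst (SOME (B, \<kappa>). dual_bases R K B \<kappa>)"
definition coord where "coord = snd (SOME (B, \<kappa>). dual_bases R K B \<kappa>)"

lemma dual_bases: "dual_bases R K basis coord"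
proof -
  have "\<exists>p. (\<lambda>(B, \<kappa>). dual_bases R K B \<kappa>) p" using dual_bases_exist by auto
  from someI_ex[OF this] show ?thesis unfolding basis_def coord_def by (simp only: case_prod_unfold)
qed

lemma basis [simp]: "finite basis" "b \<in> basis \<Longrightarrow> b \<in> carrier K" "b \<in> basis \<Longrightarrow> coord b \<in> carrier L"
  using dual_bases by (auto simp: dual_bases_def)

lemma basis_expand: "x \<in> carrier K \<Longrightarrow> finsum K (\<lambda>b. coord b x \<bullet> b) basis = x"
  using dual_bases by (auto simp: dual_bases_def)

lemma coords_K: "coords K basis (\<lambda>b. b) coord"
  by (auto simp: coords_def basis_expand intro: dual_lin)

lemma dual_finsum_apply:
  assumes "k \<in> carrier K" "\<And>i. i \<in> I \<Longrightarrow> g i \<in> carrier L"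
  shows "(finsum L g I) k = finsum (ground R) (\<lambda>i. g i k) I"
  by (rule lin_finsum[OF vs_L vs_ground lin_ev[OF assms(1)] assms(2)])

lemma lin_basis_expand:
  assumes "vs Z" "f \<in> lin_hom R K Z" "x \<in> carrier K"
  shows "finsum Z (\<lambda>b. coord b x \<odot>\<^bsub>Z\<^esub> f b) basis = f x"
proof -
  have "f x = f (finsum K (\<lambda>b. coord b x \<bullet> b) basis)" using assms basis_expand by simp
  also have "\<dots> = finsum Z (\<lambda>b. f (coord b x \<bullet> b)) basis"
    using assms by (intro lin_finsum) auto
  also have "\<dots> = finsum Z (\<lambda>b. coord b x \<odot>\<^bsub>Z\<^esub> f b) basis"
    using assms by (intro vs_finsum_cong) (auto simp: lin_scale)
  finally show ?thesis ..
qed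

lemma dual_expand:
  assumes t: "\<theta> \<in> carrier L"
  shows "finsum L (\<lambda>b. \<theta> b \<odot>\<^bsub>L\<^esub> coord b) basis = \<theta>"
proof (rule dual_eqI)
  fix k assume k: "k \<in> carrier K"
  have "(finsum L (\<lambda>b. \<theta> b \<odot>\<^bsub>L\<^esub> coord b) basis) k = finsum (ground R) (\<lambda>b. (\<theta> b \<odot>\<^bsub>L\<^esub> coord b) k) basis"
    using t k by (intro dual_finsum_apply) auto
  also have "\<dots> = finsum (ground R) (\<lambda>b. coord b k \<odot>\<^bsub>ground R\<^esub> \<theta> b) basis"
    using t k by (intro vs_finsum_cong) (auto simp: m_comm)
  also have "\<dots> = \<theta> k" using t k by (intro lin_basis_expand dual_lin) auto
  finally show "(finsum L (\<lambda>b. \<theta> b \<odot>\<^bsub>L\<^esub> coord b) basis) k = \<theta> k" .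
qed (use t in auto)

lemma coords_L: "coords L basis coord (\<lambda>b \<theta>. \<theta> b)"
  by (auto simp: coords_def dual_expand intro: lin_ev)

lemma coords_eqI:
  assumes "coords W I e f" "vs W" "x \<in> carrier W" "y \<in> carrier W" "\<And>i. i \<in> I \<Longrightarrow> f i x = f i y"
  shows "x = y"
proof -
  have f: "f i \<in> lin_hom R W (ground R)" "e i \<in> carrier W" if "i \<in> I" for i
    using assms that by (auto simp: coords_def)
  have "finsum W (\<lambda>i. f i x \<odot>\<^bsub>W\<^esub> e i) I = finsum W (\<lambda>i. f i y \<odot>\<^bsub>W\<^esub> e i) I"
    using assms f lin_closed[OF f(1)] by (intro vs_finsum_cong) auto
  then show ?thesis using assms by (simp add: coords_def)
qed

lemma K_eqI:
  assumes "x \<in> carrier K" "y \<in> carrier K" "\<And>\<theta>. \<theta> \<in> carrier L \<Longrightarrow> \<theta> x = \<theta> y"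
  shows "x = y"
  by (rule coords_eqI[OF coords_K]) (use assms in auto)

lemma dual_tensor_eqI:
  assumes "s \<in> carrier (T L L)" "t \<in> carrier (T L L)"
    and "\<And>k k'. k \<in> carrier K \<Longrightarrow> k' \<in> carrier K \<Longrightarrow> fprod (\<lambda>\<theta>. \<theta> k) (\<lambda>\<theta>. \<theta> k') s = fprod (\<lambda>\<theta>. \<theta> k) (\<lambda>\<theta>. \<theta> k') t"
  shows "s = t"
  by (rule coords_eqI[OF coords_tensor[OF _ _ coords_L coords_L]]) (use assms in auto)

lemma dual_tensor3_eqI:
  assumes "s \<in> carrier (T L (T L L))" "t \<in> carrier (T L (T L L))"
    and "\<And>a b c. a \<in> carrier K \<Longrightarrow> b \<in> carrier K \<Longrightarrow> c \<in> carrier K \<Longrightarrow>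
      fprod (\<lambda>\<theta>. \<theta> a) (fprod (\<lambda>\<theta>. \<theta> b) (\<lambda>\<theta>. \<theta> c)) s = fprod (\<lambda>\<theta>. \<theta> a) (fprod (\<lambda>\<theta>. \<theta> b) (\<lambda>\<theta>. \<theta> c)) t"
  shows "s = t"
  by (rule coords_eqI[OF coords_tensor[OF _ _ coords_L coords_tensor[OF _ _ coords_L coords_L]]])
    (use assms in auto)

text \<open>The coproduct of \<open>\<theta>\<close> is \<open>\<Sum> coord b \<otimes> \<theta> (b \<cdot> _)\<close>, summed over the basis.\<close>

lemma dual_comult_ex:
  assumes t: "\<theta> \<in> carrier L"
  shows "\<exists>s\<in>carrier (T L L). \<forall>k\<in>carrier K. \<forall>k'\<in>carrier K. fprod (\<lambda>\<theta>. \<theta> k) (\<lambda>\<theta>. \<theta> k') s = \<theta> (k \<cdot> k')"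
proof
  let ?s = "finsum (T L L) (\<lambda>b. ts L L (coord b) (\<lambda>k'\<in>carrier K. \<theta> (b \<cdot> k'))) basis"
  have c: "(\<lambda>k'\<in>carrier K. \<theta> (b \<cdot> k')) \<in> carrier L" if "b \<in> carrier K" for b
    using that t by (intro dual_ext_closed lins) auto
  show "?s \<in> carrier (T L L)" using c by auto
  show "\<forall>k\<in>carrier K. \<forall>k'\<in>carrier K. fprod (\<lambda>\<theta>. \<theta> k) (\<lambda>\<theta>. \<theta> k') ?s = \<theta> (k \<cdot> k')"
  proof (intro ballI)
    fix k k' assume k: "k \<in> carrier K" "k' \<in> carrier K"
    have "fprod (\<lambda>\<theta>. \<theta> k) (\<lambda>\<theta>. \<theta> k') ?s = finsum (ground R)
        (\<lambda>b. fprod (\<lambda>\<theta>. \<theta> k) (\<lambda>\<theta>. \<theta> k') (ts L L (coord b) (\<lambda>k'\<in>carrier K. \<theta> (b \<cdot> k')))) basis"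
      using c k by (intro lin_finsum fprod_lin lin_ev) auto
    also have "\<dots> = finsum (ground R) (\<lambda>b. coord b k \<odot>\<^bsub>ground R\<^esub> \<theta> (b \<cdot> k')) basis"
      using c k t by (intro vs_finsum_cong) (auto simp: fprod_tens lin_ev)
    also have "\<dots> = \<theta> (k \<cdot> k')"
      using c k t by (intro lin_basis_expand[of _ "\<lambda>b. \<theta> (b \<cdot> k')"] lins) auto
    finally show "fprod (\<lambda>\<theta>. \<theta> k) (\<lambda>\<theta>. \<theta> k') ?s = \<theta> (k \<cdot> k')" .
  qed
qed

text \<open>
  The definition of the dual forms the tensor square of \<open>dual_algebra\<close>, which has the same linear
  part.
\<close>

lemma dual_comult_the:
  "comult L \<theta> = (THE t. t \<in> carrier (T L L) \<and>
     (\<forall>k\<in>carrier K. \<forall>k'\<in>carrier K. fprod (\<lambda>\<theta>. \<theta> k) (\<lambda>\<theta>. \<theta> k') t = \<theta> (k \<cdot> k')))"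
proof -
  have D: "lin_part (dual_algebra R K) = lin_part L" by (simp add: lin_part_def dual_def Let_def)
  have "carrier (T (dual_algebra R K) (dual_algebra R K)) = carrier (T L L)"
    using tensor_lin_part[OF D D, of R] by (simp add: lin_part_def)
  then show ?thesis by (simp add: dual_def Let_def fprod_def)
qed

lemma dual_comult:
  assumes t: "\<theta> \<in> carrier L"
  shows "comult L \<theta> \<in> carrier (T L L)"
    and "k \<in> carrier K \<Longrightarrow> k' \<in> carrier K \<Longrightarrow> fprod (\<lambda>\<theta>. \<theta> k) (\<lambda>\<theta>. \<theta> k') (comult L \<theta>) = \<theta> (k \<cdot> k')"
proof -
  have "\<exists>!s. s \<in> carrier (T L L) \<and>
     (\<forall>k\<in>carrier K. \<forall>k'\<in>carrier K. fprod (\<lambda>\<theta>. \<theta> k) (\<lambda>\<theta>. \<theta> k') s = \<theta> (k \<cdot> k'))"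
  proof (rule ex_ex1I)
    show "\<exists>s. s \<in> carrier (T L L) \<and>
     (\<forall>k\<in>carrier K. \<forall>k'\<in>carrier K. fprod (\<lambda>\<theta>. \<theta> k) (\<lambda>\<theta>. \<theta> k') s = \<theta> (k \<cdot> k'))"
      using dual_comult_ex[OF t] by blast
  qed (rule dual_tensor_eqI, auto)
  from theI'[OF this, folded dual_comult_the]
  show "comult L \<theta> \<in> carrier (T L L)"
    and "k \<in> carrier K \<Longrightarrow> k' \<in> carrier K \<Longrightarrow> fprod (\<lambda>\<theta>. \<theta> k) (\<lambda>\<theta>. \<theta> k') (comult L \<theta>) = \<theta> (k \<cdot> k')"
    by auto
qed

lemma dual_comult_eqI:
  assumes t: "\<theta> \<in> carrier L" and "s \<in> carrier (T L L)"
    "\<And>k k'. k \<in> carrier K \<Longrightarrow> k' \<in> carrier K \<Longrightarrow> fprod (\<lambda>\<theta>. \<theta> k) (\<lambda>\<theta>. \<theta> k') s = \<theta> (k \<cdot> k')"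
  shows "comult L \<theta> = s"
  using assms dual_comult by (intro dual_tensor_eqI) auto

lemma dual_sw:
  assumes "\<theta> \<in> carrier L" "k \<in> carrier K" "k' \<in> carrier K"
  shows "tlift R (ground R) (\<lambda>\<phi> \<psi>. \<phi> k \<otimes> \<psi> k') (comult L \<theta>) = \<theta> (k \<cdot> k')"
  using dual_comult(2)[OF assms] by (simp add: fprod_def)

text \<open>Both sides are bilinear in \<open>s\<close> and \<open>t\<close>, so elementary tensors suffice.\<close>

lemma dual_tensor_mult:
  assumes k: "k \<in> carrier K" "k' \<in> carrier K" and s: "s \<in> carrier (T L L)" and t: "t \<in> carrier (T L L)"
  shows "fprod (\<lambda>\<theta>. \<theta> k) (\<lambda>\<theta>. \<theta> k') (s \<otimes>\<^bsub>T L L\<^esub> t) =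
    sw (ground R) (\<lambda>a b. sw (ground R) (\<lambda>c d.
      fprod (\<lambda>\<theta>. \<theta> a) (\<lambda>\<theta>. \<theta> c) s \<otimes> fprod (\<lambda>\<theta>. \<theta> b) (\<lambda>\<theta>. \<theta> d) t) k') k"
proof (rule bil_eq_on_tens[OF vs_L vs_L vs_L vs_L vs_ground _ _ _ s t])
  note fl = fprod_lin[OF vs_L vs_L lin_ev lin_ev]
  note fc = lin_closed[OF fl, simplified]
  show "bil (T L L) (T L L) (ground R) (\<lambda>s t. fprod (\<lambda>\<theta>. \<theta> k) (\<lambda>\<theta>. \<theta> k') (s \<otimes>\<^bsub>T L L\<^esub> t))"
    using k by (intro bilI lin_comp[OF fl] lins) auto
  show "bil (T L L) (T L L) (ground R) (\<lambda>s t. sw (ground R) (\<lambda>a b. sw (ground R) (\<lambda>c d.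
      fprod (\<lambda>\<theta>. \<theta> a) (\<lambda>\<theta>. \<theta> c) s \<otimes> fprod (\<lambda>\<theta>. \<theta> b) (\<lambda>\<theta>. \<theta> d) t) k') k)"
    using k fc by (intro bilI lin_sw_param lin_ground_mult fl) auto
  fix v w v' w' assume v: "v \<in> carrier L" "w \<in> carrier L" "v' \<in> carrier L" "w' \<in> carrier L"
  have "fprod (\<lambda>\<theta>. \<theta> k) (\<lambda>\<theta>. \<theta> k') (ts L L v w \<otimes>\<^bsub>T L L\<^esub> ts L L v' w') =
      sw (ground R) (\<lambda>a b. v a \<otimes> v' b) k \<otimes> sw (ground R) (\<lambda>c d. w c \<otimes> w' d) k'"
    using v k by (simp add: fprod_tens lin_ev)
  also have "\<dots> = sw (ground R) (\<lambda>a b. v a \<otimes> v' b \<otimes> sw (ground R) (\<lambda>c d. w c \<otimes> w' d) k') k"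
    using v k sw_closed[OF vs_ground k(2), of "\<lambda>c d. w c \<otimes> w' d"]
    by (intro sw_push[of "\<lambda>r. r \<otimes> _" "ground R" "ground R"] lins) auto
  also have "\<dots> = sw (ground R) (\<lambda>a b. sw (ground R) (\<lambda>c d. v a \<otimes> v' b \<otimes> (w c \<otimes> w' d)) k') k"
    using v k by (intro sw_cong sw_push[of "\<lambda>r. _ \<otimes> r" "ground R" "ground R"] lins) auto
  also have "\<dots> = sw (ground R) (\<lambda>a b. sw (ground R) (\<lambda>c d.
      fprod (\<lambda>\<theta>. \<theta> a) (\<lambda>\<theta>. \<theta> c) (ts L L v w) \<otimes> fprod (\<lambda>\<theta>. \<theta> b) (\<lambda>\<theta>. \<theta> d) (ts L L v' w')) k') k"
    using v k by (intro sw_cong) (auto simp: fprod_tens lin_ev m_ac)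
  finally show "fprod (\<lambda>\<theta>. \<theta> k) (\<lambda>\<theta>. \<theta> k') (ts L L v w \<otimes>\<^bsub>T L L\<^esub> ts L L v' w') =
    sw (ground R) (\<lambda>a b. sw (ground R) (\<lambda>c d.
      fprod (\<lambda>\<theta>. \<theta> a) (\<lambda>\<theta>. \<theta> c) (ts L L v w) \<otimes> fprod (\<lambda>\<theta>. \<theta> b) (\<lambda>\<theta>. \<theta> d) (ts L L v' w')) k') k" .
qed

lemma dual_comult_lin: "comult L \<in> lin_hom R L (T L L)"
proof (rule lin_homI)
  note fl = fprod_lin[OF vs_L vs_L lin_ev lin_ev]
  show "\<theta> \<in> carrier L \<Longrightarrow> comult L \<theta> \<in> carrier (T L L)" for \<theta> by (rule dual_comult)
  show "comult L (\<theta> \<oplus>\<^bsub>L\<^esub> \<phi>) = comult L \<theta> \<oplus>\<^bsub>T L L\<^esub> comult L \<phi>" if "\<theta> \<in> carrier L" "\<phi> \<in> carrier L" for \<theta> \<phi>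
    using that by (intro dual_comult_eqI) (auto simp: dual_comult lin_plus[OF fl])
  show "comult L (a \<odot>\<^bsub>L\<^esub> \<theta>) = a \<odot>\<^bsub>T L L\<^esub> comult L \<theta>" if "a \<in> carrier R" "\<theta> \<in> carrier L" for a \<theta>
    using that by (intro dual_comult_eqI) (auto simp: dual_comult lin_scale[OF fl])
qed

lemma dual_comult_mult:
  assumes t: "\<theta> \<in> carrier L" and p: "\<phi> \<in> carrier L"
  shows "comult L (\<theta> \<star> \<phi>) = comult L \<theta> \<otimes>\<^bsub>T L L\<^esub> comult L \<phi>"
proof (rule dual_comult_eqI)
  fix k k' assume k: "k \<in> carrier K" "k' \<in> carrier K"
  have "fprod (\<lambda>\<theta>. \<theta> k) (\<lambda>\<theta>. \<theta> k') (comult L \<theta> \<otimes>\<^bsub>T L L\<^esub> comult L \<phi>) =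
      sw (ground R) (\<lambda>a b. sw (ground R) (\<lambda>c d. \<theta> (a \<cdot> c) \<otimes> \<phi> (b \<cdot> d)) k') k"
    unfolding dual_tensor_mult[OF k dual_comult(1)[OF t] dual_comult(1)[OF p]]
    using k t p by (intro sw_cong) (auto simp: dual_comult(2))
  also have "\<dots> = (\<theta> \<star> \<phi>) (k \<cdot> k')"
    using k t p by (simp add: sw_mult fprod_bil dual_lin)
  finally show "fprod (\<lambda>\<theta>. \<theta> k) (\<lambda>\<theta>. \<theta> k') (comult L \<theta> \<otimes>\<^bsub>T L L\<^esub> comult L \<phi>) = (\<theta> \<star> \<phi>) (k \<cdot> k')" .
qed (use t p dual_comult(1) in auto)

lemma dual_comult_one: "comult L \<one>\<^bsub>L\<^esub> = \<one>\<^bsub>T L L\<^esub>"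
  by (rule dual_comult_eqI) (auto simp: tensor_one fprod_tens lin_ev)

lemma fprod3:
  assumes "vs U" "vs V" "vs W" "f \<in> lin_hom R U (ground R)" "g \<in> lin_hom R V (ground R)" "h \<in> lin_hom R W (ground R)"
    "t \<in> carrier (T U (T V W))"
  shows "fprod f (fprod g h) t =
    tlift R (ground R) (\<lambda>u s. tlift R (ground R) (\<lambda>v w. f u \<otimes> (g v \<otimes> h w)) s) t"
  unfolding fprod_def
proof (rule tlift_cong[OF assms(1) vs_tensor[OF assms(2,3)] vs_ground assms(7)])
  fix u s assume u: "u \<in> carrier U" and s: "s \<in> carrier (T V W)"
  note cl = lin_closed[OF assms(4), simplified] lin_closed[OF assms(5), simplified] lin_closed[OF assms(6), simplified]
  show "f u \<otimes> tlift R (ground R) (\<lambda>v w. g v \<otimes> h w) s = tlift R (ground R) (\<lambda>v w. f u \<otimes> (g v \<otimes> h w)) s"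
    using assms u cl by (intro lin_tlift[OF assms(2,3) vs_ground vs_ground _ s, of "\<lambda>r. f u \<otimes> r"] lins) auto
  show "tlift R (ground R) (\<lambda>v w. f u \<otimes> (g v \<otimes> h w)) s \<in> carrier (ground R)"
    using assms u cl by (intro tlift_closed[OF assms(2,3) vs_ground s]) auto
qed

text \<open>Paired with \<open>a \<otimes> b \<otimes> c\<close>, both sides give \<open>\<theta>\<close> at the product of the three elements.\<close>

lemma dual_coassoc:
  assumes t: "\<theta> \<in> carrier L"
  shows "tassoc R L L L (tmap R (T L L) L (comult L) id (comult L \<theta>)) = tmap R L (T L L) id (comult L) (comult L \<theta>)"
    (is "?l = ?r")
proof -
  note l = lin_id[of L, folded id_def]
  note vT = vs_tensor[OF vs_L vs_L]
  have m: "tmap R (T L L) L (comult L) id (comult L \<theta>) \<in> carrier (T (T L L) L)"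
    using lin_closed[OF tmap_lin[OF vs_L vs_L vT vs_L dual_comult_lin l] dual_comult(1)[OF t]] .
  have lc: "?l \<in> carrier (T L (T L L))" using lin_closed[OF tassoc_lin[OF vs_L vs_L vs_L] m] .
  have rc: "?r \<in> carrier (T L (T L L))"
    using lin_closed[OF tmap_lin[OF vs_L vs_L vs_L vT l dual_comult_lin] dual_comult(1)[OF t]] .
  show ?thesis
  proof (rule dual_tensor3_eqI[OF lc rc])
    fix a b c assume k: "a \<in> carrier K" "b \<in> carrier K" "c \<in> carrier K"
    let ?G = "\<lambda>\<phi> \<psi> \<chi>. \<phi> a \<otimes> (\<psi> b \<otimes> \<chi> c)"
    have G: "tril L L L (ground R) ?G"
      using k by (intro trilI lins) auto
    note e = fprod3[OF vs_L vs_L vs_L lin_ev[OF k(1)] lin_ev[OF k(2)] lin_ev[OF k(3)]]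
    have "fprod (\<lambda>\<theta>. \<theta> a) (fprod (\<lambda>\<theta>. \<theta> b) (\<lambda>\<theta>. \<theta> c)) ?l =
        tlift R (ground R) (\<lambda>s \<chi>. tlift R (ground R) (\<lambda>\<phi> \<psi>. ?G \<phi> \<psi> \<chi>) s) (tmap R (T L L) L (comult L) id (comult L \<theta>))"
      unfolding e[OF lc] by (rule tlift_tassoc[OF vs_L vs_L vs_L vs_ground G m])
    also have "\<dots> = tlift R (ground R) (\<lambda>\<theta>' \<chi>. tlift R (ground R) (\<lambda>\<phi> \<psi>. ?G \<phi> \<psi> \<chi>) (comult L \<theta>')) (comult L \<theta>)"
      using tlift_tmap[OF vs_L vs_L vT vs_L vs_ground dual_comult_lin l
          bil_tril_left[OF vs_L vs_L vs_L vs_ground G] dual_comult(1)[OF t]] by simp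
    also have "\<dots> = tlift R (ground R) (\<lambda>\<theta>' \<chi>. \<theta>' (a \<cdot> b) \<otimes> \<chi> c) (comult L \<theta>)"
    proof (rule tlift_cong[OF vs_L vs_L vs_ground dual_comult(1)[OF t]])
      fix \<theta>' \<chi> assume tc: "\<theta>' \<in> carrier L" "\<chi> \<in> carrier L"
      have "tlift R (ground R) (\<lambda>\<phi> \<psi>. ?G \<phi> \<psi> \<chi>) (comult L \<theta>') = tlift R (ground R) (\<lambda>\<phi> \<psi>. (\<phi> a \<otimes> \<psi> b) \<otimes> \<chi> c) (comult L \<theta>')"
        using k tc by (intro tlift_cong[OF vs_L vs_L vs_ground dual_comult(1)]) (auto simp: m_assoc)
      also have "\<dots> = tlift R (ground R) (\<lambda>\<phi> \<psi>. \<phi> a \<otimes> \<psi> b) (comult L \<theta>') \<otimes> \<chi> c"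
        using k tc by (intro lin_tlift[OF vs_L vs_L vs_ground vs_ground _ dual_comult(1), of "\<lambda>r. r \<otimes> \<chi> c", symmetric] lins) auto
      finally show "tlift R (ground R) (\<lambda>\<phi> \<psi>. ?G \<phi> \<psi> \<chi>) (comult L \<theta>') = \<theta>' (a \<cdot> b) \<otimes> \<chi> c"
        using k tc by (simp add: dual_sw)
    qed (use k in auto)
    also have "\<dots> = \<theta> ((a \<cdot> b) \<cdot> c)" using k t by (intro dual_sw) auto
    also have "\<dots> = \<theta> (a \<cdot> (b \<cdot> c))" using k by (simp add: alg_assoc)
    also have "\<dots> = tlift R (ground R) (\<lambda>\<phi> \<theta>'. \<phi> a \<otimes> \<theta>' (b \<cdot> c)) (comult L \<theta>)"
      using k t by (intro dual_sw[symmetric]) auto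
    also have "\<dots> = tlift R (ground R) (\<lambda>\<phi> \<theta>'. tlift R (ground R) (\<lambda>\<psi> \<chi>. ?G \<phi> \<psi> \<chi>) (comult L \<theta>')) (comult L \<theta>)"
    proof (rule tlift_cong[OF vs_L vs_L vs_ground dual_comult(1)[OF t]])
      fix \<phi> \<theta>' assume tc: "\<phi> \<in> carrier L" "\<theta>' \<in> carrier L"
      show "\<phi> a \<otimes> \<theta>' (b \<cdot> c) = tlift R (ground R) (\<lambda>\<psi> \<chi>. ?G \<phi> \<psi> \<chi>) (comult L \<theta>')"
        unfolding dual_sw[OF tc(2) k(2,3), symmetric]
        using k tc by (intro lin_tlift[OF vs_L vs_L vs_ground vs_ground _ dual_comult(1)] lins) auto
      show "tlift R (ground R) (\<lambda>\<psi> \<chi>. ?G \<phi> \<psi> \<chi>) (comult L \<theta>') \<in> carrier (ground R)"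
        using k tc by (intro tlift_closed[OF vs_L vs_L vs_ground dual_comult(1)]) auto
    qed
    also have "\<dots> = fprod (\<lambda>\<theta>. \<theta> a) (fprod (\<lambda>\<theta>. \<theta> b) (\<lambda>\<theta>. \<theta> c)) ?r"
      unfolding e[OF rc]
      using tlift_tmap[OF vs_L vs_L vs_L vT vs_ground l dual_comult_lin
          bil_tril_right[OF vs_L vs_L vs_L vs_ground G] dual_comult(1)[OF t]] by simp
    finally show "fprod (\<lambda>\<theta>. \<theta> a) (fprod (\<lambda>\<theta>. \<theta> b) (\<lambda>\<theta>. \<theta> c)) ?l = fprod (\<lambda>\<theta>. \<theta> a) (fprod (\<lambda>\<theta>. \<theta> b) (\<lambda>\<theta>. \<theta> c)) ?r" .
  qed
qed

lemma dual_tlift_apply: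
  assumes t: "\<theta> \<in> carrier L" and k: "k \<in> carrier K"
    and B: "\<And>\<phi> \<psi>. \<phi> \<in> carrier L \<Longrightarrow> \<psi> \<in> carrier L \<Longrightarrow> B \<phi> \<psi> \<in> carrier L"
  shows "(tlift R L B (comult L \<theta>)) k = tlift R (ground R) (\<lambda>\<phi> \<psi>. B \<phi> \<psi> k) (comult L \<theta>)"
  by (rule lin_tlift[OF vs_L vs_L vs_L vs_ground lin_ev[OF k] dual_comult(1)[OF t]]) (use B in auto)

text \<open>The convolution of \<open>f\<close> and \<open>g\<close> in \<open>K\<close>, transposed to the dual.\<close>

lemma dual_antipode_sum:
  assumes t: "\<theta> \<in> carrier L" and k: "k \<in> carrier K"
    and f: "f \<in> lin_hom R K K" and g: "g \<in> lin_hom R K K"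
  shows "tlift R (ground R) (\<lambda>\<phi> \<psi>. sw (ground R) (\<lambda>a b. \<phi> (f a) \<otimes> \<psi> (g b)) k) (comult L \<theta>) =
    sw (ground R) (\<lambda>a b. \<theta> (f a \<cdot> g b)) k"
proof -
  note cl = lin_closed[OF f] lin_closed[OF g]
  have "tlift R (ground R) (\<lambda>\<phi> \<psi>. sw (ground R) (\<lambda>a b. \<phi> (f a) \<otimes> \<psi> (g b)) k) (comult L \<theta>) =
     sw (ground R) (\<lambda>a b. tlift R (ground R) (\<lambda>\<phi> \<psi>. \<phi> (f a) \<otimes> \<psi> (g b)) (comult L \<theta>)) k"
    using t k cl by (intro tlift_swap[of L L K K]) (auto simp: dual_comult(1))
  also have "\<dots> = sw (ground R) (\<lambda>a b. \<theta> (f a \<cdot> g b)) k"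
    using t k cl by (intro sw_cong) (auto simp: dual_sw)
  finally show ?thesis .
qed

text \<open>
  Every axiom for the dual is the transpose of an axiom for \<open>K\<close>; an equation of functionals or of
  tensors of functionals is checked on elements of \<open>K\<close>.
\<close>

theorem dual_hopf_algebra: "hopf_algebra R L"
proof (intro hopf_algebra.intro hopf_algebra_axioms.intro alg_L dual_antipode_lin)
  show "comult L \<in> alg_hom R L (T L L)"
    using dual_comult_lin lin_closed[OF dual_comult_lin]
    by (simp add: alg_hom_def) (rule ring_hom_memI, simp_all add: lin_plus dual_comult_mult dual_comult_one)
  show "counit L \<in> alg_hom R L (ground R)"
    using lin_ev[of "\<one>\<^bsub>K\<^esub>"]
    by (auto simp: alg_hom_def dual_simps(7)[abs_def] sw_one fprod_bil dual_lin intro!: ring_hom_memI)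
  fix \<theta> assume t: "\<theta> \<in> carrier L"
  show "tassoc R L L L (tmap R (T L L) L (comult L) id (comult L \<theta>)) = tmap R L (T L L) id (comult L) (comult L \<theta>)"
    by (rule dual_coassoc[OF t])
  note Dt = dual_comult(1)[OF t]
  have c1: "tlift R L B (comult L \<theta>) \<in> carrier L"
    if "\<And>\<phi> \<psi>. \<phi> \<in> carrier L \<Longrightarrow> \<psi> \<in> carrier L \<Longrightarrow> B \<phi> \<psi> \<in> carrier L" for B
    using that by (intro tlift_closed[OF vs_L vs_L vs_L Dt])
  show "tlift R L (\<lambda>a b. counit L a \<odot>\<^bsub>L\<^esub> b) (comult L \<theta>) = \<theta>"
  proof (rule dual_eqI[OF c1 t])
    fix k assume k: "k \<in> carrier K"
    show "tlift R L (\<lambda>a b. counit L a \<odot>\<^bsub>L\<^esub> b) (comult L \<theta>) k = \<theta> k"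
      using t k dual_sw[OF t _ k, of "\<one>\<^bsub>K\<^esub>"] by (simp add: dual_tlift_apply dual_simps(7))
  qed (simp add: dual_simps(7))
  show "tlift R L (\<lambda>a b. counit L b \<odot>\<^bsub>L\<^esub> a) (comult L \<theta>) = \<theta>"
  proof (rule dual_eqI[OF c1 t])
    fix k assume k: "k \<in> carrier K"
    have "tlift R (ground R) (\<lambda>\<phi> \<psi>. \<psi> \<one>\<^bsub>K\<^esub> \<otimes> \<phi> k) (comult L \<theta>) = tlift R (ground R) (\<lambda>\<phi> \<psi>. \<phi> k \<otimes> \<psi> \<one>\<^bsub>K\<^esub>) (comult L \<theta>)"
      using k by (intro tlift_cong[OF vs_L vs_L vs_ground Dt]) (auto simp: m_comm)
    then show "tlift R L (\<lambda>a b. counit L b \<odot>\<^bsub>L\<^esub> a) (comult L \<theta>) k = \<theta> k"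
      using t k dual_sw[OF t k, of "\<one>\<^bsub>K\<^esub>"] by (simp add: dual_tlift_apply dual_simps(7))
  qed (simp add: dual_simps(7))
  note Sc = lin_closed[OF dual_antipode_lin]
  have S1: "sw (ground R) (\<lambda>a b. \<theta> (S a \<cdot> b)) k = \<epsilon> k \<otimes> \<theta> \<one>\<^bsub>K\<^esub>"
    "sw (ground R) (\<lambda>a b. \<theta> (a \<cdot> S b)) k = \<epsilon> k \<otimes> \<theta> \<one>\<^bsub>K\<^esub>" if k: "k \<in> carrier K" for k
    using sw_antipode_left[OF vs_ground dual_lin[OF t] k] sw_antipode_right[OF vs_ground dual_lin[OF t] k] by auto
  show "tlift R L (\<lambda>a b. antipode L a \<star> b) (comult L \<theta>) = counit L \<theta> \<odot>\<^bsub>L\<^esub> \<one>\<^bsub>L\<^esub>"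
  proof (rule dual_eqI[OF c1])
    fix k assume k: "k \<in> carrier K"
    have "tlift R L (\<lambda>a b. antipode L a \<star> b) (comult L \<theta>) k =
        tlift R (ground R) (\<lambda>\<phi> \<psi>. (antipode L \<phi> \<star> \<psi>) k) (comult L \<theta>)"
      using Sc by (intro dual_tlift_apply[OF t k]) auto
    also have "\<dots> = tlift R (ground R) (\<lambda>\<phi> \<psi>. sw (ground R) (\<lambda>a b. \<phi> (S a) \<otimes> \<psi> b) k) (comult L \<theta>)"
    proof (rule tlift_cong[OF vs_L vs_L vs_ground Dt])
      fix \<phi> \<psi> assume pq: "\<phi> \<in> carrier L" "\<psi> \<in> carrier L"
      show "(antipode L \<phi> \<star> \<psi>) k = sw (ground R) (\<lambda>a b. \<phi> (S a) \<otimes> \<psi> b) k"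
        using pq k by (simp only: dual_apply) (rule sw_cong, auto)
      show "sw (ground R) (\<lambda>a b. \<phi> (S a) \<otimes> \<psi> b) k \<in> carrier (ground R)" using pq k by simp
    qed
    also have "\<dots> = sw (ground R) (\<lambda>a b. \<theta> (S a \<cdot> b)) k"
      by (rule dual_antipode_sum[OF t k antipode_lin lin_id])
    also have "\<dots> = \<epsilon> k \<otimes> \<theta> \<one>\<^bsub>K\<^esub>" by (rule S1[OF k])
    also have "\<dots> = (counit L \<theta> \<odot>\<^bsub>L\<^esub> \<one>\<^bsub>L\<^esub>) k" using k t by (simp add: dual_simps(7) m_comm)
    finally show "tlift R L (\<lambda>a b. antipode L a \<star> b) (comult L \<theta>) k = (counit L \<theta> \<odot>\<^bsub>L\<^esub> \<one>\<^bsub>L\<^esub>) k" .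
  qed (use Sc t in \<open>auto simp: dual_simps(7)\<close>)
  show "tlift R L (\<lambda>a b. a \<star> antipode L b) (comult L \<theta>) = counit L \<theta> \<odot>\<^bsub>L\<^esub> \<one>\<^bsub>L\<^esub>"
  proof (rule dual_eqI[OF c1])
    fix k assume k: "k \<in> carrier K"
    have "tlift R L (\<lambda>a b. a \<star> antipode L b) (comult L \<theta>) k =
        tlift R (ground R) (\<lambda>\<phi> \<psi>. (\<phi> \<star> antipode L \<psi>) k) (comult L \<theta>)"
      using Sc by (intro dual_tlift_apply[OF t k]) auto
    also have "\<dots> = tlift R (ground R) (\<lambda>\<phi> \<psi>. sw (ground R) (\<lambda>a b. \<phi> a \<otimes> \<psi> (S b)) k) (comult L \<theta>)"
    proof (rule tlift_cong[OF vs_L vs_L vs_ground Dt])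
      fix \<phi> \<psi> assume pq: "\<phi> \<in> carrier L" "\<psi> \<in> carrier L"
      show "(\<phi> \<star> antipode L \<psi>) k = sw (ground R) (\<lambda>a b. \<phi> a \<otimes> \<psi> (S b)) k"
        using pq k by (simp only: dual_apply) (rule sw_cong, auto)
      show "sw (ground R) (\<lambda>a b. \<phi> a \<otimes> \<psi> (S b)) k \<in> carrier (ground R)" using pq k by simp
    qed
    also have "\<dots> = sw (ground R) (\<lambda>a b. \<theta> (a \<cdot> S b)) k"
      by (rule dual_antipode_sum[OF t k lin_id antipode_lin])
    also have "\<dots> = \<epsilon> k \<otimes> \<theta> \<one>\<^bsub>K\<^esub>" by (rule S1[OF k])
    also have "\<dots> = (counit L \<theta> \<odot>\<^bsub>L\<^esub> \<one>\<^bsub>L\<^esub>) k" using k t by (simp add: dual_simps(7) m_comm)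
    finally show "tlift R L (\<lambda>a b. a \<star> antipode L b) (comult L \<theta>) k = (counit L \<theta> \<odot>\<^bsub>L\<^esub> \<one>\<^bsub>L\<^esub>) k" .
  qed (use Sc t in \<open>auto simp: dual_simps(7)\<close>)
qed

text \<open>
  The functionals \<open>coord b\<close> and the evaluations at \<open>b\<close> are dual bases of the dual. A pair of dual
  bases is indexed by its vectors, so \<open>b\<close> is recovered from \<open>coord b\<close>, which is possible because
  \<open>coord b\<close> takes the value 1 at \<open>b\<close> and 0 at the other basis vectors.
\<close>

lemma dual_dual_bases_exist: "\<exists>B \<kappa>. dual_bases R L B \<kappa>"
proof -
  have hL: "hopf_over R L" using dual_hopf_algebra by (intro hopf_over.intro hopf_over_axioms.intro field_axioms)
  interpret D: hopf_over R L by (rule hL)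
  have kr: "coord b c = (if b = c then \<one> else \<zero>)" if "b \<in> basis" "c \<in> basis" for b c
    using dual_bases that by (auto simp: dual_bases_def)
  have inj: "inj_on coord basis"
  proof (rule inj_onI)
    fix b c assume bc: "b \<in> basis" "c \<in> basis" "coord b = coord c"
    have "coord c b = \<one>" using kr[of b b] bc(1) unfolding bc(3) by simp
    with kr[OF bc(2,1)] show "b = c" by (cases "c = b") auto
  qed
  let ?k = "\<lambda>\<phi>. \<lambda>\<theta>\<in>carrier L. \<theta> (inv_into basis coord \<phi>)"
  have iv: "inv_into basis coord (coord b) = b" if "b \<in> basis" for b using inj that by (rule inv_into_f_f)
  have "dual_bases R L (coord ` basis) ?k"
    unfolding dual_bases_def
  proof (intro conjI ballI)
    show "?k \<in> coord ` basis \<rightarrow> carrier (dual R L)"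
      using iv by (auto intro!: D.dual_ext_closed lin_ev)
    fix \<theta> assume t: "\<theta> \<in> carrier L"
    have "finsum L (\<lambda>\<phi>. ?k \<phi> \<theta> \<odot>\<^bsub>L\<^esub> \<phi>) (coord ` basis) = finsum L (\<lambda>b. ?k (coord b) \<theta> \<odot>\<^bsub>L\<^esub> coord b) basis"
      using t iv inj by (intro abelian_monoid.finsum_reindex[OF vs_abelian_monoid[OF vs_L]]) auto
    also have "\<dots> = finsum L (\<lambda>b. \<theta> b \<odot>\<^bsub>L\<^esub> coord b) basis"
      using t iv by (intro vs_finsum_cong) auto
    finally show "finsum L (\<lambda>\<phi>. ?k \<phi> \<theta> \<odot>\<^bsub>L\<^esub> \<phi>) (coord ` basis) = \<theta>" using dual_expand[OF t] by simp
  qed (use iv kr inj in \<open>auto simp: inj_on_def\<close>)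
  then show ?thesis by blast
qed

lemma dual_fd_hopf: "fd_hopf R L"
  by (intro fd_hopf.intro hopf_over.intro hopf_over_axioms.intro fd_hopf_axioms.intro field_axioms
      dual_hopf_algebra dual_dual_bases_exist)

end

section \<open>Existence of dual bases\<close>

context field begin

definition spans where
  "spans V B \<longleftrightarrow> finite B \<and> B \<subseteq> carrier V \<and>
    (\<forall>x\<in>carrier V. \<exists>c. (\<forall>b\<in>B. c b \<in> carrier R) \<and> x = finsum V (\<lambda>b. c b \<odot>\<^bsub>V\<^esub> b) B)"

text \<open>
  The linear combinations of a finite set form a submodule that contains the set, hence also its
  hull.
\<close>

lemma finite_dimensional_spans:
  assumes V: "vs V" and fd: "finite_dimensional R V"
  shows "\<exists>B. spans V B"
proof -
  obtain B where B: "finite B" "B \<subseteq> carrier V" "(\<lambda>N. submodule N R V) hull B = carrier V"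
    using fd by (auto simp: finite_dimensional_def)
  interpret V: module R V by (rule V)
  let ?S = "{finsum V (\<lambda>b. c b \<odot>\<^bsub>V\<^esub> b) B | c. \<forall>b\<in>B. c b \<in> carrier R}"
  have Bc: "b \<in> B \<Longrightarrow> b \<in> carrier V" for b using B by auto
  have zero: "\<zero>\<^bsub>V\<^esub> \<in> ?S"
    using V Bc by (auto intro!: exI[of _ "\<lambda>_. \<zero>"] vs_finsum_zero[symmetric])
  have add: "x \<oplus>\<^bsub>V\<^esub> y \<in> ?S" if xy: "x \<in> ?S" "y \<in> ?S" for x y
  proof -
    obtain c d where c: "\<forall>b\<in>B. c b \<in> carrier R" "x = finsum V (\<lambda>b. c b \<odot>\<^bsub>V\<^esub> b) B"
      and d: "\<forall>b\<in>B. d b \<in> carrier R" "y = finsum V (\<lambda>b. d b \<odot>\<^bsub>V\<^esub> b) B" using xy by auto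
    have "x \<oplus>\<^bsub>V\<^esub> y = finsum V (\<lambda>b. c b \<odot>\<^bsub>V\<^esub> b \<oplus>\<^bsub>V\<^esub> d b \<odot>\<^bsub>V\<^esub> b) B"
      using c d Bc V by (simp add: vs_finsum_add)
    also have "\<dots> = finsum V (\<lambda>b. (c b \<oplus> d b) \<odot>\<^bsub>V\<^esub> b) B"
      using c d Bc V by (intro vs_finsum_cong) (auto simp: V.smult_l_distr)
    finally show ?thesis using c d by (auto intro!: exI[of _ "\<lambda>b. c b \<oplus> d b"])
  qed
  have sm: "a \<odot>\<^bsub>V\<^esub> x \<in> ?S" if a: "a \<in> carrier R" and x: "x \<in> ?S" for a x
  proof -
    obtain c where c: "\<forall>b\<in>B. c b \<in> carrier R" "x = finsum V (\<lambda>b. c b \<odot>\<^bsub>V\<^esub> b) B" using x by auto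
    have "a \<odot>\<^bsub>V\<^esub> x = finsum V (\<lambda>b. (a \<otimes> c b) \<odot>\<^bsub>V\<^esub> b) B"
      using c a Bc V by (simp add: vs_finsum_smult vs_smult_smult cong: vs_finsum_cong)
    then show ?thesis using c a by (auto intro!: exI[of _ "\<lambda>b. a \<otimes> c b"])
  qed
  have sub: "?S \<subseteq> carrier V" using V Bc by (auto intro!: vs_finsum_closed vs_smult_closed)
  have "submodule ?S R V"
  proof (rule V.submoduleI[OF sub zero])
    fix x assume x: "x \<in> ?S"
    have "\<ominus>\<^bsub>V\<^esub> x = (\<ominus> \<one>) \<odot>\<^bsub>V\<^esub> x" using subsetD[OF sub x] by (simp add: V.smult_l_minus)
    then show "\<ominus>\<^bsub>V\<^esub> x \<in> ?S" using sm[OF _ x, of "\<ominus> \<one>"] by simp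
  qed (use add sm in blast)+
  moreover have "B \<subseteq> ?S"
  proof
    fix b assume b: "b \<in> B"
    have "finsum V (\<lambda>x. (if x = b then \<one> else \<zero>) \<odot>\<^bsub>V\<^esub> x) {b} =
        finsum V (\<lambda>x. (if x = b then \<one> else \<zero>) \<odot>\<^bsub>V\<^esub> x) B"
      using V B(1) b Bc by (intro vs_finsum_superset) auto
    then have "b = finsum V (\<lambda>x. (if x = b then \<one> else \<zero>) \<odot>\<^bsub>V\<^esub> x) B"
      using V Bc[OF b] vs_finsum_insert[OF V, of "{}" b] by simp
    then show "b \<in> ?S" by (auto intro!: exI[of _ "\<lambda>x. if x = b then \<one> else \<zero>"])
  qed
  ultimately have "carrier V \<subseteq> ?S" unfolding B(3)[symmetric] by (intro hull_minimal)
  then have "spans V B" using B by (auto simp: spans_def)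
  then show ?thesis ..
qed

text \<open>
  If two combinations of a spanning set agree but differ in the coefficient of \<open>p\<close>, then \<open>p\<close> is a
  combination of the other vectors, and these form a smaller spanning set.
\<close>

lemma minimal_spanning_independent:
  assumes V: "vs V" and B: "spans V B" and min: "\<And>B'. spans V B' \<Longrightarrow> card B \<le> card B'"
    and c: "\<And>b. b \<in> B \<Longrightarrow> c b \<in> carrier R" and d: "\<And>b. b \<in> B \<Longrightarrow> d b \<in> carrier R"
    and eq: "finsum V (\<lambda>b. c b \<odot>\<^bsub>V\<^esub> b) B = finsum V (\<lambda>b. d b \<odot>\<^bsub>V\<^esub> b) B"
    and p: "p \<in> B"
  shows "c p = d p"
proof (rule ccontr)
  assume ne: "c p \<noteq> d p"
  interpret V: module R V by (rule V)
  have Bc: "b \<in> B \<Longrightarrow> b \<in> carrier V" for b using B by (auto simp: spans_def)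
  \<comment> \<open>\<open>A\<close> is the smaller spanning set; \<open>?e\<close> below gives the coefficients of \<open>p\<close> with respect to it.\<close>
  define A where "A = B - {p}"
  have A: "B = insert p A" "p \<notin> A" "finite A" "A \<subseteq> B" using p B by (auto simp: A_def spans_def)
  define u where "u = inv (c p \<ominus> d p)"
  have "c p \<ominus> d p \<noteq> \<zero>"
    using ne c[OF p] d[OF p] minus_equality[of "c p" "\<ominus> d p"] by (auto simp: minus_eq)
  then have u: "u \<in> carrier R" "u \<otimes> (c p \<ominus> d p) = \<one>"
    using c[OF p] d[OF p] field_Units by (auto simp: u_def)
  have split: "finsum V (\<lambda>b. e b \<odot>\<^bsub>V\<^esub> b) B = e p \<odot>\<^bsub>V\<^esub> p \<oplus>\<^bsub>V\<^esub> finsum V (\<lambda>b. e b \<odot>\<^bsub>V\<^esub> b) A"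
    if "\<And>b. b \<in> B \<Longrightarrow> e b \<in> carrier R" for e
    unfolding A(1) using A(2-) that Bc V A(1) by (intro vs_finsum_insert) auto
  have closed: "finsum V (\<lambda>b. e b \<odot>\<^bsub>V\<^esub> b) A \<in> carrier V" if "\<And>b. b \<in> B \<Longrightarrow> e b \<in> carrier R" for e
    using A that Bc V by (intro vs_finsum_closed) auto
  let ?e = "\<lambda>b. u \<otimes> (d b \<ominus> c b)"
  have e: "?e b \<in> carrier R" if "b \<in> B" for b using that c d u by simp
  have comb: "finsum V (\<lambda>b. (f b \<oplus> r \<otimes> g b) \<odot>\<^bsub>V\<^esub> b) A =
      finsum V (\<lambda>b. f b \<odot>\<^bsub>V\<^esub> b) A \<oplus>\<^bsub>V\<^esub> r \<odot>\<^bsub>V\<^esub> finsum V (\<lambda>b. g b \<odot>\<^bsub>V\<^esub> b) A"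
    if "\<And>b. b \<in> B \<Longrightarrow> f b \<in> carrier R" "\<And>b. b \<in> B \<Longrightarrow> g b \<in> carrier R" "r \<in> carrier R" for f g r
  proof -
    have "finsum V (\<lambda>b. (f b \<oplus> r \<otimes> g b) \<odot>\<^bsub>V\<^esub> b) A =
        finsum V (\<lambda>b. f b \<odot>\<^bsub>V\<^esub> b \<oplus>\<^bsub>V\<^esub> r \<odot>\<^bsub>V\<^esub> (g b \<odot>\<^bsub>V\<^esub> b)) A"
      using that A(4) Bc V
      by (intro vs_finsum_cong) (auto simp: V.smult_l_distr vs_smult_smult subset_iff)
    also have "\<dots> = finsum V (\<lambda>b. f b \<odot>\<^bsub>V\<^esub> b) A \<oplus>\<^bsub>V\<^esub> r \<odot>\<^bsub>V\<^esub> finsum V (\<lambda>b. g b \<odot>\<^bsub>V\<^esub> b) A"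
      using that A(4) Bc V by (subst vs_finsum_add) (auto simp: vs_finsum_smult subset_iff)
    finally show ?thesis .
  qed
  have pe: "p = finsum V (\<lambda>b. ?e b \<odot>\<^bsub>V\<^esub> b) A"
  proof -
    let ?C = "finsum V (\<lambda>b. c b \<odot>\<^bsub>V\<^esub> b) A" and ?D = "finsum V (\<lambda>b. d b \<odot>\<^bsub>V\<^esub> b) A"
    have CD: "?C \<in> carrier V" "?D \<in> carrier V" using closed c d by auto
    have cd: "c p \<in> carrier R" "d p \<in> carrier R" "p \<in> carrier V" using c d p Bc by auto
    have "c p \<odot>\<^bsub>V\<^esub> p \<oplus>\<^bsub>V\<^esub> ?C = d p \<odot>\<^bsub>V\<^esub> p \<oplus>\<^bsub>V\<^esub> ?D" using eq split[OF c] split[OF d] by simp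
    then have "(c p \<odot>\<^bsub>V\<^esub> p \<oplus>\<^bsub>V\<^esub> ?C) \<oplus>\<^bsub>V\<^esub> (\<ominus>\<^bsub>V\<^esub> (d p \<odot>\<^bsub>V\<^esub> p) \<oplus>\<^bsub>V\<^esub> \<ominus>\<^bsub>V\<^esub> ?C) =
       (d p \<odot>\<^bsub>V\<^esub> p \<oplus>\<^bsub>V\<^esub> ?D) \<oplus>\<^bsub>V\<^esub> (\<ominus>\<^bsub>V\<^esub> (d p \<odot>\<^bsub>V\<^esub> p) \<oplus>\<^bsub>V\<^esub> \<ominus>\<^bsub>V\<^esub> ?C)" by simp
    moreover have "(c p \<odot>\<^bsub>V\<^esub> p \<oplus>\<^bsub>V\<^esub> ?C) \<oplus>\<^bsub>V\<^esub> (\<ominus>\<^bsub>V\<^esub> (d p \<odot>\<^bsub>V\<^esub> p) \<oplus>\<^bsub>V\<^esub> \<ominus>\<^bsub>V\<^esub> ?C) =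
       (c p \<odot>\<^bsub>V\<^esub> p \<oplus>\<^bsub>V\<^esub> \<ominus>\<^bsub>V\<^esub> (d p \<odot>\<^bsub>V\<^esub> p)) \<oplus>\<^bsub>V\<^esub> (?C \<oplus>\<^bsub>V\<^esub> \<ominus>\<^bsub>V\<^esub> ?C)"
      using CD cd V by (simp add: V.M.a_ac)
    moreover have "(d p \<odot>\<^bsub>V\<^esub> p \<oplus>\<^bsub>V\<^esub> ?D) \<oplus>\<^bsub>V\<^esub> (\<ominus>\<^bsub>V\<^esub> (d p \<odot>\<^bsub>V\<^esub> p) \<oplus>\<^bsub>V\<^esub> \<ominus>\<^bsub>V\<^esub> ?C) =
       (d p \<odot>\<^bsub>V\<^esub> p \<oplus>\<^bsub>V\<^esub> \<ominus>\<^bsub>V\<^esub> (d p \<odot>\<^bsub>V\<^esub> p)) \<oplus>\<^bsub>V\<^esub> (?D \<oplus>\<^bsub>V\<^esub> \<ominus>\<^bsub>V\<^esub> ?C)"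
      using CD cd V by (simp add: V.M.a_ac)
    ultimately have "(c p \<ominus> d p) \<odot>\<^bsub>V\<^esub> p = ?D \<oplus>\<^bsub>V\<^esub> \<ominus>\<^bsub>V\<^esub> ?C"
      using CD cd V by (simp add: V.M.r_neg minus_eq V.smult_l_distr V.smult_l_minus)
    also have "\<dots> = ?D \<oplus>\<^bsub>V\<^esub> (\<ominus> \<one>) \<odot>\<^bsub>V\<^esub> ?C" using CD by (simp add: V.smult_l_minus)
    also have "\<dots> = finsum V (\<lambda>b. (d b \<oplus> (\<ominus> \<one>) \<otimes> c b) \<odot>\<^bsub>V\<^esub> b) A" using c d by (intro comb[symmetric]) auto
    finally have "u \<odot>\<^bsub>V\<^esub> ((c p \<ominus> d p) \<odot>\<^bsub>V\<^esub> p) = u \<odot>\<^bsub>V\<^esub> finsum V (\<lambda>b. (d b \<oplus> (\<ominus> \<one>) \<otimes> c b) \<odot>\<^bsub>V\<^esub> b) A" by simp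
    also have "u \<odot>\<^bsub>V\<^esub> ((c p \<ominus> d p) \<odot>\<^bsub>V\<^esub> p) = p" using u cd V by (simp add: vs_smult_smult)
    also have "u \<odot>\<^bsub>V\<^esub> finsum V (\<lambda>b. (d b \<oplus> (\<ominus> \<one>) \<otimes> c b) \<odot>\<^bsub>V\<^esub> b) A = finsum V (\<lambda>b. ?e b \<odot>\<^bsub>V\<^esub> b) A"
    proof -
      have "u \<odot>\<^bsub>V\<^esub> ((d b \<oplus> (\<ominus> \<one>) \<otimes> c b) \<odot>\<^bsub>V\<^esub> b) = ?e b \<odot>\<^bsub>V\<^esub> b" if "b \<in> A" for b
        using that A(4) u c d Bc V by (auto simp: vs_smult_smult minus_eq l_minus subset_iff)
      then show ?thesis using A(4) u c d Bc V
        by (subst vs_finsum_smult) (auto simp: subset_iff intro!: vs_finsum_cong)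
    qed
    finally show ?thesis .
  qed
  have "spans V A"
    unfolding spans_def
  proof (intro conjI ballI)
    fix x assume x: "x \<in> carrier V"
    then obtain f where f: "\<And>b. b \<in> B \<Longrightarrow> f b \<in> carrier R" "x = finsum V (\<lambda>b. f b \<odot>\<^bsub>V\<^esub> b) B"
      using B unfolding spans_def by blast
    have "x = f p \<odot>\<^bsub>V\<^esub> finsum V (\<lambda>b. ?e b \<odot>\<^bsub>V\<^esub> b) A \<oplus>\<^bsub>V\<^esub> finsum V (\<lambda>b. f b \<odot>\<^bsub>V\<^esub> b) A"
      using f(2) split[OF f(1)] pe by simp
    also have "\<dots> = finsum V (\<lambda>b. f b \<odot>\<^bsub>V\<^esub> b) A \<oplus>\<^bsub>V\<^esub> f p \<odot>\<^bsub>V\<^esub> finsum V (\<lambda>b. ?e b \<odot>\<^bsub>V\<^esub> b) A"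
      using closed[OF f(1)] closed[OF e] f(1)[OF p] V by (intro V.M.a_comm) auto
    also have "\<dots> = finsum V (\<lambda>b. (f b \<oplus> f p \<otimes> ?e b) \<odot>\<^bsub>V\<^esub> b) A"
      using f(1) p e by (intro comb[symmetric]) auto
    finally show "\<exists>c. (\<forall>b\<in>A. c b \<in> carrier R) \<and> x = finsum V (\<lambda>b. c b \<odot>\<^bsub>V\<^esub> b) A"
      using f(1) p e A(4) by (intro exI[of _ "\<lambda>b. f b \<oplus> f p \<otimes> ?e b"]) (auto simp: subset_iff)
  qed (use A Bc in auto)
  then have "card B \<le> card A" by (rule min)
  then show False using A by simp
qed

end

context hopf_over begin

lemma finite_dimensional_dual_bases:
  assumes fd: "finite_dimensional R K"
  shows "\<exists>B \<kappa>. dual_bases R K B \<kappa>"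
proof -
  obtain B where B: "spans K B" and min: "\<And>B'. spans K B' \<Longrightarrow> card B \<le> card B'"
    using finite_dimensional_spans[OF vs_K fd] ex_has_least_nat[of "spans K" _ card] by metis
  have Bc: "b \<in> B \<Longrightarrow> b \<in> carrier K" "finite B" for b using B by (auto simp: spans_def)
  have "\<forall>x\<in>carrier K. \<exists>c. (\<forall>b\<in>B. c b \<in> carrier R) \<and> x = finsum K (\<lambda>b. c b \<bullet> b) B"
    using B by (auto simp: spans_def)
  then obtain C where C: "\<And>x b. x \<in> carrier K \<Longrightarrow> b \<in> B \<Longrightarrow> C x b \<in> carrier R"
    "\<And>x. x \<in> carrier K \<Longrightarrow> x = finsum K (\<lambda>b. C x b \<bullet> b) B" by metis
  have uniq: "C x b = d b" if x: "x \<in> carrier K" and d: "\<And>b. b \<in> B \<Longrightarrow> d b \<in> carrier R"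
    and e: "x = finsum K (\<lambda>b. d b \<bullet> b) B" and b: "b \<in> B" for x d b
    by (rule minimal_spanning_independent[OF vs_K B min C(1)[OF x] d _ b]) (use C(2)[OF x] e in auto)
  interpret K: module R K by simp
  let ?\<kappa> = "\<lambda>b. \<lambda>x\<in>carrier K. C x b"
  have lin: "(\<lambda>x. C x b) \<in> lin_hom R K (ground R)" if b: "b \<in> B" for b
  proof (rule lin_homI)
    fix x y assume xy: "x \<in> carrier K" "y \<in> carrier K"
    have "x \<oplus>\<^bsub>K\<^esub> y = finsum K (\<lambda>b. C x b \<bullet> b) B \<oplus>\<^bsub>K\<^esub> finsum K (\<lambda>b. C y b \<bullet> b) B"
      using C(2)[OF xy(1)] C(2)[OF xy(2)] by simp
    also have "\<dots> = finsum K (\<lambda>b. C x b \<bullet> b \<oplus>\<^bsub>K\<^esub> C y b \<bullet> b) B"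
      using xy Bc C(1) by (intro vs_finsum_add[symmetric]) auto
    also have "\<dots> = finsum K (\<lambda>b. (C x b \<oplus> C y b) \<bullet> b) B"
      using xy Bc C(1) by (intro vs_finsum_cong) (auto simp: K.smult_l_distr)
    finally have e: "x \<oplus>\<^bsub>K\<^esub> y = finsum K (\<lambda>b. (C x b \<oplus> C y b) \<bullet> b) B" .
    have "C (x \<oplus>\<^bsub>K\<^esub> y) b = C x b \<oplus> C y b"
      by (rule uniq[OF _ _ e b]) (use xy C(1) in auto)
    then show "C (x \<oplus>\<^bsub>K\<^esub> y) b = C x b \<oplus>\<^bsub>ground R\<^esub> C y b" by simp
  next
    fix a x assume x: "a \<in> carrier R" "x \<in> carrier K"
    have "a \<bullet> x = a \<bullet> finsum K (\<lambda>b. C x b \<bullet> b) B" using C(2)[OF x(2)] by simp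
    also have "\<dots> = finsum K (\<lambda>b. a \<bullet> (C x b \<bullet> b)) B"
      using x Bc C(1) by (intro vs_finsum_smult) auto
    also have "\<dots> = finsum K (\<lambda>b. (a \<otimes> C x b) \<bullet> b) B"
      using x Bc C(1) by (intro vs_finsum_cong) (auto simp: vs_smult_smult)
    finally have e: "a \<bullet> x = finsum K (\<lambda>b. (a \<otimes> C x b) \<bullet> b) B" .
    have "C (a \<bullet> x) b = a \<otimes> C x b"
      by (rule uniq[OF _ _ e b]) (use x C(1) in auto)
    then show "C (a \<bullet> x) b = a \<odot>\<^bsub>ground R\<^esub> C x b" by simp
  qed (use b C in auto)
  have "dual_bases R K B ?\<kappa>"
    unfolding dual_bases_def
  proof (intro conjI ballI)
    show "?\<kappa> \<in> B \<rightarrow> carrier (dual R K)" using lin by (auto intro: dual_ext_closed)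
    show "finsum K (\<lambda>b. ?\<kappa> b x \<bullet> b) B = x" if "x \<in> carrier K" for x
      using C(2)[OF that] that by simp
    fix b c assume bc: "b \<in> B" "c \<in> B"
    let ?d = "\<lambda>x. if x = c then \<one> else \<zero>"
    have "finsum K (\<lambda>x. ?d x \<bullet> x) {c} = finsum K (\<lambda>x. ?d x \<bullet> x) B"
      using Bc bc by (intro vs_finsum_superset) auto
    then have "c = finsum K (\<lambda>x. ?d x \<bullet> x) B"
      using Bc(1)[OF bc(2)] vs_finsum_insert[OF vs_K, of "{}" c] by simp
    then have "C c b = ?d b" by (intro uniq) (use Bc bc in auto)
    then show "?\<kappa> b c = (if b = c then \<one> else \<zero>)" using Bc bc by simp
  qed (use Bc in auto)
  then show ?thesis by blast
qed

lemma finite_dimensional_fd_hopf: "finite_dimensional R K \<Longrightarrow> fd_hopf R K"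
  by (intro fd_hopf.intro fd_hopf_axioms.intro finite_dimensional_dual_bases hopf_over_axioms)

end

section \<open>The antipode\<close>

context field begin

text \<open>
  Gaussian elimination: an equation with a nonzero coefficient is solved for that unknown, and the
  result is substituted into the remaining equations.
\<close>

lemma underdetermined_system:
  fixes a :: "'e \<Rightarrow> 'i \<Rightarrow> 'a"
  assumes "finite E" "finite I" "card E < card I" "\<And>e i. e \<in> E \<Longrightarrow> i \<in> I \<Longrightarrow> a e i \<in> carrier R"
  shows "\<exists>c. (\<forall>i\<in>I. c i \<in> carrier R) \<and> (\<exists>i\<in>I. c i \<noteq> \<zero>) \<and> (\<forall>e\<in>E. (\<Oplus>i\<in>I. c i \<otimes> a e i) = \<zero>)"
  using assms
proof (induction E arbitrary: I a)
  case empty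
  then obtain i where "i \<in> I" by fastforce
  then show ?case by (auto intro!: exI[of _ "\<lambda>_. \<one>"])
next
  case (insert e0 E)
  show ?case
  proof (cases "\<forall>i\<in>I. a e0 i = \<zero>")
    case True
    obtain c where c: "\<forall>i\<in>I. c i \<in> carrier R" "\<exists>i\<in>I. c i \<noteq> \<zero>" "\<forall>e\<in>E. (\<Oplus>i\<in>I. c i \<otimes> a e i) = \<zero>"
      using insert.IH[of I a] insert.hyps insert.prems by (auto simp: card_insert_if)
    have "(\<Oplus>i\<in>I. c i \<otimes> a e0 i) = (\<Oplus>i\<in>I. \<zero>)"
      using True c(1) by (intro finsum_cong') auto
    then show ?thesis using c by (intro exI[of _ c]) auto
  next
    case False
    then obtain j where j: "j \<in> I" "a e0 j \<noteq> \<zero>" by blast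
    \<comment> \<open>The unknown \<open>j\<close> is eliminated; \<open>u\<close> is the inverse of its coefficient in the equation \<open>e0\<close>.\<close>
    define J where "J = I - {j}"
    have J: "I = insert j J" "j \<notin> J" "finite J" using j insert.prems by (auto simp: J_def)
    have ac: "a e i \<in> carrier R" if "e = e0 \<or> e \<in> E" "i = j \<or> i \<in> J" for e i
      using that insert.prems(3) J by auto
    define u where "u = inv (a e0 j)"
    have u: "u \<in> carrier R" "u \<otimes> a e0 j = \<one>" "a e0 j \<otimes> u = \<one>"
      using j(2) ac[of e0 j] field_Units by (auto simp: u_def)
    let ?a = "\<lambda>e i. a e i \<ominus> (a e j \<otimes> u) \<otimes> a e0 i"
    have "card E < card J" using insert J by (auto simp: card_insert_if)
    moreover have "?a e i \<in> carrier R" if "e \<in> E" "i \<in> J" for e i using that ac u by simp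
    ultimately obtain c where c: "\<forall>i\<in>J. c i \<in> carrier R" "\<exists>i\<in>J. c i \<noteq> \<zero>"
      "\<forall>e\<in>E. (\<Oplus>i\<in>J. c i \<otimes> ?a e i) = \<zero>"
      using insert.IH[OF J(3), of ?a] by blast
    define s where "s = (\<Oplus>i\<in>J. c i \<otimes> a e0 i)"
    have s: "s \<in> carrier R" unfolding s_def using c ac by (intro finsum_closed) auto
    let ?c = "\<lambda>i. if i = j then \<ominus> (u \<otimes> s) else c i"
    have val: "(\<Oplus>i\<in>I. ?c i \<otimes> a e i) = \<ominus> (u \<otimes> s) \<otimes> a e j \<oplus> (\<Oplus>i\<in>J. c i \<otimes> a e i)"
      if "e = e0 \<or> e \<in> E" for e
    proof -
      have "(\<Oplus>i\<in>I. ?c i \<otimes> a e i) = ?c j \<otimes> a e j \<oplus> (\<Oplus>i\<in>J. ?c i \<otimes> a e i)"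
        unfolding J(1) using J c ac that u s by (intro finsum_insert) auto
      moreover have "(\<Oplus>i\<in>J. ?c i \<otimes> a e i) = (\<Oplus>i\<in>J. c i \<otimes> a e i)"
        using J c ac that by (intro finsum_cong') auto
      ultimately show ?thesis by simp
    qed
    have "(\<Oplus>i\<in>I. ?c i \<otimes> a e i) = \<zero>" if e: "e = e0 \<or> e \<in> E" for e
    proof (cases "e = e0")
      case True
      have "\<ominus> (u \<otimes> s) \<otimes> a e0 j = \<ominus> s"
      proof -
        have "u \<otimes> s \<otimes> a e0 j = (u \<otimes> a e0 j) \<otimes> s"
          using u(1) s ac[of e0 j] by (simp add: m_ac)
        then show ?thesis using u s ac[of e0 j] by (simp add: l_minus)
      qed
      then show ?thesis unfolding val[OF e] unfolding True using s by (simp add: s_def[symmetric] l_neg)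
    next
      case False
      then have eE: "e \<in> E" using e by simp
      have cl: "c i \<otimes> a e i \<in> carrier R" "c i \<otimes> a e0 i \<in> carrier R" if "i \<in> J" for i
        using that c ac eE by auto
      have "c i \<otimes> ?a e i = c i \<otimes> a e i \<oplus> (\<ominus> (a e j \<otimes> u)) \<otimes> (c i \<otimes> a e0 i)" if "i \<in> J" for i
        using that c ac eE u by (simp add: minus_eq r_distr l_minus r_minus m_ac)
      then have "(\<Oplus>i\<in>J. c i \<otimes> ?a e i) = (\<Oplus>i\<in>J. c i \<otimes> a e i \<oplus> (\<ominus> (a e j \<otimes> u)) \<otimes> (c i \<otimes> a e0 i))"
        using c ac eE u by (intro finsum_cong') auto
      also have "\<dots> = (\<Oplus>i\<in>J. c i \<otimes> a e i) \<oplus> (\<Oplus>i\<in>J. (\<ominus> (a e j \<otimes> u)) \<otimes> (c i \<otimes> a e0 i))"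
        using cl ac eE u by (intro finsum_addf) auto
      also have "(\<Oplus>i\<in>J. (\<ominus> (a e j \<otimes> u)) \<otimes> (c i \<otimes> a e0 i)) = (\<ominus> (a e j \<otimes> u)) \<otimes> s"
        unfolding s_def using cl ac eE u J by (intro finsum_rdistr[symmetric]) auto
      also have "\<dots> = \<ominus> (u \<otimes> s) \<otimes> a e j"
      proof -
        have aj: "a e j \<in> carrier R" using ac eE by blast
        then have "(a e j \<otimes> u) \<otimes> s = (u \<otimes> s) \<otimes> a e j" using s u(1) by (simp add: m_ac)
        then show ?thesis using s u(1) aj by (simp add: l_minus)
      qed
      finally have "(\<Oplus>i\<in>J. c i \<otimes> a e i) \<oplus> \<ominus> (u \<otimes> s) \<otimes> a e j = \<zero>" using c(3) eE by simp
      moreover have "(\<Oplus>i\<in>J. c i \<otimes> a e i) \<in> carrier R" using cl by (intro finsum_closed) auto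
      ultimately show ?thesis unfolding val[OF e] using u s ac eE by (simp add: a_comm)
    qed
    moreover have "\<exists>i\<in>I. ?c i \<noteq> \<zero>" using c(2) J by auto
    moreover have "\<forall>i\<in>I. ?c i \<in> carrier R" using c(1) J u s by auto
    ultimately show ?thesis by (intro exI[of _ ?c]) blast
  qed
qed

lemma tlift_finsum:
  assumes V: "vs V" and W: "vs W" and Z: "vs Z" and t: "t \<in> carrier (T V W)" and I: "finite I"
    and B: "\<And>i v w. i \<in> I \<Longrightarrow> v \<in> carrier V \<Longrightarrow> w \<in> carrier W \<Longrightarrow> B i v w \<in> carrier Z"
  shows "tlift R Z (\<lambda>v w. finsum Z (\<lambda>i. B i v w) I) t = finsum Z (\<lambda>i. tlift R Z (\<lambda>v w. B i v w) t) I"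
proof -
  note c = some_rep_coeffs[OF V W t]
  define f where "f = (SOME f. f \<in> t)"
  have "tlift R Z (\<lambda>v w. finsum Z (\<lambda>i. B i v w) I) t =
      finsum Z (\<lambda>p. finsum Z (\<lambda>i. f p \<odot>\<^bsub>Z\<^esub> B i (fst p) (snd p)) I) {p. f p \<noteq> \<zero>}"
    unfolding tlift_fext fext_def f_def[symmetric] using Z B c[folded f_def]
    by (intro vs_finsum_cong vs_finsum_smult vs_finsum_closed) auto
  also have "\<dots> = finsum Z (\<lambda>i. tlift R Z (\<lambda>v w. B i v w) t) I"
    unfolding tlift_fext fext_def f_def[symmetric] using Z B I c[folded f_def]
    by (intro vs_finsum_swap) auto
  finally show ?thesis .
qed

end

context hopf_over begin

lemma antipode_one [simp]: "S \<one>\<^bsub>K\<^esub> = \<one>\<^bsub>K\<^esub>"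
proof -
  have "bil K K K (\<lambda>a b. S a \<cdot> b)" by (intro bilI lins antipode_lin) auto
  from sw_one[OF vs_K this] sw_antipode_left[OF vs_K lin_id alg_closed(2)[OF alg_K]]
  show ?thesis by simp
qed

lemma sw_swap:
  assumes "vs Z" "h \<in> carrier K" "k \<in> carrier K"
    "\<And>a b c d. a \<in> carrier K \<Longrightarrow> b \<in> carrier K \<Longrightarrow> c \<in> carrier K \<Longrightarrow> d \<in> carrier K \<Longrightarrow> G a b c d \<in> carrier Z"
  shows "sw Z (\<lambda>a b. sw Z (\<lambda>c d. G a b c d) k) h = sw Z (\<lambda>c d. sw Z (\<lambda>a b. G a b c d) h) k"
  using assms by (intro tlift_swap[of K K K K]) auto

text \<open>
  The map \<open>(h, k) \<mapsto> S k \<cdot> S h\<close> is a left inverse of the multiplication for the convolution of maps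
  \<open>K \<otimes> K \<rightarrow> K\<close>.
\<close>

lemma antipode_conv_left:
  assumes h: "h \<in> carrier K" and k: "k \<in> carrier K"
  shows "sw K (\<lambda>a b. sw K (\<lambda>c d. (S c \<cdot> S a) \<cdot> (b \<cdot> d)) k) h =
    (\<epsilon> h \<otimes> \<epsilon> k) \<bullet> \<one>\<^bsub>K\<^esub>"
proof -
  \<comment> \<open>The sum over \<open>h\<close> only sees \<open>S h\<^sub>1 \<cdot> h\<^sub>2\<close>, as the argument of a linear map.\<close>
  let ?F = "\<lambda>x. sw K (\<lambda>c d. (S c \<cdot> x) \<cdot> d) k"
  have F: "?F \<in> lin_hom R K K" using k by (intro lin_sw_param lins) auto
  have "sw K (\<lambda>a b. sw K (\<lambda>c d. (S c \<cdot> S a) \<cdot> (b \<cdot> d)) k) h =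
      sw K (\<lambda>a b. ?F (S a \<cdot> b)) h"
    using h k by (intro sw_cong) (auto simp: alg_assoc)
  also have "\<dots> = \<epsilon> h \<bullet> ?F \<one>\<^bsub>K\<^esub>" by (rule sw_antipode_left[OF vs_K F h])
  also have "?F \<one>\<^bsub>K\<^esub> = sw K (\<lambda>c d. S c \<cdot> d) k" using k by (intro sw_cong) auto
  also have "\<dots> = \<epsilon> k \<bullet> \<one>\<^bsub>K\<^esub>" using sw_antipode_left[OF vs_K lin_id k] by simp
  finally show ?thesis using h k by (simp add: vs_smult_smult)
qed

text \<open>
  The map \<open>(h, k) \<mapsto> S (h \<cdot> k)\<close> is a right inverse of the multiplication for the same convolution.
\<close>

lemma antipode_conv_right:
  assumes h: "h \<in> carrier K" and k: "k \<in> carrier K"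
  shows "sw K (\<lambda>a b. sw K (\<lambda>c d. (a \<cdot> c) \<cdot> S (b \<cdot> d)) k) h =
    (\<epsilon> h \<otimes> \<epsilon> k) \<bullet> \<one>\<^bsub>K\<^esub>"
proof -
  have "bil K K K (\<lambda>a b. a \<cdot> S b)" by (intro bilI lins antipode_lin) auto
  from sw_mult[OF vs_K h k this] show ?thesis
    using h k sw_antipode_right[OF vs_K lin_id, of "h \<cdot> k"] by simp
qed

text \<open>
  A left inverse and a right inverse agree. To see this, the sum of \<open>(S k\<^sub>1 \<cdot> S h\<^sub>1) \<cdot> (h\<^sub>2 \<cdot> k\<^sub>2)
  \<cdot> S (h\<^sub>3 \<cdot> k\<^sub>3)\<close> is evaluated with both bracketings.
\<close>

theorem antipode_mult:
  assumes h: "h \<in> carrier K" and k: "k \<in> carrier K"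
  shows "S (h \<cdot> k) = S k \<cdot> S h"
proof -
  let ?P = "\<lambda>a b d e. (S d \<cdot> S a) \<cdot> (b \<cdot> e)"
  let ?Q = "\<lambda>b c e f. (b \<cdot> e) \<cdot> S (c \<cdot> f)"
  let ?G = "\<lambda>a b c d e f. ?P a b d e \<cdot> S (c \<cdot> f)"
  have "S (h \<cdot> k) = sw K (\<lambda>x c. \<epsilon> x \<bullet> S (c \<cdot> k)) h"
    using h k by (intro sw_counit_left[symmetric, of K "\<lambda>c. S (c \<cdot> k)"] lins) auto
  also have "\<dots> = sw K (\<lambda>x c. \<epsilon> x \<bullet> sw K (\<lambda>y f. \<epsilon> y \<bullet> S (c \<cdot> f)) k) h"
    using h k sw_counit_left[OF vs_K, of "\<lambda>f. S (_ \<cdot> f)" k]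
    by (intro sw_cong arg_cong2[of _ _ _ _ "smult K"] refl
        sw_counit_left[symmetric, of K "\<lambda>f. S (_ \<cdot> f)"] lins) auto
  also have "\<dots> = sw K (\<lambda>x c. sw K (\<lambda>y f. ((\<epsilon> x \<otimes> \<epsilon> y) \<bullet> \<one>\<^bsub>K\<^esub>) \<cdot> S (c \<cdot> f)) k) h"
  proof (rule sw_cong[OF vs_K h])
    fix x c assume x: "x \<in> carrier K" and c: "c \<in> carrier K"
    have "\<epsilon> x \<bullet> sw K (\<lambda>y f. \<epsilon> y \<bullet> S (c \<cdot> f)) k = sw K (\<lambda>y f. \<epsilon> x \<bullet> (\<epsilon> y \<bullet> S (c \<cdot> f))) k"
      using x c k by (intro sw_push[of "\<lambda>z. \<epsilon> x \<bullet> z" K K] lins) auto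
    also have "\<dots> = sw K (\<lambda>y f. ((\<epsilon> x \<otimes> \<epsilon> y) \<bullet> \<one>\<^bsub>K\<^esub>) \<cdot> S (c \<cdot> f)) k"
      using x c k by (intro sw_cong) (auto simp: alg_smult vs_smult_smult)
    finally show "\<epsilon> x \<bullet> sw K (\<lambda>y f. \<epsilon> y \<bullet> S (c \<cdot> f)) k =
      sw K (\<lambda>y f. ((\<epsilon> x \<otimes> \<epsilon> y) \<bullet> \<one>\<^bsub>K\<^esub>) \<cdot> S (c \<cdot> f)) k" .
  qed (use k in auto)
  also have "\<dots> = sw K (\<lambda>x c. sw K (\<lambda>y f. sw K (\<lambda>a b. sw K (\<lambda>d e. ?G a b c d e f) y) x) k) h"
  proof (intro sw_cong vs_K h k)
    fix x c y f assume x: "x \<in> carrier K" "c \<in> carrier K" "y \<in> carrier K" "f \<in> carrier K"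
    have "((\<epsilon> x \<otimes> \<epsilon> y) \<bullet> \<one>\<^bsub>K\<^esub>) \<cdot> S (c \<cdot> f) =
        sw K (\<lambda>a b. sw K (\<lambda>d e. ?P a b d e) y) x \<cdot> S (c \<cdot> f)"
      using antipode_conv_left[of x y] x by simp
    also have "\<dots> = sw K (\<lambda>a b. sw K (\<lambda>d e. ?P a b d e) y \<cdot> S (c \<cdot> f)) x"
      using x by (intro sw_push[of "\<lambda>z. z \<cdot> S (c \<cdot> f)" K K] lins) auto
    also have "\<dots> = sw K (\<lambda>a b. sw K (\<lambda>d e. ?G a b c d e f) y) x"
      using x by (intro sw_cong sw_push[of "\<lambda>z. z \<cdot> S (c \<cdot> f)" K K] lins) auto
    finally show "((\<epsilon> x \<otimes> \<epsilon> y) \<bullet> \<one>\<^bsub>K\<^esub>) \<cdot> S (c \<cdot> f) = sw K (\<lambda>a b. sw K (\<lambda>d e. ?G a b c d e f) y) x" .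
  qed (auto simp: h k)
  also have "\<dots> = sw K (\<lambda>x c. sw K (\<lambda>a b. sw K (\<lambda>y f. sw K (\<lambda>d e. ?G a b c d e f) y) k) x) h"
    using h k by (intro sw_cong sw_swap) auto
  also have "\<dots> = sw K (\<lambda>x c. sw K (\<lambda>a b. sw K (\<lambda>d z. sw K (\<lambda>e f. ?G a b c d e f) z) k) x) h"
    using h k by (intro sw_cong sw_coassoc trilI lins) auto
  also have "\<dots> = sw K (\<lambda>a w. sw K (\<lambda>b c. sw K (\<lambda>d z. sw K (\<lambda>e f. ?G a b c d e f) z) k) w) h"
    using h k by (intro sw_coassoc trilI lin_sw_param lins antipode_lin) auto
  also have "\<dots> = sw K (\<lambda>a w. sw K (\<lambda>d z. sw K (\<lambda>b c. sw K (\<lambda>e f. ?G a b c d e f) z) w) k) h"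
    using h k by (intro sw_cong sw_swap) auto
  also have "\<dots> = sw K (\<lambda>a w. sw K (\<lambda>d z. (S d \<cdot> S a) \<cdot> ((\<epsilon> w \<otimes> \<epsilon> z) \<bullet> \<one>\<^bsub>K\<^esub>)) k) h"
  proof (intro sw_cong vs_K h k)
    fix a w d z assume x: "a \<in> carrier K" "w \<in> carrier K" "d \<in> carrier K" "z \<in> carrier K"
    have "sw K (\<lambda>b c. sw K (\<lambda>e f. ?G a b c d e f) z) w =
        sw K (\<lambda>b c. sw K (\<lambda>e f. (S d \<cdot> S a) \<cdot> ?Q b c e f) z) w"
      using x by (intro sw_cong) (auto simp: alg_assoc)
    also have "\<dots> = sw K (\<lambda>b c. (S d \<cdot> S a) \<cdot> sw K (\<lambda>e f. ?Q b c e f) z) w"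
      using x by (intro sw_cong sw_push[of "\<lambda>y. (S d \<cdot> S a) \<cdot> y" K K, symmetric] lins) auto
    also have "\<dots> = (S d \<cdot> S a) \<cdot> sw K (\<lambda>b c. sw K (\<lambda>e f. ?Q b c e f) z) w"
      using x by (intro sw_push[of "\<lambda>y. (S d \<cdot> S a) \<cdot> y" K K, symmetric] lins) auto
    finally show "sw K (\<lambda>b c. sw K (\<lambda>e f. ?G a b c d e f) z) w =
        (S d \<cdot> S a) \<cdot> ((\<epsilon> w \<otimes> \<epsilon> z) \<bullet> \<one>\<^bsub>K\<^esub>)"
      using antipode_conv_right[of w z] x by simp
  qed (auto simp: h k)
  also have "\<dots> = sw K (\<lambda>a w. \<epsilon> w \<bullet> sw K (\<lambda>d z. \<epsilon> z \<bullet> (S d \<cdot> S a)) k) h"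
  proof (rule sw_cong[OF vs_K h])
    fix a w assume x: "a \<in> carrier K" "w \<in> carrier K"
    have "sw K (\<lambda>d z. (S d \<cdot> S a) \<cdot> ((\<epsilon> w \<otimes> \<epsilon> z) \<bullet> \<one>\<^bsub>K\<^esub>)) k =
        sw K (\<lambda>d z. \<epsilon> w \<bullet> (\<epsilon> z \<bullet> (S d \<cdot> S a))) k"
      using x k by (intro sw_cong) (auto simp: alg_smult vs_smult_smult)
    also have "\<dots> = \<epsilon> w \<bullet> sw K (\<lambda>d z. \<epsilon> z \<bullet> (S d \<cdot> S a)) k"
      using x k by (intro sw_push[of "\<lambda>y. \<epsilon> w \<bullet> y" K K, symmetric] lins) auto
    finally show "sw K (\<lambda>d z. (S d \<cdot> S a) \<cdot> ((\<epsilon> w \<otimes> \<epsilon> z) \<bullet> \<one>\<^bsub>K\<^esub>)) k =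
      \<epsilon> w \<bullet> sw K (\<lambda>d z. \<epsilon> z \<bullet> (S d \<cdot> S a)) k" .
  qed (use k in auto)
  also have "\<dots> = sw K (\<lambda>a w. \<epsilon> w \<bullet> (S k \<cdot> S a)) h"
    using h k by (intro sw_cong arg_cong2[of _ _ _ _ "smult K"] refl
        sw_counit_right[of K "\<lambda>d. S d \<cdot> S _"] lins antipode_lin) auto
  also have "\<dots> = S k \<cdot> S h"
    using h k by (intro sw_counit_right[of K "\<lambda>a. S k \<cdot> S a"] lins antipode_lin) auto
  finally show ?thesis .
qed

text \<open>
  The convolution powers of the antipode; \<open>spow 0\<close> is the unit of the convolution product.
\<close>

primrec spow :: "nat \<Rightarrow> 'k \<Rightarrow> 'k" where
  "spow 0 = (\<lambda>h. \<epsilon> h \<bullet> \<one>\<^bsub>K\<^esub>)"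
| "spow (Suc i) = (\<lambda>h. sw K (\<lambda>a b. S a \<cdot> spow i b) h)"

lemma spow_lin: "spow i \<in> lin_hom R K K"
proof (induction i)
  case 0
  then show ?case by (auto intro!: lins counit_lin)
next
  case (Suc i)
  then show ?case unfolding spow.simps
    by (intro lin_sw_arg bilI lin_mult_left lin_mult_right lin_comp[OF Suc] lin_id antipode_lin) auto
qed

lemma spow_closed [simp]: "h \<in> carrier K \<Longrightarrow> spow i h \<in> carrier K"
  by (rule lin_closed[OF spow_lin])

text \<open>
  The identity is the convolution inverse of the antipode, so convolving with it lowers the
  exponent by one.
\<close>

lemma conv_id_spow:
  assumes h: "h \<in> carrier K"
  shows "sw K (\<lambda>a b. a \<cdot> spow (Suc i) b) h = spow i h" "sw K (\<lambda>a b. a \<cdot> spow 0 b) h = h"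
proof -
  note sl = lin_comp[OF spow_lin]
  have "sw K (\<lambda>a b. a \<cdot> spow (Suc i) b) h = sw K (\<lambda>a y. sw K (\<lambda>b c. (a \<cdot> S b) \<cdot> spow i c) y) h"
  proof (rule sw_cong[OF vs_K h])
    fix a y assume a: "a \<in> carrier K" "y \<in> carrier K"
    have "a \<cdot> spow (Suc i) y = sw K (\<lambda>b c. a \<cdot> (S b \<cdot> spow i c)) y"
      unfolding spow.simps using a by (intro sw_push[of "\<lambda>z. a \<cdot> z" K K] lins) auto
    also have "\<dots> = sw K (\<lambda>b c. (a \<cdot> S b) \<cdot> spow i c) y"
      using a by (intro sw_cong) (auto simp: alg_assoc)
    finally show "a \<cdot> spow (Suc i) y = sw K (\<lambda>b c. (a \<cdot> S b) \<cdot> spow i c) y" .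
  qed auto
  also have "\<dots> = sw K (\<lambda>x c. sw K (\<lambda>a b. (a \<cdot> S b) \<cdot> spow i c) x) h"
    using h by (intro sw_coassoc[symmetric] trilI lin_mult_left lin_mult_right sl lin_antipode lin_id antipode_lin) auto
  also have "\<dots> = sw K (\<lambda>x c. \<epsilon> x \<bullet> spow i c) h"
  proof (rule sw_cong[OF vs_K h])
    fix x c assume x: "x \<in> carrier K" "c \<in> carrier K"
    show "sw K (\<lambda>a b. (a \<cdot> S b) \<cdot> spow i c) x = \<epsilon> x \<bullet> spow i c"
      using x sw_antipode_right[OF vs_K lin_mult_left[OF alg_K lin_id, of "spow i c"], of x] by simp
  qed auto
  also have "\<dots> = spow i h" by (rule sw_counit_left[OF vs_K spow_lin h])
  finally show "sw K (\<lambda>a b. a \<cdot> spow (Suc i) b) h = spow i h" .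
  have "sw K (\<lambda>a b. a \<cdot> spow 0 b) h = sw K (\<lambda>a b. \<epsilon> b \<bullet> a) h"
    using h by (intro sw_cong) (auto simp: alg_smult)
  then show "sw K (\<lambda>a b. a \<cdot> spow 0 b) h = h" using sw_counit_right[OF vs_K lin_id h] by simp
qed

text \<open>
  The antipode reverses products, so \<open>spow i h = \<Sum> S (h\<^sub>i \<cdots> h\<^sub>1)\<close>, and \<open>spow 0 h\<close> is a scalar,
  which the antipode fixes.
\<close>

lemma spow_in_image:
  assumes h: "h \<in> carrier K"
  shows "spow i h \<in> S ` carrier K"
proof -
  have "\<exists>f\<in>lin_hom R K K. \<forall>h\<in>carrier K. spow i h = S (f h)"
  proof (induction i)
    case 0
    show ?case
      by (rule bexI[of _ "spow 0"]) (use spow_lin[of 0] lin_scale[OF antipode_lin] in auto)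
  next
    case (Suc i)
    then obtain f where f: "f \<in> lin_hom R K K" "\<And>h. h \<in> carrier K \<Longrightarrow> spow i h = S (f h)" by blast
    let ?g = "\<lambda>h. sw K (\<lambda>a b. f b \<cdot> a) h"
    have fc: "f h \<in> carrier K" if "h \<in> carrier K" for h using lin_closed[OF f(1) that] .
    show ?case
    proof (rule bexI[of _ ?g], rule ballI)
      fix h assume h: "h \<in> carrier K"
      have "S (?g h) = sw K (\<lambda>a b. S (f b \<cdot> a)) h"
        using h fc by (intro sw_push[OF antipode_lin]) auto
      also have "\<dots> = spow (Suc i) h"
        unfolding spow.simps using h fc f by (intro sw_cong) (auto simp: antipode_mult)
      finally show "spow (Suc i) h = S (?g h)" ..
    next
      show "?g \<in> lin_hom R K K"
        by (intro lin_sw_arg bilI lin_mult_left lin_mult_right f(1) lin_id fc) auto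
    qed
  qed
  then show ?thesis using h lin_closed by fastforce
qed

lemma antipode_image_closed:
  assumes "x \<in> S ` carrier K" "y \<in> S ` carrier K" "a \<in> carrier R"
  shows "x \<oplus>\<^bsub>K\<^esub> y \<in> S ` carrier K" "a \<bullet> x \<in> S ` carrier K"
  using assms by (auto simp: lin_plus[OF antipode_lin, symmetric] lin_scale[OF antipode_lin, symmetric])

text \<open>
  A relation \<open>\<Sum> d i \<bullet> spow i = 0\<close> convolved with the identity becomes \<open>d 0 \<bullet> id + \<Sum> d (i + 1) \<bullet>
  spow i = 0\<close>. If \<open>d 0\<close> is nonzero, this expresses every \<open>h\<close> through elements of the image;
  otherwise it is a shorter relation.
\<close>

lemma antipode_surj_if_dependent:
  assumes "\<And>i. i < n \<Longrightarrow> d i \<in> carrier R" "\<exists>i<n. d i \<noteq> \<zero>"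
    and "\<And>h. h \<in> carrier K \<Longrightarrow> finsum K (\<lambda>i. d i \<bullet> spow i h) {..<n} = \<zero>\<^bsub>K\<^esub>"
    and h: "h \<in> carrier K"
  shows "h \<in> S ` carrier K"
  using assms
proof (induction n arbitrary: d)
  case 0
  then show ?case by simp
next
  case (Suc n)
  let ?D = "\<lambda>i. d (Suc i)"
  have d: "i < Suc n \<Longrightarrow> d i \<in> carrier R" for i using Suc by auto
  let ?y = "\<lambda>h. finsum K (\<lambda>i. ?D i \<bullet> spow i h) {..<n}"
  have main: "d 0 \<bullet> h \<oplus>\<^bsub>K\<^esub> ?y h = \<zero>\<^bsub>K\<^esub>" if h: "h \<in> carrier K" for h
  proof -
    let ?c = "\<lambda>i. sw K (\<lambda>a b. a \<cdot> spow i b) h"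
    have tm: "sw K (\<lambda>a b. a \<cdot> (d i \<bullet> spow i b)) h = d i \<bullet> ?c i" if "i < Suc n" for i
    proof -
      have "sw K (\<lambda>a b. a \<cdot> (d i \<bullet> spow i b)) h = sw K (\<lambda>a b. d i \<bullet> (a \<cdot> spow i b)) h"
        using h d[OF that] spow_closed by (intro sw_cong) (auto simp: alg_smult simp del: spow.simps)
      also have "\<dots> = d i \<bullet> ?c i"
        using h d[OF that] spow_closed by (intro sw_push[of "\<lambda>z. d i \<bullet> z" K K, symmetric] lins) auto
      finally show ?thesis .
    qed
    have "\<zero>\<^bsub>K\<^esub> = \<zero> \<bullet> sw K (\<lambda>a b. b) h" using h by simp
    also have "\<dots> = sw K (\<lambda>a b. \<zero> \<bullet> b) h"
      using h by (intro sw_push[of "\<lambda>z. \<zero> \<bullet> z" K K] lins) auto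
    also have "\<dots> = sw K (\<lambda>a b. a \<cdot> finsum K (\<lambda>i. d i \<bullet> spow i b) {..<Suc n}) h"
      using h Suc.prems(3)
      by (intro sw_cong) (auto simp: lin_zero[OF vs_K vs_K lin_mult_right[OF alg_K lin_id]] simp del: spow.simps)
    also have "\<dots> = sw K (\<lambda>a b. finsum K (\<lambda>i. a \<cdot> (d i \<bullet> spow i b)) {..<Suc n}) h"
      using h d spow_closed
      by (intro sw_cong lin_finsum[OF vs_K vs_K lin_mult_right[OF alg_K lin_id]] vs_finsum_closed)
        (auto simp del: spow.simps)
    also have "\<dots> = finsum K (\<lambda>i. sw K (\<lambda>a b. a \<cdot> (d i \<bullet> spow i b)) h) {..<Suc n}"
      using h d spow_closed by (intro tlift_finsum[of K K]) (auto simp del: spow.simps)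
    also have "\<dots> = finsum K (\<lambda>i. d i \<bullet> ?c i) {..<Suc n}"
      using h d spow_closed tm by (intro vs_finsum_cong) (auto simp del: spow.simps)
    also have "{..<Suc n} = insert 0 (Suc ` {..<n})" by (rule lessThan_Suc_eq_insert_0)
    also have "finsum K (\<lambda>i. d i \<bullet> ?c i) (insert 0 (Suc ` {..<n})) =
        d 0 \<bullet> ?c 0 \<oplus>\<^bsub>K\<^esub> finsum K (\<lambda>i. d i \<bullet> ?c i) (Suc ` {..<n})"
      using h d spow_closed by (intro vs_finsum_insert) (auto simp del: spow.simps)
    also have "finsum K (\<lambda>i. d i \<bullet> ?c i) (Suc ` {..<n}) = finsum K (\<lambda>i. ?D i \<bullet> ?c (Suc i)) {..<n}"
      using h d spow_closed
      by (intro abelian_monoid.finsum_reindex[OF vs_abelian_monoid[OF vs_K]]) (auto simp del: spow.simps)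
    also have "\<dots> = ?y h"
      using h d spow_closed by (intro vs_finsum_cong) (auto simp: conv_id_spow(1) simp del: spow.simps)
    finally show ?thesis using conv_id_spow(2)[OF h] by simp
  qed
  have cl: "?y h \<in> carrier K" if "h \<in> carrier K" for h
    using that d by (intro vs_finsum_closed vs_smult_closed spow_closed vs_K) auto
  show ?case
  proof (cases "d 0 = \<zero>")
    case True
    show ?thesis
    proof (rule Suc.IH[of ?D])
      show "\<exists>i<n. ?D i \<noteq> \<zero>" using Suc.prems(2) True by (metis Suc_less_eq not0_implies_Suc)
      show "?y h = \<zero>\<^bsub>K\<^esub>" if "h \<in> carrier K" for h
        using main[OF that] cl[OF that] True that by (simp del: spow.simps)
    qed (use d h in auto)
  next
    case False
    interpret K: module R K by simp
    have S0: "\<zero>\<^bsub>K\<^esub> \<in> S ` carrier K"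
      using lin_zero[OF vs_K vs_K antipode_lin] by (metis imageI vs_zero_closed vs_K)
    have "finsum K (\<lambda>i. ?D i \<bullet> spow i h) I \<in> S ` carrier K" if "finite I" "I \<subseteq> {..<n}" for I
      using that
    proof (induction I)
      case empty
      then show ?case using S0 by simp
    next
      case (insert i I)
      have "finsum K (\<lambda>i. ?D i \<bullet> spow i h) (insert i I) = ?D i \<bullet> spow i h \<oplus>\<^bsub>K\<^esub> finsum K (\<lambda>i. ?D i \<bullet> spow i h) I"
        using insert d h by (intro vs_finsum_insert) (auto simp del: spow.simps)
      then show ?case using insert d h spow_in_image[OF h, of i]
        by (auto intro!: antipode_image_closed simp del: spow.simps)
    qed
    then have y: "?y h \<in> S ` carrier K" by blast
    have "d 0 \<bullet> h = \<ominus>\<^bsub>K\<^esub> ?y h"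
      using main[OF h] cl[OF h] d[of 0] h K.M.minus_equality[of "d 0 \<bullet> h" "?y h"] by (simp del: spow.simps)
    also have "\<dots> = (\<ominus> \<one>) \<bullet> ?y h" using cl[OF h] by (simp add: K.smult_l_minus del: spow.simps)
    finally have "inv (d 0) \<bullet> (d 0 \<bullet> h) = inv (d 0) \<bullet> ((\<ominus> \<one>) \<bullet> ?y h)" by simp
    moreover have "inv (d 0) \<bullet> (d 0 \<bullet> h) = h"
      using False d[of 0] h field_Units by (simp add: vs_smult_smult)
    moreover have "inv (d 0) \<bullet> ((\<ominus> \<one>) \<bullet> ?y h) \<in> S ` carrier K"
      using False d[of 0] y field_Units by (intro antipode_image_closed) auto
    ultimately show ?thesis by simp
  qed
qed

end

context fd_hopf begin

text \<open>
  The matrix of an endomorphism has \<open>card (basis \<times> basis)\<close> entries, so one more convolution power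
  than that gives a nontrivial relation.
\<close>

theorem antipode_surj: "S ` carrier K = carrier K"
proof
  show "S ` carrier K \<subseteq> carrier K" by auto
  let ?E = "basis \<times> basis"
  let ?n = "Suc (card ?E)"
  have "\<exists>c. (\<forall>i\<in>{..<?n}. c i \<in> carrier R) \<and> (\<exists>i\<in>{..<?n}. c i \<noteq> \<zero>) \<and>
      (\<forall>e\<in>?E. (\<Oplus>i\<in>{..<?n}. c i \<otimes> coord (snd e) (spow i (fst e))) = \<zero>)"
    by (rule underdetermined_system) (auto simp del: spow.simps)
  then obtain c where c: "\<And>i. i < ?n \<Longrightarrow> c i \<in> carrier R" "\<exists>i<?n. c i \<noteq> \<zero>"
    "\<And>b b'. b \<in> basis \<Longrightarrow> b' \<in> basis \<Longrightarrow> (\<Oplus>i\<in>{..<?n}. c i \<otimes> coord b' (spow i b)) = \<zero>"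
    by auto
  let ?f = "\<lambda>h. finsum K (\<lambda>i. c i \<bullet> spow i h) {..<?n}"
  have f: "?f \<in> lin_hom R K K" using c(1) by (intro lin_finsum_fun lins spow_lin) auto
  have gs: "finsum (ground R) = finsum R" by (intro ext) (simp add: finsum_def finprod_def ground_def)
  have fb: "?f b = \<zero>\<^bsub>K\<^esub>" if b: "b \<in> basis" for b
  proof (rule coords_eqI[OF coords_K])
    fix b' assume b': "b' \<in> basis"
    have "coord b' (?f b) = finsum (ground R) (\<lambda>i. coord b' (c i \<bullet> spow i b)) {..<?n}"
      using b b' c(1) by (intro lin_finsum dual_lin) (auto simp del: spow.simps)
    also have "\<dots> = finsum (ground R) (\<lambda>i. c i \<otimes> coord b' (spow i b)) {..<?n}"
      using b b' c(1) by (intro vs_finsum_cong) (auto simp: lin_scale[OF dual_lin] simp del: spow.simps)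
    also have "\<dots> = \<zero>" unfolding gs by (rule c(3)[OF b b'])
    finally show "coord b' (?f b) = coord b' \<zero>\<^bsub>K\<^esub>"
      using lin_zero[OF vs_K vs_ground dual_lin[OF basis(3)[OF b']]] by simp
  qed (use b lin_closed[OF f] in auto)
  have f0: "?f h = \<zero>\<^bsub>K\<^esub>" if h: "h \<in> carrier K" for h
  proof -
    have "?f h = finsum K (\<lambda>b. coord b h \<bullet> ?f b) basis" using lin_basis_expand[OF vs_K f h] by simp
    also have "\<dots> = finsum K (\<lambda>b. \<zero>\<^bsub>K\<^esub>) basis" using fb h by (intro vs_finsum_cong) auto
    finally show ?thesis by (simp add: vs_finsum_zero)
  qed
  show "carrier K \<subseteq> S ` carrier K"
  proof
    fix h assume h: "h \<in> carrier K"
    show "h \<in> S ` carrier K"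
      by (rule antipode_surj_if_dependent[of ?n c h]) (fact c(1), fact c(2), fact f0, fact h)
  qed
qed

text \<open>
  The antipode of the dual is the transpose of \<open>S\<close>. Since it is onto, functionals that factor
  through \<open>S\<close> separate the points of \<open>K\<close>.
\<close>

theorem antipode_inj: "inj_on S (carrier K)"
proof (rule inj_onI)
  fix x y assume xy: "x \<in> carrier K" "y \<in> carrier K" and e: "S x = S y"
  interpret D: fd_hopf R L by (rule dual_fd_hopf)
  show "x = y"
  proof (rule K_eqI[OF xy])
    fix \<theta> assume "\<theta> \<in> carrier L"
    then obtain \<phi> where "\<phi> \<in> carrier L" "\<theta> = antipode L \<phi>" using D.antipode_surj by blast
    then have "\<theta> x = \<phi> (S x)" "\<theta> y = \<phi> (S y)" using xy by simp_all
    then show "\<theta> x = \<theta> y" unfolding e by simp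
  qed
qed

end

section \<open>Maps between tensor products\<close>

context field begin

lemma lin_hom_id: "id \<in> lin_hom R V V"
  using lin_id[of V] by (simp add: id_def)

lemma tmap_comp:
  assumes V: "vs V" and W: "vs W" and V': "vs V'" and W': "vs W'" and V'': "vs V''" and W'': "vs W''"
    and f: "f \<in> lin_hom R V V'" and g: "g \<in> lin_hom R W W'"
    and f': "f' \<in> lin_hom R V' V''" and g': "g' \<in> lin_hom R W' W''"
    and t: "t \<in> carrier (T V W)"
  shows "tmap R V'' W'' f' g' (tmap R V' W' f g t) = tmap R V'' W'' (\<lambda>v. f' (f v)) (\<lambda>w. g' (g w)) t"
proof -
  note b = bil_tmap[OF V'' W'' f' g']
  show ?thesis
    unfolding tmap_def[of R V'' W'']
    by (rule tlift_tmap[OF V W V' W' vs_tensor[OF V'' W''] f g b t])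
qed

lemma tmap_cong:
  assumes V: "vs V" and W: "vs W" and V': "vs V'" and W': "vs W'"
    and f: "f \<in> lin_hom R V V'" and g: "g \<in> lin_hom R W W'"
    and eq: "\<And>v. v \<in> carrier V \<Longrightarrow> f' v = f v" "\<And>w. w \<in> carrier W \<Longrightarrow> g' w = g w"
    and t: "t \<in> carrier (T V W)"
  shows "tmap R V' W' f' g' t = tmap R V' W' f g t"
  unfolding tmap_def using assms
  by (intro tlift_cong[OF V W vs_tensor[OF V' W'] t]) (auto simp: lin_closed)

lemma tmap_id_id: "vs V \<Longrightarrow> vs W \<Longrightarrow> t \<in> carrier (T V W) \<Longrightarrow> tmap R V W (\<lambda>v. v) (\<lambda>w. w) t = t"
  unfolding tmap_def by (rule tlift_eta)

lemma slice_tmap: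
  assumes V: "vs V" and W: "vs W" and W': "vs W'" and g: "g \<in> lin_hom R W W'"
    and c: "c \<in> lin_hom R W' (ground R)" and t: "t \<in> carrier (T V W)"
  shows "slice V c (tmap R V W' id g t) = slice V (\<lambda>w. c (g w)) t"
  unfolding slice_def
  using tlift_tmap[OF V W V W' V lin_hom_id g slice_bil[OF V W' c] t] by simp

lemma slice_assoc:
  assumes U: "vs U" and V: "vs V" and W: "vs W" and c: "c \<in> lin_hom R (T V W) (ground R)"
    and t: "t \<in> carrier (T (T U V) W)"
  shows "slice U c (tassoc R U V W t) =
    tlift R U (\<lambda>s w. tlift R U (\<lambda>u v. c (ts V W v w) \<odot>\<^bsub>U\<^esub> u) s) t"
proof -
  have ta: "tassoc R U V W t \<in> carrier (T U (T V W))" using lin_closed[OF tassoc_lin[OF U V W] t] .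
  have cl: "c (ts V W v w) \<in> carrier R" if "v \<in> carrier V" "w \<in> carrier W" for v w
    using lin_closed[OF c] that V W by simp
  have "slice U c (tassoc R U V W t) =
      tlift R U (\<lambda>u s. tlift R U (\<lambda>v w. c (ts V W v w) \<odot>\<^bsub>U\<^esub> u) s) (tassoc R U V W t)"
    unfolding slice_def
  proof (rule tlift_cong[OF U vs_tensor[OF V W] U ta])
    fix u s assume u: "u \<in> carrier U" and s: "s \<in> carrier (T V W)"
    show "c s \<odot>\<^bsub>U\<^esub> u = tlift R U (\<lambda>v w. c (ts V W v w) \<odot>\<^bsub>U\<^esub> u) s"
      by (rule lin_eta[OF V W U lin_scalar[OF U u c] s])
    show "tlift R U (\<lambda>v w. c (ts V W v w) \<odot>\<^bsub>U\<^esub> u) s \<in> carrier U"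
      using u cl U by (intro tlift_closed[OF V W U s]) auto
  qed
  also have "\<dots> = tlift R U (\<lambda>s w. tlift R U (\<lambda>u v. c (ts V W v w) \<odot>\<^bsub>U\<^esub> u) s) t"
  proof (rule tlift_tassoc[OF U V W U _ t])
    show "tril U V W U (\<lambda>u v w. c (ts V W v w) \<odot>\<^bsub>U\<^esub> u)"
      using U V W cl by (intro trilI lin_smult_const lin_scalar lin_comp[OF c] lin_tens_left lin_tens_right lin_id) auto
  qed
  finally show ?thesis .
qed

lemma m_inv_eqI: "alg A \<Longrightarrow> x \<in> carrier A \<Longrightarrow> y \<in> carrier A \<Longrightarrow> x \<otimes>\<^bsub>A\<^esub> y = \<one>\<^bsub>A\<^esub> \<Longrightarrow> y \<otimes>\<^bsub>A\<^esub> x = \<one>\<^bsub>A\<^esub> \<Longrightarrow>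
    inv\<^bsub>A\<^esub> x = y"
  using monoid.inv_char[of A x y] alg_ring[of A] by (simp add: ring_def)

text \<open>The inverse of conjugation by \<open>u\<close> is conjugation by its inverse \<open>v\<close>.\<close>

lemma inv_Ad:
  assumes A: "alg A" and u: "u \<in> carrier A" and v: "v \<in> carrier A"
    and uv: "u \<otimes>\<^bsub>A\<^esub> v = \<one>\<^bsub>A\<^esub>" "v \<otimes>\<^bsub>A\<^esub> u = \<one>\<^bsub>A\<^esub>" and z: "z \<in> carrier A"
  shows "inv_into (carrier A) (Ad A u) z = v \<otimes>\<^bsub>A\<^esub> z \<otimes>\<^bsub>A\<^esub> u"
proof -
  have Ad: "Ad A u x = u \<otimes>\<^bsub>A\<^esub> x \<otimes>\<^bsub>A\<^esub> v" for x by (simp add: Ad_def m_inv_eqI[OF A u v uv])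
  have 1: "v \<otimes>\<^bsub>A\<^esub> (u \<otimes>\<^bsub>A\<^esub> x \<otimes>\<^bsub>A\<^esub> v) \<otimes>\<^bsub>A\<^esub> u = x" if x: "x \<in> carrier A" for x
  proof -
    have "v \<otimes>\<^bsub>A\<^esub> (u \<otimes>\<^bsub>A\<^esub> x \<otimes>\<^bsub>A\<^esub> v) \<otimes>\<^bsub>A\<^esub> u = (v \<otimes>\<^bsub>A\<^esub> u) \<otimes>\<^bsub>A\<^esub> x \<otimes>\<^bsub>A\<^esub> (v \<otimes>\<^bsub>A\<^esub> u)"
      using A u v x by (simp add: alg_assoc del: alg_one)
    then show ?thesis using A x uv by simp
  qed
  have 2: "u \<otimes>\<^bsub>A\<^esub> (v \<otimes>\<^bsub>A\<^esub> x \<otimes>\<^bsub>A\<^esub> u) \<otimes>\<^bsub>A\<^esub> v = x" if x: "x \<in> carrier A" for x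
  proof -
    have "u \<otimes>\<^bsub>A\<^esub> (v \<otimes>\<^bsub>A\<^esub> x \<otimes>\<^bsub>A\<^esub> u) \<otimes>\<^bsub>A\<^esub> v = (u \<otimes>\<^bsub>A\<^esub> v) \<otimes>\<^bsub>A\<^esub> x \<otimes>\<^bsub>A\<^esub> (u \<otimes>\<^bsub>A\<^esub> v)"
      using A u v x by (simp add: alg_assoc del: alg_one)
    then show ?thesis using A x uv by simp
  qed
  have "inj_on (Ad A u) (carrier A)"
    by (rule inj_on_inverseI[of _ "\<lambda>y. v \<otimes>\<^bsub>A\<^esub> y \<otimes>\<^bsub>A\<^esub> u"]) (simp add: Ad 1)
  then have "inv_into (carrier A) (Ad A u) (Ad A u (v \<otimes>\<^bsub>A\<^esub> z \<otimes>\<^bsub>A\<^esub> u)) = v \<otimes>\<^bsub>A\<^esub> z \<otimes>\<^bsub>A\<^esub> u"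
    using A u v z by (intro inv_into_f_f) auto
  then show ?thesis by (simp add: Ad 2 z)
qed

end

section \<open>The Yetter--Drinfeld equation\<close>

context hopf_over begin

text \<open>
  The elements of \<open>K\<close> obtained from \<open>U (a \<otimes> \<phi>)\<close> and \<open>(a \<otimes> \<phi>) U\<close> by evaluating the second factor at
  \<open>k\<close>, where \<open>U\<close> is the canonical element and the products are those of \<open>K\<^sup>o\<^sup>p \<otimes> L\<close>
  (\<open>elt_mult_tens\<close>).
\<close>

definition left_U where "left_U a \<phi> k = sw K (\<lambda>x z. \<phi> z \<bullet> (a \<cdot> x)) k"
definition right_U where "right_U a \<phi> k = sw K (\<lambda>x z. \<phi> x \<bullet> (z \<cdot> a)) k"

text \<open>
  The Yetter--Drinfeld equation, multiplied by \<open>U\<close> and sliced with \<open>\<theta> \<otimes> k\<close> (\<open>yd_equation_iff\<close>).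
\<close>

definition yd_cond where
  "yd_cond Y \<alpha> \<beta> \<longleftrightarrow> (\<forall>y\<in>carrier Y. \<forall>\<theta>\<in>carrier L. \<forall>k\<in>carrier K.
     tlift R Y (\<lambda>v \<phi>. tlift R Y (\<lambda>u a. \<theta> (left_U a \<phi> k) \<odot>\<^bsub>Y\<^esub> u) (\<alpha> v)) (\<beta> y) =
     tlift R Y (\<lambda>v a. tlift R Y (\<lambda>u \<phi>. \<theta> (right_U a \<phi> k) \<odot>\<^bsub>Y\<^esub> u) (\<beta> v)) (\<alpha> y))"

lemma left_U_closed [simp]: "a \<in> carrier K \<Longrightarrow> \<phi> \<in> carrier L \<Longrightarrow> k \<in> carrier K \<Longrightarrow> left_U a \<phi> k \<in> carrier K"
  and right_U_closed [simp]: "a \<in> carrier K \<Longrightarrow> \<phi> \<in> carrier L \<Longrightarrow> k \<in> carrier K \<Longrightarrow> right_U a \<phi> k \<in> carrier K"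
  by (auto simp: left_U_def right_U_def)

end

context fd_hopf begin

abbreviation A where "A \<equiv> T (hopf_op K) L"

lemma lin_part_A: "lin_part A = lin_part (T K L)"
  by (intro tensor_lin_part lin_part_op refl)

lemma A_simps [simp]: "carrier A = carrier (T K L)" "ts (hopf_op K) L = ts K L" "vs A" "alg A"
  using lin_part_A tens_lin_part[OF lin_part_op(2) refl, of R K L] by (simp_all add: lin_part_def)

lemma lin_A: "lin_hom R A Z = lin_hom R (T K L) Z" "lin_hom R Z A = lin_hom R Z (T K L)"
  by (rule lin_hom_lin_part; simp add: lin_part_A)+

text \<open>
  The isomorphism from the linear endomorphisms of \<open>K\<close> to \<open>K\<^sup>o\<^sup>p \<otimes> L\<close>. The identity is sent to the
  canonical element, and products correspond to convolutions with reversed factors (\<open>elt_mult\<close>).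
\<close>

definition elt where "elt g = finsum A (\<lambda>b. ts K L (g b) (coord b)) basis"

lemma elt_closed [simp]: "g \<in> lin_hom R K K \<Longrightarrow> elt g \<in> carrier (T K L)"
  using vs_finsum_closed[OF A_simps(3), of basis "\<lambda>b. ts K L (g b) (coord b)"] lin_closed[of g K K]
  by (simp add: elt_def)

lemma canonical_element_elt: "canonical_element R K = elt (\<lambda>k. k)"
  unfolding elt_def canonical_element_def basis_def coord_def Let_def case_prod_unfold A_simps ..

abbreviation sl where "sl k \<equiv> slice K (\<lambda>\<phi>. \<phi> k)"

lemma sl_lin: "k \<in> carrier K \<Longrightarrow> sl k \<in> lin_hom R (T K L) K"
  by (intro slice_lin lin_ev) auto

lemma sl_tens: "k \<in> carrier K \<Longrightarrow> a \<in> carrier K \<Longrightarrow> \<phi> \<in> carrier L \<Longrightarrow> sl k (ts K L a \<phi>) = \<phi> k \<bullet> a"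
  unfolding slice_def by (simp add: tlift_tens slice_bil lin_ev)

lemma sl_eqI:
  assumes "s \<in> carrier (T K L)" "t \<in> carrier (T K L)" "\<And>k. k \<in> carrier K \<Longrightarrow> sl k s = sl k t"
  shows "s = t"
  by (rule tensor_eqI[OF vs_K vs_L coords_L]) (use assms in auto)

lemma fprod_sl:
  assumes "k \<in> carrier K" "\<theta> \<in> carrier L" "t \<in> carrier (T K L)"
  shows "fprod \<theta> (\<lambda>\<phi>. \<phi> k) t = \<theta> (sl k t)"
proof (rule lin_eq_on_tens[OF vs_K vs_L assms(3) vs_ground])
  show "fprod \<theta> (\<lambda>\<phi>. \<phi> k) \<in> lin_hom R (T K L) (ground R)"
    using assms by (intro fprod_lin lin_ev dual_lin) auto
  show "(\<lambda>t. \<theta> (sl k t)) \<in> lin_hom R (T K L) (ground R)"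
    using assms by (intro lin_dual sl_lin)
qed (use assms in \<open>auto simp: fprod_tens lin_ev dual_lin sl_tens lin_scale[OF dual_lin] m_comm\<close>)

text \<open>
  Summing over the dual bases substitutes \<open>f\<close> for the functional \<open>coord b\<close>. The maps \<open>q\<close> and \<open>r\<close>
  tell which leg of the coproduct each functional receives.
\<close>

lemma basis_sum_sw:
  assumes Z: "vs Z" and k: "k \<in> carrier K" and f: "f \<in> lin_hom R K Z" and p: "\<phi> \<in> carrier L"
    and q: "\<And>x z. x \<in> carrier K \<Longrightarrow> z \<in> carrier K \<Longrightarrow> q x z \<in> carrier K \<and> r x z \<in> carrier K"
  shows "finsum Z (\<lambda>b. sw (ground R) (\<lambda>x z. coord b (q x z) \<otimes> \<phi> (r x z)) k \<odot>\<^bsub>Z\<^esub> f b) basis =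
    sw Z (\<lambda>x z. \<phi> (r x z) \<odot>\<^bsub>Z\<^esub> f (q x z)) k"
proof -
  have fc: "f x \<in> carrier Z" if "x \<in> carrier K" for x using lin_closed[OF f that] .
  have "finsum Z (\<lambda>b. sw (ground R) (\<lambda>x z. coord b (q x z) \<otimes> \<phi> (r x z)) k \<odot>\<^bsub>Z\<^esub> f b) basis =
      finsum Z (\<lambda>b. sw Z (\<lambda>x z. (coord b (q x z) \<otimes> \<phi> (r x z)) \<odot>\<^bsub>Z\<^esub> f b) k) basis"
    using Z k p fc q
    by (intro vs_finsum_cong[OF Z refl])
      (auto intro!: sw_push[of "\<lambda>r. r \<odot>\<^bsub>Z\<^esub> f _" "ground R" Z] lin_scalar lin_id)
  also have "\<dots> = sw Z (\<lambda>x z. finsum Z (\<lambda>b. (coord b (q x z) \<otimes> \<phi> (r x z)) \<odot>\<^bsub>Z\<^esub> f b) basis) k"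
    using Z k p fc q by (intro tlift_finsum[symmetric, of K K]) auto
  also have "\<dots> = sw Z (\<lambda>x z. \<phi> (r x z) \<odot>\<^bsub>Z\<^esub> f (q x z)) k"
  proof (rule sw_cong[OF Z k])
    fix x z assume x: "x \<in> carrier K" "z \<in> carrier K"
    have "finsum Z (\<lambda>b. (coord b (q x z) \<otimes> \<phi> (r x z)) \<odot>\<^bsub>Z\<^esub> f b) basis =
        \<phi> (r x z) \<odot>\<^bsub>Z\<^esub> finsum Z (\<lambda>b. coord b (q x z) \<odot>\<^bsub>Z\<^esub> f b) basis"
      using Z p fc x q by (subst vs_finsum_smult) (auto simp: vs_smult_smult m_comm intro!: vs_finsum_cong)
    then show "finsum Z (\<lambda>b. (coord b (q x z) \<otimes> \<phi> (r x z)) \<odot>\<^bsub>Z\<^esub> f b) basis = \<phi> (r x z) \<odot>\<^bsub>Z\<^esub> f (q x z)"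
      using lin_basis_expand[OF Z f] q[OF x] by simp
  qed (use p fc q Z in auto)
  finally show ?thesis .
qed

lemma basis_sum_mult:
  assumes Z: "vs Z" and k: "k \<in> carrier K" and f: "f \<in> lin_hom R K Z" and p: "\<phi> \<in> carrier L"
  shows "finsum Z (\<lambda>b. (coord b \<star> \<phi>) k \<odot>\<^bsub>Z\<^esub> f b) basis = sw Z (\<lambda>x z. \<phi> z \<odot>\<^bsub>Z\<^esub> f x) k"
    and "finsum Z (\<lambda>b. (\<phi> \<star> coord b) k \<odot>\<^bsub>Z\<^esub> f b) basis = sw Z (\<lambda>x z. \<phi> x \<odot>\<^bsub>Z\<^esub> f z) k"
proof -
  show "finsum Z (\<lambda>b. (coord b \<star> \<phi>) k \<odot>\<^bsub>Z\<^esub> f b) basis = sw Z (\<lambda>x z. \<phi> z \<odot>\<^bsub>Z\<^esub> f x) k"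
    unfolding dual_apply(5)[OF k] by (intro basis_sum_sw Z k f p conjI)
  have "(\<phi> \<star> coord b) k = sw (ground R) (\<lambda>x z. coord b z \<otimes> \<phi> x) k" if "b \<in> basis" for b
    unfolding dual_apply(5)[OF k] using k p that by (intro sw_cong) (auto simp: m_comm)
  then have "finsum Z (\<lambda>b. (\<phi> \<star> coord b) k \<odot>\<^bsub>Z\<^esub> f b) basis =
      finsum Z (\<lambda>b. sw (ground R) (\<lambda>x z. coord b z \<otimes> \<phi> x) k \<odot>\<^bsub>Z\<^esub> f b) basis"
    using Z k p lin_closed[OF f] by (intro vs_finsum_cong) auto
  also have "\<dots> = sw Z (\<lambda>x z. \<phi> x \<odot>\<^bsub>Z\<^esub> f z) k" by (intro basis_sum_sw Z k f p conjI)
  finally show "finsum Z (\<lambda>b. (\<phi> \<star> coord b) k \<odot>\<^bsub>Z\<^esub> f b) basis = sw Z (\<lambda>x z. \<phi> x \<odot>\<^bsub>Z\<^esub> f z) k" .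
qed

lemma A_mult_tens:
  assumes "a \<in> carrier K" "\<phi> \<in> carrier L" "a' \<in> carrier K" "\<phi>' \<in> carrier L"
  shows "ts K L a \<phi> \<otimes>\<^bsub>A\<^esub> ts K L a' \<phi>' = ts K L (a' \<cdot> a) (\<phi> \<star> \<phi>')"
  using tensor_mult_tens[OF alg_hopf_op[OF alg_K] alg_L, of a \<phi> a' \<phi>'] assms by simp

lemma A_mult_lin:
  assumes "c \<in> carrier (T K L)"
  shows "(\<lambda>z. z \<otimes>\<^bsub>A\<^esub> c) \<in> lin_hom R (T K L) (T K L)" "(\<lambda>z. c \<otimes>\<^bsub>A\<^esub> z) \<in> lin_hom R (T K L) (T K L)"
  using bil_left[OF alg_bil[OF A_simps(4)], of c] bil_right[OF alg_bil[OF A_simps(4)], of c] assms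
  unfolding lin_A by simp_all

lemma A_mult_closed [simp]:
  "x \<in> carrier (T K L) \<Longrightarrow> y \<in> carrier (T K L) \<Longrightarrow> x \<otimes>\<^bsub>A\<^esub> y \<in> carrier (T K L)"
  using alg_closed(1)[OF A_simps(4), of x y] by simp

lemma elt_mult_tens:
  assumes g: "g \<in> lin_hom R K K" and k: "k \<in> carrier K" and a: "a \<in> carrier K" and p: "\<phi> \<in> carrier L"
  shows "sl k (elt g \<otimes>\<^bsub>A\<^esub> ts K L a \<phi>) = sw K (\<lambda>x z. \<phi> z \<bullet> (a \<cdot> g x)) k"
    and "sl k (ts K L a \<phi> \<otimes>\<^bsub>A\<^esub> elt g) = sw K (\<lambda>x z. \<phi> x \<bullet> (g z \<cdot> a)) k"
proof -
  have gc: "g x \<in> carrier K" if "x \<in> carrier K" for x using lin_closed[OF g that] .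
  have t: "ts K L a \<phi> \<in> carrier (T K L)" using a p by simp
  have fA: "finsum A = finsum (T K L)" by (rule finsum_lin_part[OF lin_part_A])
  have "sl k (elt g \<otimes>\<^bsub>A\<^esub> ts K L a \<phi>) =
      finsum K (\<lambda>b. sl k (ts K L (g b) (coord b) \<otimes>\<^bsub>A\<^esub> ts K L a \<phi>)) basis"
    unfolding elt_def fA using gc
    by (intro lin_finsum[OF vs_tensor[OF vs_K vs_L] vs_K lin_comp[OF sl_lin[OF k] A_mult_lin(1)[OF t]]]) auto
  also have "\<dots> = finsum K (\<lambda>b. (coord b \<star> \<phi>) k \<bullet> (a \<cdot> g b)) basis"
    using a p gc k by (intro vs_finsum_cong[OF vs_K refl])
      (simp_all add: A_mult_tens sl_tens del: dual_apply)
  also have "\<dots> = sw K (\<lambda>x z. \<phi> z \<bullet> (a \<cdot> g x)) k"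
    using a p k by (intro basis_sum_mult(1)[of K k "\<lambda>b. a \<cdot> g b"] lin_mult_right g) auto
  finally show "sl k (elt g \<otimes>\<^bsub>A\<^esub> ts K L a \<phi>) = sw K (\<lambda>x z. \<phi> z \<bullet> (a \<cdot> g x)) k" .
  have "sl k (ts K L a \<phi> \<otimes>\<^bsub>A\<^esub> elt g) =
      finsum K (\<lambda>b. sl k (ts K L a \<phi> \<otimes>\<^bsub>A\<^esub> ts K L (g b) (coord b))) basis"
    unfolding elt_def fA using gc
    by (intro lin_finsum[OF vs_tensor[OF vs_K vs_L] vs_K lin_comp[OF sl_lin[OF k] A_mult_lin(2)[OF t]]]) auto
  also have "\<dots> = finsum K (\<lambda>b. (\<phi> \<star> coord b) k \<bullet> (g b \<cdot> a)) basis"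
    using a p gc k by (intro vs_finsum_cong[OF vs_K refl])
      (simp_all add: A_mult_tens sl_tens del: dual_apply)
  also have "\<dots> = sw K (\<lambda>x z. \<phi> x \<bullet> (g z \<cdot> a)) k"
    using a p k by (intro basis_sum_mult(2)[of K k "\<lambda>b. g b \<cdot> a"] lin_mult_left g) auto
  finally show "sl k (ts K L a \<phi> \<otimes>\<^bsub>A\<^esub> elt g) = sw K (\<lambda>x z. \<phi> x \<bullet> (g z \<cdot> a)) k" .
qed

lemma elt_mult:
  assumes f: "f \<in> lin_hom R K K" and g: "g \<in> lin_hom R K K" and k: "k \<in> carrier K"
  shows "sl k (elt f \<otimes>\<^bsub>A\<^esub> elt g) = sw K (\<lambda>x z. g z \<cdot> f x) k"
proof -
  have gc: "g x \<in> carrier K" "f x \<in> carrier K" if "x \<in> carrier K" for x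
    using lin_closed[OF g that] lin_closed[OF f that] .
  have fA: "finsum A = finsum (T K L)" by (rule finsum_lin_part[OF lin_part_A])
  have "sl k (elt f \<otimes>\<^bsub>A\<^esub> elt g) = finsum K (\<lambda>b. sl k (elt f \<otimes>\<^bsub>A\<^esub> ts K L (g b) (coord b))) basis"
    unfolding elt_def[of g] fA using gc f
    by (intro lin_finsum[OF vs_tensor[OF vs_K vs_L] vs_K lin_comp[OF sl_lin[OF k] A_mult_lin(2)]]) auto
  also have "\<dots> = finsum K (\<lambda>b. sw K (\<lambda>x z. coord b z \<bullet> (g b \<cdot> f x)) k) basis"
    using gc k f by (intro vs_finsum_cong[OF vs_K refl]) (simp_all add: elt_mult_tens(1))
  also have "\<dots> = sw K (\<lambda>x z. finsum K (\<lambda>b. coord b z \<bullet> (g b \<cdot> f x)) basis) k"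
    using k gc by (intro tlift_finsum[symmetric, of K K]) auto
  also have "\<dots> = sw K (\<lambda>x z. g z \<cdot> f x) k"
    using gc by (intro sw_cong[OF vs_K k] lin_basis_expand[of K "\<lambda>b. g b \<cdot> f _"] lin_mult_left g) auto
  finally show ?thesis .
qed

definition Sinv where "Sinv = inv_into (carrier K) S"

lemma Sinv [simp]:
  "k \<in> carrier K \<Longrightarrow> Sinv k \<in> carrier K" "k \<in> carrier K \<Longrightarrow> S (Sinv k) = k"
  "k \<in> carrier K \<Longrightarrow> Sinv (S k) = k"
  unfolding Sinv_def
  using antipode_surj antipode_inj by (auto intro!: f_inv_into_f inv_into_into)

lemma Sinv_lin: "Sinv \<in> lin_hom R K K"
proof (rule lin_homI)
  show "Sinv (x \<oplus>\<^bsub>K\<^esub> y) = Sinv x \<oplus>\<^bsub>K\<^esub> Sinv y" if "x \<in> carrier K" "y \<in> carrier K" for x y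
    using that Sinv(3)[of "Sinv x \<oplus>\<^bsub>K\<^esub> Sinv y"] by (simp add: lin_plus[OF antipode_lin])
  show "Sinv (a \<bullet> x) = a \<bullet> Sinv x" if "a \<in> carrier R" "x \<in> carrier K" for a x
    using that Sinv(3)[of "a \<bullet> Sinv x"] by (simp add: lin_scale[OF antipode_lin])
qed simp

text \<open>
  The inverse of the antipode is an antipode for the opposite product: apply \<open>S\<close>, which is
  injective and reverses products.
\<close>

lemma sw_Sinv:
  assumes k: "k \<in> carrier K"
  shows "sw K (\<lambda>x z. Sinv z \<cdot> x) k = \<epsilon> k \<bullet> \<one>\<^bsub>K\<^esub>"
    "sw K (\<lambda>x z. z \<cdot> Sinv x) k = \<epsilon> k \<bullet> \<one>\<^bsub>K\<^esub>"
proof -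
  have S1: "S (\<epsilon> k \<bullet> \<one>\<^bsub>K\<^esub>) = \<epsilon> k \<bullet> \<one>\<^bsub>K\<^esub>"
    using k by (simp add: lin_scale[OF antipode_lin])
  have "S (sw K (\<lambda>x z. Sinv z \<cdot> x) k) = sw K (\<lambda>x z. S (Sinv z \<cdot> x)) k"
    using k by (intro sw_push[OF antipode_lin]) auto
  also have "\<dots> = sw K (\<lambda>x z. S x \<cdot> z) k"
    using k by (intro sw_cong) (auto simp: antipode_mult)
  also have "\<dots> = \<epsilon> k \<bullet> \<one>\<^bsub>K\<^esub>" using sw_antipode_left[OF vs_K lin_id k] by simp
  finally have e: "S (sw K (\<lambda>x z. Sinv z \<cdot> x) k) = S (\<epsilon> k \<bullet> \<one>\<^bsub>K\<^esub>)"
    unfolding S1 .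
  show "sw K (\<lambda>x z. Sinv z \<cdot> x) k = \<epsilon> k \<bullet> \<one>\<^bsub>K\<^esub>"
    by (rule inj_onD[OF antipode_inj e]) (use k in auto)
  have "S (sw K (\<lambda>x z. z \<cdot> Sinv x) k) = sw K (\<lambda>x z. S (z \<cdot> Sinv x)) k"
    using k by (intro sw_push[OF antipode_lin]) auto
  also have "\<dots> = sw K (\<lambda>x z. x \<cdot> S z) k"
    using k by (intro sw_cong) (auto simp: antipode_mult)
  also have "\<dots> = \<epsilon> k \<bullet> \<one>\<^bsub>K\<^esub>" using sw_antipode_right[OF vs_K lin_id k] by simp
  finally have e: "S (sw K (\<lambda>x z. z \<cdot> Sinv x) k) = S (\<epsilon> k \<bullet> \<one>\<^bsub>K\<^esub>)"
    unfolding S1 .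
  show "sw K (\<lambda>x z. z \<cdot> Sinv x) k = \<epsilon> k \<bullet> \<one>\<^bsub>K\<^esub>"
    by (rule inj_onD[OF antipode_inj e]) (use k in auto)
qed

abbreviation U where "U \<equiv> elt (\<lambda>k. k)"
abbreviation Ui where "Ui \<equiv> elt Sinv"

lemma U_closed: "U \<in> carrier (T K L)" "Ui \<in> carrier (T K L)"
  by (auto intro: elt_closed lin_id Sinv_lin)

lemma U_inverse: "U \<otimes>\<^bsub>A\<^esub> Ui = \<one>\<^bsub>A\<^esub>" "Ui \<otimes>\<^bsub>A\<^esub> U = \<one>\<^bsub>A\<^esub>"
proof -
  have one: "\<one>\<^bsub>A\<^esub> = ts K L \<one>\<^bsub>K\<^esub> \<one>\<^bsub>L\<^esub>" by (simp add: tensor_one)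
  have cl: "\<one>\<^bsub>A\<^esub> \<in> carrier (T K L)" unfolding one by simp
  show "U \<otimes>\<^bsub>A\<^esub> Ui = \<one>\<^bsub>A\<^esub>"
    by (rule sl_eqI[OF _ cl]) (simp_all add: U_closed elt_mult lin_id Sinv_lin sw_Sinv one sl_tens)
  show "Ui \<otimes>\<^bsub>A\<^esub> U = \<one>\<^bsub>A\<^esub>"
    by (rule sl_eqI[OF _ cl]) (simp_all add: U_closed elt_mult lin_id Sinv_lin sw_Sinv one sl_tens)
qed

text \<open>
  Since \<open>Ad U\<close> has the inverse \<open>z \<mapsto> U\<^sup>-\<^sup>1 z U\<close>, multiplication by \<open>U\<close> from the left turns the
  equation into one between \<open>U ((\<alpha> \<otimes> id) (\<beta> y))\<close> and \<open>((\<beta> \<otimes> id) (\<alpha> y)) U\<close>, up to a flip. The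
  functionals \<open>\<theta> \<otimes> k\<close> separate the points of \<open>K \<otimes> L\<close>, so the two sides may be compared slice by
  slice.
\<close>

theorem yd_equation_iff:
  assumes Y: "vs Y" and \<alpha>: "\<alpha> \<in> lin_hom R Y (T Y K)" and \<beta>: "\<beta> \<in> lin_hom R Y (T Y L)"
  shows "(\<forall>y\<in>carrier Y.
        tassoc R Y (hopf_op K) L (tmap R (tensor R Y (hopf_op K)) L \<alpha> id (\<beta> y)) =
        tmap R Y A id (inv_into (carrier A) (Ad A (canonical_element R K)))
          (tmap R Y A id (tflip R L (hopf_op K))
            (tassoc R Y L (hopf_op K) (tmap R (tensor R Y L) (hopf_op K) \<beta> id (\<alpha> y)))))
    \<longleftrightarrow> yd_cond Y \<alpha> \<beta>"
proof -
  let ?T = "T K L"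
  note vT = vs_tensor[OF vs_K vs_L]
  let ?J = "\<lambda>z. Ui \<otimes>\<^bsub>A\<^esub> z \<otimes>\<^bsub>A\<^esub> U" and ?l = "\<lambda>z. U \<otimes>\<^bsub>A\<^esub> z" and ?r = "\<lambda>z. z \<otimes>\<^bsub>A\<^esub> U" and ?l' = "\<lambda>z. Ui \<otimes>\<^bsub>A\<^esub> z"
  have J: "?J \<in> lin_hom R ?T ?T" and l: "?l \<in> lin_hom R ?T ?T" and r: "?r \<in> lin_hom R ?T ?T" and l': "?l' \<in> lin_hom R ?T ?T"
    using lin_comp[OF A_mult_lin(1) A_mult_lin(2)] A_mult_lin U_closed by auto
  note np = lin_part_op(2)[of K]
  \<comment> \<open>The opposite product on \<open>K\<close> leaves all maps between the tensor products unchanged.\<close>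
  have n1: "tassoc R Y (hopf_op K) L = tassoc R Y K L" "tassoc R Y L (hopf_op K) = tassoc R Y L K"
    by (intro tassoc_lin_part refl np)+
  have n2: "tmap R (T Y (hopf_op K)) L = tmap R (T Y K) L" "tmap R Y A = tmap R Y ?T"
    "tmap R (T Y L) (hopf_op K) = tmap R (T Y L) K" "tflip R L (hopf_op K) = tflip R L K"
    by (intro tmap_lin_part tflip_lin_part tensor_lin_part lin_part_A refl np)+
  have "(tassoc R Y K L (tmap R (T Y K) L \<alpha> id (\<beta> y)) =
        tmap R Y ?T id (inv_into (carrier A) (Ad A (canonical_element R K)))
          (tmap R Y ?T id (tflip R L K) (tassoc R Y L K (tmap R (T Y L) K \<beta> id (\<alpha> y))))) \<longleftrightarrow>
     (\<forall>\<theta>\<in>carrier L. \<forall>k\<in>carrier K.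
     tlift R Y (\<lambda>v \<phi>. tlift R Y (\<lambda>u a. \<theta> (left_U a \<phi> k) \<odot>\<^bsub>Y\<^esub> u) (\<alpha> v)) (\<beta> y) =
     tlift R Y (\<lambda>v a. tlift R Y (\<lambda>u \<phi>. \<theta> (right_U a \<phi> k) \<odot>\<^bsub>Y\<^esub> u) (\<beta> v)) (\<alpha> y))"
    if y: "y \<in> carrier Y" for y
  proof -
    let ?Pa = "tmap R (T Y K) L \<alpha> id (\<beta> y)" and ?Qa = "tmap R (T Y L) K \<beta> id (\<alpha> y)"
    let ?P = "tassoc R Y K L ?Pa" and ?Qb = "tassoc R Y L K ?Qa"
    let ?Q = "tmap R Y ?T id (tflip R L K) ?Qb"
    note ay = lin_closed[OF \<alpha> y] and by' = lin_closed[OF \<beta> y]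
    note vYK = vs_tensor[OF Y vs_K] and vYL = vs_tensor[OF Y vs_L]
    have P0: "?Pa \<in> carrier (T (T Y K) L)"
      by (rule lin_closed[OF tmap_lin[OF Y vs_L vYK vs_L \<alpha> lin_hom_id] by'])
    have Q0: "?Qa \<in> carrier (T (T Y L) K)"
      by (rule lin_closed[OF tmap_lin[OF Y vs_K vYL vs_K \<beta> lin_hom_id] ay])
    have P: "?P \<in> carrier (T Y ?T)" by (rule lin_closed[OF tassoc_lin[OF Y vs_K vs_L] P0])
    have Q1: "?Qb \<in> carrier (T Y (T L K))" by (rule lin_closed[OF tassoc_lin[OF Y vs_L vs_K] Q0])
    note fl = tflip_lin[OF vs_L vs_K]
    note vLK = vs_tensor[OF vs_L vs_K]
    have Q: "?Q \<in> carrier (T Y ?T)"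
      by (rule tmap_id_closed[OF Y vLK vT fl Q1])
    \<comment> \<open>\<open>tmap\<close> uses the second map on \<open>carrier ?T\<close> only, where \<open>inv_into\<close> is conjugation.\<close>
    have inv: "tmap R Y ?T id (inv_into (carrier A) (Ad A (canonical_element R K))) ?Q = tmap R Y ?T id ?J ?Q"
      by (rule tmap_cong[OF Y vT Y vT lin_hom_id J refl _ Q])
        (use inv_Ad[OF A_simps(4), of U Ui] U_closed U_inverse in \<open>simp add: canonical_element_elt\<close>)
    have as: "U \<otimes>\<^bsub>A\<^esub> ?J z = ?r z" "Ui \<otimes>\<^bsub>A\<^esub> ?r z = ?J z" "Ui \<otimes>\<^bsub>A\<^esub> ?l z = z" if z: "z \<in> carrier ?T" for z
    proof -
      note cl = U_closed z
      show "Ui \<otimes>\<^bsub>A\<^esub> ?r z = ?J z" using cl by (simp add: alg_assoc[OF A_simps(4)])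
      have "U \<otimes>\<^bsub>A\<^esub> ?J z = (U \<otimes>\<^bsub>A\<^esub> Ui) \<otimes>\<^bsub>A\<^esub> ?r z" using cl by (simp add: alg_assoc[OF A_simps(4)])
      then show "U \<otimes>\<^bsub>A\<^esub> ?J z = ?r z" using cl by (simp add: U_inverse alg_one[OF A_simps(4)])
      have "Ui \<otimes>\<^bsub>A\<^esub> ?l z = (Ui \<otimes>\<^bsub>A\<^esub> U) \<otimes>\<^bsub>A\<^esub> z" using cl by (simp add: alg_assoc[OF A_simps(4)])
      then show "Ui \<otimes>\<^bsub>A\<^esub> ?l z = z" using cl by (simp add: U_inverse alg_one[OF A_simps(4)])
    qed
    have "?P = tmap R Y ?T id ?J ?Q \<longleftrightarrow> tmap R Y ?T id ?l ?P = tmap R Y ?T id ?r ?Q"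
    proof
      assume "?P = tmap R Y ?T id ?J ?Q"
      then have "tmap R Y ?T id ?l ?P = tmap R Y ?T id ?l (tmap R Y ?T id ?J ?Q)" by simp
      also have "\<dots> = tmap R Y ?T (\<lambda>v. id (id v)) (\<lambda>z. ?l (?J z)) ?Q"
        by (rule tmap_comp[OF Y vT Y vT Y vT lin_hom_id J lin_hom_id l Q])
      also have "\<dots> = tmap R Y ?T id ?r ?Q"
        by (rule tmap_cong[OF Y vT Y vT lin_hom_id r _ _ Q]) (simp_all add: as)
      finally show "tmap R Y ?T id ?l ?P = tmap R Y ?T id ?r ?Q" .
    next
      assume e: "tmap R Y ?T id ?l ?P = tmap R Y ?T id ?r ?Q"
      have "?P = tmap R Y ?T (\<lambda>v. v) (\<lambda>w. w) ?P" by (rule tmap_id_id[OF Y vT P, symmetric])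
      also have "\<dots> = tmap R Y ?T (\<lambda>v. id (id v)) (\<lambda>z. ?l' (?l z)) ?P"
        by (rule tmap_cong[OF Y vT Y vT _ _ _ _ P, symmetric]) (simp_all add: as lin_id)
      also have "\<dots> = tmap R Y ?T id ?l' (tmap R Y ?T id ?l ?P)"
        by (rule tmap_comp[OF Y vT Y vT Y vT lin_hom_id l lin_hom_id l' P, symmetric])
      also have "\<dots> = tmap R Y ?T id ?l' (tmap R Y ?T id ?r ?Q)" unfolding e ..
      also have "\<dots> = tmap R Y ?T (\<lambda>v. id (id v)) (\<lambda>z. ?l' (?r z)) ?Q"
        by (rule tmap_comp[OF Y vT Y vT Y vT lin_hom_id r lin_hom_id l' Q])
      also have "\<dots> = tmap R Y ?T id ?J ?Q"
        by (rule tmap_cong[OF Y vT Y vT lin_hom_id J _ _ Q]) (simp_all add: as)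
      finally show "?P = tmap R Y ?T id ?J ?Q" .
    qed
    also have "\<dots> \<longleftrightarrow> (\<forall>\<theta>\<in>carrier L. \<forall>k\<in>carrier K.
        slice Y (fprod \<theta> (\<lambda>\<phi>. \<phi> k)) (tmap R Y ?T id ?l ?P) = slice Y (fprod \<theta> (\<lambda>\<phi>. \<phi> k)) (tmap R Y ?T id ?r ?Q))"
    proof (rule iffI)
      assume e: "\<forall>\<theta>\<in>carrier L. \<forall>k\<in>carrier K.
        slice Y (fprod \<theta> (\<lambda>\<phi>. \<phi> k)) (tmap R Y ?T id ?l ?P) = slice Y (fprod \<theta> (\<lambda>\<phi>. \<phi> k)) (tmap R Y ?T id ?r ?Q)"
      show "tmap R Y ?T id ?l ?P = tmap R Y ?T id ?r ?Q"
        by (rule tensor_eqI[OF Y vT coords_tensor[OF vs_K vs_L coords_K coords_L]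
              tmap_id_closed[OF Y vT vT l P] tmap_id_closed[OF Y vT vT r Q]]) (use e in auto)
    qed simp
    also have "\<dots> \<longleftrightarrow> (\<forall>\<theta>\<in>carrier L. \<forall>k\<in>carrier K.
     tlift R Y (\<lambda>v \<phi>. tlift R Y (\<lambda>u a. \<theta> (left_U a \<phi> k) \<odot>\<^bsub>Y\<^esub> u) (\<alpha> v)) (\<beta> y) =
     tlift R Y (\<lambda>v a. tlift R Y (\<lambda>u \<phi>. \<theta> (right_U a \<phi> k) \<odot>\<^bsub>Y\<^esub> u) (\<beta> v)) (\<alpha> y))"
    proof (intro ball_cong refl arg_cong2[of _ _ _ _ "(=)"])
      fix \<theta> k assume t: "\<theta> \<in> carrier L" and k: "k \<in> carrier K"
      let ?c = "fprod \<theta> (\<lambda>\<phi>. \<phi> k)"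
      have c: "?c \<in> lin_hom R ?T (ground R)" by (rule fprod_lin[OF vs_K vs_L dual_lin[OF t] lin_ev[OF k]])
      have cl: "?c (?l (ts K L a \<phi>)) = \<theta> (left_U a \<phi> k)" "?c (?r (ts K L a \<phi>)) = \<theta> (right_U a \<phi> k)"
        if a: "a \<in> carrier K" and p: "\<phi> \<in> carrier L" for a \<phi>
        using elt_mult_tens[OF lin_id k a p] a p k t U_closed
        by (simp_all add: fprod_sl left_U_def right_U_def)
      have "slice Y ?c (tmap R Y ?T id ?l ?P) = slice Y (\<lambda>z. ?c (?l z)) ?P"
        by (rule slice_tmap[OF Y vT vT l c P])
      also have "\<dots> = tlift R Y (\<lambda>s \<phi>. tlift R Y (\<lambda>u a. ?c (?l (ts K L a \<phi>)) \<odot>\<^bsub>Y\<^esub> u) s) ?Pa"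
        by (rule slice_assoc[OF Y vs_K vs_L lin_comp[OF c l] P0])
      also have "\<dots> = tlift R Y (\<lambda>s \<phi>. tlift R Y (\<lambda>u a. \<theta> (left_U a \<phi> k) \<odot>\<^bsub>Y\<^esub> u) s) ?Pa"
        by (intro tlift_cong[OF vYK vs_L Y P0] tlift_cong[OF Y vs_K Y] tlift_closed[OF Y vs_K Y])
          (use cl Y t k in auto)
      also have "\<dots> = tlift R Y (\<lambda>v \<phi>. tlift R Y (\<lambda>u a. \<theta> (left_U a \<phi> k) \<odot>\<^bsub>Y\<^esub> u) (\<alpha> v)) (\<beta> y)"
      proof -
        have "tril Y K L Y (\<lambda>u a \<phi>. \<theta> (left_U a \<phi> k) \<odot>\<^bsub>Y\<^esub> u)"
          unfolding left_U_def using Y t k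
          by (intro trilI lin_smult_const lin_scalar lin_dual lin_sw_param lin_mult_left lin_mult_right lin_ev lin_id) auto
        from tlift_tmap[OF Y vs_L vYK vs_L Y \<alpha> lin_hom_id bil_tril_left[OF Y vs_K vs_L Y this] by']
        show ?thesis by simp
      qed
      finally show "slice Y ?c (tmap R Y ?T id ?l ?P) =
        tlift R Y (\<lambda>v \<phi>. tlift R Y (\<lambda>u a. \<theta> (left_U a \<phi> k) \<odot>\<^bsub>Y\<^esub> u) (\<alpha> v)) (\<beta> y)" .
      have flt: "tflip R L K (ts L K \<phi> a) = ts K L a \<phi>" if "a \<in> carrier K" "\<phi> \<in> carrier L" for a \<phi>
        using that tlift_tens[OF vs_L vs_K vT, of "\<lambda>v w. ts K L w v" \<phi> a]
        by (simp add: tflip_def bilI lin_tens_left lin_tens_right lin_id)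
      have "slice Y ?c (tmap R Y ?T id ?r ?Q) = slice Y (\<lambda>z. ?c (?r z)) ?Q"
        by (rule slice_tmap[OF Y vT vT r c Q])
      also have "\<dots> = slice Y (\<lambda>z. ?c (?r (tflip R L K z))) ?Qb"
        by (rule slice_tmap[OF Y vLK vT fl lin_comp[OF c r] Q1])
      also have "\<dots> = tlift R Y (\<lambda>s a. tlift R Y (\<lambda>u \<phi>. ?c (?r (tflip R L K (ts L K \<phi> a))) \<odot>\<^bsub>Y\<^esub> u) s) ?Qa"
        by (rule slice_assoc[OF Y vs_L vs_K lin_comp[OF lin_comp[OF c r] fl] Q0])
      also have "\<dots> = tlift R Y (\<lambda>s a. tlift R Y (\<lambda>u \<phi>. \<theta> (right_U a \<phi> k) \<odot>\<^bsub>Y\<^esub> u) s) ?Qa"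
        by (intro tlift_cong[OF vYL vs_K Y Q0] tlift_cong[OF Y vs_L Y] tlift_closed[OF Y vs_L Y])
          (use cl Y t k flt in auto)
      also have "\<dots> = tlift R Y (\<lambda>v a. tlift R Y (\<lambda>u \<phi>. \<theta> (right_U a \<phi> k) \<odot>\<^bsub>Y\<^esub> u) (\<beta> v)) (\<alpha> y)"
      proof -
        have "tril Y L K Y (\<lambda>u \<phi> a. \<theta> (right_U a \<phi> k) \<odot>\<^bsub>Y\<^esub> u)"
          unfolding right_U_def using Y t k
          by (intro trilI lin_smult_const lin_scalar lin_dual lin_sw_param lin_mult_left lin_mult_right lin_ev lin_id) auto
        from tlift_tmap[OF Y vs_K vYL vs_K Y \<beta> lin_hom_id bil_tril_left[OF Y vs_L vs_K Y this] ay]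
        show ?thesis by simp
      qed
      finally show "slice Y ?c (tmap R Y ?T id ?r ?Q) =
        tlift R Y (\<lambda>v a. tlift R Y (\<lambda>u \<phi>. \<theta> (right_U a \<phi> k) \<odot>\<^bsub>Y\<^esub> u) (\<beta> v)) (\<alpha> y)" .
    qed
    finally show ?thesis unfolding inv .
  qed
  then show ?thesis unfolding n1 n2 yd_cond_def by (intro ball_cong refl) auto
qed

end

section \<open>The bidual\<close>

context fd_hopf begin

abbreviation LL where "LL \<equiv> dual R L"
abbreviation bid where "bid \<equiv> to_bidual R K"

lemma bid_apply: "\<theta> \<in> carrier L \<Longrightarrow> bid k \<theta> = \<theta> k"
  by (simp add: to_bidual_def)

lemma bid_closed [simp]:
  assumes "k \<in> carrier K" shows "bid k \<in> carrier LL"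
proof -
  interpret D: fd_hopf R L by (rule dual_fd_hopf)
  show ?thesis unfolding to_bidual_def by (intro D.dual_ext_closed lin_ev assms)
qed

lemma vs_LL [simp]: "vs LL"
proof -
  interpret D: fd_hopf R L by (rule dual_fd_hopf)
  show ?thesis by simp
qed

lemma bid_lin: "bid \<in> lin_hom R K LL"
proof -
  interpret D: fd_hopf R L by (rule dual_fd_hopf)
  show ?thesis
  proof (rule D.lin_into_dual)
    fix \<theta> assume t: "\<theta> \<in> carrier L"
    show "(\<lambda>x. bid x \<theta>) \<in> lin_hom R K (ground R)" using t dual_lin[OF t] by (simp add: bid_apply)
  qed auto
qed

text \<open>The preimage of \<open>\<xi>\<close> is \<open>\<Sum> \<xi> (coord b) \<bullet> b\<close>, because \<open>\<theta> = \<Sum> \<theta> b \<bullet> coord b\<close>.\<close>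

lemma bid_surj:
  assumes x: "\<xi> \<in> carrier LL" shows "\<exists>k\<in>carrier K. \<xi> = bid k"
proof
  interpret D: fd_hopf R L by (rule dual_fd_hopf)
  let ?k = "finsum K (\<lambda>b. \<xi> (coord b) \<bullet> b) basis"
  show k: "?k \<in> carrier K" using x by simp
  show "\<xi> = bid ?k"
  proof (rule D.dual_eqI[OF x bid_closed[OF k]])
    fix \<theta> assume t: "\<theta> \<in> carrier L"
    have "\<xi> \<theta> = \<xi> (finsum L (\<lambda>b. \<theta> b \<odot>\<^bsub>L\<^esub> coord b) basis)" using dual_expand[OF t] by simp
    also have "\<dots> = finsum (ground R) (\<lambda>b. \<xi> (\<theta> b \<odot>\<^bsub>L\<^esub> coord b)) basis"
      using t x by (intro lin_finsum[OF vs_L vs_ground D.dual_lin]) auto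
    also have "\<dots> = finsum (ground R) (\<lambda>b. \<theta> (\<xi> (coord b) \<bullet> b)) basis"
      using t x by (intro vs_finsum_cong)
        (auto simp: lin_scale[OF D.dual_lin[OF x]] lin_scale[OF dual_lin[OF t]] m_comm)
    also have "\<dots> = \<theta> ?k"
      using t x by (intro lin_finsum[OF vs_K vs_ground dual_lin, symmetric]) auto
    finally show "\<xi> \<theta> = bid ?k \<theta>" using t by (simp add: bid_apply)
  qed
qed

lemma dual_weighted_sum:
  assumes t: "\<theta> \<in> carrier L" and k: "k \<in> carrier K"
    and c: "\<And>s r. s \<in> carrier K \<Longrightarrow> r \<in> carrier K \<Longrightarrow> p s r \<in> carrier K \<and> q s r \<in> carrier K \<and> c s r \<in> carrier R"
  shows "tlift R (ground R) (\<lambda>\<phi> \<psi>. sw (ground R) (\<lambda>s r. c s r \<otimes> (\<phi> (p s r) \<otimes> \<psi> (q s r))) k) (comult L \<theta>) =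
    sw (ground R) (\<lambda>s r. c s r \<otimes> \<theta> (p s r \<cdot> q s r)) k"
proof -
  note Dt = dual_comult(1)[OF t]
  have "tlift R (ground R) (\<lambda>\<phi> \<psi>. sw (ground R) (\<lambda>s r. c s r \<otimes> (\<phi> (p s r) \<otimes> \<psi> (q s r))) k) (comult L \<theta>) =
      sw (ground R) (\<lambda>s r. tlift R (ground R) (\<lambda>\<phi> \<psi>. c s r \<otimes> (\<phi> (p s r) \<otimes> \<psi> (q s r))) (comult L \<theta>)) k"
    using k c by (intro tlift_swap[OF vs_L vs_L vs_K vs_K vs_ground Dt]) auto
  also have "\<dots> = sw (ground R) (\<lambda>s r. c s r \<otimes> \<theta> (p s r \<cdot> q s r)) k"
  proof (rule sw_cong[OF vs_ground k])
    fix s r assume s: "s \<in> carrier K" "r \<in> carrier K"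
    note cs = c[OF s]
    have "c s r \<otimes> tlift R (ground R) (\<lambda>\<phi> \<psi>. \<phi> (p s r) \<otimes> \<psi> (q s r)) (comult L \<theta>) =
        tlift R (ground R) (\<lambda>\<phi> \<psi>. c s r \<otimes> (\<phi> (p s r) \<otimes> \<psi> (q s r))) (comult L \<theta>)"
      using cs by (intro lin_tlift[OF vs_L vs_L vs_ground vs_ground lin_ground_mult(2)[OF lin_id] Dt]) auto
    then show "tlift R (ground R) (\<lambda>\<phi> \<psi>. c s r \<otimes> (\<phi> (p s r) \<otimes> \<psi> (q s r))) (comult L \<theta>) =
        c s r \<otimes> \<theta> (p s r \<cdot> q s r)"
      using cs by (simp add: dual_sw[OF t])
  qed (use t c in auto)
  finally show ?thesis .
qed

text \<open>Duality exchanges left and right multiplication by the canonical element.\<close>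

lemma dual_left_right_U:
  assumes t: "\<theta> \<in> carrier L" and p: "\<phi> \<in> carrier L" and a: "a \<in> carrier K" and k: "k \<in> carrier K"
  shows "hopf_over.left_U R L \<phi> (bid a) \<theta> k = \<theta> (right_U a \<phi> k)"
    and "hopf_over.right_U R L \<phi> (bid a) \<theta> k = \<theta> (left_U a \<phi> k)"
proof -
  interpret D: fd_hopf R L by (rule dual_fd_hopf)
  note Dt = dual_comult(1)[OF t]
  have "D.left_U \<phi> (bid a) \<theta> k = tlift R (ground R) (\<lambda>x z. (bid a z \<odot>\<^bsub>L\<^esub> (\<phi> \<star> x)) k) (comult L \<theta>)"
    unfolding D.left_U_def using p a by (intro dual_tlift_apply[OF t k]) auto
  also have "\<dots> = tlift R (ground R) (\<lambda>x z. sw (ground R) (\<lambda>s r. \<phi> s \<otimes> (x r \<otimes> z a)) k) (comult L \<theta>)"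
  proof (rule tlift_cong[OF vs_L vs_L vs_ground Dt])
    fix x z assume x: "x \<in> carrier L" "z \<in> carrier L"
    have "(bid a z \<odot>\<^bsub>L\<^esub> (\<phi> \<star> x)) k = sw (ground R) (\<lambda>s r. z a \<otimes> (\<phi> s \<otimes> x r)) k"
      using x p a k sw_push[OF lin_ground_mult(2)[OF lin_id], of "z a" k "\<lambda>s r. \<phi> s \<otimes> x r"]
      by (simp add: bid_apply)
    also have "\<dots> = sw (ground R) (\<lambda>s r. \<phi> s \<otimes> (x r \<otimes> z a)) k"
      using x p a k by (intro sw_cong) (auto simp: m_ac)
    finally show "(bid a z \<odot>\<^bsub>L\<^esub> (\<phi> \<star> x)) k = sw (ground R) (\<lambda>s r. \<phi> s \<otimes> (x r \<otimes> z a)) k" .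
  qed (use p a k in auto)
  also have "\<dots> = sw (ground R) (\<lambda>s r. \<phi> s \<otimes> \<theta> (r \<cdot> a)) k"
    using p a by (intro dual_weighted_sum t k) auto
  also have "\<dots> = \<theta> (right_U a \<phi> k)"
    unfolding right_U_def using t p a k
    by (subst sw_push[OF dual_lin[OF t] vs_K vs_ground k]) (auto simp: lin_scale[OF dual_lin[OF t]] intro!: sw_cong)
  finally show "D.left_U \<phi> (bid a) \<theta> k = \<theta> (right_U a \<phi> k)" .
  have "D.right_U \<phi> (bid a) \<theta> k = tlift R (ground R) (\<lambda>x z. (bid a x \<odot>\<^bsub>L\<^esub> (z \<star> \<phi>)) k) (comult L \<theta>)"
    unfolding D.right_U_def using p a by (intro dual_tlift_apply[OF t k]) auto
  also have "\<dots> = tlift R (ground R) (\<lambda>x z. sw (ground R) (\<lambda>s r. \<phi> r \<otimes> (x a \<otimes> z s)) k) (comult L \<theta>)"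
  proof (rule tlift_cong[OF vs_L vs_L vs_ground Dt])
    fix x z assume x: "x \<in> carrier L" "z \<in> carrier L"
    have "(bid a x \<odot>\<^bsub>L\<^esub> (z \<star> \<phi>)) k = sw (ground R) (\<lambda>s r. x a \<otimes> (z s \<otimes> \<phi> r)) k"
      using x p a k sw_push[OF lin_ground_mult(2)[OF lin_id], of "x a" k "\<lambda>s r. z s \<otimes> \<phi> r"]
      by (simp add: bid_apply)
    also have "\<dots> = sw (ground R) (\<lambda>s r. \<phi> r \<otimes> (x a \<otimes> z s)) k"
      using x p a k by (intro sw_cong) (auto simp: m_ac)
    finally show "(bid a x \<odot>\<^bsub>L\<^esub> (z \<star> \<phi>)) k = sw (ground R) (\<lambda>s r. \<phi> r \<otimes> (x a \<otimes> z s)) k" .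
  qed (use p a k in auto)
  also have "\<dots> = sw (ground R) (\<lambda>s r. \<phi> r \<otimes> \<theta> (a \<cdot> s)) k"
    using p a by (intro dual_weighted_sum t k) auto
  also have "\<dots> = \<theta> (left_U a \<phi> k)"
    unfolding left_U_def using t p a k
    by (subst sw_push[OF dual_lin[OF t] vs_K vs_ground k]) (auto simp: lin_scale[OF dual_lin[OF t]] intro!: sw_cong)
  finally show "D.right_U \<phi> (bid a) \<theta> k = \<theta> (left_U a \<phi> k)" .
qed

lemma tlift_bid:
  assumes Y: "vs Y" and Z: "vs Z" and B: "bil Y LL Z B" and t: "t \<in> carrier (T Y K)"
  shows "tlift R Z B (tmap R Y LL id bid t) = tlift R Z (\<lambda>v k. B v (bid k)) t"
  using tlift_tmap[OF Y vs_K Y vs_LL Z lin_hom_id bid_lin B t] by simp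

text \<open>
  The two sides of the identity for \<open>L\<close> at \<open>(k, \<theta>)\<close> are those of the identity for \<open>K\<close> at \<open>(\<theta>, k)\<close>,
  in the opposite order; here \<open>k\<close> ranges over all of the bidual by \<open>bid_surj\<close>.
\<close>

theorem yd_cond_dual:
  assumes Y: "vs Y" and \<alpha>: "\<alpha> \<in> lin_hom R Y (T Y K)" and \<beta>: "\<beta> \<in> lin_hom R Y (T Y L)"
  shows "hopf_over.yd_cond R L Y \<beta> (\<lambda>y. tmap R Y LL id bid (\<alpha> y)) \<longleftrightarrow> yd_cond Y \<alpha> \<beta>"
proof -
  interpret D: fd_hopf R L by (rule dual_fd_hopf)
  let ?\<alpha> = "\<lambda>y. tmap R Y LL id bid (\<alpha> y)"
  note ac = lin_closed[OF \<alpha>] and bc = lin_closed[OF \<beta>]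
  have 1: "tlift R Y (\<lambda>v \<xi>. tlift R Y (\<lambda>u \<phi>. bid k (D.left_U \<phi> \<xi> \<theta>) \<odot>\<^bsub>Y\<^esub> u) (\<beta> v)) (?\<alpha> y) =
      tlift R Y (\<lambda>v a. tlift R Y (\<lambda>u \<phi>. \<theta> (right_U a \<phi> k) \<odot>\<^bsub>Y\<^esub> u) (\<beta> v)) (\<alpha> y)"
    and 2: "tlift R Y (\<lambda>v \<phi>. tlift R Y (\<lambda>u \<xi>. bid k (D.right_U \<phi> \<xi> \<theta>) \<odot>\<^bsub>Y\<^esub> u) (?\<alpha> v)) (\<beta> y) =
      tlift R Y (\<lambda>v \<phi>. tlift R Y (\<lambda>u a. \<theta> (left_U a \<phi> k) \<odot>\<^bsub>Y\<^esub> u) (\<alpha> v)) (\<beta> y)"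
    if y: "y \<in> carrier Y" and t: "\<theta> \<in> carrier L" and k: "k \<in> carrier K" for y \<theta> k
  proof -
    note bk = bid_closed[OF k]
    have t1: "tril Y L LL Y (\<lambda>u \<phi> \<xi>. bid k (D.left_U \<phi> \<xi> \<theta>) \<odot>\<^bsub>Y\<^esub> u)"
      unfolding D.left_U_def using Y t bk
      by (intro trilI lin_smult_const lin_scalar D.lin_dual D.lin_sw_param lin_mult_left lin_mult_right D.lin_ev lin_id) auto
    have b1: "bil Y LL Y (\<lambda>v \<xi>. tlift R Y (\<lambda>u \<phi>. bid k (D.left_U \<phi> \<xi> \<theta>) \<odot>\<^bsub>Y\<^esub> u) (\<beta> v))"
      using tril_lin[OF t1] bc Y
      by (intro bilI lin_tlift_arg[OF Y vs_L Y _ \<beta>] lin_tlift_param[OF Y vs_L Y]) auto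
    show "tlift R Y (\<lambda>v \<xi>. tlift R Y (\<lambda>u \<phi>. bid k (D.left_U \<phi> \<xi> \<theta>) \<odot>\<^bsub>Y\<^esub> u) (\<beta> v)) (?\<alpha> y) =
      tlift R Y (\<lambda>v a. tlift R Y (\<lambda>u \<phi>. \<theta> (right_U a \<phi> k) \<odot>\<^bsub>Y\<^esub> u) (\<beta> v)) (\<alpha> y)"
      unfolding tlift_bid[OF Y Y b1 ac[OF y]] using Y t k bc
      by (intro tlift_cong[OF Y vs_K Y ac[OF y]] tlift_cong[OF Y vs_L Y bc] tlift_closed[OF Y vs_L Y bc])
        (auto simp: dual_left_right_U bid_apply)
    show "tlift R Y (\<lambda>v \<phi>. tlift R Y (\<lambda>u \<xi>. bid k (D.right_U \<phi> \<xi> \<theta>) \<odot>\<^bsub>Y\<^esub> u) (?\<alpha> v)) (\<beta> y) =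
      tlift R Y (\<lambda>v \<phi>. tlift R Y (\<lambda>u a. \<theta> (left_U a \<phi> k) \<odot>\<^bsub>Y\<^esub> u) (\<alpha> v)) (\<beta> y)"
    proof (rule tlift_cong[OF Y vs_L Y bc[OF y]])
      fix v \<phi> assume v: "v \<in> carrier Y" and p: "\<phi> \<in> carrier L"
      have b2: "bil Y LL Y (\<lambda>u \<xi>. bid k (D.right_U \<phi> \<xi> \<theta>) \<odot>\<^bsub>Y\<^esub> u)"
        unfolding D.right_U_def using Y t bk p
        by (intro bilI lin_smult_const lin_scalar D.lin_dual D.lin_sw_param lin_mult_left lin_mult_right D.lin_ev lin_id) auto
      show "tlift R Y (\<lambda>u \<xi>. bid k (D.right_U \<phi> \<xi> \<theta>) \<odot>\<^bsub>Y\<^esub> u) (?\<alpha> v) = tlift R Y (\<lambda>u a. \<theta> (left_U a \<phi> k) \<odot>\<^bsub>Y\<^esub> u) (\<alpha> v)"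
        unfolding tlift_bid[OF Y Y b2 ac[OF v]] using Y t k p
        by (intro tlift_cong[OF Y vs_K Y ac[OF v]]) (auto simp: dual_left_right_U bid_apply)
      show "tlift R Y (\<lambda>u a. \<theta> (left_U a \<phi> k) \<odot>\<^bsub>Y\<^esub> u) (\<alpha> v) \<in> carrier Y"
        using Y t k p by (intro tlift_closed[OF Y vs_K Y ac[OF v]]) auto
    qed
  qed
  have "D.yd_cond Y \<beta> ?\<alpha> \<longleftrightarrow> (\<forall>y\<in>carrier Y. \<forall>k\<in>carrier K. \<forall>\<theta>\<in>carrier L.
     tlift R Y (\<lambda>v \<xi>. tlift R Y (\<lambda>u \<phi>. bid k (D.left_U \<phi> \<xi> \<theta>) \<odot>\<^bsub>Y\<^esub> u) (\<beta> v)) (?\<alpha> y) =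
     tlift R Y (\<lambda>v \<phi>. tlift R Y (\<lambda>u \<xi>. bid k (D.right_U \<phi> \<xi> \<theta>) \<odot>\<^bsub>Y\<^esub> u) (?\<alpha> v)) (\<beta> y))"
    unfolding D.yd_cond_def using bid_surj bid_closed by blast
  also have "\<dots> \<longleftrightarrow> (\<forall>y\<in>carrier Y. \<forall>k\<in>carrier K. \<forall>\<theta>\<in>carrier L.
      tlift R Y (\<lambda>v a. tlift R Y (\<lambda>u \<phi>. \<theta> (right_U a \<phi> k) \<odot>\<^bsub>Y\<^esub> u) (\<beta> v)) (\<alpha> y) =
      tlift R Y (\<lambda>v \<phi>. tlift R Y (\<lambda>u a. \<theta> (left_U a \<phi> k) \<odot>\<^bsub>Y\<^esub> u) (\<alpha> v)) (\<beta> y))"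
    by (intro ball_cong refl) (simp only: 1 2)
  also have "\<dots> \<longleftrightarrow> yd_cond Y \<alpha> \<beta>" unfolding yd_cond_def by (auto simp: eq_commute)
  finally show ?thesis .
qed

section \<open>Braided commutativity\<close>

lemma counit_antipode [simp]: "k \<in> carrier K \<Longrightarrow> \<epsilon> (S k) = \<epsilon> k"
proof -
  assume k: "k \<in> carrier K"
  have "\<epsilon> (S k) = sw (ground R) (\<lambda>a b. \<epsilon> b \<odot>\<^bsub>ground R\<^esub> \<epsilon> (S a)) k"
    using k by (intro sw_counit_right[symmetric, of "ground R" "\<lambda>a. \<epsilon> (S a)"] lins antipode_lin) auto
  also have "\<dots> = sw (ground R) (\<lambda>a b. \<epsilon> (S a \<cdot> b)) k"
    using k by (intro sw_cong) (auto simp: m_comm)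
  also have "\<dots> = \<epsilon> k" using sw_antipode_left[OF vs_ground counit_lin k] k by simp
  finally show ?thesis .
qed

text \<open>
  The antipode reverses coproducts: this is \<open>antipode_mult\<close> for the dual, evaluated at \<open>k\<close>.
\<close>

lemma antipode_comult:
  assumes c: "\<chi> \<in> carrier L" and p: "\<psi> \<in> carrier L" and k: "k \<in> carrier K"
  shows "sw (ground R) (\<lambda>x z. \<chi> x \<otimes> \<psi> z) (S k) =
    sw (ground R) (\<lambda>x z. \<chi> (S z) \<otimes> \<psi> (S x)) k"
proof -
  interpret D: fd_hopf R L by (rule dual_fd_hopf)
  have "sw (ground R) (\<lambda>x z. \<chi> x \<otimes> \<psi> z) (S k) = antipode L (\<chi> \<star> \<psi>) k" using k by simp
  also have "\<dots> = (antipode L \<psi> \<star> antipode L \<chi>) k" using D.antipode_mult[OF c p] by simp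
  also have "\<dots> = sw (ground R) (\<lambda>x z. \<chi> (S z) \<otimes> \<psi> (S x)) k"
    using k c p by (simp only: dual_apply) (intro sw_cong, auto simp: m_comm)
  finally show ?thesis .
qed

abbreviation Heis where "Heis \<equiv> heisenberg R K"

text \<open>The product \<open>(k # \<theta>) (k' # \<theta>')\<close> of the Heisenberg algebra.\<close>

definition heis_mult where
  "heis_mult k \<theta> k' \<theta>' = sw (T K L) (\<lambda>x z. tlift R (T K L) (\<lambda>\<theta>1 \<theta>2.
     \<theta>1 z \<odot>\<^bsub>T K L\<^esub> ts K L (k \<cdot> x) (\<theta>2 \<star> \<theta>')) (comult L \<theta>)) k'"

lemma lin_part_Heis: "lin_part Heis = lin_part (T K L)"
  by (simp add: heisenberg_def Let_def lin_part_def)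

lemma Heis_simps [simp]: "carrier Heis = carrier (T K L)" "vs Heis"
  using module_lin_part[OF lin_part_Heis[symmetric], of R] lin_part_Heis by (simp_all, simp add: lin_part_def)

lemma lin_Heis: "lin_hom R Heis Z = lin_hom R (T K L) Z" "lin_hom R Z Heis = lin_hom R Z (T K L)"
  by (rule lin_hom_lin_part; simp add: lin_part_Heis)+

lemma Heis_mult: "s \<otimes>\<^bsub>Heis\<^esub> t = tlift R (T K L) (\<lambda>k \<theta>. tlift R (T K L) (\<lambda>k' \<theta>'. heis_mult k \<theta> k' \<theta>') t) s"
  by (simp add: heisenberg_def Let_def heis_mult_def)

lemma heis_mult_lin:
  assumes "k \<in> carrier K" "\<theta> \<in> carrier L" "k' \<in> carrier K" "\<theta>' \<in> carrier L"
  shows "(\<lambda>k. heis_mult k \<theta> k' \<theta>') \<in> lin_hom R K (T K L)" "(\<lambda>\<theta>. heis_mult k \<theta> k' \<theta>') \<in> lin_hom R L (T K L)"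
    "(\<lambda>k'. heis_mult k \<theta> k' \<theta>') \<in> lin_hom R K (T K L)" "(\<lambda>\<theta>'. heis_mult k \<theta> k' \<theta>') \<in> lin_hom R L (T K L)"
proof -
  interpret D: fd_hopf R L by (rule dual_fd_hopf)
  note vT = vs_tensor[OF vs_K vs_L]
  show "(\<lambda>k. heis_mult k \<theta> k' \<theta>') \<in> lin_hom R K (T K L)" unfolding heis_mult_def using assms
    by (intro lin_sw_param D.lin_sw_param lin_smult_const lin_tens_left lin_mult_left lin_id vT) auto
  show "(\<lambda>\<theta>. heis_mult k \<theta> k' \<theta>') \<in> lin_hom R L (T K L)" unfolding heis_mult_def using assms
    by (intro lin_sw_param D.lin_sw_arg bilI lin_smult_const lin_scalar lin_ev lin_tens_right lin_mult_left lin_id vT) auto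
  show "(\<lambda>k'. heis_mult k \<theta> k' \<theta>') \<in> lin_hom R K (T K L)" unfolding heis_mult_def using assms
    by (intro lin_sw_arg bilI D.lin_sw_param lin_smult_const lin_scalar lin_dual lin_tens_left lin_mult_right lin_id vT) auto
  show "(\<lambda>\<theta>'. heis_mult k \<theta> k' \<theta>') \<in> lin_hom R L (T K L)" unfolding heis_mult_def using assms
    by (intro lin_sw_param D.lin_sw_param lin_smult_const lin_tens_right lin_mult_right lin_id vT) auto
qed

lemma Heis_bil: "bil Heis Heis Heis (\<lambda>s t. s \<otimes>\<^bsub>Heis\<^esub> t)"
proof -
  note vT = vs_tensor[OF vs_K vs_L]
  show ?thesis unfolding Heis_mult
  proof (rule bilI; unfold lin_Heis Heis_simps)
    fix s assume s: "s \<in> carrier (T K L)"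
    show "(\<lambda>t. tlift R (T K L) (\<lambda>k \<theta>. tlift R (T K L) (\<lambda>k' \<theta>'. heis_mult k \<theta> k' \<theta>') t) s) \<in> lin_hom R (T K L) (T K L)"
      by (intro lin_tlift_param[OF vs_K vs_L vT s] tlift_lin[OF vs_K vs_L vT] bilI heis_mult_lin)
  next
    fix t assume t: "t \<in> carrier (T K L)"
    show "(\<lambda>s. tlift R (T K L) (\<lambda>k \<theta>. tlift R (T K L) (\<lambda>k' \<theta>'. heis_mult k \<theta> k' \<theta>') t) s) \<in> lin_hom R (T K L) (T K L)"
      by (intro tlift_lin[OF vs_K vs_L vT] bilI lin_tlift_param[OF vs_K vs_L vT t] heis_mult_lin)
  qed
qed

lemma Heis_mult_tens:
  assumes "k \<in> carrier K" "\<theta> \<in> carrier L" "k' \<in> carrier K" "\<theta>' \<in> carrier L"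
  shows "ts K L k \<theta> \<otimes>\<^bsub>Heis\<^esub> ts K L k' \<theta>' = heis_mult k \<theta> k' \<theta>'"
proof -
  note vT = vs_tensor[OF vs_K vs_L]
  have t: "ts K L k' \<theta>' \<in> carrier (T K L)" using assms by simp
  have b: "bil K L (T K L) (\<lambda>k \<theta>. tlift R (T K L) (\<lambda>k' \<theta>'. heis_mult k \<theta> k' \<theta>') (ts K L k' \<theta>'))"
    by (intro bilI lin_tlift_param[OF vs_K vs_L vT t] heis_mult_lin)
  have b': "bil K L (T K L) (\<lambda>k' \<theta>'. heis_mult k \<theta> k' \<theta>')" using assms by (intro bilI heis_mult_lin)
  show ?thesis
    unfolding Heis_mult tlift_tens[OF vs_K vs_L vT b assms(1,2)] tlift_tens[OF vs_K vs_L vT b' assms(3,4)] ..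
qed

lemma Heis_mult_left:
  assumes k: "k \<in> carrier K" and t: "\<theta> \<in> carrier L"
  shows "ts K L k \<one>\<^bsub>L\<^esub> \<otimes>\<^bsub>Heis\<^esub> ts K L \<one>\<^bsub>K\<^esub> \<theta> = ts K L k \<theta>"
proof -
  interpret D: fd_hopf R L by (rule dual_fd_hopf)
  note vT = vs_tensor[OF vs_K vs_L]
  have "heis_mult k \<one>\<^bsub>L\<^esub> \<one>\<^bsub>K\<^esub> \<theta> = sw (T K L) (\<lambda>x z. \<one>\<^bsub>L\<^esub> z \<odot>\<^bsub>T K L\<^esub> ts K L (k \<cdot> x) (\<one>\<^bsub>L\<^esub> \<star> \<theta>)) \<one>\<^bsub>K\<^esub>"
    unfolding heis_mult_def using k t
    by (intro sw_cong D.sw_one[of "T K L"] bilI lin_smult_const lin_scalar lin_ev lin_tens_right lin_mult_left lin_id vT) auto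
  also have "\<dots> = \<one>\<^bsub>L\<^esub> \<one>\<^bsub>K\<^esub> \<odot>\<^bsub>T K L\<^esub> ts K L (k \<cdot> \<one>\<^bsub>K\<^esub>) (\<one>\<^bsub>L\<^esub> \<star> \<theta>)"
    using k t by (intro sw_one[of "T K L"] bilI lin_smult_const lin_scalar lin_dual lin_tens_left lin_mult_right lin_id vT) auto
  finally show ?thesis using k t by (simp add: Heis_mult_tens)
qed

text \<open>
  The product formula applies the coproduct to \<open>S k\<close>; \<open>antipode_comult\<close> moves it to \<open>k\<close>, with the
  two legs exchanged.
\<close>

lemma Heis_mult_right:
  assumes k: "k \<in> carrier K" and t: "\<theta> \<in> carrier L" and c: "\<chi> \<in> carrier L" and h: "h \<in> carrier K"
  shows "fprod \<chi> (\<lambda>\<phi>. \<phi> h) (ts K L \<one>\<^bsub>K\<^esub> \<theta> \<otimes>\<^bsub>Heis\<^esub> ts K L (S k) \<one>\<^bsub>L\<^esub>) =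
    sw (ground R) (\<lambda>x z. \<chi> (S z) \<otimes> \<theta> (S x \<cdot> h)) k"
proof -
  note vT = vs_tensor[OF vs_K vs_L]
  let ?c = "fprod \<chi> (\<lambda>\<phi>. \<phi> h)"
  have lc: "?c \<in> lin_hom R (T K L) (ground R)" by (rule fprod_lin[OF vs_K vs_L dual_lin[OF c] lin_ev[OF h]])
  note Dt = dual_comult(1)[OF t]
  let ?Sk = "S k"
  have Sk: "?Sk \<in> carrier K" using k by simp
  have "?c (heis_mult \<one>\<^bsub>K\<^esub> \<theta> ?Sk \<one>\<^bsub>L\<^esub>) = sw (ground R) (\<lambda>x z. ?c (tlift R (T K L) (\<lambda>\<theta>1 \<theta>2.
     \<theta>1 z \<odot>\<^bsub>T K L\<^esub> ts K L (\<one>\<^bsub>K\<^esub> \<cdot> x) (\<theta>2 \<star> \<one>\<^bsub>L\<^esub>)) (comult L \<theta>))) ?Sk"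
    unfolding heis_mult_def
    by (rule sw_push[OF lc vT vs_ground Sk]) (intro tlift_closed[OF vs_L vs_L vT Dt], auto)
  also have "\<dots> = sw (ground R) (\<lambda>x z. \<chi> x \<otimes> \<theta> (z \<cdot> h)) ?Sk"
  proof (rule sw_cong[OF vs_ground Sk])
    fix x z assume x: "x \<in> carrier K" "z \<in> carrier K"
    have "?c (tlift R (T K L) (\<lambda>\<theta>1 \<theta>2. \<theta>1 z \<odot>\<^bsub>T K L\<^esub> ts K L (\<one>\<^bsub>K\<^esub> \<cdot> x) (\<theta>2 \<star> \<one>\<^bsub>L\<^esub>)) (comult L \<theta>)) =
        tlift R (ground R) (\<lambda>\<theta>1 \<theta>2. ?c (\<theta>1 z \<odot>\<^bsub>T K L\<^esub> ts K L (\<one>\<^bsub>K\<^esub> \<cdot> x) (\<theta>2 \<star> \<one>\<^bsub>L\<^esub>))) (comult L \<theta>)"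
      using x by (intro lin_tlift[OF vs_L vs_L vT vs_ground lc Dt]) auto
    also have "\<dots> = tlift R (ground R) (\<lambda>\<theta>1 \<theta>2. \<chi> x \<otimes> (\<theta>1 z \<otimes> \<theta>2 h)) (comult L \<theta>)"
      using x c h by (intro tlift_cong[OF vs_L vs_L vs_ground Dt])
        (auto simp: lin_scale[OF lc] fprod_tens dual_lin lin_ev m_ac)
    also have "\<dots> = \<chi> x \<otimes> tlift R (ground R) (\<lambda>\<theta>1 \<theta>2. \<theta>1 z \<otimes> \<theta>2 h) (comult L \<theta>)"
      using x c h by (intro lin_tlift[OF vs_L vs_L vs_ground vs_ground lin_ground_mult(2)[OF lin_id] Dt, symmetric]) auto
    finally show "?c (tlift R (T K L) (\<lambda>\<theta>1 \<theta>2. \<theta>1 z \<odot>\<^bsub>T K L\<^esub> ts K L (\<one>\<^bsub>K\<^esub> \<cdot> x) (\<theta>2 \<star> \<one>\<^bsub>L\<^esub>)) (comult L \<theta>)) =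
        \<chi> x \<otimes> \<theta> (z \<cdot> h)"
      using dual_sw[OF t x(2) h] by simp
  qed (use t c h in auto)
  also have "\<dots> = sw (ground R) (\<lambda>x z. \<chi> x \<otimes> (\<lambda>z\<in>carrier K. \<theta> (z \<cdot> h)) z) ?Sk"
    using Sk t c h by (intro sw_cong) auto
  also have "\<dots> = sw (ground R) (\<lambda>x z. \<chi> (S z) \<otimes> (\<lambda>z\<in>carrier K. \<theta> (z \<cdot> h)) (S x)) k"
    using t h by (intro antipode_comult c k dual_ext_closed lin_dual lin_mult_left lin_id) auto
  also have "\<dots> = sw (ground R) (\<lambda>x z. \<chi> (S z) \<otimes> \<theta> (S x \<cdot> h)) k"
    using k t c h by (intro sw_cong) auto
  finally show ?thesis using k t by (simp add: Heis_mult_tens)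
qed

end

context field begin

lemma slice_tensor_mult:
  assumes Y: "alg Y" and Heis: "vs B" and mB: "bil B B B (\<lambda>x y. x \<otimes>\<^bsub>B\<^esub> y)"
    and V: "vs V" and W: "vs W" and F: "F \<in> lin_hom R V B" and G: "G \<in> lin_hom R W B"
    and c: "c \<in> lin_hom R B (ground R)" and s: "s \<in> carrier (T Y V)" and t: "t \<in> carrier (T Y W)"
  shows "slice Y c (tmap R Y B id F s \<otimes>\<^bsub>T Y B\<^esub> tmap R Y B id G t) =
    tlift R Y (\<lambda>u v. tlift R Y (\<lambda>u' w. c (F v \<otimes>\<^bsub>B\<^esub> G w) \<odot>\<^bsub>Y\<^esub> (u \<otimes>\<^bsub>Y\<^esub> u')) t) s"
proof -
  note Yv = alg_vs[OF Y]
  note vT = vs_tensor[OF Yv Heis]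
  let ?p = "tmap R Y B id F s" and ?q = "tmap R Y B id G t"
  have p: "?p \<in> carrier (T Y B)" and q: "?q \<in> carrier (T Y B)"
    using tmap_id_closed[OF Yv V Heis F s] tmap_id_closed[OF Yv W Heis G t] .
  note mc = bil_closed[OF mB]
  have m0: "bil Y B (T Y B) (\<lambda>a' b'. ts Y B (a \<otimes>\<^bsub>Y\<^esub> a') (b \<otimes>\<^bsub>B\<^esub> b'))"
    if "a \<in> carrier Y" "b \<in> carrier B" for a b
    using that Y Heis mc
    by (intro bilI lin_tens_left lin_tens_right lin_mult_right bil_right[OF mB] lin_id) auto
  have cc: "c x \<in> carrier R" if "x \<in> carrier B" for x using lin_closed[OF c that] by simp
  have b1: "bil Y B Y (\<lambda>u' b. c (b0 \<otimes>\<^bsub>B\<^esub> b) \<odot>\<^bsub>Y\<^esub> (u \<otimes>\<^bsub>Y\<^esub> u'))"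
    if "u \<in> carrier Y" "b0 \<in> carrier B" for u b0
    using that Y Heis mc cc
    by (intro bilI lin_smult_const lin_scalar lin_mult_right lin_comp[OF c] bil_right[OF mB] lin_id) auto
  have sl: "slice Y c \<in> lin_hom R (T Y B) Y" by (rule slice_lin[OF Yv Heis c])
  have st: "slice Y c (ts Y B a b) = c b \<odot>\<^bsub>Y\<^esub> a" if "a \<in> carrier Y" "b \<in> carrier B" for a b
    unfolding slice_def using that by (simp add: tlift_tens[OF Yv Heis Yv slice_bil[OF Yv Heis c]])
  have "slice Y c (?p \<otimes>\<^bsub>T Y B\<^esub> ?q) =
      tlift R Y (\<lambda>a b. slice Y c (tlift R (T Y B) (\<lambda>a' b'. ts Y B (a \<otimes>\<^bsub>Y\<^esub> a') (b \<otimes>\<^bsub>B\<^esub> b')) ?q)) ?p"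
    unfolding tensor_mult
    by (rule lin_tlift[OF Yv Heis vT Yv sl p]) (rule lin_closed[OF tlift_lin[OF Yv Heis vT m0] q])
  also have "\<dots> = tlift R Y (\<lambda>a b. tlift R Y (\<lambda>a' b'. c (b \<otimes>\<^bsub>B\<^esub> b') \<odot>\<^bsub>Y\<^esub> (a \<otimes>\<^bsub>Y\<^esub> a')) ?q) ?p"
  proof (rule tlift_cong[OF Yv Heis Yv p])
    fix a b assume ab: "a \<in> carrier Y" "b \<in> carrier B"
    have "slice Y c (tlift R (T Y B) (\<lambda>a' b'. ts Y B (a \<otimes>\<^bsub>Y\<^esub> a') (b \<otimes>\<^bsub>B\<^esub> b')) ?q) =
        tlift R Y (\<lambda>a' b'. slice Y c (ts Y B (a \<otimes>\<^bsub>Y\<^esub> a') (b \<otimes>\<^bsub>B\<^esub> b'))) ?q"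
      using ab Y Heis mc by (intro lin_tlift[OF Yv Heis vT Yv sl q]) auto
    also have "\<dots> = tlift R Y (\<lambda>a' b'. c (b \<otimes>\<^bsub>B\<^esub> b') \<odot>\<^bsub>Y\<^esub> (a \<otimes>\<^bsub>Y\<^esub> a')) ?q"
      using ab Y Heis mc cc by (intro tlift_cong[OF Yv Heis Yv q]) (auto simp: st)
    finally show "slice Y c (tlift R (T Y B) (\<lambda>a' b'. ts Y B (a \<otimes>\<^bsub>Y\<^esub> a') (b \<otimes>\<^bsub>B\<^esub> b')) ?q) =
      tlift R Y (\<lambda>a' b'. c (b \<otimes>\<^bsub>B\<^esub> b') \<odot>\<^bsub>Y\<^esub> (a \<otimes>\<^bsub>Y\<^esub> a')) ?q" .
    show "tlift R Y (\<lambda>a' b'. c (b \<otimes>\<^bsub>B\<^esub> b') \<odot>\<^bsub>Y\<^esub> (a \<otimes>\<^bsub>Y\<^esub> a')) ?q \<in> carrier Y"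
      using ab Y Heis mc cc by (intro tlift_closed[OF Yv Heis Yv q]) auto
  qed
  also have "\<dots> = tlift R Y (\<lambda>a b. tlift R Y (\<lambda>u' w. c (b \<otimes>\<^bsub>B\<^esub> G w) \<odot>\<^bsub>Y\<^esub> (a \<otimes>\<^bsub>Y\<^esub> u')) t) ?p"
    using tlift_tmap[OF Yv W Yv Heis Yv lin_hom_id G b1 t] Y Heis mc cc lin_closed[OF G]
    by (intro tlift_cong[OF Yv Heis Yv p] tlift_closed[OF Yv W Yv t]) auto
  also have "\<dots> = tlift R Y (\<lambda>u v. tlift R Y (\<lambda>u' w. c (F v \<otimes>\<^bsub>B\<^esub> G w) \<odot>\<^bsub>Y\<^esub> (u \<otimes>\<^bsub>Y\<^esub> u')) t) s"
  proof -
    have "bil Y B Y (\<lambda>a b. tlift R Y (\<lambda>u' w. c (b \<otimes>\<^bsub>B\<^esub> G w) \<odot>\<^bsub>Y\<^esub> (a \<otimes>\<^bsub>Y\<^esub> u')) t)"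
      using Y Heis mc cc lin_closed[OF G]
      by (intro bilI lin_tlift_param[OF Yv W Yv t] lin_smult_const lin_scalar lin_mult_left lin_comp[OF c] bil_left[OF mB] lin_id) auto
    from tlift_tmap[OF Yv V Yv Heis Yv lin_hom_id F this s] show ?thesis by simp
  qed
  finally show ?thesis .
qed

lemma coaction_tril:
  assumes Y: "vs Y" and W: "vs W" and Z: "vs Z" and D: "D \<in> lin_hom R W (T W W)"
    and \<alpha>: "\<alpha> \<in> lin_hom R Y (T Y W)"
    and ca: "tassoc R Y W W (tmap R (T Y W) W \<alpha> id (\<alpha> y)) = tmap R Y (T W W) id D (\<alpha> y)"
    and y: "y \<in> carrier Y" and G: "tril Y W W Z G"
  shows "tlift R Z (\<lambda>u k. tlift R Z (\<lambda>v h. G v h k) (\<alpha> u)) (\<alpha> y) =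
    tlift R Z (\<lambda>u k. tlift R Z (\<lambda>a b. G u a b) (D k)) (\<alpha> y)"
proof -
  note vYW = vs_tensor[OF Y W] and vWW = vs_tensor[OF W W]
  note ay = lin_closed[OF \<alpha> y]
  have m: "tmap R (T Y W) W \<alpha> id (\<alpha> y) \<in> carrier (T (T Y W) W)"
    by (rule lin_closed[OF tmap_lin[OF Y W vYW W \<alpha> lin_hom_id] ay])
  have "tlift R Z (\<lambda>u k. tlift R Z (\<lambda>v h. G v h k) (\<alpha> u)) (\<alpha> y) =
      tlift R Z (\<lambda>s k. tlift R Z (\<lambda>v h. G v h k) s) (tmap R (T Y W) W \<alpha> id (\<alpha> y))"
    using tlift_tmap[OF Y W vYW W Z \<alpha> lin_hom_id bil_tril_left[OF Y W W Z G] ay] by simp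
  also have "\<dots> = tlift R Z (\<lambda>u s. tlift R Z (\<lambda>a b. G u a b) s) (tassoc R Y W W (tmap R (T Y W) W \<alpha> id (\<alpha> y)))"
    by (rule tlift_tassoc[OF Y W W Z G m, symmetric])
  also have "\<dots> = tlift R Z (\<lambda>u k. tlift R Z (\<lambda>a b. G u a b) (D k)) (\<alpha> y)"
    unfolding ca using tlift_tmap[OF Y W Y vWW Z lin_hom_id D bil_tril_right[OF Y W W Z G] ay] by simp
  finally show ?thesis .
qed

text \<open>Coassociativity of the coaction with \<open>f\<close> applied to the last factor.\<close>

lemma coaction_slice:
  assumes Y: "vs Y" and W: "vs W" and Z: "vs Z" and D: "D \<in> lin_hom R W (T W W)"
    and \<alpha>: "\<alpha> \<in> lin_hom R Y (T Y W)"
    and ca: "tassoc R Y W W (tmap R (T Y W) W \<alpha> id (\<alpha> y)) = tmap R Y (T W W) id D (\<alpha> y)"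
    and y: "y \<in> carrier Y" and G: "bil Y W Z G" and f: "f \<in> lin_hom R W (ground R)"
  shows "tlift R Z (\<lambda>v h. G v h) (\<alpha> (slice Y f (\<alpha> y))) =
    tlift R Z (\<lambda>u k. tlift R Z (\<lambda>a b. f b \<odot>\<^bsub>Z\<^esub> G u a) (D k)) (\<alpha> y)"
proof -
  note ay = lin_closed[OF \<alpha>]
  have fc: "f k \<in> carrier R" if "k \<in> carrier W" for k using lin_closed[OF f that] by simp
  note gc = bil_closed[OF G]
  have L: "(\<lambda>u. tlift R Z (\<lambda>v h. G v h) (\<alpha> u)) \<in> lin_hom R Y Z" by (rule lin_tlift_arg[OF Y W Z G \<alpha>])
  have "tlift R Z (\<lambda>v h. G v h) (\<alpha> (slice Y f (\<alpha> y))) =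
      tlift R Z (\<lambda>u k. tlift R Z (\<lambda>v h. G v h) (\<alpha> (f k \<odot>\<^bsub>Y\<^esub> u))) (\<alpha> y)"
    unfolding slice_def using Y fc by (intro lin_tlift[OF Y W Y Z L ay[OF y]]) auto
  also have "\<dots> = tlift R Z (\<lambda>u k. tlift R Z (\<lambda>v h. f k \<odot>\<^bsub>Z\<^esub> G v h) (\<alpha> u)) (\<alpha> y)"
  proof (rule tlift_cong[OF Y W Z ay[OF y]])
    fix u k assume u: "u \<in> carrier Y" and k: "k \<in> carrier W"
    have "tlift R Z (\<lambda>v h. G v h) (\<alpha> (f k \<odot>\<^bsub>Y\<^esub> u)) = f k \<odot>\<^bsub>Z\<^esub> tlift R Z (\<lambda>v h. G v h) (\<alpha> u)"
      by (rule lin_scale[OF L fc[OF k] u])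
    also have "\<dots> = tlift R Z (\<lambda>v h. f k \<odot>\<^bsub>Z\<^esub> G v h) (\<alpha> u)"
      using gc fc k Z by (intro lin_tlift[OF Y W Z Z lin_smult_const[OF Z fc[OF k] lin_id] ay[OF u]]) auto
    finally show "tlift R Z (\<lambda>v h. G v h) (\<alpha> (f k \<odot>\<^bsub>Y\<^esub> u)) = tlift R Z (\<lambda>v h. f k \<odot>\<^bsub>Z\<^esub> G v h) (\<alpha> u)" .
    show "tlift R Z (\<lambda>v h. f k \<odot>\<^bsub>Z\<^esub> G v h) (\<alpha> u) \<in> carrier Z"
      using gc fc k Z by (intro tlift_closed[OF Y W Z ay[OF u]]) auto
  qed
  also have "\<dots> = tlift R Z (\<lambda>u k. tlift R Z (\<lambda>a b. f b \<odot>\<^bsub>Z\<^esub> G u a) (D k)) (\<alpha> y)"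
    using gc fc Z
    by (intro coaction_tril[OF Y W Z D \<alpha> ca y] trilI lin_smult_const lin_scalar bil_left[OF G] bil_right[OF G] f) auto
  finally show ?thesis .
qed

end

context hopf_over begin

text \<open>In Sweedler notation, \<open>x y = \<Sum> y\<^sup>1 (S x\<^sub>1) y\<^sup>0 x\<^sub>0\<close>.\<close>

definition bc_cond where
  "bc_cond Y \<alpha> \<beta> \<longleftrightarrow> (\<forall>x\<in>carrier Y. \<forall>y\<in>carrier Y. x \<otimes>\<^bsub>Y\<^esub> y =
     tlift R Y (\<lambda>u k. tlift R Y (\<lambda>v \<theta>. \<theta> (S k) \<odot>\<^bsub>Y\<^esub> (v \<otimes>\<^bsub>Y\<^esub> u)) (\<beta> y)) (\<alpha> x))"

end

context fd_hopf begin

text \<open>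
  Slicing the commutation relation with \<open>\<chi> \<otimes> h\<close> gives an equation in \<open>Y\<close>. For \<open>\<chi> = 1\<close> and \<open>h = 1\<close>
  it is the identity of \<open>bc_cond\<close>. In general, coassociativity of the two coactions shows that it
  is this identity at \<open>(id \<otimes> \<chi> \<circ> S) (\<alpha> x)\<close> and \<open>(id \<otimes> h) (\<beta> y)\<close>.
\<close>

theorem bc_equation_iff:
  assumes Y: "alg Y" and \<alpha>: "\<alpha> \<in> lin_hom R Y (T Y K)" and \<beta>: "\<beta> \<in> lin_hom R Y (T Y L)"
    and ca: "\<And>y. y \<in> carrier Y \<Longrightarrow> tassoc R Y K K (tmap R (T Y K) K \<alpha> id (\<alpha> y)) = tmap R Y (T K K) id (comult K) (\<alpha> y)"
    and cb: "\<And>y. y \<in> carrier Y \<Longrightarrow> tassoc R Y L L (tmap R (T Y L) L \<beta> id (\<beta> y)) = tmap R Y (T L L) id (comult L) (\<beta> y)"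
    and ua: "\<And>y. y \<in> carrier Y \<Longrightarrow> tlift R Y (\<lambda>u k. \<epsilon> k \<odot>\<^bsub>Y\<^esub> u) (\<alpha> y) = y"
    and ub: "\<And>y. y \<in> carrier Y \<Longrightarrow> tlift R Y (\<lambda>u \<theta>. \<theta> \<one>\<^bsub>K\<^esub> \<odot>\<^bsub>Y\<^esub> u) (\<beta> y) = y"
  shows "(\<forall>x\<in>carrier Y. \<forall>y\<in>carrier Y.
      tmap R Y Heis id (\<lambda>k. ts K L (S k) \<one>\<^bsub>L\<^esub>) (\<alpha> x) \<otimes>\<^bsub>T Y Heis\<^esub> tmap R Y Heis id (\<lambda>\<theta>. ts K L \<one>\<^bsub>K\<^esub> \<theta>) (\<beta> y) =
      tmap R Y Heis id (\<lambda>\<theta>. ts K L \<one>\<^bsub>K\<^esub> \<theta>) (\<beta> y) \<otimes>\<^bsub>T Y Heis\<^esub> tmap R Y Heis id (\<lambda>k. ts K L (S k) \<one>\<^bsub>L\<^esub>) (\<alpha> x))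
    \<longleftrightarrow> bc_cond Y \<alpha> \<beta>"
proof -
  interpret D: fd_hopf R L by (rule dual_fd_hopf)
  note Yv = alg_vs[OF Y]
  note ac = lin_closed[OF \<alpha>] and bc = lin_closed[OF \<beta>]
  let ?F = "\<lambda>k. ts K L (S k) \<one>\<^bsub>L\<^esub>" and ?G = "\<lambda>\<theta>. ts K L \<one>\<^bsub>K\<^esub> \<theta>"
  have F: "?F \<in> lin_hom R K Heis" unfolding lin_Heis by (intro lin_tens_left antipode_lin) auto
  have G: "?G \<in> lin_hom R L Heis" unfolding lin_Heis by (intro lin_tens_right lin_id) auto
  let ?p = "\<lambda>x. tmap R Y Heis id ?F (\<alpha> x)" and ?q = "\<lambda>y. tmap R Y Heis id ?G (\<beta> y)"
  let ?l = "\<lambda>x y \<chi> h. tlift R Y (\<lambda>u k. tlift R Y (\<lambda>v \<theta>. (\<chi> (S k) \<otimes> \<theta> h) \<odot>\<^bsub>Y\<^esub> (u \<otimes>\<^bsub>Y\<^esub> v)) (\<beta> y)) (\<alpha> x)"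
  let ?s = "\<lambda>\<chi> h k \<theta>. sw (ground R) (\<lambda>a b. \<chi> (S b) \<otimes> \<theta> (S a \<cdot> h)) k"
  let ?r = "\<lambda>x y \<chi> h. tlift R Y (\<lambda>u k. tlift R Y (\<lambda>v \<theta>. ?s \<chi> h k \<theta> \<odot>\<^bsub>Y\<^esub> (v \<otimes>\<^bsub>Y\<^esub> u)) (\<beta> y)) (\<alpha> x)"
  let ?m = "\<lambda>x y. tlift R Y (\<lambda>u k. tlift R Y (\<lambda>v \<theta>. \<theta> (S k) \<odot>\<^bsub>Y\<^esub> (v \<otimes>\<^bsub>Y\<^esub> u)) (\<beta> y)) (\<alpha> x)"
  have pc: "?p x \<in> carrier (T Y Heis)" if "x \<in> carrier Y" for x
    using tmap_id_closed[OF Yv vs_K Heis_simps(2) F ac[OF that]] .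
  have qc: "?q x \<in> carrier (T Y Heis)" if "x \<in> carrier Y" for x
    using tmap_id_closed[OF Yv vs_L Heis_simps(2) G bc[OF that]] .
  have mult_closed: "s \<otimes>\<^bsub>T Y Heis\<^esub> t \<in> carrier (T Y Heis)" if s: "s \<in> carrier (T Y Heis)" and t: "t \<in> carrier (T Y Heis)" for s t
    unfolding tensor_mult using Y bil_closed[OF Heis_bil]
    by (intro tlift_closed[OF Yv Heis_simps(2) vs_tensor[OF Yv Heis_simps(2)] s]
          tlift_closed[OF Yv Heis_simps(2) vs_tensor[OF Yv Heis_simps(2)] t] ts_closed[OF Yv Heis_simps(2)]) auto
  have sep: "?p x \<otimes>\<^bsub>T Y Heis\<^esub> ?q y = ?q y \<otimes>\<^bsub>T Y Heis\<^esub> ?p x \<longleftrightarrow> (\<forall>\<chi>\<in>carrier L. \<forall>h\<in>carrier K. ?l x y \<chi> h = ?r x y \<chi> h)"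
    if x: "x \<in> carrier Y" and y: "y \<in> carrier Y" for x y
  proof -
    have e: "slice Y (fprod \<chi> (\<lambda>\<phi>. \<phi> h)) (?p x \<otimes>\<^bsub>T Y Heis\<^esub> ?q y) = ?l x y \<chi> h"
      "slice Y (fprod \<chi> (\<lambda>\<phi>. \<phi> h)) (?q y \<otimes>\<^bsub>T Y Heis\<^esub> ?p x) = ?r x y \<chi> h"
      if c: "\<chi> \<in> carrier L" and h: "h \<in> carrier K" for \<chi> h
    proof -
      let ?c = "fprod \<chi> (\<lambda>\<phi>. \<phi> h)"
      have lc: "?c \<in> lin_hom R Heis (ground R)"
        unfolding lin_Heis by (rule fprod_lin[OF vs_K vs_L dual_lin[OF c] lin_ev[OF h]])
      have "slice Y ?c (?p x \<otimes>\<^bsub>T Y Heis\<^esub> ?q y) =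
          tlift R Y (\<lambda>u k. tlift R Y (\<lambda>v \<theta>. ?c (?F k \<otimes>\<^bsub>Heis\<^esub> ?G \<theta>) \<odot>\<^bsub>Y\<^esub> (u \<otimes>\<^bsub>Y\<^esub> v)) (\<beta> y)) (\<alpha> x)"
        by (rule slice_tensor_mult[OF Y Heis_simps(2) Heis_bil vs_K vs_L F G lc ac[OF x] bc[OF y]])
      also have "\<dots> = ?l x y \<chi> h"
        using Y c h by (intro tlift_cong[OF Yv vs_K Yv ac[OF x]] tlift_cong[OF Yv vs_L Yv bc[OF y]] tlift_closed[OF Yv vs_L Yv bc[OF y]])
          (auto simp: Heis_mult_left fprod_tens dual_lin lin_ev)
      finally show "slice Y ?c (?p x \<otimes>\<^bsub>T Y Heis\<^esub> ?q y) = ?l x y \<chi> h" .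
      have "slice Y ?c (?q y \<otimes>\<^bsub>T Y Heis\<^esub> ?p x) =
          tlift R Y (\<lambda>v \<theta>. tlift R Y (\<lambda>u k. ?c (?G \<theta> \<otimes>\<^bsub>Heis\<^esub> ?F k) \<odot>\<^bsub>Y\<^esub> (v \<otimes>\<^bsub>Y\<^esub> u)) (\<alpha> x)) (\<beta> y)"
        by (rule slice_tensor_mult[OF Y Heis_simps(2) Heis_bil vs_L vs_K G F lc bc[OF y] ac[OF x]])
      also have "\<dots> = tlift R Y (\<lambda>v \<theta>. tlift R Y (\<lambda>u k. ?s \<chi> h k \<theta> \<odot>\<^bsub>Y\<^esub> (v \<otimes>\<^bsub>Y\<^esub> u)) (\<alpha> x)) (\<beta> y)"
        using Y c h by (intro tlift_cong[OF Yv vs_K Yv ac[OF x]] tlift_cong[OF Yv vs_L Yv bc[OF y]] tlift_closed[OF Yv vs_K Yv ac[OF x]])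
          (auto simp: Heis_mult_right)
      also have "\<dots> = ?r x y \<chi> h"
        using Y c h by (intro tlift_swap[OF Yv vs_L Yv vs_K Yv bc[OF y] ac[OF x]]) auto
      finally show "slice Y ?c (?q y \<otimes>\<^bsub>T Y Heis\<^esub> ?p x) = ?r x y \<chi> h" .
    qed
    have co: "coords Heis (basis \<times> basis) (\<lambda>p. ts K L (fst p) (coord (snd p))) (\<lambda>p. fprod (coord (fst p)) (\<lambda>\<theta>. \<theta> (snd p)))"
      using coords_tensor[OF vs_K vs_L coords_K coords_L] lin_part_Heis
      unfolding coords_def lin_Heis Heis_simps finsum_lin_part[OF lin_part_Heis] by (simp add: lin_part_def)
    show ?thesis
    proof (intro iffI ballI)
      fix \<chi> h assume "?p x \<otimes>\<^bsub>T Y Heis\<^esub> ?q y = ?q y \<otimes>\<^bsub>T Y Heis\<^esub> ?p x" "\<chi> \<in> carrier L" "h \<in> carrier K"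
      then show "?l x y \<chi> h = ?r x y \<chi> h" using e[of \<chi> h] by simp
    next
      assume a: "\<forall>\<chi>\<in>carrier L. \<forall>h\<in>carrier K. ?l x y \<chi> h = ?r x y \<chi> h"
      show "?p x \<otimes>\<^bsub>T Y Heis\<^esub> ?q y = ?q y \<otimes>\<^bsub>T Y Heis\<^esub> ?p x"
      proof (rule tensor_eqI[OF Yv Heis_simps(2) co mult_closed[OF pc[OF x] qc[OF y]] mult_closed[OF qc[OF y] pc[OF x]]])
        fix i assume "i \<in> basis \<times> basis"
        then have i: "coord (fst i) \<in> carrier L" "snd i \<in> carrier K" by auto
        show "slice Y (fprod (coord (fst i)) (\<lambda>\<theta>. \<theta> (snd i))) (?p x \<otimes>\<^bsub>T Y Heis\<^esub> ?q y) =
          slice Y (fprod (coord (fst i)) (\<lambda>\<theta>. \<theta> (snd i))) (?q y \<otimes>\<^bsub>T Y Heis\<^esub> ?p x)"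
          unfolding e[OF i] using a i by blast
      qed
    qed
  qed
  have left: "?l x y \<chi> h = slice Y (\<lambda>k. \<chi> (S k)) (\<alpha> x) \<otimes>\<^bsub>Y\<^esub> slice Y (\<lambda>\<theta>. \<theta> h) (\<beta> y)"
    if x: "x \<in> carrier Y" and y: "y \<in> carrier Y" and c: "\<chi> \<in> carrier L" and h: "h \<in> carrier K" for x y \<chi> h
  proof -
    let ?y = "slice Y (\<lambda>\<theta>. \<theta> h) (\<beta> y)"
    have yc: "?y \<in> carrier Y" by (rule lin_closed[OF slice_lin[OF Yv vs_L lin_ev[OF h]] bc[OF y]])
    have "?l x y \<chi> h = tlift R Y (\<lambda>u k. (\<chi> (S k) \<odot>\<^bsub>Y\<^esub> u) \<otimes>\<^bsub>Y\<^esub> ?y) (\<alpha> x)"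
    proof (rule tlift_cong[OF Yv vs_K Yv ac[OF x]])
      fix u k assume u: "u \<in> carrier Y" and k: "k \<in> carrier K"
      have uc: "\<chi> (S k) \<odot>\<^bsub>Y\<^esub> u \<in> carrier Y" using u k c Yv by simp
      have "(\<chi> (S k) \<odot>\<^bsub>Y\<^esub> u) \<otimes>\<^bsub>Y\<^esub> ?y = tlift R Y (\<lambda>v \<theta>. (\<chi> (S k) \<odot>\<^bsub>Y\<^esub> u) \<otimes>\<^bsub>Y\<^esub> (\<theta> h \<odot>\<^bsub>Y\<^esub> v)) (\<beta> y)"
        unfolding slice_def using uc h Yv
        by (intro lin_tlift[OF Yv vs_L Yv Yv lin_mult_right[OF Y lin_id uc] bc[OF y]]) auto
      also have "\<dots> = tlift R Y (\<lambda>v \<theta>. (\<chi> (S k) \<otimes> \<theta> h) \<odot>\<^bsub>Y\<^esub> (u \<otimes>\<^bsub>Y\<^esub> v)) (\<beta> y)"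
        using Y u k c h by (intro tlift_cong[OF Yv vs_L Yv bc[OF y]]) (auto simp: alg_smult vs_smult_smult m_comm)
      finally show "tlift R Y (\<lambda>v \<theta>. (\<chi> (S k) \<otimes> \<theta> h) \<odot>\<^bsub>Y\<^esub> (u \<otimes>\<^bsub>Y\<^esub> v)) (\<beta> y) = (\<chi> (S k) \<odot>\<^bsub>Y\<^esub> u) \<otimes>\<^bsub>Y\<^esub> ?y" ..
    qed (use Y c yc in auto)
    also have "\<dots> = slice Y (\<lambda>k. \<chi> (S k)) (\<alpha> x) \<otimes>\<^bsub>Y\<^esub> ?y"
      unfolding slice_def[of Y "\<lambda>k. \<chi> (S k)"] using Yv c
      by (intro lin_tlift[OF Yv vs_K Yv Yv lin_mult_left[OF Y lin_id yc] ac[OF x], symmetric]) auto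
    finally show ?thesis .
  qed
  have right: "?r x y \<chi> h = ?m (slice Y (\<lambda>k. \<chi> (S k)) (\<alpha> x)) (slice Y (\<lambda>\<theta>. \<theta> h) (\<beta> y))"
    if x: "x \<in> carrier Y" and y: "y \<in> carrier Y" and c: "\<chi> \<in> carrier L" and h: "h \<in> carrier K" for x y \<chi> h
  proof -
    let ?x = "slice Y (\<lambda>k. \<chi> (S k)) (\<alpha> x)" and ?y = "slice Y (\<lambda>\<theta>. \<theta> h) (\<beta> y)"
    have cS: "(\<lambda>k. \<chi> (S k)) \<in> lin_hom R K (ground R)" by (intro lin_dual c antipode_lin)
    have xc: "?x \<in> carrier Y" by (rule lin_closed[OF slice_lin[OF Yv vs_K cS] ac[OF x]])
    \<comment> \<open>The inner sum after \<open>\<beta>\<close> has absorbed \<open>h\<close>; the functional \<open>\<chi> \<circ> S\<close> is absorbed into \<open>\<alpha>\<close> next.\<close>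
    let ?g = "\<lambda>u k. tlift R Y (\<lambda>v \<theta>. \<theta> (S k \<cdot> h) \<odot>\<^bsub>Y\<^esub> (v \<otimes>\<^bsub>Y\<^esub> u)) (\<beta> y)"
    have "?m ?x ?y = tlift R Y ?g (\<alpha> ?x)"
    proof (rule tlift_cong[OF Yv vs_K Yv ac[OF xc]])
      fix u k assume u: "u \<in> carrier Y" and k: "k \<in> carrier K"
      have "tlift R Y (\<lambda>v \<theta>. \<theta> (S k) \<odot>\<^bsub>Y\<^esub> (v \<otimes>\<^bsub>Y\<^esub> u)) (\<beta> ?y) =
          tlift R Y (\<lambda>v \<theta>. tlift R Y (\<lambda>\<theta>1 \<theta>2. \<theta>2 h \<odot>\<^bsub>Y\<^esub> (\<theta>1 (S k) \<odot>\<^bsub>Y\<^esub> (v \<otimes>\<^bsub>Y\<^esub> u))) (comult L \<theta>)) (\<beta> y)"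
        using Y u k
        by (intro coaction_slice[OF Yv vs_L Yv dual_comult_lin \<beta> cb[OF y] y _ lin_ev[OF h]]
            bilI lin_smult_const lin_scalar lin_mult_left lin_ev lin_id) auto
      also have "\<dots> = ?g u k"
      proof (rule tlift_cong[OF Yv vs_L Yv bc[OF y]])
        fix v \<theta> assume v: "v \<in> carrier Y" and t: "\<theta> \<in> carrier L"
        note Dt = dual_comult(1)[OF t]
        have vu: "v \<otimes>\<^bsub>Y\<^esub> u \<in> carrier Y" using Y u v by simp
        have "tlift R Y (\<lambda>\<theta>1 \<theta>2. \<theta>2 h \<odot>\<^bsub>Y\<^esub> (\<theta>1 (S k) \<odot>\<^bsub>Y\<^esub> (v \<otimes>\<^bsub>Y\<^esub> u))) (comult L \<theta>) =
            tlift R Y (\<lambda>\<theta>1 \<theta>2. (\<theta>1 (S k) \<otimes> \<theta>2 h) \<odot>\<^bsub>Y\<^esub> (v \<otimes>\<^bsub>Y\<^esub> u)) (comult L \<theta>)"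
          using Yv vu h k by (intro tlift_cong[OF vs_L vs_L Yv Dt]) (auto simp: vs_smult_smult m_comm)
        also have "\<dots> = tlift R (ground R) (\<lambda>\<theta>1 \<theta>2. \<theta>1 (S k) \<otimes> \<theta>2 h) (comult L \<theta>) \<odot>\<^bsub>Y\<^esub> (v \<otimes>\<^bsub>Y\<^esub> u)"
          using h k by (intro lin_tlift[OF vs_L vs_L vs_ground Yv lin_scalar[OF Yv vu lin_id] Dt, symmetric]) auto
        finally show "tlift R Y (\<lambda>\<theta>1 \<theta>2. \<theta>2 h \<odot>\<^bsub>Y\<^esub> (\<theta>1 (S k) \<odot>\<^bsub>Y\<^esub> (v \<otimes>\<^bsub>Y\<^esub> u))) (comult L \<theta>) =
            \<theta> (S k \<cdot> h) \<odot>\<^bsub>Y\<^esub> (v \<otimes>\<^bsub>Y\<^esub> u)"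
          using dual_sw[OF t _ h, of "S k"] k by simp
      qed (use Y u k h in auto)
      finally show "tlift R Y (\<lambda>v \<theta>. \<theta> (S k) \<odot>\<^bsub>Y\<^esub> (v \<otimes>\<^bsub>Y\<^esub> u)) (\<beta> ?y) = ?g u k" .
      show "?g u k \<in> carrier Y" using Y u k h by (intro tlift_closed[OF Yv vs_L Yv bc[OF y]]) auto
    qed
    also have "\<dots> = tlift R Y (\<lambda>u k. sw Y (\<lambda>a b. \<chi> (S b) \<odot>\<^bsub>Y\<^esub> ?g u a) k) (\<alpha> x)"
      using Y h
      by (intro coaction_slice[OF Yv vs_K Yv comult_lin \<alpha> ca[OF x] x _ cS] bilI lin_tlift_param[OF Yv vs_L Yv bc[OF y]]
          lin_smult_const lin_scalar lin_mult_left lin_mult_right lin_dual lin_antipode lin_id antipode_lin) auto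
    also have "\<dots> = ?r x y \<chi> h"
    proof (rule tlift_cong[OF Yv vs_K Yv ac[OF x]])
      fix u k assume u: "u \<in> carrier Y" and k: "k \<in> carrier K"
      have "sw Y (\<lambda>a b. \<chi> (S b) \<odot>\<^bsub>Y\<^esub> ?g u a) k =
          sw Y (\<lambda>a b. tlift R Y (\<lambda>v \<theta>. (\<chi> (S b) \<otimes> \<theta> (S a \<cdot> h)) \<odot>\<^bsub>Y\<^esub> (v \<otimes>\<^bsub>Y\<^esub> u)) (\<beta> y)) k"
      proof (rule sw_cong[OF Yv k])
        fix a b assume a: "a \<in> carrier K" "b \<in> carrier K"
        have "\<chi> (S b) \<odot>\<^bsub>Y\<^esub> ?g u a =
            tlift R Y (\<lambda>v \<theta>. \<chi> (S b) \<odot>\<^bsub>Y\<^esub> (\<theta> (S a \<cdot> h) \<odot>\<^bsub>Y\<^esub> (v \<otimes>\<^bsub>Y\<^esub> u))) (\<beta> y)"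
          using Y a c h u by (intro lin_tlift[OF Yv vs_L Yv Yv lin_smult_const[OF Yv _ lin_id] bc[OF y]]) auto
        also have "\<dots> = tlift R Y (\<lambda>v \<theta>. (\<chi> (S b) \<otimes> \<theta> (S a \<cdot> h)) \<odot>\<^bsub>Y\<^esub> (v \<otimes>\<^bsub>Y\<^esub> u)) (\<beta> y)"
          using Y a c h u by (intro tlift_cong[OF Yv vs_L Yv bc[OF y]]) (auto simp: vs_smult_smult)
        finally show "\<chi> (S b) \<odot>\<^bsub>Y\<^esub> ?g u a =
          tlift R Y (\<lambda>v \<theta>. (\<chi> (S b) \<otimes> \<theta> (S a \<cdot> h)) \<odot>\<^bsub>Y\<^esub> (v \<otimes>\<^bsub>Y\<^esub> u)) (\<beta> y)" .
        show "tlift R Y (\<lambda>v \<theta>. (\<chi> (S b) \<otimes> \<theta> (S a \<cdot> h)) \<odot>\<^bsub>Y\<^esub> (v \<otimes>\<^bsub>Y\<^esub> u)) (\<beta> y) \<in> carrier Y"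
          using Y a c h u by (intro tlift_closed[OF Yv vs_L Yv bc[OF y]]) auto
      qed
      also have "\<dots> = tlift R Y (\<lambda>v \<theta>. sw Y (\<lambda>a b. (\<chi> (S b) \<otimes> \<theta> (S a \<cdot> h)) \<odot>\<^bsub>Y\<^esub> (v \<otimes>\<^bsub>Y\<^esub> u)) k) (\<beta> y)"
        using Y c h u k by (intro tlift_swap[OF vs_K vs_K Yv vs_L Yv structure_closed(1)[OF k] bc[OF y]]) auto
      also have "\<dots> = tlift R Y (\<lambda>v \<theta>. ?s \<chi> h k \<theta> \<odot>\<^bsub>Y\<^esub> (v \<otimes>\<^bsub>Y\<^esub> u)) (\<beta> y)"
        using Y c h u k
        by (intro tlift_cong[OF Yv vs_L Yv bc[OF y]] sw_push[OF lin_scalar[OF Yv _ lin_id], symmetric]) auto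
      finally show "sw Y (\<lambda>a b. \<chi> (S b) \<odot>\<^bsub>Y\<^esub> ?g u a) k = tlift R Y (\<lambda>v \<theta>. ?s \<chi> h k \<theta> \<odot>\<^bsub>Y\<^esub> (v \<otimes>\<^bsub>Y\<^esub> u)) (\<beta> y)" .
      show "tlift R Y (\<lambda>v \<theta>. ?s \<chi> h k \<theta> \<odot>\<^bsub>Y\<^esub> (v \<otimes>\<^bsub>Y\<^esub> u)) (\<beta> y) \<in> carrier Y"
        using Y c h u k by (intro tlift_closed[OF Yv vs_L Yv bc[OF y]]) auto
    qed
    finally show ?thesis ..
  qed
  have sc: "slice Y (\<lambda>k. \<chi> (S k)) (\<alpha> x) \<in> carrier Y" "slice Y (\<lambda>\<theta>. \<theta> h) (\<beta> y) \<in> carrier Y"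
    if "x \<in> carrier Y" "y \<in> carrier Y" "\<chi> \<in> carrier L" "h \<in> carrier K" for x y \<chi> h
    using that lin_closed[OF slice_lin[OF Yv vs_K lin_dual[OF _ antipode_lin]] ac]
      lin_closed[OF slice_lin[OF Yv vs_L lin_ev] bc] by auto
  have s1: "slice Y (\<lambda>k. \<one>\<^bsub>L\<^esub> (S k)) (\<alpha> x) = x" if x: "x \<in> carrier Y" for x
  proof -
    have "slice Y (\<lambda>k. \<one>\<^bsub>L\<^esub> (S k)) (\<alpha> x) = tlift R Y (\<lambda>u k. \<epsilon> k \<odot>\<^bsub>Y\<^esub> u) (\<alpha> x)"
      unfolding slice_def using Yv by (intro tlift_cong[OF Yv vs_K Yv ac[OF x]]) auto
    then show ?thesis using ua[OF x] by simp
  qed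
  have s2: "slice Y (\<lambda>\<theta>. \<theta> \<one>\<^bsub>K\<^esub>) (\<beta> y) = y" if "y \<in> carrier Y" for y
    using ub[OF that] by (simp add: slice_def)
  have "(\<forall>x\<in>carrier Y. \<forall>y\<in>carrier Y. ?p x \<otimes>\<^bsub>T Y Heis\<^esub> ?q y = ?q y \<otimes>\<^bsub>T Y Heis\<^esub> ?p x) \<longleftrightarrow>
      (\<forall>x\<in>carrier Y. \<forall>y\<in>carrier Y. \<forall>\<chi>\<in>carrier L. \<forall>h\<in>carrier K. ?l x y \<chi> h = ?r x y \<chi> h)"
    by (intro ball_cong refl sep)
  also have "\<dots> \<longleftrightarrow> bc_cond Y \<alpha> \<beta>"
    unfolding bc_cond_def
  proof (intro iffI ballI)
    fix x y assume a: "\<forall>x\<in>carrier Y. \<forall>y\<in>carrier Y. \<forall>\<chi>\<in>carrier L. \<forall>h\<in>carrier K. ?l x y \<chi> h = ?r x y \<chi> h"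
      and x: "x \<in> carrier Y" and y: "y \<in> carrier Y"
    have "?l x y \<one>\<^bsub>L\<^esub> \<one>\<^bsub>K\<^esub> = ?r x y \<one>\<^bsub>L\<^esub> \<one>\<^bsub>K\<^esub>" using a x y alg_closed(2)[OF alg_L] alg_closed(2)[OF alg_K] by blast
    then show "x \<otimes>\<^bsub>Y\<^esub> y = ?m x y"
      unfolding left[OF x y alg_closed(2)[OF alg_L] alg_closed(2)[OF alg_K]]
        right[OF x y alg_closed(2)[OF alg_L] alg_closed(2)[OF alg_K]] s1[OF x] s2[OF y] .
  next
    fix x y \<chi> h assume a: "\<forall>x\<in>carrier Y. \<forall>y\<in>carrier Y. x \<otimes>\<^bsub>Y\<^esub> y = ?m x y"
      and x: "x \<in> carrier Y" and y: "y \<in> carrier Y" and c: "\<chi> \<in> carrier L" and h: "h \<in> carrier K"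
    show "?l x y \<chi> h = ?r x y \<chi> h"
      unfolding left[OF x y c h] right[OF x y c h] using a sc[OF x y c h] by blast
  qed
  finally show ?thesis .
qed

end

section \<open>Opposite coactions\<close>

context field begin

text \<open>
  The opposite coaction reads the same coset in a tensor product with the same linear part.
\<close>

lemma op_coaction_eq:
  assumes X: "vs X" and L: "vs L" and K: "lin_part K = lin_part L" and t: "\<alpha> x \<in> carrier (T X K)"
  shows "op_coaction R L X \<alpha> x = \<alpha> x"
proof -
  have e: "lin_part (T (op_alg X) L) = lin_part (T X L)" "lin_part (T X K) = lin_part (T X L)"
    by (intro tensor_lin_part lin_part_op K refl)+
  have e2: "ts (op_alg X) L = ts X L" by (intro tens_lin_part lin_part_op refl)
  have "\<alpha> x \<in> carrier (T X L)" using t e(2) by (simp add: lin_part_def)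
  from tlift_eta[OF X L this] show ?thesis
    by (simp add: op_coaction_def tlift_lin_part[OF e(1)] e2)
qed

text \<open>
  Exchanging the two Sweedler sums in the product of \<open>A \<otimes> B\<close> reverses both products at once.
\<close>

lemma tensor_mult_flip:
  assumes A: "alg A" and B: "alg B" and lA: "lin_part A' = lin_part A" and lB: "lin_part B' = lin_part B"
    and mA: "\<And>x y. x \<otimes>\<^bsub>A'\<^esub> y = y \<otimes>\<^bsub>A\<^esub> x" and mB: "\<And>x y. x \<otimes>\<^bsub>B'\<^esub> y = y \<otimes>\<^bsub>B\<^esub> x"
    and s: "s \<in> carrier (T A B)" and t: "t \<in> carrier (T A B)"
  shows "s \<otimes>\<^bsub>T A' B'\<^esub> t = t \<otimes>\<^bsub>T A B\<^esub> s"
  unfolding tensor_mult mA mB tlift_lin_part[OF tensor_lin_part[OF lA lB]] tens_lin_part[OF lA lB]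
  using A B by (intro tlift_swap[OF _ _ _ _ _ s t]) auto

lemma right_coaction_linD:
  assumes "right_coaction R K Y \<alpha>"
  shows "\<alpha> \<in> lin_hom R Y (T Y K)"
    and "y \<in> carrier Y \<Longrightarrow> tassoc R Y K K (tmap R (T Y K) K \<alpha> id (\<alpha> y)) = tmap R Y (T K K) id (comult K) (\<alpha> y)"
    and "y \<in> carrier Y \<Longrightarrow> tlift R Y (\<lambda>u k. counit K k \<odot>\<^bsub>Y\<^esub> u) (\<alpha> y) = y"
  using assms by (auto simp: right_coaction_def alg_hom_def)

lemma right_coaction_op:
  assumes Y: "alg Y" and K: "alg K" and l: "lin_part K' = lin_part K"
    and m: "\<And>x y. x \<otimes>\<^bsub>K'\<^esub> y = y \<otimes>\<^bsub>K\<^esub> x" and one: "\<one>\<^bsub>K'\<^esub> = \<one>\<^bsub>K\<^esub>"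
    and D: "comult K' = comult K" and e: "counit K' = counit K"
    and c: "right_coaction R K Y \<alpha>" and eq: "\<And>y. y \<in> carrier Y \<Longrightarrow> \<alpha>' y = \<alpha> y"
  shows "right_coaction R K' (op_alg Y) \<alpha>'"
proof -
  note Yv = alg_vs[OF Y] and Kv = alg_vs[OF K]
  note lin = right_coaction_linD(1)[OF c]
  have rh: "\<alpha> \<in> ring_hom Y (T Y K)" using c by (simp add: right_coaction_def alg_hom_def)
  note lY = lin_part_op(1)[of Y]
  have lT: "lin_part (T (op_alg Y) K') = lin_part (T Y K)" by (intro tensor_lin_part lY l)
  have cT: "carrier (T (op_alg Y) K') = carrier (T Y K)" "add (T (op_alg Y) K') = add (T Y K)"
    using lT by (simp_all add: lin_part_def)
  have ac: "\<alpha> y \<in> carrier (T Y K)" if "y \<in> carrier Y" for y using lin_closed[OF lin that] .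
  have lin': "\<alpha>' \<in> lin_hom R (op_alg Y) (T (op_alg Y) K')"
    unfolding lin_hom_lin_part[OF lY lT] by (rule lin_hom_cong[OF lin Yv]) (simp add: eq)
  have "\<alpha>' \<in> ring_hom (op_alg Y) (T (op_alg Y) K')"
  proof (rule ring_hom_memI)
    show "\<alpha>' x \<in> carrier (T (op_alg Y) K')" if "x \<in> carrier (op_alg Y)" for x by (rule lin_closed[OF lin' that])
  next
    fix x y assume xy: "x \<in> carrier (op_alg Y)" "y \<in> carrier (op_alg Y)"
    show "\<alpha>' (x \<oplus>\<^bsub>op_alg Y\<^esub> y) = \<alpha>' x \<oplus>\<^bsub>T (op_alg Y) K'\<^esub> \<alpha>' y" by (rule lin_plus[OF lin' xy])
    have "\<alpha> (y \<otimes>\<^bsub>Y\<^esub> x) = \<alpha> y \<otimes>\<^bsub>T Y K\<^esub> \<alpha> x" using rh xy by (simp add: ring_hom_def)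
    also have "\<dots> = \<alpha> x \<otimes>\<^bsub>T (op_alg Y) K'\<^esub> \<alpha> y"
      using xy by (intro tensor_mult_flip[OF Y K lY l _ m ac ac, symmetric]) auto
    finally show "\<alpha>' (x \<otimes>\<^bsub>op_alg Y\<^esub> y) = \<alpha>' x \<otimes>\<^bsub>T (op_alg Y) K'\<^esub> \<alpha>' y" using xy Y by (simp add: eq)
  next
    have "\<alpha> \<one>\<^bsub>Y\<^esub> = \<one>\<^bsub>T Y K\<^esub>" using rh by (simp add: ring_hom_def)
    then show "\<alpha>' \<one>\<^bsub>op_alg Y\<^esub> = \<one>\<^bsub>T (op_alg Y) K'\<^esub>"
      using Y by (simp add: eq tensor_one one tens_lin_part[OF lY l])
  qed
  moreover have "tassoc R (op_alg Y) K' K' (tmap R (T (op_alg Y) K') K' \<alpha>' id (\<alpha>' y)) =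
      tmap R (op_alg Y) (T K' K') id (comult K') (\<alpha>' y)" if y: "y \<in> carrier Y" for y
  proof -
    have "tmap R (T Y K) K \<alpha>' id (\<alpha> y) = tmap R (T Y K) K \<alpha> id (\<alpha> y)"
      by (rule tmap_cong[OF Yv Kv vs_tensor[OF Yv Kv] Kv lin lin_hom_id eq refl ac[OF y]])
    then show ?thesis
      using right_coaction_linD(2)[OF c y]
      unfolding tassoc_lin_part[OF lY l l] tmap_lin_part[OF lT l] tmap_lin_part[OF lY tensor_lin_part[OF l l]]
        D eq[OF y] by simp
  qed
  moreover have "tlift R (op_alg Y) (\<lambda>u k. counit K' k \<odot>\<^bsub>op_alg Y\<^esub> u) (\<alpha>' y) = y" if y: "y \<in> carrier Y" for y
    using right_coaction_linD(3)[OF c y] by (simp add: eq[OF y] e tlift_lin_part[OF lY])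
  ultimately show ?thesis using lin' by (simp add: right_coaction_def alg_hom_def)
qed

lemma tassoc_natural:
  assumes U: "vs U" and V: "vs V" and W: "vs W" and U': "vs U'" and V': "vs V'" and W': "vs W'"
    and f: "f \<in> lin_hom R U U'" and g: "g \<in> lin_hom R V V'" and h: "h \<in> lin_hom R W W'"
    and t: "t \<in> carrier (T (T U V) W)"
  shows "tassoc R U' V' W' (tmap R (T U' V') W' (tmap R U' V' f g) h t) =
    tmap R U' (T V' W') f (tmap R V' W' g h) (tassoc R U V W t)"
proof -
  note vUV = vs_tensor[OF U V] and vVW = vs_tensor[OF V W] and vUV' = vs_tensor[OF U' V'] and vVW' = vs_tensor[OF V' W']
  note vt = vs_tensor[OF U' vVW']
  note fg = tmap_lin[OF U V U' V' f g] and gh = tmap_lin[OF V W V' W' g h]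
  note fc = lin_closed[OF f] and gc = lin_closed[OF g] and hc = lin_closed[OF h]
  have asl: "tassoc R U V W (ts (T U V) W (ts U V a b) c) = ts U (T V W) a (ts V W b c)"
    if "a \<in> carrier U" "b \<in> carrier V" "c \<in> carrier W" for a b c
    unfolding tassoc_def Let_def using that U V W
      tlift_tens[OF vUV W vs_tensor[OF U vVW] bil_tril_left[OF U V W vs_tensor[OF U vVW] tril_tens[OF U V W]]]
      tlift_tens[OF U V vs_tensor[OF U vVW] tril_lin(5)[OF tril_tens[OF U V W]]] by simp
  have asl': "tassoc R U' V' W' (ts (T U' V') W' (ts U' V' a b) c) = ts U' (T V' W') a (ts V' W' b c)"
    if "a \<in> carrier U'" "b \<in> carrier V'" "c \<in> carrier W'" for a b c
    unfolding tassoc_def Let_def using that U' V' W'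
      tlift_tens[OF vUV' W' vt bil_tril_left[OF U' V' W' vt tril_tens[OF U' V' W']]]
      tlift_tens[OF U' V' vt tril_lin(5)[OF tril_tens[OF U' V' W']]] by simp
  have L: "(\<lambda>t. tassoc R U' V' W' (tmap R (T U' V') W' (tmap R U' V' f g) h t)) \<in> lin_hom R (T (T U V) W) (T U' (T V' W'))"
    by (rule lin_comp[OF tassoc_lin[OF U' V' W'] tmap_lin[OF vUV W vUV' W' fg h]])
  have M: "(\<lambda>t. tmap R U' (T V' W') f (tmap R V' W' g h) (tassoc R U V W t)) \<in> lin_hom R (T (T U V) W) (T U' (T V' W'))"
    by (rule lin_comp[OF tmap_lin[OF U vVW U' vVW' f gh] tassoc_lin[OF U V W]])
  show ?thesis
  proof (rule lin_eq_on_tens[OF vUV W t vt L M])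
    fix s w assume s: "s \<in> carrier (T U V)" and w: "w \<in> carrier W"
    have cs: "ts (T U V) W s w \<in> carrier (T (T U V) W)" if "s \<in> carrier (T U V)" for s using that w vUV W by simp
    note tl = ts_lin_left0[OF vUV W w]
    show "tassoc R U' V' W' (tmap R (T U' V') W' (tmap R U' V' f g) h (ts (T U V) W s w)) =
        tmap R U' (T V' W') f (tmap R V' W' g h) (tassoc R U V W (ts (T U V) W s w))"
    proof (rule lin_eq_on_tens[OF U V s vt lin_comp[OF L tl] lin_comp[OF M tl]])
      fix u v assume u: "u \<in> carrier U" and v: "v \<in> carrier V"
      show "tassoc R U' V' W' (tmap R (T U' V') W' (tmap R U' V' f g) h (ts (T U V) W (ts U V u v) w)) =
        tmap R U' (T V' W') f (tmap R V' W' g h) (tassoc R U V W (ts (T U V) W (ts U V u v) w))"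
        using u v w U V W fc gc hc
        by (simp add: asl asl' tmap_tens[OF vUV W vUV' W' fg h] tmap_tens[OF U V U' V' f g]
            tmap_tens[OF U vVW U' vVW' f gh] tmap_tens[OF V W V' W' g h])
    qed
  qed
qed

lemma tmap_mult:
  assumes Y: "alg Y" and A: "alg A" and B: "alg B" and f: "f \<in> alg_hom R A B"
    and s: "s \<in> carrier (T Y A)" and t: "t \<in> carrier (T Y A)"
  shows "tmap R Y B id f (s \<otimes>\<^bsub>T Y A\<^esub> t) = tmap R Y B id f s \<otimes>\<^bsub>T Y B\<^esub> tmap R Y B id f t"
proof -
  note v = alg_vs[OF Y] alg_vs[OF A] alg_vs[OF B]
  have fl: "f \<in> lin_hom R A B" and fm: "\<And>x y. x \<in> carrier A \<Longrightarrow> y \<in> carrier A \<Longrightarrow> f (x \<otimes>\<^bsub>A\<^esub> y) = f x \<otimes>\<^bsub>B\<^esub> f y"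
    using f by (auto simp: alg_hom_def ring_hom_def)
  note tm = tmap_lin[OF v(1,2) v(1,3) lin_hom_id fl]
  note tc = lin_closed[OF tm]
  note mA = alg_bil[OF alg_tensor[OF Y A]] and mB = alg_bil[OF alg_tensor[OF Y B]]
  show ?thesis
  proof (rule bil_eq_on_tens[OF v(1,2) v(1,2) vs_tensor[OF v(1,3)] _ _ _ s t])
    show "bil (T Y A) (T Y A) (T Y B) (\<lambda>s t. tmap R Y B id f (s \<otimes>\<^bsub>T Y A\<^esub> t))"
      by (intro bilI lin_comp[OF tm] bil_left[OF mA] bil_right[OF mA])
    show "bil (T Y A) (T Y A) (T Y B) (\<lambda>s t. tmap R Y B id f s \<otimes>\<^bsub>T Y B\<^esub> tmap R Y B id f t)"
      by (rule bil_comp[OF mB tm tm])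
    fix a b a' b' assume "a \<in> carrier Y" "b \<in> carrier A" "a' \<in> carrier Y" "b' \<in> carrier A"
    then show "tmap R Y B id f (ts Y A a b \<otimes>\<^bsub>T Y A\<^esub> ts Y A a' b') = tmap R Y B id f (ts Y A a b) \<otimes>\<^bsub>T Y B\<^esub> tmap R Y B id f (ts Y A a' b')"
      using Y A B lin_closed[OF fl] by (simp add: tmap_tens[OF v(1,2) v(1,3) lin_hom_id fl] fm)
  qed
qed

text \<open>A coaction can be composed with a homomorphism of bialgebras.\<close>

lemma right_coaction_push:
  assumes Y: "alg Y" and K: "alg K" and K': "alg K'" and f: "f \<in> alg_hom R K K'"
    and Dl: "comult K \<in> lin_hom R K (T K K)" and Dl': "comult K' \<in> lin_hom R K' (T K' K')"
    and D: "\<And>k. k \<in> carrier K \<Longrightarrow> comult K' (f k) = tmap R K' K' f f (comult K k)"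
    and el: "counit K' \<in> lin_hom R K' (ground R)"
    and e: "\<And>k. k \<in> carrier K \<Longrightarrow> counit K' (f k) = counit K k"
    and c: "right_coaction R K Y \<alpha>"
  shows "right_coaction R K' Y (\<lambda>y. tmap R Y K' id f (\<alpha> y))"
proof -
  let ?a = "\<lambda>y. tmap R Y K' id f (\<alpha> y)"
  note v = alg_vs[OF Y] alg_vs[OF K] alg_vs[OF K']
  have fl: "f \<in> lin_hom R K K'" and f1: "f \<one>\<^bsub>K\<^esub> = \<one>\<^bsub>K'\<^esub>"
    using f by (auto simp: alg_hom_def ring_hom_def)
  note lin = right_coaction_linD(1)[OF c]
  note tm = tmap_lin[OF v(1,2) v(1,3) lin_hom_id fl]
  have lin': "?a \<in> lin_hom R Y (T Y K')" by (rule lin_comp[OF tm lin])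
  have rh: "\<alpha> \<in> ring_hom Y (T Y K)" using c by (simp add: right_coaction_def alg_hom_def)
  note ac = lin_closed[OF lin]
  have "?a \<in> ring_hom Y (T Y K')"
  proof (rule ring_hom_memI)
    show "?a x \<in> carrier (T Y K')" if "x \<in> carrier Y" for x by (rule lin_closed[OF lin' that])
  next
    fix x y assume xy: "x \<in> carrier Y" "y \<in> carrier Y"
    show "?a (x \<oplus>\<^bsub>Y\<^esub> y) = ?a x \<oplus>\<^bsub>T Y K'\<^esub> ?a y" by (rule lin_plus[OF lin' xy])
    have "\<alpha> (x \<otimes>\<^bsub>Y\<^esub> y) = \<alpha> x \<otimes>\<^bsub>T Y K\<^esub> \<alpha> y" using rh xy by (simp add: ring_hom_def)
    then show "?a (x \<otimes>\<^bsub>Y\<^esub> y) = ?a x \<otimes>\<^bsub>T Y K'\<^esub> ?a y"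
      using tmap_mult[OF Y K K' f ac[OF xy(1)] ac[OF xy(2)]] by simp
  next
    have "\<alpha> \<one>\<^bsub>Y\<^esub> = \<one>\<^bsub>T Y K\<^esub>" using rh by (simp add: ring_hom_def)
    then show "?a \<one>\<^bsub>Y\<^esub> = \<one>\<^bsub>T Y K'\<^esub>"
      using Y K by (simp add: tensor_one tmap_tens[OF v(1,2) v(1,3) lin_hom_id fl] f1)
  qed
  moreover have "tassoc R Y K' K' (tmap R (T Y K') K' ?a id (?a y)) = tmap R Y (T K' K') id (comult K') (?a y)"
    if y: "y \<in> carrier Y" for y
  proof -
    note vYK = vs_tensor[OF v(1,2)] and vYK' = vs_tensor[OF v(1,3)] and vKK = vs_tensor[OF v(2,2)] and vKK' = vs_tensor[OF v(3,3)]
    note ff = tmap_lin[OF v(2,2) v(3,3) fl fl]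
    have m: "tmap R (T Y K) K \<alpha> id (\<alpha> y) \<in> carrier (T (T Y K) K)"
      by (rule lin_closed[OF tmap_lin[OF v(1,2) vYK v(2) lin lin_hom_id] ac[OF y]])
    have "tmap R (T Y K') K' ?a id (?a y) = tmap R (T Y K') K' (\<lambda>y. ?a (id y)) (\<lambda>k. id (f k)) (\<alpha> y)"
      by (rule tmap_comp[OF v(1,2) v(1,3) vYK' v(3) lin_hom_id fl lin' lin_hom_id ac[OF y]])
    also have "\<dots> = tmap R (T Y K') K' (\<lambda>y. tmap R Y K' id f (\<alpha> y)) (\<lambda>k. f (id k)) (\<alpha> y)" by simp
    also have "\<dots> = tmap R (T Y K') K' (tmap R Y K' id f) f (tmap R (T Y K) K \<alpha> id (\<alpha> y))"
      by (rule tmap_comp[OF v(1,2) vYK v(2) vYK' v(3) lin lin_hom_id tm fl ac[OF y], symmetric])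
    finally have "tassoc R Y K' K' (tmap R (T Y K') K' ?a id (?a y)) =
        tmap R Y (T K' K') id (tmap R K' K' f f) (tassoc R Y K K (tmap R (T Y K) K \<alpha> id (\<alpha> y)))"
      using tassoc_natural[OF v(1,2,2) v(1,3,3) lin_hom_id fl fl m] by simp
    also have "\<dots> = tmap R Y (T K' K') id (tmap R K' K' f f) (tmap R Y (T K K) id (comult K) (\<alpha> y))"
      using right_coaction_linD(2)[OF c y] by simp
    also have "\<dots> = tmap R Y (T K' K') (\<lambda>y. id (id y)) (\<lambda>k. tmap R K' K' f f (comult K k)) (\<alpha> y)"
      by (rule tmap_comp[OF v(1,2) v(1) vKK v(1) vKK' lin_hom_id Dl lin_hom_id ff ac[OF y]])
    also have "\<dots> = tmap R Y (T K' K') (\<lambda>y. id (id y)) (\<lambda>k. comult K' (f k)) (\<alpha> y)"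
      by (rule tmap_cong[OF v(1,2) v(1) vKK' _ lin_comp[OF Dl' fl] _ _ ac[OF y]]) (simp_all add: D lin_id)
    also have "\<dots> = tmap R Y (T K' K') id (comult K') (?a y)"
      by (rule tmap_comp[OF v(1,2) v(1,3) v(1) vKK' lin_hom_id fl lin_hom_id Dl' ac[OF y], symmetric])
    finally show ?thesis .
  qed
  moreover have "tlift R Y (\<lambda>u k. counit K' k \<odot>\<^bsub>Y\<^esub> u) (?a y) = y" if y: "y \<in> carrier Y" for y
  proof -
    note ec = lin_closed[OF el, simplified] and fc = lin_closed[OF fl]
    have "tlift R Y (\<lambda>u k. counit K' k \<odot>\<^bsub>Y\<^esub> u) (?a y) = tlift R Y (\<lambda>u k. counit K' (f k) \<odot>\<^bsub>Y\<^esub> u) (\<alpha> y)"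
      using tlift_tmap[OF v(1,2) v(1,3) v(1) lin_hom_id fl slice_bil[OF v(1,3) el] ac[OF y]] by simp
    also have "\<dots> = tlift R Y (\<lambda>u k. counit K k \<odot>\<^bsub>Y\<^esub> u) (\<alpha> y)"
      using v ec fc by (intro tlift_cong[OF v(1,2) v(1) ac[OF y]]) (auto simp: e[symmetric])
    finally show ?thesis using right_coaction_linD(3)[OF c y] by simp
  qed
  ultimately show ?thesis using lin' by (simp add: right_coaction_def alg_hom_def)
qed

end

section \<open>The two conditions for a triple and its opposite\<close>

context fd_hopf begin

lemma bid_alg_hom: "bid \<in> alg_hom R K LL"
proof -
  interpret D: fd_hopf R L by (rule dual_fd_hopf)
  have m: "bid (x \<cdot> y) = bid x \<otimes>\<^bsub>LL\<^esub> bid y" if xy: "x \<in> carrier K" "y \<in> carrier K" for x y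
  proof (rule D.dual_eqI)
    fix \<theta> assume t: "\<theta> \<in> carrier L"
    have "(bid x \<otimes>\<^bsub>LL\<^esub> bid y) \<theta> = tlift R (ground R) (\<lambda>\<phi> \<psi>. \<phi> x \<otimes> \<psi> y) (comult L \<theta>)"
      using t xy by (simp only: D.dual_apply) (intro D.sw_cong, auto simp: bid_apply)
    then show "bid (x \<cdot> y) \<theta> = (bid x \<otimes>\<^bsub>LL\<^esub> bid y) \<theta>"
      using t xy by (simp add: dual_sw bid_apply)
  qed (use xy in auto)
  have one: "bid \<one>\<^bsub>K\<^esub> = \<one>\<^bsub>LL\<^esub>"
    by (rule D.dual_eqI) (auto simp: bid_apply dual_simps(7))
  show ?thesis
    by (simp add: alg_hom_def bid_lin) (rule ring_hom_memI, simp_all add: m one lin_plus[OF bid_lin])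
qed

lemma bid_comult:
  assumes k: "k \<in> carrier K"
  shows "comult LL (bid k) = tmap R LL LL bid bid (comult K k)"
proof -
  interpret D: fd_hopf R L by (rule dual_fd_hopf)
  show ?thesis
  proof (rule D.dual_comult_eqI[OF bid_closed[OF k]])
    show "tmap R LL LL bid bid (comult K k) \<in> carrier (T LL LL)"
      using lin_closed[OF tmap_lin[OF vs_K vs_K vs_LL vs_LL bid_lin bid_lin]] k by simp
    fix \<theta> \<phi> assume t: "\<theta> \<in> carrier L" "\<phi> \<in> carrier L"
    have "fprod (\<lambda>\<xi>. \<xi> \<theta>) (\<lambda>\<xi>. \<xi> \<phi>) (tmap R LL LL bid bid (comult K k)) =
        sw (ground R) (\<lambda>a b. bid a \<theta> \<otimes> bid b \<phi>) k"
      unfolding fprod_def using k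
      by (intro tlift_tmap[OF vs_K vs_K vs_LL vs_LL vs_ground bid_lin bid_lin
            fprod_bil[OF D.lin_ev[OF t(1)] D.lin_ev[OF t(2)]]]) auto
    then show "fprod (\<lambda>\<xi>. \<xi> \<theta>) (\<lambda>\<xi>. \<xi> \<phi>) (tmap R LL LL bid bid (comult K k)) = bid k (\<theta> \<star> \<phi>)"
      using t k by (simp add: bid_apply)
  qed
qed

lemma bidual_right_coaction:
  assumes Y: "alg Y" and c: "right_coaction R K Y \<alpha>"
  shows "right_coaction R LL Y (\<lambda>y. tmap R Y LL id bid (\<alpha> y))"
proof -
  interpret D: fd_hopf R L by (rule dual_fd_hopf)
  show ?thesis
    by (rule right_coaction_push[OF Y alg_K D.alg_L bid_alg_hom comult_lin D.dual_comult_lin bid_comult _ _ c])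
      (use D.lin_ev[of "\<one>\<^bsub>L\<^esub>"] in \<open>auto simp: D.dual_simps(7)[abs_def] bid_apply\<close>)
qed

lemma yd_iff:
  assumes Y: "alg Y" and a: "right_coaction R (hopf_op K) Y \<alpha>" and b: "right_coaction R L Y \<beta>"
  shows "yetter_drinfeld_algebra R K Y \<alpha> \<beta> \<longleftrightarrow> yd_cond Y \<alpha> \<beta>"
proof -
  have lT: "lin_part (T Y (hopf_op K)) = lin_part (T Y K)" by (intro tensor_lin_part lin_part_op refl)
  have al: "\<alpha> \<in> lin_hom R Y (T Y K)"
    using right_coaction_linD(1)[OF a] unfolding lin_hom_lin_part[OF refl lT] .
  show ?thesis
    using yd_equation_iff[OF alg_vs[OF Y] al right_coaction_linD(1)[OF b]] Y a b
    by (simp add: yetter_drinfeld_algebra_def Let_def)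
qed

lemma bc_iff:
  assumes Y: "alg Y" and a: "right_coaction R (hopf_op K) Y \<alpha>" and b: "right_coaction R L Y \<beta>"
  shows "braided_commutative R K Y \<alpha> \<beta> \<longleftrightarrow> yd_cond Y \<alpha> \<beta> \<and> bc_cond Y \<alpha> \<beta>"
proof -
  note np = lin_part_op(2)[of K]
  have lT: "lin_part (T Y (hopf_op K)) = lin_part (T Y K)" by (intro tensor_lin_part np refl)
  note al = right_coaction_linD(1)[OF a, unfolded lin_hom_lin_part[OF refl lT]]
  note ca = right_coaction_linD(2)[OF a, unfolded tassoc_lin_part[OF refl np np] tmap_lin_part[OF lT np]
      tmap_lin_part[OF refl tensor_lin_part[OF np np]], simplified]
  note ea = right_coaction_linD(3)[OF a, simplified]
  note eb = right_coaction_linD(3)[OF b, unfolded dual_simps(7)]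
  show ?thesis
    unfolding braided_commutative_def yd_iff[OF assms] Let_def
    using bc_equation_iff[OF Y al right_coaction_linD(1)[OF b] ca right_coaction_linD(2)[OF b] ea eb]
    by simp
qed

lemma yd_cond_cong:
  assumes Y: "vs Y" and a: "\<alpha> \<in> lin_hom R Y (T Y K)" and b: "\<beta> \<in> lin_hom R Y (T Y L)"
    and l: "lin_part Y' = lin_part Y"
    and eq: "\<And>y. y \<in> carrier Y \<Longrightarrow> \<alpha>' y = \<alpha> y" "\<And>y. y \<in> carrier Y \<Longrightarrow> \<beta>' y = \<beta> y"
  shows "yd_cond Y' \<alpha>' \<beta>' \<longleftrightarrow> yd_cond Y \<alpha> \<beta>"
proof -
  have e: "carrier Y' = carrier Y" "smult Y' = smult Y" using l by (auto simp: lin_part_def)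
  note ac = lin_closed[OF a] and bc = lin_closed[OF b]
  have 1: "tlift R Y (\<lambda>v \<phi>. tlift R Y (\<lambda>u a. \<theta> (left_U a \<phi> k) \<odot>\<^bsub>Y\<^esub> u) (\<alpha>' v)) (\<beta>' y) =
      tlift R Y (\<lambda>v \<phi>. tlift R Y (\<lambda>u a. \<theta> (left_U a \<phi> k) \<odot>\<^bsub>Y\<^esub> u) (\<alpha> v)) (\<beta> y)"
    "tlift R Y (\<lambda>v a. tlift R Y (\<lambda>u \<phi>. \<theta> (right_U a \<phi> k) \<odot>\<^bsub>Y\<^esub> u) (\<beta>' v)) (\<alpha>' y) =
      tlift R Y (\<lambda>v a. tlift R Y (\<lambda>u \<phi>. \<theta> (right_U a \<phi> k) \<odot>\<^bsub>Y\<^esub> u) (\<beta> v)) (\<alpha> y)"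
    if y: "y \<in> carrier Y" and t: "\<theta> \<in> carrier L" and k: "k \<in> carrier K" for y \<theta> k
  proof -
    show "tlift R Y (\<lambda>v \<phi>. tlift R Y (\<lambda>u a. \<theta> (left_U a \<phi> k) \<odot>\<^bsub>Y\<^esub> u) (\<alpha>' v)) (\<beta>' y) =
      tlift R Y (\<lambda>v \<phi>. tlift R Y (\<lambda>u a. \<theta> (left_U a \<phi> k) \<odot>\<^bsub>Y\<^esub> u) (\<alpha> v)) (\<beta> y)"
      unfolding eq(2)[OF y] using Y t k
      by (intro tlift_cong[OF Y vs_L Y bc[OF y]] tlift_closed[OF Y vs_K Y ac]) (auto simp: eq)
    show "tlift R Y (\<lambda>v a. tlift R Y (\<lambda>u \<phi>. \<theta> (right_U a \<phi> k) \<odot>\<^bsub>Y\<^esub> u) (\<beta>' v)) (\<alpha>' y) =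
      tlift R Y (\<lambda>v a. tlift R Y (\<lambda>u \<phi>. \<theta> (right_U a \<phi> k) \<odot>\<^bsub>Y\<^esub> u) (\<beta> v)) (\<alpha> y)"
      unfolding eq(1)[OF y] using Y t k
      by (intro tlift_cong[OF Y vs_K Y ac[OF y]] tlift_closed[OF Y vs_L Y bc]) (auto simp: eq)
  qed
  show ?thesis
    unfolding yd_cond_def e tlift_lin_part[OF l] by (intro ball_cong refl) (simp only: 1)
qed

text \<open>
  Reversing the product of \<open>X\<close> and exchanging the two coactions changes \<open>y\<^sup>1 (S x\<^sub>1) y\<^sup>0 x\<^sub>0\<close>
  into \<open>x\<^sup>0 y\<^sub>0 \<cdot> x\<^sup>1 (S y\<^sub>1)\<close>, because the antipode of the dual is the transpose of \<open>S\<close>. This is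
  the same expression with \<open>x\<close> and \<open>y\<close> exchanged, and so is the product on the other side.
\<close>

theorem bc_cond_dual:
  assumes X: "alg X" and a: "\<alpha> \<in> lin_hom R X (T X K)" and b: "\<beta> \<in> lin_hom R X (T X L)"
    and eq: "\<And>y. y \<in> carrier X \<Longrightarrow> \<beta>' y = \<beta> y"
      "\<And>y. y \<in> carrier X \<Longrightarrow> \<alpha>' y = tmap R X LL id bid (\<alpha> y)"
  shows "hopf_over.bc_cond R L (op_alg X) \<beta>' \<alpha>' \<longleftrightarrow> bc_cond X \<alpha> \<beta>"
proof -
  interpret D: fd_hopf R L by (rule dual_fd_hopf)
  note Xv = alg_vs[OF X]
  note ac = lin_closed[OF a] and bc = lin_closed[OF b]
  have 1: "tlift R X (\<lambda>u \<theta>. tlift R X (\<lambda>v \<xi>. \<xi> (antipode L \<theta>) \<odot>\<^bsub>X\<^esub> (u \<otimes>\<^bsub>X\<^esub> v)) (\<alpha>' y)) (\<beta>' x) =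
     tlift R X (\<lambda>u k. tlift R X (\<lambda>v \<theta>. \<theta> (S k) \<odot>\<^bsub>X\<^esub> (v \<otimes>\<^bsub>X\<^esub> u)) (\<beta> x)) (\<alpha> y)"
    if x: "x \<in> carrier X" and y: "y \<in> carrier X" for x y
  proof -
    have "tlift R X (\<lambda>u \<theta>. tlift R X (\<lambda>v \<xi>. \<xi> (antipode L \<theta>) \<odot>\<^bsub>X\<^esub> (u \<otimes>\<^bsub>X\<^esub> v)) (\<alpha>' y)) (\<beta>' x) =
       tlift R X (\<lambda>u \<theta>. tlift R X (\<lambda>v k. \<theta> (S k) \<odot>\<^bsub>X\<^esub> (u \<otimes>\<^bsub>X\<^esub> v)) (\<alpha> y)) (\<beta> x)"
      unfolding eq(1)[OF x] eq(2)[OF y]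
    proof (rule tlift_cong[OF Xv vs_L Xv bc[OF x]])
      fix u \<theta> assume u: "u \<in> carrier X" and t: "\<theta> \<in> carrier L"
      have St: "antipode L \<theta> \<in> carrier L" using t by simp
      have b2: "bil X LL X (\<lambda>v \<xi>. \<xi> (antipode L \<theta>) \<odot>\<^bsub>X\<^esub> (u \<otimes>\<^bsub>X\<^esub> v))"
        using X u St by (intro bilI lin_smult_const lin_scalar lin_mult_right D.lin_ev lin_id) auto
      show "tlift R X (\<lambda>v \<xi>. \<xi> (antipode L \<theta>) \<odot>\<^bsub>X\<^esub> (u \<otimes>\<^bsub>X\<^esub> v)) (tmap R X LL id bid (\<alpha> y)) =
          tlift R X (\<lambda>v k. \<theta> (S k) \<odot>\<^bsub>X\<^esub> (u \<otimes>\<^bsub>X\<^esub> v)) (\<alpha> y)"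
        unfolding tlift_bid[OF Xv Xv b2 ac[OF y]] using X u t St
        by (intro tlift_cong[OF Xv vs_K Xv ac[OF y]]) (auto simp: bid_apply)
      show "tlift R X (\<lambda>v k. \<theta> (S k) \<odot>\<^bsub>X\<^esub> (u \<otimes>\<^bsub>X\<^esub> v)) (\<alpha> y) \<in> carrier X"
        using X u t by (intro tlift_closed[OF Xv vs_K Xv ac[OF y]]) auto
    qed
    also have "\<dots> = tlift R X (\<lambda>u k. tlift R X (\<lambda>v \<theta>. \<theta> (S k) \<odot>\<^bsub>X\<^esub> (v \<otimes>\<^bsub>X\<^esub> u)) (\<beta> x)) (\<alpha> y)"
      using X by (intro tlift_swap[OF Xv vs_L Xv vs_K Xv bc[OF x] ac[OF y]]) auto
    finally show ?thesis .
  qed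
  have "D.bc_cond (op_alg X) \<beta>' \<alpha>' \<longleftrightarrow> (\<forall>x\<in>carrier X. \<forall>y\<in>carrier X. y \<otimes>\<^bsub>X\<^esub> x =
     tlift R X (\<lambda>u k. tlift R X (\<lambda>v \<theta>. \<theta> (S k) \<odot>\<^bsub>X\<^esub> (v \<otimes>\<^bsub>X\<^esub> u)) (\<beta> x)) (\<alpha> y))"
    unfolding D.bc_cond_def tlift_lin_part[OF lin_part_op(1)] op_simps
    by (intro ball_cong refl) (simp only: 1)
  also have "\<dots> \<longleftrightarrow> bc_cond X \<alpha> \<beta>" unfolding bc_cond_def by blast
  finally show ?thesis .
qed

end

theorem proposition4p21:
  fixes R :: "('a, 'm) ring_scheme"
    and H :: "('a, 'h, 'n) hopf_scheme"
    and X :: "('a, 'x, 'o) module_scheme"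
    and \<alpha> :: "'x \<Rightarrow> ('x \<times> 'h \<Rightarrow> 'a) set"
    and \<beta> :: "'x \<Rightarrow> ('x \<times> ('h \<Rightarrow> 'a) \<Rightarrow> 'a) set"
  assumes "hopf_algebra R H"
    and "finite_dimensional R H"
    and "unital_algebra R X"
    and "right_coaction R (hopf_op H) X \<alpha>"
    and "right_coaction R (dual R H) X \<beta>"
  shows
    "let \<beta>op = op_coaction R (hopf_op (dual R H)) X \<beta>;
         \<alpha>op = op_coaction R H X \<alpha>;
         \<alpha>op' = bidual_coaction R H (op_alg X) \<alpha>op
     in right_coaction R (hopf_op (dual R H)) (op_alg X) \<beta>op \<and>
        right_coaction R H (op_alg X) \<alpha>op \<and>
        (yetter_drinfeld_algebra R H X \<alpha> \<beta> \<longleftrightarrow>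
         yetter_drinfeld_algebra R (dual R H) (op_alg X) \<beta>op \<alpha>op') \<and>
        (braided_commutative R H X \<alpha> \<beta> \<longleftrightarrow>
         braided_commutative R (dual R H) (op_alg X) \<beta>op \<alpha>op')"
proof -
  have field: "field R" using hopf_algebra.axioms(1)[OF assms(1)] by (rule unital_algebra.axioms)
  interpret field R by (rule field)
  have "hopf_over R H" by (intro hopf_over.intro hopf_over_axioms.intro field assms(1))
  then interpret H: fd_hopf R H using assms(2) by (rule hopf_over.finite_dimensional_fd_hopf)
  interpret D: fd_hopf R "dual R H" by (rule H.dual_fd_hopf)
  note X = assms(3) and a = assms(4) and b = assms(5)
  note Xv = alg_vs[OF X]
  define \<beta>op where "\<beta>op = op_coaction R (hopf_op (dual R H)) X \<beta>"
  define \<alpha>op where "\<alpha>op = op_coaction R H X \<alpha>"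
  define \<alpha>op' where "\<alpha>op' = bidual_coaction R H (op_alg X) \<alpha>op"
  have lT: "lin_part (T X (hopf_op H)) = lin_part (T X H)" by (intro tensor_lin_part lin_part_op refl)
  have al0: "\<alpha> \<in> lin_hom R X (T X (hopf_op H))" and bl: "\<beta> \<in> lin_hom R X (T X (dual R H))"
    using right_coaction_linD(1)[OF a] right_coaction_linD(1)[OF b] .
  note al = al0[unfolded lin_hom_lin_part[OF refl lT]]
  have ae: "\<alpha>op y = \<alpha> y" if "y \<in> carrier X" for y
    unfolding \<alpha>op_def by (rule op_coaction_eq[where \<alpha> = \<alpha>, OF Xv H.vs_K _ lin_closed[OF al0 that]]) simp
  have be: "\<beta>op y = \<beta> y" if "y \<in> carrier X" for y
    unfolding \<beta>op_def by (rule op_coaction_eq[where \<alpha> = \<beta>, OF Xv _ _ lin_closed[OF bl that]]) simp_all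
  have bop: "right_coaction R (hopf_op (dual R H)) (op_alg X) \<beta>op"
    by (rule right_coaction_op[OF X H.alg_L _ _ _ _ _ b be]) simp_all
  have aop: "right_coaction R H (op_alg X) \<alpha>op"
    by (rule right_coaction_op[OF X alg_hopf_op[OF H.alg_K] _ _ _ _ _ a ae]) simp_all
  have a': "\<alpha>op' = (\<lambda>y. tmap R (op_alg X) (dual R (dual R H)) id (to_bidual R H) (\<alpha>op y))"
    by (intro ext) (simp add: \<alpha>op'_def bidual_coaction_def)
  have aop': "right_coaction R (dual R (dual R H)) (op_alg X) \<alpha>op'"
    unfolding a' using X by (intro H.bidual_right_coaction aop) simp
  have yd: "D.yd_cond (op_alg X) \<beta>op \<alpha>op' \<longleftrightarrow> H.yd_cond X \<alpha> \<beta>"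
  proof -
    have l: "lin_part (T (op_alg X) (hopf_op (dual R H))) = lin_part (T (op_alg X) (dual R H))"
      by (intro tensor_lin_part lin_part_op refl)
    have "D.yd_cond (op_alg X) \<beta>op \<alpha>op' \<longleftrightarrow> H.yd_cond (op_alg X) \<alpha>op \<beta>op"
      unfolding a'
      using right_coaction_linD(1)[OF aop] right_coaction_linD(1)[OF bop] X
      unfolding lin_hom_lin_part[OF refl l] by (intro H.yd_cond_dual) simp_all
    also have "\<dots> \<longleftrightarrow> H.yd_cond X \<alpha> \<beta>"
      by (rule H.yd_cond_cong[OF Xv al bl lin_part_op(1) ae be])
    finally show ?thesis .
  qed
  have bc: "D.bc_cond (op_alg X) \<beta>op \<alpha>op' \<longleftrightarrow> H.bc_cond X \<alpha> \<beta>"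
    by (rule H.bc_cond_dual[OF X al bl be])
      (simp_all add: a' ae tmap_lin_part[OF lin_part_op(1) refl])
  have "alg (op_alg X)" using X by simp
  then show ?thesis
    unfolding Let_def \<beta>op_def[symmetric] \<alpha>op_def[symmetric] \<alpha>op'_def[symmetric]
    using bop aop yd bc H.yd_iff[OF X a b] D.yd_iff[OF _ bop aop']
      H.bc_iff[OF X a b] D.bc_iff[OF _ bop aop'] by blast
qed

end
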